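(* Let $r>1$ be given. Then there is a constant $C=C(r)$ such that for all $k\in\mathbb N$: (1) (case $d=1$) $$\sup_{K\in \mathbf H^{r,2}_{1,\infty}} \varepsilon_k(\mathbf W^K_1,L_\infty(\mathbb T)) \le C\, k^{-2r} (\log 2k)^{2r};$$ (2) (case $d=2$) $$\sup_{K\in \mathbf H^{r,4}_{1,\infty}} \varepsilon_k(\mathbf W^K_1,L_\infty(\mathbb T^2)) \le C\, k^{-2r} (\log 2k)^{4r+5/2}.$$
   Context: $\mathbb T^d=[0,2\pi]^d$ (periodic functions), with the normalized Lebesgue measure $(2\pi)^{-d}d\mathbf x$; all $L_p$ norms are with respect to it. Entropy numbers: for a Banach space $X$, $A\subset X$ and an integer $k\ge 0$, $\varepsilon_k(A,X):=\inf\{\varepsilon: \exists\, y^1,\dots,y^{2^k}\in X:\ A\subseteq\bigcup_{j=1}^{2^k}B_X(y^j,\varepsilon)\}$, where $B_X(y,\varepsilon)=\{x\in X:\|x-y\|\le\varepsilon\}$. Class generated by a kernel: for a function $K(\mathbf x,\mathbf y)$ on $\mathbb T^d\times\mathbb T^d$ and $1\le q\le\infty$, $$\mathbf W^K_q:=\Big\{f: f(\mathbf x)=(2\pi)^{-d}\int_{\mathbb T^d}K(\mathbf x,\mathbf y)\varphi(\mathbf y)\,d\mathbf y,\ \|\varphi\|_{L_q(\mathbb T^d)}\le 1\Big\}.$$ Vector norm: for functions of $v$ variables and $\mathbf q=(q_1,\dots,q_v)$, $\|f\|_{\mathbf q}:=\|\cdots\|f(\cdot,x_2,\dots,x_v)\|_{q_1}\cdots\|_{q_v}$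 (the norm in $x_1$ is taken first). Class $\mathbf H^{r,2d}_{h_1,h_2}$: let $v=2d$, let $q_j=h_1$, $q_{j+d}=h_2$ for $j=1,\dots,d$, and fix an integer $l>r$. Let $\Delta^l_{t,j}$ be the $l$-th order difference with step $t$ in the $j$-th variable (the $l$-th power of $f\mapsto f(\dots,x_j+t,\dots)-f$), and for $e\subseteq\{1,\dots,v\}$, $\mathbf t\in\mathbb R^v$, put $\Delta^l_{\mathbf t}(e):=\prod_{j\in e}\Delta^l_{t_j,j}$, $\Delta^l_{\mathbf t}(\varnothing)=\mathrm{Id}$. Then $\mathbf H^{r,2d}_{h_1,h_2}$ is the set of $2\pi$-periodic (in each variable) functions $f\in L_{\mathbf q}(\mathbb T^{v})$ such that for every $e\subseteq\{1,\dots,v\}$ and all $\mathbf t$, $\|\Delta^l_{\mathbf t}(e)f\|_{\mathbf q}\le\prod_{j\in e}|t_j|^{r}$. Different $l>r$ give equivalent classes (up to a constant multiple), so $l$ is omitted from the notation; constants may depend on the fixed choice of $l$. A function $K\in\mathbf H^{r,2d}_{1,\infty}$ is viewed as a kernel $K(\mathbf x,\mathbf y)$ where $\mathbf x$ is the first $d$ and $\mathbf y$ the last $d$ variables, so $\|K\|_{1,\infty}=\operatorname{ess\,sup}_{\mathbf y}\|K(\cdot,\mathbf y)\|_{L_1(\mathbb T^d)}$. *)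

theory Defs
  imports "HOL-Probability.Probability"
begin

text \<open>
  Points with \<open>d\<close> real coordinates are the elements of \<open>PiE {1..d} (\<lambda>_. UNIV)\<close>, so that the
  number of variables is an ordinary natural number and the variables are ordered.
  Functions on the torus are complex-valued functions on these points that are
  \<open>2\<pi>\<close>-periodic in each variable; their values at other arguments are irrelevant.
\<close>

definition torus :: "nat \<Rightarrow> (nat \<Rightarrow> real) measure"
  where "torus d = (\<Pi>\<^sub>M j\<in>{1..d}. uniform_measure lborel {0..2 * pi})"

definition periodic :: "nat \<Rightarrow> ((nat \<Rightarrow> real) \<Rightarrow> complex) \<Rightarrow> bool"
  where "periodic d f \<longleftrightarrow>
    (\<forall>x \<in> PiE {1..d} (\<lambda>_. UNIV). \<forall>j \<in> {1..d}. f (x(j := x j + 2 * pi)) = f x)"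

definition enn_power :: "ennreal \<Rightarrow> real \<Rightarrow> ennreal"
  where "enn_power a p = (if a = \<infinity> then \<infinity> else ennreal (enn2real a powr p))"

text \<open>
  The \<open>L\<^sub>p\<close> norm of a nonnegative measurable function, for \<open>1 \<le> p \<le> \<infinity>\<close>. It is \<open>\<infinity>\<close> if the function
  is not in \<open>L\<^sub>p\<close>; functions equal almost everywhere are not identified.
\<close>

definition Lp_norm :: "ennreal \<Rightarrow> 'a measure \<Rightarrow> ('a \<Rightarrow> ennreal) \<Rightarrow> ennreal"
  where "Lp_norm p M g =
    (if p = \<infinity> then esssup M g
     else enn_power (\<integral>\<^sup>+ x. enn_power (g x) (enn2real p) \<partial>M) (1 / enn2real p))"

definition torus_norm :: "ennreal \<Rightarrow> nat \<Rightarrow> ((nat \<Rightarrow> real) \<Rightarrow> complex) \<Rightarrow> ennreal"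
  where "torus_norm p d f = Lp_norm p (torus d) (\<lambda>x. ennreal (norm (f x)))"

definition torus_Lp :: "ennreal \<Rightarrow> nat \<Rightarrow> ((nat \<Rightarrow> real) \<Rightarrow> complex) set"
  where "torus_Lp p d =
    {f. f \<in> borel_measurable (torus d) \<and> periodic d f \<and> torus_norm p d f < \<infinity>}"

text \<open>
  \<open>iter_norm q n g x\<close> takes the norms of \<open>g\<close> in the variables \<open>1, \<dots>, n\<close>, in this order (the
  innermost norm is that in variable 1), the remaining variables being those of \<open>x\<close>.
\<close>

fun iter_norm ::
    "(nat \<Rightarrow> ennreal) \<Rightarrow> nat \<Rightarrow> ((nat \<Rightarrow> real) \<Rightarrow> ennreal) \<Rightarrow> (nat \<Rightarrow> real) \<Rightarrow> ennreal"
  where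
    "iter_norm q 0 g x = g x"
  | "iter_norm q (Suc n) g x =
       Lp_norm (q (Suc n)) (uniform_measure lborel {0..2 * pi})
         (\<lambda>s. iter_norm q n g (x(Suc n := s)))"

definition mixed_norm :: "(nat \<Rightarrow> ennreal) \<Rightarrow> nat \<Rightarrow> ((nat \<Rightarrow> real) \<Rightarrow> complex) \<Rightarrow> ennreal"
  where "mixed_norm q v f = iter_norm q v (\<lambda>x. ennreal (norm (f x))) (\<lambda>_. undefined)"

definition mixed_Lp :: "(nat \<Rightarrow> ennreal) \<Rightarrow> nat \<Rightarrow> ((nat \<Rightarrow> real) \<Rightarrow> complex) set"
  where "mixed_Lp q v =
    {f. f \<in> borel_measurable (torus v) \<and> periodic v f \<and> mixed_norm q v f < \<infinity>}"

definition difference ::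
    "nat \<Rightarrow> real \<Rightarrow> ((nat \<Rightarrow> real) \<Rightarrow> complex) \<Rightarrow> (nat \<Rightarrow> real) \<Rightarrow> complex"
  where "difference j s f = (\<lambda>x. f (x(j := x j + s)) - f x)"

text \<open>
  The operators \<open>difference j (t j) ^^ l\<close> commute, so the order of composition is immaterial.
\<close>

definition mixed_difference ::
    "nat \<Rightarrow> (nat \<Rightarrow> real) \<Rightarrow> nat set \<Rightarrow> ((nat \<Rightarrow> real) \<Rightarrow> complex) \<Rightarrow> (nat \<Rightarrow> real) \<Rightarrow> complex"
  where "mixed_difference l t e f =
    fold (\<lambda>j. difference j (t j) ^^ l) (sorted_list_of_set e) f"

definition H_class ::
    "nat \<Rightarrow> real \<Rightarrow> nat \<Rightarrow> ennreal \<Rightarrow> ennreal \<Rightarrow> ((nat \<Rightarrow> real) \<Rightarrow> complex) set"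
  where "H_class l r d h1 h2 =
    (let v = 2 * d; q = (\<lambda>j. if j \<le> d then h1 else h2)
     in {f \<in> mixed_Lp q v. \<forall>e \<subseteq> {1..v}. \<forall>t.
           mixed_norm q v (mixed_difference l t e f) \<le> ennreal (\<Prod>j\<in>e. \<bar>t j\<bar> powr r)})"

definition join :: "nat \<Rightarrow> (nat \<Rightarrow> real) \<Rightarrow> (nat \<Rightarrow> real) \<Rightarrow> nat \<Rightarrow> real"
  where "join d x y = (\<lambda>j\<in>{1..2 * d}. if j \<le> d then x j else y (j - d))"

text \<open>The factor \<open>(2\<pi>)\<^sup>-\<^sup>d\<close> in front of the integral is contained in the measure.\<close>

definition W_class ::
    "nat \<Rightarrow> ((nat \<Rightarrow> real) \<Rightarrow> complex) \<Rightarrow> ennreal \<Rightarrow> ((nat \<Rightarrow> real) \<Rightarrow> complex) set"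
  where "W_class d K q =
    {(\<lambda>x. \<integral>y. K (join d x y) * \<phi> y \<partial>torus d) | \<phi>. \<phi> \<in> torus_Lp q d \<and> torus_norm q d \<phi> \<le> 1}"

text \<open>
  Entropy numbers of \<open>A\<close> in the space with underlying set \<open>X\<close> and norm \<open>N\<close>; the infimum of the
  empty set is \<open>\<infinity>\<close>. The norm may vanish on nonzero elements, as it does for \<open>L\<^sub>p\<close> norms on
  functions: passing to the quotient by the elements of norm 0 does not change the value.
\<close>

definition norm_ball :: "'a::minus set \<Rightarrow> ('a \<Rightarrow> ennreal) \<Rightarrow> 'a \<Rightarrow> ennreal \<Rightarrow> 'a set"
  where "norm_ball X N y \<epsilon> = {x \<in> X. N (x - y) \<le> \<epsilon>}"

definition entropy_number :: "nat \<Rightarrow> 'a::minus set \<Rightarrow> 'a set \<Rightarrow> ('a \<Rightarrow> ennreal) \<Rightarrow> ennreal"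
  where "entropy_number k A X N =
    Inf {\<epsilon>. \<exists>y. (\<forall>j \<in> {1..(2::nat) ^ k}. y j \<in> X) \<and> A \<subseteq> (\<Union>j \<in> {1..2 ^ k}. norm_ball X N (y j) \<epsilon>)}"

end

theory Submission
  imports Defs "HOL-Library.Real_Mod"
begin

text \<open>
  Cut the kernel into dyadic blocks in each of its \<open>2d\<close> variables. Let \<open>s\<close> and \<open>s'\<close> be the vectors of
  the dyadic levels of a block in \<open>x\<close> and in \<open>y\<close>, and let \<open>u\<close> and \<open>w\<close> be the sums of their entries. The
  smoothness conditions give the block an \<open>L1\<close> norm in \<open>x\<close> of order \<open>2 powr (- r * (u + w))\<close>, uniformly in
  \<open>y\<close> (\<open>block_decomposition\<close>); since the block has about \<open>2 ^ u\<close> frequencies in \<open>x\<close>, its supremum is at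
  most \<open>2 ^ u\<close> times as large. Integration against a function \<open>\<phi>\<close> of \<open>L1\<close> norm at most 1 keeps both bounds.
  The result lies in a space of dimension about \<open>2 ^ u\<close>, and it depends on about \<open>2 ^ w\<close> functionals of
  \<open>\<phi>\<close> only.

  Fix a level \<open>m\<close>. The blocks with \<open>u \<le> m\<close> or \<open>w \<le> m\<close> are described by about \<open>2 ^ m * (m + 1) ^ (d - 1)\<close>
  numbers, which are rounded so finely that the error does not matter, at a price of order \<open>m + 1\<close> bits for
  each (\<open>covered_low_x\<close>, \<open>covered_low_y\<close>). On the other blocks the \<open>L1\<close> bound is what counts. There the
  vector of \<open>2 ^ u\<close> grid values has mean modulus \<open>\<rho> = 2 powr (- r * (u + w))\<close>. In units of
  \<open>2 ^ p * \<rho>\<close> it has an \<open>l1\<close> norm of order \<open>2 ^ u / 2 ^ p\<close> only, and there are few integer vectors with so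
  small a norm (\<open>card_integer_l1_ball\<close>). Take \<open>p\<close> slightly larger than \<open>u - m\<close> and let
  \<open>t = (u - m) + (w - m)\<close>. Since \<open>r > 1\<close>, one such block needs about \<open>2 ^ m\<close> bits and has an error of
  about \<open>2 powr (- 2 * r * m)\<close>, each with an additional factor that decays exponentially in \<open>t\<close>
  (\<open>covered_high_high\<close>).

  The sum over all blocks is \<open>covered_blocks\<close>: about \<open>2 ^ m * (m + 1) ^ d\<close> bits and an error of about
  \<open>2 powr (- 2 * r * m) * (m + 1) ^ (2 * (d - 1))\<close>. The high blocks contribute \<open>2 ^ m * (m + 1) ^ (2 * (d - 1))\<close>
  bits, which is within this budget for \<open>d \<le> 2\<close>. The largest \<open>m\<close> that \<open>k\<close> bits allow gives the
  order \<open>k powr (- 2 * r)\<close> with the logarithm to the power \<open>2 * r * d + 2 * (d - 1)\<close>: this is \<open>2 * r\<close> for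
  \<open>d = 1\<close> and \<open>4 * r + 2\<close> for \<open>d = 2\<close>.

  All this is done for kernels that are trigonometric polynomials, with means over fine grids in place of
  integrals. The Fejer means of a general kernel satisfy the same smoothness conditions on every fine grid
  (\<open>mollify_smooth_kernel\<close>). They form a uniform Cauchy sequence, because the blocks of large level are
  uniformly small for \<open>r > 1\<close> (\<open>smooth_kernel_small\<close>), and they converge to the kernel in \<open>L1\<close>
  by Marchaud's inequality. So some Fejer mean is as close to the kernel as desired, almost everywhere
  (\<open>mollify_approx_AE\<close>), and the covering of its class serves for that of the kernel.
\<close>

section \<open>Trigonometric kernels on equidistant grids\<close>

definition grid :: "nat \<Rightarrow> nat \<Rightarrow> real"
  where "grid N \<tau> = 2 * pi * real \<tau> / real N"

lemma grid_orthogonality: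
  fixes a :: int
  assumes "\<bar>a\<bar> < int N"
  shows "(\<Sum>\<tau><N. cis (of_int a * grid N \<tau>)) = (if a = 0 then of_nat N else 0)"
proof (cases "a = 0")
  case True then show ?thesis by simp
next
  case False
  have N: "N > 0" using assms by linarith
  define w where "w = cis (of_int a * (2 * pi / real N))"
  have pow: "cis (of_int a * grid N \<tau>) = w ^ \<tau>" for \<tau>
    by (simp add: w_def grid_def Complex.DeMoivre algebra_simps)
  have "w \<noteq> 1"
  proof
    assume "w = 1"
    then obtain k where "of_int a * (2 * pi / real N) = of_int k * (2 * pi)"
      unfolding w_def cis_eq_1_iff by blast
    then have "of_int a = (of_int k * real N :: real)"
      using N pi_gt_zero by (simp add: field_simps)
    then have "a = k * int N" by (metis of_int_eq_iff of_int_mult of_int_of_nat_eq)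
    then have "int N dvd a" by simp
    then show False using assms False dvd_imp_le_int[of a "int N"] by linarith
  qed
  have wN: "w ^ N = 1"
  proof -
    have "w ^ N = cis (of_int a * (2 * pi))" using N by (simp add: w_def Complex.DeMoivre)
    also have "\<dots> = 1" by (metis cis_multiple_2pi Ints_of_int mult.commute)
    finally show ?thesis .
  qed
  have "(\<Sum>\<tau><N. w ^ \<tau>) = 0"
    using geometric_sum[OF \<open>w \<noteq> 1\<close>, of N] wN by simp
  then show ?thesis using False by (simp add: pow)
qed

definition dirichlet :: "int set \<Rightarrow> real \<Rightarrow> complex"
  where "dirichlet A t = (\<Sum>b\<in>A. cis (of_int b * t))"

lemma norm_dirichlet_le: "norm (dirichlet A t) \<le> real (card A)"
  unfolding dirichlet_def by (rule order.trans[OF norm_sum]) simp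

lemma norm_dirichlet_minus: "norm (dirichlet A (- t)) = norm (dirichlet A t)"
proof -
  have "dirichlet A (- t) = cnj (dirichlet A t)"
    by (simp add: dirichlet_def cis_cnj)
  then show ?thesis by simp
qed

text \<open>
  Parseval: the frequencies are distinct modulo \<open>N\<close>, so that the discrete characters stay orthogonal.
\<close>

lemma dirichlet_grid_l2:
  assumes fin: "finite A" and diam: "\<And>b b'. b \<in> A \<Longrightarrow> b' \<in> A \<Longrightarrow> \<bar>b - b'\<bar> < int N"
  shows "(\<Sum>\<tau><N. (norm (dirichlet A (u - grid N \<tau>)))\<^sup>2) = real N * real (card A)"
proof -
  have "complex_of_real (\<Sum>\<tau><N. (norm (dirichlet A (u - grid N \<tau>)))\<^sup>2)
      = (\<Sum>\<tau><N. dirichlet A (u - grid N \<tau>) * cnj (dirichlet A (u - grid N \<tau>)))"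
    by (simp flip: complex_norm_square)
  also have "\<dots> = (\<Sum>\<tau><N. \<Sum>b\<in>A. \<Sum>b'\<in>A. cis (of_int (b - b') * u) * cis (of_int (b' - b) * grid N \<tau>))"
    unfolding dirichlet_def cnj_sum sum_product
    by (intro sum.cong refl) (simp add: cis_cnj cis_mult algebra_simps)
  also have "\<dots> = (\<Sum>b\<in>A. \<Sum>b'\<in>A. cis (of_int (b - b') * u) * (\<Sum>\<tau><N. cis (of_int (b' - b) * grid N \<tau>)))"
    by (subst sum.swap, intro sum.cong refl, subst sum.swap, simp add: sum_distrib_left)
  also have "\<dots> = (\<Sum>b\<in>A. \<Sum>b'\<in>A. if b = b' then of_nat N else 0)"
    using diam by (intro sum.cong refl, subst grid_orthogonality) auto
  also have "\<dots> = complex_of_real (real N * real (card A))"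
    using fin by simp
  finally show ?thesis by (simp only: of_real_eq_iff)
qed

text \<open>
  A kernel of de la Vallee Poussin type. A frequency \<open>a\<close> with \<open>\<bar>a\<bar> \<le> n\<close> arises in exactly \<open>2 * n + 1\<close> ways as a sum
  of one frequency from each factor, hence the normalization; and the mean of a product of two functions
  is controlled by the two quadratic means.
\<close>

definition vp_kernel :: "nat \<Rightarrow> real \<Rightarrow> complex"
  where "vp_kernel n u =
    dirichlet {- 2 * int n..2 * int n} u * dirichlet {- int n..int n} u / of_nat (2 * n + 1)"

lemma norm_vp_kernel:
  "norm (vp_kernel n u) =
    norm (dirichlet {- 2 * int n..2 * int n} u) * norm (dirichlet {- int n..int n} u) / (2 * real n + 1)"
proof -
  have "norm (of_nat (2 * n + 1) :: complex) = 2 * real n + 1"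
    by (subst norm_of_nat) simp
  then show ?thesis unfolding vp_kernel_def norm_divide norm_mult by simp
qed

lemma norm_vp_kernel_le: "norm (vp_kernel n u) \<le> 4 * real n + 1"
proof -
  have 1: "norm (dirichlet {- 2 * int n..2 * int n} u) \<le> 4 * real n + 1"
    using norm_dirichlet_le[of "{- 2 * int n..2 * int n}" u] by simp
  have 2: "norm (dirichlet {- int n..int n} u) \<le> 2 * real n + 1"
    using norm_dirichlet_le[of "{- int n..int n}" u] by simp
  have "norm (vp_kernel n u) = norm (dirichlet {- 2 * int n..2 * int n} u)
       * norm (dirichlet {- int n..int n} u) / (2 * real n + 1)"
    by (rule norm_vp_kernel)
  also have "\<dots> \<le> (4 * real n + 1) * (2 * real n + 1) / (2 * real n + 1)"
    using 1 2 by (intro divide_right_mono mult_mono) auto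
  also have "\<dots> = 4 * real n + 1" by simp
  finally show ?thesis .
qed

lemma norm_vp_kernel_minus: "norm (vp_kernel n (- u)) = norm (vp_kernel n u)"
  by (simp add: vp_kernel_def norm_mult norm_divide norm_dirichlet_minus)

text \<open>
  The kernel has degree \<open>3 * n\<close> and the character at most \<open>n\<close>; with more than \<open>4 * n\<close> nodes there is no aliasing.
\<close>

lemma vp_kernel_reproduces:
  assumes N: "4 * n < N" and a: "\<bar>a\<bar> \<le> int n"
  shows "(\<Sum>\<tau><N. cis (of_int a * grid N \<tau>) * vp_kernel n (u - grid N \<tau>)) = of_nat N * cis (of_int a * u)"
proof -
  let ?A = "{- 2 * int n..2 * int n}" and ?B = "{- int n..int n}"
  have "(\<Sum>\<tau><N. cis (of_int a * grid N \<tau>) * (dirichlet ?A (u - grid N \<tau>) * dirichlet ?B (u - grid N \<tau>)))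
     = (\<Sum>\<tau><N. \<Sum>b\<in>?A. \<Sum>b'\<in>?B. cis (of_int (b + b') * u) * cis (of_int (a - b - b') * grid N \<tau>))"
    unfolding dirichlet_def sum_product unfolding sum_distrib_left
    by (intro sum.cong refl) (simp add: cis_mult algebra_simps)
  also have "\<dots> = (\<Sum>b\<in>?A. \<Sum>b'\<in>?B. cis (of_int (b + b') * u) * (\<Sum>\<tau><N. cis (of_int (a - b - b') * grid N \<tau>)))"
    by (subst sum.swap, intro sum.cong refl, subst sum.swap, simp add: sum_distrib_left)
  also have "\<dots> = (\<Sum>b\<in>?A. \<Sum>b'\<in>?B. cis (of_int (b + b') * u) * (if a - b - b' = 0 then of_nat N else 0))"
    using N a by (intro sum.cong refl, subst grid_orthogonality) auto
  also have "\<dots> = (\<Sum>b'\<in>?B. \<Sum>b\<in>?A. if b = a - b' then cis (of_int a * u) * of_nat N else 0)"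
    by (subst sum.swap, intro sum.cong refl) (auto simp: algebra_simps)
  also have "\<dots> = (\<Sum>b'\<in>?B. cis (of_int a * u) * of_nat N)"
    using a by (intro sum.cong refl) (subst sum.delta, auto)
  also have "\<dots> = of_nat (2 * n + 1) * (of_nat N * cis (of_int a * u))"
    by (simp add: algebra_simps)
  finally show ?thesis
    unfolding vp_kernel_def times_divide_eq_right sum_divide_distrib[symmetric]
    by (simp add: nonzero_mult_div_cancel_left del: of_nat_add of_nat_mult of_nat_Suc)
qed

text \<open>
  Cauchy-Schwarz and \<open>dirichlet_grid_l2\<close> for the two factors.
\<close>

lemma vp_kernel_grid_l1:
  assumes N: "4 * n < N"
  shows "(\<Sum>\<tau><N. norm (vp_kernel n (u - grid N \<tau>))) \<le> 2 * real N"
proof -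
  let ?A = "{- 2 * int n..2 * int n}" and ?B = "{- int n..int n}"
  have "norm (vp_kernel n v) \<le> ((norm (dirichlet ?A v))\<^sup>2 + (norm (dirichlet ?B v))\<^sup>2) / (2 * (2 * real n + 1))" for v
  proof -
    have "norm (vp_kernel n v) = norm (dirichlet ?A v) * norm (dirichlet ?B v) / (2 * real n + 1)"
      by (rule norm_vp_kernel)
    moreover have "norm (dirichlet ?A v) * norm (dirichlet ?B v)
        \<le> ((norm (dirichlet ?A v))\<^sup>2 + (norm (dirichlet ?B v))\<^sup>2) / 2"
      using sum_squares_bound[of "norm (dirichlet ?A v)" "norm (dirichlet ?B v)"] by simp
    moreover have "x * y / c \<le> (x\<^sup>2 + y\<^sup>2) / (2 * c)" if "c > 0" "x * y \<le> (x\<^sup>2 + y\<^sup>2) / 2" for x y c :: real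
      using that by (simp add: field_simps)
    ultimately show ?thesis by (metis (no_types, lifting) add_nonneg_pos of_nat_0_le_iff zero_less_one mult_nonneg_nonneg zero_le_numeral)
  qed
  then have "(\<Sum>\<tau><N. norm (vp_kernel n (u - grid N \<tau>)))
      \<le> (\<Sum>\<tau><N. ((norm (dirichlet ?A (u - grid N \<tau>)))\<^sup>2 + (norm (dirichlet ?B (u - grid N \<tau>)))\<^sup>2) / (2 * (2 * real n + 1)))"
    by (intro sum_mono) auto
  also have "\<dots> = (real N * real (card ?A) + real N * real (card ?B)) / (2 * (2 * real n + 1))"
  proof -
    have "(\<Sum>\<tau><N. (norm (dirichlet ?A (u - grid N \<tau>)))\<^sup>2) = real N * real (card ?A)"
      by (rule dirichlet_grid_l2) (use N in auto)
    moreover have "(\<Sum>\<tau><N. (norm (dirichlet ?B (u - grid N \<tau>)))\<^sup>2) = real N * real (card ?B)"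
      by (rule dirichlet_grid_l2) (use N in auto)
    ultimately show ?thesis by (simp add: sum_divide_distrib[symmetric] sum.distrib)
  qed
  also have "\<dots> = real N * ((6 * real n + 2) / (4 * real n + 2))" by (simp add: field_simps)
  also have "\<dots> \<le> real N * 2" by (intro mult_left_mono) (auto simp: field_simps)
  finally show ?thesis by simp
qed

lemma vp_kernel_grid_l1':
  assumes N: "4 * n < N"
  shows "(\<Sum>\<tau><N. norm (vp_kernel n (grid N \<tau> - u))) \<le> 2 * real N"
  using vp_kernel_grid_l1[OF assms, of u] norm_vp_kernel_minus by (metis (no_types, lifting) minus_diff_eq sum.cong)


inductive trig_poly :: "nat \<Rightarrow> (real \<Rightarrow> complex) \<Rightarrow> bool" for m where
  zero: "trig_poly m (\<lambda>t. 0)"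
| monomial: "\<bar>a\<bar> \<le> int m \<Longrightarrow> trig_poly m f \<Longrightarrow> trig_poly m (\<lambda>t. c * cis (of_int a * t) + f t)"

lemma trig_poly_add: "trig_poly m f \<Longrightarrow> trig_poly m g \<Longrightarrow> trig_poly m (\<lambda>t. f t + g t)"
proof (induction rule: trig_poly.induct)
  case (monomial a f c)
  then show ?case using trig_poly.monomial[of a m "\<lambda>t. f t + g t" c] by (simp add: add.assoc)
qed simp

lemma trig_poly_monomial_mult:
  assumes "trig_poly m f" "\<bar>a\<bar> \<le> int m'"
  shows "trig_poly (m + m') (\<lambda>t. c * cis (of_int a * t) * f t)"
  using assms(1)
proof (induction rule: trig_poly.induct)
  case zero show ?case by (simp add: trig_poly.zero)
next
  case (monomial b f c')
  have "trig_poly (m + m') (\<lambda>t. (c * c') * cis (of_int (a + b) * t) + c * cis (of_int a * t) * f t)"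
    using monomial assms(2) by (intro trig_poly.monomial) auto
  moreover have "(\<lambda>t. (c * c') * cis (of_int (a + b) * t) + c * cis (of_int a * t) * f t)
     = (\<lambda>t. c * cis (of_int a * t) * (c' * cis (of_int b * t) + f t))"
    by (auto simp: algebra_simps cis_mult[symmetric])
  ultimately show ?case by simp
qed

lemma trig_poly_mult:
  assumes "trig_poly m f" "trig_poly m' g"
  shows "trig_poly (m + m') (\<lambda>t. f t * g t)"
  using assms(1)
proof (induction rule: trig_poly.induct)
  case zero show ?case by (simp add: trig_poly.zero)
next
  case (monomial a f c)
  have "trig_poly (m' + m) (\<lambda>t. c * cis (of_int a * t) * g t)"
    using monomial assms(2) by (intro trig_poly_monomial_mult)
  from trig_poly_add[OF this[unfolded add.commute[of m']] monomial.IH]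
  show ?case by (simp add: algebra_simps)
qed

lemma trig_poly_power: "trig_poly m f \<Longrightarrow> trig_poly (k * m) (\<lambda>t. f t ^ k)"
proof (induction k)
  case 0
  have "trig_poly 0 (\<lambda>t. 1 * cis (of_int 0 * t) + 0)" by (intro trig_poly.intros) auto
  then show ?case by simp
next
  case (Suc k)
  then show ?case using trig_poly_mult[of m f "k * m" "\<lambda>t. f t ^ k"] by simp
qed

lemma trig_poly_dirichlet:
  assumes "finite A" "\<And>b. b \<in> A \<Longrightarrow> \<bar>b\<bar> \<le> int m"
  shows "trig_poly m (dirichlet A)" "trig_poly m (\<lambda>t. cnj (dirichlet A t))"
proof -
  have "trig_poly m (dirichlet A) \<and> trig_poly m (\<lambda>t. cnj (dirichlet A t))"
    using assms
  proof (induction A rule: finite_induct)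
    case empty show ?case by (simp add: dirichlet_def trig_poly.zero)
  next
    case (insert b A)
    then have "trig_poly m (\<lambda>t. 1 * cis (of_int b * t) + dirichlet A t)"
      and "trig_poly m (\<lambda>t. 1 * cis (of_int (- b) * t) + cnj (dirichlet A t))"
      by (intro trig_poly.monomial; auto)+
    then show ?case using insert.hyps by (simp add: dirichlet_def cis_cnj)
  qed
  then show "trig_poly m (dirichlet A)" "trig_poly m (\<lambda>t. cnj (dirichlet A t))" by auto
qed

lemma trig_poly_grid_orthogonal:
  assumes "trig_poly m f" "int m < \<bar>a\<bar>" "\<bar>a\<bar> + int m < int N"
  shows "(\<Sum>\<tau><N. cis (of_int a * grid N \<tau>) * f (grid N \<tau>)) = 0"
  using assms(1)
proof (induction rule: trig_poly.induct)
  case (monomial b f c)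
  have "(\<Sum>\<tau><N. cis (of_int a * grid N \<tau>) * (c * cis (of_int b * grid N \<tau>) + f (grid N \<tau>)))
      = c * (\<Sum>\<tau><N. cis (of_int (a + b) * grid N \<tau>)) + (\<Sum>\<tau><N. cis (of_int a * grid N \<tau>) * f (grid N \<tau>))"
    by (simp add: sum_distrib_left sum.distrib[symmetric] algebra_simps cis_mult[symmetric])
  also have "(\<Sum>\<tau><N. cis (of_int (a + b) * grid N \<tau>)) = 0"
    using monomial assms by (subst grid_orthogonality) auto
  finally show ?case using monomial by simp
qed simp

text \<open>
  The grid points are moved to \<open>[- pi, pi]\<close>, where the modulus of a point is its distance to 0 on the circle: the
  smoothness conditions are useful for small steps only.
\<close>

definition sgrid :: "nat \<Rightarrow> nat \<Rightarrow> real"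
  where "sgrid N \<tau> = (if 2 * \<tau> \<le> N then grid N \<tau> else grid N \<tau> - 2 * pi)"

lemma cis_sgrid: "cis (of_int a * sgrid N \<tau>) = cis (of_int a * grid N \<tau>)"
proof -
  have "cis (of_int a * (grid N \<tau> - 2 * pi)) = cis (of_int a * grid N \<tau>) / cis (2 * pi * of_int a)"
    by (simp add: cis_divide algebra_simps)
  then show ?thesis by (simp add: sgrid_def)
qed

lemma abs_sgrid_le: "\<tau> < N \<Longrightarrow> \<bar>sgrid N \<tau>\<bar> \<le> pi"
proof -
  assume t: "\<tau> < N"
  then have N: "real N > 0" by simp
  show ?thesis
  proof (cases "2 * \<tau> \<le> N")
    case True
    then have "2 * real \<tau> \<le> real N" by linarith
    then have "pi * (2 * real \<tau>) \<le> pi * real N" by (intro mult_left_mono) auto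
    then show ?thesis using True N by (simp add: sgrid_def grid_def field_simps)
  next
    case False
    then have "2 * real \<tau> \<ge> real N" by linarith
    then have "pi * (2 * real \<tau>) \<ge> pi * real N" by (intro mult_left_mono) auto
    moreover have "pi * real \<tau> \<le> pi * real N" using t by (intro mult_left_mono) auto
    ultimately show ?thesis using False N by (simp add: sgrid_def grid_def field_simps abs_le_iff)
  qed
qed

lemma trig_poly_sgrid: "trig_poly m f \<Longrightarrow> f (sgrid N \<tau>) = f (grid N \<tau>)"
  by (induction rule: trig_poly.induct) (auto simp: cis_sgrid)

lemma norm_cis_minus_one_ge:
  assumes "\<bar>t\<bar> \<le> pi"
  shows "\<bar>t\<bar> / 2 \<le> norm (cis t - 1)"
proof -
  have sin_ge: "y * cos y \<le> sin y" if "0 \<le> y" "y \<le> pi / 4" for y :: real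
  proof -
    have "sin 0 - 0 * cos 0 \<le> sin y - y * cos (y::real)"
    proof (rule DERIV_nonneg_imp_nondecreasing[OF that(1), where f="\<lambda>y. sin y - y * cos y"], intro exI conjI)
      fix x assume x: "0 \<le> x" "x \<le> y"
      show "((\<lambda>y. sin y - y * cos y) has_real_derivative x * sin x) (at x)"
        by (auto intro!: derivative_eq_intros)
      show "0 \<le> x * sin x" using x that by (intro mult_nonneg_nonneg sin_ge_zero) auto
    qed
    then show ?thesis by simp
  qed
  define y where "y = \<bar>t\<bar> / 4"
  have y: "0 \<le> y" "y \<le> pi / 4" using assms by (auto simp: y_def)
  have "cos (pi / 4) \<le> cos y" using y by (intro cos_monotone_0_pi_le) auto
  then have c: "sqrt 2 / 2 \<le> cos y" by (simp add: cos_45)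
  have "(sqrt 2 / 2)\<^sup>2 \<le> (cos y)\<^sup>2" using c by (intro power_mono) auto
  then have c2: "1 / 2 \<le> cos y * cos y" by (simp add: power2_eq_square)
  have "y * (1 / 2) \<le> y * (cos y * cos y)" using y c2 by (intro mult_left_mono)
  also have "\<dots> = (y * cos y) * cos y" by simp
  also have "\<dots> \<le> sin y * cos y"
    using sin_ge[OF y] c by (intro mult_right_mono) (auto intro: order.trans[of 0 "sqrt 2 / 2"])
  finally have "y \<le> 2 * sin y * cos y" by simp
  also have "\<dots> = sin (\<bar>t\<bar> / 2)" using sin_double[of y] by (simp add: y_def)
  also have "\<dots> \<le> \<bar>sin (t / 2)\<bar>" by (cases "t \<ge> 0") auto
  finally have "\<bar>t\<bar> / 2 \<le> 2 * \<bar>sin (t / 2)\<bar>" by (simp add: y_def)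
  also have "\<dots> = norm (cis t - 1)" using dist_exp_i_1[of t] by (simp add: cis_conv_exp)
  finally show ?thesis .
qed

lemma norm_dirichlet_decay:
  assumes "\<bar>t\<bar> \<le> pi"
  shows "norm (dirichlet {0..<int n} t) * \<bar>t\<bar> \<le> 4"
proof -
  have "dirichlet {0..<int n} t = (\<Sum>b<n. cis t ^ b)"
  proof -
    have "{0..<int n} = int ` {..<n}"
      by (metis atLeast0LessThan image_int_atLeastLessThan of_nat_0)
    then show ?thesis
      by (simp add: dirichlet_def sum.reindex Complex.DeMoivre)
  qed
  then have "dirichlet {0..<int n} t * (cis t - 1) = cis t ^ n - 1"
    using power_diff_1_eq[of "cis t" n] by (simp add: mult.commute)
  then have "norm (dirichlet {0..<int n} t) * norm (cis t - 1) = norm (cis t ^ n - 1)"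
    by (metis norm_mult)
  also have "\<dots> \<le> 2" using norm_triangle_ineq4[of "cis t ^ n" 1] by (simp add: norm_power)
  finally have 1: "norm (dirichlet {0..<int n} t) * norm (cis t - 1) \<le> 2" .
  have "norm (dirichlet {0..<int n} t) * (\<bar>t\<bar> / 2) \<le> norm (dirichlet {0..<int n} t) * norm (cis t - 1)"
    by (intro mult_left_mono norm_cis_minus_one_ge assms) auto
  with 1 show ?thesis by simp
qed

lemma norm_dirichlet_ge:
  assumes "0 \<le> t" "t * real n \<le> 1"
  shows "real n / 2 \<le> norm (dirichlet {0..<int n} t)"
proof -
  have "cos (pi / 3) \<le> cos (of_int b * t)" if "b \<in> {0..<int n}" for b
  proof (rule cos_monotone_0_pi_le)
    have "of_int b * t \<le> real n * t" using that assms by (intro mult_right_mono) auto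
    also have "\<dots> \<le> 1" using assms by (simp add: mult.commute)
    also have "\<dots> \<le> pi / 3" using pi_gt3 by simp
    finally show "of_int b * t \<le> pi / 3" .
  qed (use that assms in auto)
  then have "(\<Sum>b\<in>{0..<int n}. 1 / 2) \<le> (\<Sum>b\<in>{0..<int n}. cos (of_int b * t))"
    by (intro sum_mono) (auto simp: cos_60)
  then have "real n / 2 \<le> Re (dirichlet {0..<int n} t)"
    by (simp add: dirichlet_def)
  also have "\<dots> \<le> norm (dirichlet {0..<int n} t)" by (rule complex_Re_le_cmod)
  finally show ?thesis .
qed

section \<open>Jackson kernels and dyadic multipliers\<close>

definition jackson_weight :: "nat \<Rightarrow> nat \<Rightarrow> real \<Rightarrow> real"
  where "jackson_weight p n t = norm (dirichlet {0..<int n} t) ^ (2 * p)"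

lemma trig_poly_jackson_weight: "trig_poly (2 * n * p) (\<lambda>t. of_real (jackson_weight p n t))"
proof -
  have "trig_poly (n + n) (\<lambda>t. dirichlet {0..<int n} t * cnj (dirichlet {0..<int n} t))"
    by (intro trig_poly_mult trig_poly_dirichlet) auto
  from trig_poly_power[OF this, of p]
  have "trig_poly (p * (n + n)) (\<lambda>t. (dirichlet {0..<int n} t * cnj (dirichlet {0..<int n} t)) ^ p)" .
  moreover have "(dirichlet {0..<int n} t * cnj (dirichlet {0..<int n} t)) ^ p = of_real (jackson_weight p n t)" for t
    unfolding jackson_weight_def complex_norm_square[symmetric] by (simp add: power_mult)
  moreover have "p * (n + n) = 2 * n * p" by simp
  ultimately show ?thesis by (simp only:)
qed

lemma jackson_weight_sgrid: "jackson_weight p n (sgrid N \<tau>) = jackson_weight p n (grid N \<tau>)"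
  using trig_poly_sgrid[OF trig_poly_jackson_weight, of p n N \<tau>] by (simp only: of_real_eq_iff)

definition jackson_mass :: "nat \<Rightarrow> nat \<Rightarrow> nat \<Rightarrow> real"
  where "jackson_mass p n N = (\<Sum>\<tau><N. jackson_weight p n (sgrid N \<tau>)) / N"

text \<open>
  The grid points with \<open>0 \<le> t \<le> 1 / n\<close> suffice: there are at least \<open>N / (8 * n)\<close> of them, and the Dirichlet kernel
  is at least \<open>n / 2\<close> there.
\<close>

lemma jackson_mass_ge:
  assumes "0 < n" "8 * n \<le> N"
  shows "(1 / (8 * real n)) * (real n / 2) ^ (2 * p) \<le> jackson_mass p n N"
proof -
  have N: "real N > 0" using assms by simp
  let ?K = "N div (8 * n)"
  have K: "?K < N" using assms by (simp add: div_less_dividend)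
  have grid_le: "grid N \<tau> * real n \<le> 1" "0 \<le> grid N \<tau>" if "\<tau> \<le> ?K" for \<tau>
  proof -
    have "8 * n * \<tau> \<le> N" using that by (metis times_div_less_eq_dividend mult_le_mono2 order.trans)
    then have "8 * (real n * real \<tau>) \<le> real N"
      by (metis of_nat_le_iff of_nat_mult of_nat_numeral mult.assoc)
    moreover have "2 * pi * (real n * real \<tau>) \<le> 8 * (real n * real \<tau>)"
      using pi_less_4 by (intro mult_right_mono) auto
    ultimately show "grid N \<tau> * real n \<le> 1" using N by (simp add: grid_def field_simps)
    show "0 \<le> grid N \<tau>" by (simp add: grid_def)
  qed
  have "real N / (8 * real n) \<le> real (?K + 1)"
  proof -
    have "N < 8 * n * (?K + 1)" using assms(1) by (metis dividend_less_times_div Suc_eq_plus1 mult_Suc_right mult_pos_pos zero_less_numeral add.commute)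
    then have "real N \<le> 8 * real n * real (?K + 1)"
      by (metis less_imp_le of_nat_le_iff of_nat_mult of_nat_numeral)
    then show ?thesis using assms(1) by (simp add: field_simps)
  qed
  then have "real N / (8 * real n) * (real n / 2) ^ (2 * p) \<le> real (?K + 1) * (real n / 2) ^ (2 * p)"
    by (intro mult_right_mono) auto
  also have "\<dots> = (\<Sum>\<tau>\<in>{..?K}. (real n / 2) ^ (2 * p))" by simp
  also have "\<dots> \<le> (\<Sum>\<tau>\<in>{..?K}. jackson_weight p n (sgrid N \<tau>))"
    unfolding jackson_weight_sgrid unfolding jackson_weight_def
    by (intro sum_mono power_mono norm_dirichlet_ge grid_le) auto
  also have "\<dots> \<le> (\<Sum>\<tau><N. jackson_weight p n (sgrid N \<tau>))"
    using K by (intro sum_mono2) (auto simp: jackson_weight_def)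
  finally show ?thesis using N by (simp add: jackson_mass_def field_simps)
qed

lemma jackson_mass_pos: "0 < n \<Longrightarrow> 8 * n \<le> N \<Longrightarrow> 0 < jackson_mass p n N"
  using jackson_mass_ge[of n N p] by (smt (verit) divide_pos_pos mult_pos_pos of_nat_0_less_iff zero_less_power)

definition jackson :: "nat \<Rightarrow> nat \<Rightarrow> nat \<Rightarrow> real \<Rightarrow> real"
  where "jackson p n N t = jackson_weight p n t / jackson_mass p n N"

lemma jackson_nonneg: "0 \<le> jackson p n N t"
  by (simp add: jackson_def jackson_weight_def jackson_mass_def sum_nonneg)

lemma jackson_mean: "0 < n \<Longrightarrow> 8 * n \<le> N \<Longrightarrow> (\<Sum>\<tau><N. jackson p n N (sgrid N \<tau>)) = N"
proof -
  assume "0 < n" "8 * n \<le> N"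
  then have "0 < jackson_mass p n N" by (rule jackson_mass_pos)
  moreover have "(\<Sum>\<tau><N. jackson_weight p n (sgrid N \<tau>)) = N * jackson_mass p n N"
    using \<open>0 < n\<close> \<open>8 * n \<le> N\<close> by (simp add: jackson_mass_def)
  ultimately show ?thesis by (simp add: jackson_def sum_divide_distrib[symmetric])
qed

text \<open>
  The decay \<open>norm (dirichlet {0..<n} t) * \<bar>t\<bar> \<le> 4\<close> absorbs the factor \<open>\<bar>t\<bar> ^ (2 * q)\<close> and leaves a square, whose
  mean is known.
\<close>

lemma jackson_moment_even:
  assumes "0 < n" "8 * n \<le> N"
  shows "(\<Sum>\<tau><N. jackson (Suc q) n N (sgrid N \<tau>) * \<bar>sgrid N \<tau>\<bar> ^ (2 * q)) / N
          \<le> 32 * 64 ^ q / real n ^ (2 * q)"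
proof -
  have N: "real N > 0" and n: "real n > 0" using assms by auto
  let ?D = "\<lambda>t. norm (dirichlet {0..<int n} t)"
  have "jackson_weight (Suc q) n t * \<bar>t\<bar> ^ (2 * q) \<le> 4 ^ (2 * q) * (?D t)\<^sup>2" if "\<bar>t\<bar> \<le> pi" for t
  proof -
    have "jackson_weight (Suc q) n t * \<bar>t\<bar> ^ (2 * q) = (?D t * \<bar>t\<bar>) ^ (2 * q) * (?D t)\<^sup>2"
      by (simp add: jackson_weight_def power_mult_distrib power_add[symmetric] power2_eq_square mult_ac flip: power_Suc)
    also have "\<dots> \<le> 4 ^ (2 * q) * (?D t)\<^sup>2"
      by (intro mult_right_mono power_mono norm_dirichlet_decay that) auto
    finally show ?thesis .
  qed
  then have "(\<Sum>\<tau><N. jackson_weight (Suc q) n (sgrid N \<tau>) * \<bar>sgrid N \<tau>\<bar> ^ (2 * q))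
     \<le> (\<Sum>\<tau><N. 4 ^ (2 * q) * (?D (sgrid N \<tau>))\<^sup>2)"
    by (intro sum_mono) (auto simp: abs_sgrid_le)
  also have "\<dots> = 4 ^ (2 * q) * (\<Sum>\<tau><N. (?D (0 - grid N \<tau>))\<^sup>2)"
  proof -
    have "dirichlet {0..<int n} (sgrid N \<tau>) = dirichlet {0..<int n} (grid N \<tau>)" for \<tau>
      by (rule trig_poly_sgrid[of n], rule trig_poly_dirichlet) auto
    then show ?thesis by (simp add: sum_distrib_left[symmetric] norm_dirichlet_minus)
  qed
  also have "\<dots> = 4 ^ (2 * q) * (real N * real n)"
    using assms by (subst dirichlet_grid_l2) auto
  finally have 1: "(\<Sum>\<tau><N. jackson_weight (Suc q) n (sgrid N \<tau>) * \<bar>sgrid N \<tau>\<bar> ^ (2 * q)) / N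
      \<le> 4 ^ (2 * q) * real n"
    using N by (simp add: field_simps)
  let ?m = "(1 / (8 * real n)) * (real n / 2) ^ (2 * Suc q)"
  have m: "0 < ?m" using n by simp
  have "(\<Sum>\<tau><N. jackson (Suc q) n N (sgrid N \<tau>) * \<bar>sgrid N \<tau>\<bar> ^ (2 * q)) / N
     = (\<Sum>\<tau><N. jackson_weight (Suc q) n (sgrid N \<tau>) * \<bar>sgrid N \<tau>\<bar> ^ (2 * q)) / N / jackson_mass (Suc q) n N"
    by (simp add: jackson_def sum_divide_distrib mult_ac)
  also have "\<dots> \<le> (4 ^ (2 * q) * real n) / ?m"
    using jackson_mass_ge[OF assms, of "Suc q"] m 1 by (intro frac_le) auto
  also have "\<dots> = 32 * 64 ^ q / real n ^ (2 * q)"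
  proof -
    have "(4::real) ^ (2 * q) * 4 ^ q = 64 ^ q" by (simp add: power_mult power_mult_distrib[symmetric])
    moreover have "(2::real) ^ (2 * q) = 4 ^ q" by (simp add: power_mult)
    ultimately show ?thesis using n by (simp add: field_simps power_divide power2_eq_square)
  qed
  finally show ?thesis .
qed

text \<open>
  The exponent \<open>r\<close> lies between 0 and \<open>2 * q\<close>: compare \<open>(n * \<bar>t\<bar>) powr r\<close> with \<open>1 + (n * \<bar>t\<bar>) ^ (2 * q)\<close>.
\<close>

lemma jackson_moment:
  assumes "0 < n" "8 * n \<le> N" and r: "0 < r" "r \<le> 2 * real q"
  shows "(\<Sum>\<tau><N. jackson (Suc q) n N (sgrid N \<tau>) * \<bar>sgrid N \<tau>\<bar> powr r) / N
          \<le> (1 + 32 * 64 ^ q) * real n powr (- r)"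
proof -
  have N: "real N > 0" and n: "real n > 0" using assms by auto
  have le: "x powr r \<le> real n powr (- r) + real n powr (- r) * real n ^ (2 * q) * x ^ (2 * q)" if x: "0 \<le> x" for x
  proof -
    have "(real n * x) powr r \<le> 1 + (real n * x) ^ (2 * q)"
    proof (cases "real n * x \<le> 1")
      case True
      then have "(real n * x) powr r \<le> 1" using x n r by (intro powr_le1) auto
      then show ?thesis using x by (smt (verit) n mult_nonneg_nonneg zero_le_power)
    next
      case False
      then have "(real n * x) powr r \<le> (real n * x) powr real (2 * q)"
        using r by (intro powr_mono) auto
      also have "\<dots> = (real n * x) ^ (2 * q)" using False by (intro powr_realpow) auto
      finally show ?thesis by simp
    qed
    then have "real n powr r * x powr r \<le> 1 + real n ^ (2 * q) * x ^ (2 * q)"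
      using n x by (simp add: powr_mult power_mult_distrib)
    then have "real n powr (- r) * (real n powr r * x powr r) \<le> real n powr (- r) * (1 + real n ^ (2 * q) * x ^ (2 * q))"
      by (intro mult_left_mono) auto
    moreover have "real n powr (- r) * (real n powr r * x powr r) = x powr r"
      using n by (simp add: powr_minus mult.assoc[symmetric])
    ultimately show ?thesis by (simp only: distrib_left mult_1_right mult.assoc)
  qed
  let ?J = "\<lambda>\<tau>. jackson (Suc q) n N (sgrid N \<tau>)"
  have "(\<Sum>\<tau><N. ?J \<tau> * \<bar>sgrid N \<tau>\<bar> powr r)
     \<le> (\<Sum>\<tau><N. ?J \<tau> * (real n powr (- r) + real n powr (- r) * real n ^ (2 * q) * \<bar>sgrid N \<tau>\<bar> ^ (2 * q)))"
    by (intro sum_mono mult_left_mono le jackson_nonneg) auto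
  also have "\<dots> = real n powr (- r) * (\<Sum>\<tau><N. ?J \<tau>)
      + real n powr (- r) * real n ^ (2 * q) * (\<Sum>\<tau><N. ?J \<tau> * \<bar>sgrid N \<tau>\<bar> ^ (2 * q))"
    by (simp add: sum_distrib_left sum.distrib[symmetric] algebra_simps)
  finally have "(\<Sum>\<tau><N. ?J \<tau> * \<bar>sgrid N \<tau>\<bar> powr r) / N
    \<le> real n powr (- r) * ((\<Sum>\<tau><N. ?J \<tau>) / N)
      + real n powr (- r) * real n ^ (2 * q) * ((\<Sum>\<tau><N. ?J \<tau> * \<bar>sgrid N \<tau>\<bar> ^ (2 * q)) / N)"
    using N by (simp add: field_simps)
  also have "\<dots> \<le> real n powr (- r) * 1 + real n powr (- r) * real n ^ (2 * q) * (32 * 64 ^ q / real n ^ (2 * q))"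
    using jackson_mean[OF assms(1,2), of "Suc q"] jackson_moment_even[OF assms(1,2), of q] N
    by (intro add_mono mult_left_mono) auto
  also have "\<dots> = (1 + 32 * 64 ^ q) * real n powr (- r)"
    using n by (simp add: field_simps)
  finally show ?thesis .
qed

text \<open>
  In the binomial expansion of the difference factor, all powers but the zeroth oscillate with a frequency above the
  degree of the Jackson kernel and average to 0.
\<close>

lemma jackson_annihilates:
  assumes "0 < n" "8 * n \<le> N" "int (2 * n * p) < \<bar>a\<bar>" "int l * \<bar>a\<bar> + int (2 * n * p) < int N"
  shows "(\<Sum>\<tau><N. of_real (jackson p n N (sgrid N \<tau>)) * (cis (of_int a * sgrid N \<tau>) - 1) ^ l) = (- 1) ^ l * of_nat N"
proof -
  let ?J = "\<lambda>\<tau>. complex_of_real (jackson p n N (sgrid N \<tau>))"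
  have mean0: "(\<Sum>\<tau><N. ?J \<tau> * cis (of_int a * sgrid N \<tau>) ^ i) = 0" if "0 < i" "i \<le> l" for i
  proof -
    have i: "\<bar>a\<bar> \<le> int i * \<bar>a\<bar>" "int i * \<bar>a\<bar> \<le> int l * \<bar>a\<bar>"
      using that by (auto intro: mult_right_mono simp: mult_le_cancel_right1)
    have "(\<Sum>\<tau><N. ?J \<tau> * cis (of_int a * sgrid N \<tau>) ^ i)
      = (\<Sum>\<tau><N. cis (of_int (int i * a) * grid N \<tau>) * of_real (jackson_weight p n (grid N \<tau>))) / of_real (jackson_mass p n N)"
      unfolding sum_divide_distrib jackson_def jackson_weight_sgrid
      by (intro sum.cong refl) (simp add: cis_sgrid Complex.DeMoivre mult_ac)
    also have "(\<Sum>\<tau><N. cis (of_int (int i * a) * grid N \<tau>) * of_real (jackson_weight p n (grid N \<tau>))) = 0"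
      using trig_poly_grid_orthogonal[OF trig_poly_jackson_weight, of n p "int i * a" N] i assms
      by (simp add: abs_mult)
    finally show ?thesis by simp
  qed
  have "(\<Sum>\<tau><N. ?J \<tau> * (cis (of_int a * sgrid N \<tau>) - 1) ^ l)
     = (\<Sum>\<tau><N. \<Sum>i\<le>l. ?J \<tau> * (of_nat (l choose i) * cis (of_int a * sgrid N \<tau>) ^ i * (- 1) ^ (l - i)))"
    using binomial_ring[of "cis (of_int a * sgrid N _)" "- 1" l] by (simp add: sum_distrib_left)
  also have "\<dots> = (\<Sum>i\<le>l. of_nat (l choose i) * (- 1) ^ (l - i) * (\<Sum>\<tau><N. ?J \<tau> * cis (of_int a * sgrid N \<tau>) ^ i))"
    by (subst sum.swap) (simp add: sum_distrib_left mult_ac)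
  also have "\<dots> = (\<Sum>i\<in>{0}. of_nat (l choose i) * (- 1) ^ (l - i) * (\<Sum>\<tau><N. ?J \<tau> * cis (of_int a * sgrid N \<tau>) ^ i))"
    using mean0 by (intro sum.mono_neutral_right) auto
  also have "\<dots> = (- 1) ^ l * of_real (\<Sum>\<tau><N. jackson p n N (sgrid N \<tau>))" by simp
  also have "\<dots> = (- 1) ^ l * of_nat N" using jackson_mean[OF assms(1,2), of p] by simp
  finally show ?thesis .
qed

text \<open>
  The symbol of the operator \<open>\<alpha> Id\<close> plus a mean of \<open>l\<close>-th differences with steps \<open>sgrid N \<tau>\<close> and weights
  \<open>\<beta> \<tau>\<close>. Such an operator can be estimated directly by the smoothness conditions.
\<close>

definition multiplier :: "nat \<Rightarrow> nat \<Rightarrow> real \<Rightarrow> (nat \<Rightarrow> real) \<Rightarrow> int \<Rightarrow> complex"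
  where "multiplier l N \<alpha> \<beta> a =
    of_real \<alpha> + (\<Sum>\<tau><N. of_real (\<beta> \<tau>) * (cis (of_int a * sgrid N \<tau>) - 1) ^ l) / of_nat N"

text \<open>
  The multipliers of the levels \<open>0, \<dots>, M\<close> form a decomposition of the identity. On trigonometric polynomials of degree below
  \<open>P * 2 ^ M\<close> the second condition puts level \<open>s\<close> below the frequency \<open>P * 2 ^ s\<close>, the third makes it small of order \<open>2 powr (- r * s)\<close> on functions with
  \<open>r\<close>-th order smoothness, and the fourth keeps it bounded on all functions.
\<close>

definition smoothing_family ::
    "nat \<Rightarrow> real \<Rightarrow> nat \<Rightarrow> real \<Rightarrow> nat \<Rightarrow> nat \<Rightarrow> (nat \<Rightarrow> real) \<Rightarrow> (nat \<Rightarrow> nat \<Rightarrow> real) \<Rightarrow> bool"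
  where "smoothing_family l r P C M N \<alpha> \<beta> \<longleftrightarrow>
    (\<forall>a. (\<Sum>s\<le>M. multiplier l N (\<alpha> s) (\<beta> s) a) = 1) \<and>
    (\<forall>s\<le>M. \<forall>a. int (P * 2 ^ s) \<le> \<bar>a\<bar> \<and> \<bar>a\<bar> < int (P * 2 ^ M) \<longrightarrow> multiplier l N (\<alpha> s) (\<beta> s) a = 0) \<and>
    (\<forall>s\<le>M. \<bar>\<alpha> s\<bar> + (\<Sum>\<tau><N. \<bar>\<beta> s \<tau>\<bar> * \<bar>sgrid N \<tau>\<bar> powr r) / N \<le> C * 2 powr (- (r * s))) \<and>
    (\<forall>s\<le>M. \<bar>\<alpha> s\<bar> + (\<Sum>\<tau><N. \<bar>\<beta> s \<tau>\<bar>) / N \<le> 2)"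

text \<open>
  The generalized Jackson operator \<open>Id - (- 1) ^ l * (\<Sum>\<tau><N. \<kappa> \<tau> * (shift - Id) ^ l) / N\<close>, with a Jackson kernel \<open>\<kappa>\<close>
  of parameter \<open>2 ^ s\<close>, approximates to the order \<open>2 powr (- r * s)\<close> and kills high frequencies. The
  multipliers are the differences of these operators for successive \<open>s\<close>.
\<close>

lemma smoothing_multipliers:
  fixes r :: real and l :: nat
  assumes "0 < r"
  shows "\<exists>P::nat. \<exists>C::real. 1 \<le> P \<and> 1 \<le> C \<and> (\<forall>M. \<exists>N0. \<forall>N\<ge>N0. \<exists>\<alpha> \<beta>. smoothing_family l r P C M N \<alpha> \<beta>)"
proof -
  define q where "q = nat \<lceil>r\<rceil>"
  have q: "r \<le> 2 * real q" using assms unfolding q_def by linarith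
  \<comment> \<open>The Jackson weight of order \<open>Suc q\<close> and parameter \<open>2 ^ s\<close> has degree at most \<open>2 * Suc q * 2 ^ s\<close>.\<close>
  define P where "P = 2 * Suc q + 1"
  define A where "A = 1 + 32 * (64::real) ^ q"
  define C where "C = 1 + A * (2 powr r + 1)"
  have A: "A \<ge> 1" by (simp add: A_def)
  have "\<exists>\<alpha> \<beta>. smoothing_family l r P C M N \<alpha> \<beta>"
    if N0: "(l + 9) * P * 2 ^ M \<le> N" for M N
  proof -
    have P: "P \<ge> 1" by (simp add: P_def)
    have N8: "8 * 2 ^ s \<le> N" if "s \<le> M" for s
    proof -
      have "8 * 2 ^ s \<le> 8 * (2::nat) ^ M" using that by simp
      also have "\<dots> \<le> (l + 9) * P * 2 ^ M" using P by (intro mult_right_mono) (auto intro: order.trans[of _ "(l + 9) * 1"])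
      finally show ?thesis using N0 by linarith
    qed
    have N: "N > 0" using N8[of 0] by simp
    \<comment> \<open>The last mean is replaced by 0: the top level takes up all that the others leave, and the sum is exact.\<close>
    define \<kappa> where "\<kappa> s \<tau> = (if s < M then jackson (Suc q) (2 ^ s) N (sgrid N \<tau>) else 0)" for s \<tau>
    define \<alpha> where "\<alpha> s = (if s = 0 then 1 else 0 :: real)" for s :: nat
    define \<beta> where "\<beta> s \<tau> = (if s = 0 then - ((- 1) ^ l * \<kappa> 0 \<tau>) else (- 1) ^ l * (\<kappa> (s - 1) \<tau> - \<kappa> s \<tau>))" for s \<tau>
    have telescope: "(\<Sum>s\<le>m. \<beta> s \<tau>) = - ((- 1) ^ l * \<kappa> m \<tau>)" for m \<tau>
      by (induction m) (auto simp: \<beta>_def algebra_simps)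
    have 1: "(\<Sum>s\<le>M. multiplier l N (\<alpha> s) (\<beta> s) a) = 1" for a
    proof -
      have "(\<Sum>s\<le>M. multiplier l N (\<alpha> s) (\<beta> s) a) = (\<Sum>s\<le>M. of_real (\<alpha> s))
         + (\<Sum>\<tau><N. of_real (\<Sum>s\<le>M. \<beta> s \<tau>) * (cis (of_int a * sgrid N \<tau>) - 1) ^ l) / of_nat N"
        unfolding multiplier_def of_real_sum sum_distrib_right
        by (subst sum.swap) (simp add: sum.distrib sum_divide_distrib)
      also have "(\<Sum>s\<le>M. complex_of_real (\<alpha> s)) = (\<Sum>s\<le>M. if s = 0 then 1 else 0)"
        by (intro sum.cong) (auto simp: \<alpha>_def)
      also have "\<dots> = 1" by simp
      finally show ?thesis by (simp add: telescope \<kappa>_def)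
    qed
    have \<kappa>sum: "(\<Sum>\<tau><N. of_real (\<kappa> s' \<tau>) * (cis (of_int a * sgrid N \<tau>) - 1) ^ l) = (- 1) ^ l * of_nat N"
      if "s' \<le> s" "s < M" "int (P * 2 ^ s) \<le> \<bar>a\<bar>" "\<bar>a\<bar> < int (P * 2 ^ M)" for s s' a
    proof -
      have "2 ^ s' \<le> (2::nat) ^ s" using that by simp
      then have "2 * 2 ^ s' * Suc q < P * 2 ^ s" unfolding P_def
        by (smt (verit, ccfv_threshold) Suc_eq_plus1 add_lessD1 add_mult_distrib less_add_same_cancel1 mult.commute mult.left_commute mult_le_mono2 nat_1_add_1 not_less one_add_one zero_less_numeral zero_less_power le_neq_implies_less mult_1 less_le_trans)
      then have d: "int (2 * 2 ^ s' * Suc q) < int (P * 2 ^ s)" by (simp only: of_nat_less_iff)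
      then have d': "int (2 * 2 ^ s' * Suc q) < \<bar>a\<bar>" using that by linarith
      have "int l * \<bar>a\<bar> + int (2 * 2 ^ s' * Suc q) < int l * \<bar>a\<bar> + \<bar>a\<bar> + 1" using d' by linarith
      also have "\<dots> \<le> (int l + 9) * int (P * 2 ^ M)"
      proof -
        have "(int l + 1) * \<bar>a\<bar> \<le> (int l + 1) * int (P * 2 ^ M)" using that by (intro mult_left_mono) auto
        moreover have "1 \<le> int (P * 2 ^ M)" using that by linarith
        ultimately show ?thesis by (simp add: algebra_simps)
      qed
      also have "\<dots> \<le> int N" using N0
        by (metis of_nat_le_iff of_nat_mult of_nat_add of_nat_numeral mult.assoc)
      finally have "int l * \<bar>a\<bar> + int (2 * 2 ^ s' * Suc q) < int N" .
      from jackson_annihilates[OF _ _ d' this] show ?thesis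
        using that N8[of s'] by (simp add: \<kappa>_def)
    qed
    have 2: "multiplier l N (\<alpha> s) (\<beta> s) a = 0"
      if "s \<le> M" "int (P * 2 ^ s) \<le> \<bar>a\<bar>" "\<bar>a\<bar> < int (P * 2 ^ M)" for s a
    proof -
      have sM: "s < M" using that by (cases "s = M") auto
      have [simp]: "(- 1) ^ l * (- 1) ^ l = (1::complex)" by (simp flip: power_mult_distrib)
      show ?thesis
      proof (cases "s = 0")
        case True
        have "(\<Sum>\<tau><N. of_real (\<beta> s \<tau>) * (cis (of_int a * sgrid N \<tau>) - 1) ^ l)
           = - ((- 1) ^ l * (\<Sum>\<tau><N. of_real (\<kappa> 0 \<tau>) * (cis (of_int a * sgrid N \<tau>) - 1) ^ l))"
          using True by (simp add: \<beta>_def sum_distrib_left sum_negf mult_ac)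
        also have "\<dots> = - of_nat N" using \<kappa>sum[of 0 s a] that sM by (simp add: mult.assoc[symmetric])
        finally show ?thesis using True N by (simp add: multiplier_def \<alpha>_def)
      next
        case False
        have "(\<Sum>\<tau><N. of_real (\<beta> s \<tau>) * (cis (of_int a * sgrid N \<tau>) - 1) ^ l)
           = (- 1) ^ l * ((\<Sum>\<tau><N. of_real (\<kappa> (s - 1) \<tau>) * (cis (of_int a * sgrid N \<tau>) - 1) ^ l)
               - (\<Sum>\<tau><N. of_real (\<kappa> s \<tau>) * (cis (of_int a * sgrid N \<tau>) - 1) ^ l))"
          using False by (simp add: \<beta>_def sum_distrib_left sum_subtractf algebra_simps)
        also have "\<dots> = 0" using \<kappa>sum[of "s - 1" s a] \<kappa>sum[of s s a] that sM by simp
        finally show ?thesis using False by (simp add: multiplier_def \<alpha>_def)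
      qed
    qed
    have \<kappa>moment: "(\<Sum>\<tau><N. \<kappa> s \<tau> * \<bar>sgrid N \<tau>\<bar> powr r) / N \<le> A * 2 powr (- (r * s))" for s
    proof (cases "s < M")
      case True
      have "real (2 ^ s) powr (- r) = 2 powr (- (r * s))"
        by (simp add: powr_powr mult.commute flip: powr_realpow)
      then show ?thesis
        using jackson_moment[of "2 ^ s" N r q] N8[of s] True assms q by (simp add: \<kappa>_def A_def)
    qed (use A in \<open>simp add: \<kappa>_def\<close>)
    have \<kappa>pos: "\<kappa> s \<tau> \<ge> 0" for s \<tau> by (simp add: \<kappa>_def jackson_nonneg)
    have \<kappa>mean: "(\<Sum>\<tau><N. \<kappa> s \<tau>) / N \<le> 1" for s
      using jackson_mean[of "2 ^ s" N "Suc q"] N8[of s] by (cases "s < M") (auto simp: \<kappa>_def)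
    have 4: "\<bar>\<alpha> s\<bar> + (\<Sum>\<tau><N. \<bar>\<beta> s \<tau>\<bar>) / N \<le> 2" for s
    proof (cases "s = 0")
      case True
      have "\<bar>\<beta> s \<tau>\<bar> = \<kappa> 0 \<tau>" for \<tau> using True \<kappa>pos[of 0 \<tau>] by (simp add: \<beta>_def abs_mult power_abs)
      then show ?thesis using \<kappa>mean[of 0] True by (simp add: \<alpha>_def)
    next
      case False
      have b: "\<bar>\<beta> s \<tau>\<bar> \<le> \<kappa> (s - 1) \<tau> + \<kappa> s \<tau>" for \<tau>
        using False \<kappa>pos[of s \<tau>] \<kappa>pos[of "s - 1" \<tau>] by (simp add: \<beta>_def abs_mult power_abs)
      have "(\<Sum>\<tau><N. \<bar>\<beta> s \<tau>\<bar>) / N \<le> (\<Sum>\<tau><N. \<kappa> (s - 1) \<tau> + \<kappa> s \<tau>) / N"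
        by (intro divide_right_mono sum_mono b) auto
      also have "\<dots> \<le> 2" using \<kappa>mean[of "s - 1"] \<kappa>mean[of s] by (simp add: sum.distrib add_divide_distrib)
      finally show ?thesis using False by (simp add: \<alpha>_def)
    qed
    have 3: "\<bar>\<alpha> s\<bar> + (\<Sum>\<tau><N. \<bar>\<beta> s \<tau>\<bar> * \<bar>sgrid N \<tau>\<bar> powr r) / N \<le> C * 2 powr (- (r * s))" for s
    proof (cases "s = 0")
      case True
      have "\<bar>\<beta> s \<tau>\<bar> = \<kappa> 0 \<tau>" for \<tau> using True \<kappa>pos[of 0 \<tau>] by (simp add: \<beta>_def abs_mult power_abs)
      then have "\<bar>\<alpha> s\<bar> + (\<Sum>\<tau><N. \<bar>\<beta> s \<tau>\<bar> * \<bar>sgrid N \<tau>\<bar> powr r) / N \<le> 1 + A * 1"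
        using \<kappa>moment[of 0] True by (simp add: \<alpha>_def)
      also have "\<dots> \<le> C" using A by (simp add: C_def algebra_simps)
      finally show ?thesis using True by simp
    next
      case False
      have b: "\<bar>\<beta> s \<tau>\<bar> \<le> \<kappa> (s - 1) \<tau> + \<kappa> s \<tau>" for \<tau>
        using False \<kappa>pos[of s \<tau>] \<kappa>pos[of "s - 1" \<tau>] by (simp add: \<beta>_def abs_mult power_abs)
      have "(\<Sum>\<tau><N. \<bar>\<beta> s \<tau>\<bar> * \<bar>sgrid N \<tau>\<bar> powr r) / N
        \<le> (\<Sum>\<tau><N. (\<kappa> (s - 1) \<tau> + \<kappa> s \<tau>) * \<bar>sgrid N \<tau>\<bar> powr r) / N"
        by (intro divide_right_mono sum_mono mult_right_mono b) auto
      also have "\<dots> = (\<Sum>\<tau><N. \<kappa> (s - 1) \<tau> * \<bar>sgrid N \<tau>\<bar> powr r) / N + (\<Sum>\<tau><N. \<kappa> s \<tau> * \<bar>sgrid N \<tau>\<bar> powr r) / N"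
        by (simp add: add_divide_distrib sum.distrib algebra_simps)
      also have "\<dots> \<le> A * 2 powr (- (r * real (s - 1))) + A * 2 powr (- (r * s))"
        using \<kappa>moment[of "s - 1"] \<kappa>moment[of s] False by (intro add_mono) auto
      also have "2 powr (- (r * real (s - 1))) = 2 powr r * 2 powr (- (r * s))"
        using False by (simp add: powr_add[symmetric] algebra_simps of_nat_diff)
      also have "A * (2 powr r * 2 powr (- (r * s))) + A * 2 powr (- (r * s)) = A * (2 powr r + 1) * 2 powr (- (r * s))"
        by (simp add: algebra_simps)
      also have "\<dots> \<le> C * 2 powr (- (r * s))" by (intro mult_right_mono) (auto simp: C_def)
      finally show ?thesis using False by (simp add: \<alpha>_def)
    qed
    show ?thesis unfolding smoothing_family_def using 1 2 3 4 by blast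
  qed
  moreover have "1 \<le> P" "1 \<le> C" using A by (auto simp: P_def C_def)
  ultimately show ?thesis by blast
qed

section \<open>Grid means and band-limited functions\<close>

definition grid_point :: "(nat \<Rightarrow> nat) \<Rightarrow> (nat \<Rightarrow> nat) \<Rightarrow> nat \<Rightarrow> real"
  where "grid_point N \<sigma> = (\<lambda>j. grid (N j) (\<sigma> j))"

definition grid_index :: "nat \<Rightarrow> (nat \<Rightarrow> nat) \<Rightarrow> (nat \<Rightarrow> nat) set"
  where "grid_index d N = PiE {1..d} (\<lambda>j. {..<N j})"

definition grid_size :: "nat \<Rightarrow> (nat \<Rightarrow> nat) \<Rightarrow> nat"
  where "grid_size d N = (\<Prod>j\<in>{1..d}. N j)"

definition grid_mean :: "nat \<Rightarrow> (nat \<Rightarrow> nat) \<Rightarrow> ((nat \<Rightarrow> real) \<Rightarrow> 'a::real_normed_field) \<Rightarrow> 'a"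
  where "grid_mean d N f = (\<Sum>\<sigma>\<in>grid_index d N. f (grid_point N \<sigma>)) / of_nat (grid_size d N)"

lemma finite_grid_index [simp]: "finite (grid_index d N)"
  by (auto simp: grid_index_def intro!: finite_PiE)

lemma card_grid_index: "card (grid_index d N) = grid_size d N"
  by (simp add: grid_index_def grid_size_def card_PiE)

lemma grid_mean_mono:
  "(\<And>\<xi>. f \<xi> \<le> g \<xi>) \<Longrightarrow> grid_mean d N f \<le> (grid_mean d N g :: real)"
  by (auto simp: grid_mean_def intro!: divide_right_mono sum_mono)

lemma grid_mean_nonneg: "(\<And>\<xi>. 0 \<le> f \<xi>) \<Longrightarrow> 0 \<le> (grid_mean d N f :: real)"
  by (auto simp: grid_mean_def intro!: divide_nonneg_nonneg sum_nonneg)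

lemma norm_grid_mean_le: "norm (grid_mean d N f) \<le> grid_mean d N (\<lambda>\<xi>. norm (f \<xi>))"
  by (auto simp: grid_mean_def norm_divide intro!: divide_right_mono norm_sum)

lemma grid_mean_sum: "grid_mean d N (\<lambda>\<xi>. \<Sum>i\<in>I. f i \<xi>) = (\<Sum>i\<in>I. grid_mean d N (f i))"
  unfolding grid_mean_def by (subst sum.swap) (simp add: sum_divide_distrib)

lemma grid_mean_cmult: "grid_mean d N (\<lambda>\<xi>. c * f \<xi>) = c * grid_mean d N f"
  by (simp add: grid_mean_def sum_distrib_left)

lemma grid_mean_multc: "grid_mean d N (\<lambda>\<xi>. f \<xi> * c) = grid_mean d N f * c"
  by (simp add: grid_mean_def sum_distrib_right)

lemma grid_mean_swap:
  "grid_mean d N (\<lambda>\<xi>. grid_mean d' N' (f \<xi>)) = grid_mean d' N' (\<lambda>\<zeta>. grid_mean d N (\<lambda>\<xi>. f \<xi> \<zeta>))"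
  unfolding grid_mean_def sum_divide_distrib by (subst sum.swap) (simp add: mult.commute)

lemma grid_mean_prod:
  "grid_mean d N (\<lambda>\<xi>. \<Prod>j\<in>{1..d}. f j (\<xi> j)) = (\<Prod>j\<in>{1..d}. (\<Sum>\<tau><N j. f j (grid (N j) \<tau>)) / of_nat (N j))"
  by (simp add: grid_mean_def grid_point_def grid_index_def grid_size_def prod_dividef prod_sum_PiE)

definition character :: "nat \<Rightarrow> (nat \<Rightarrow> int) \<Rightarrow> (nat \<Rightarrow> real) \<Rightarrow> complex"
  where "character d a x = (\<Prod>j\<in>{1..d}. cis (of_int (a j) * x j))"

lemma norm_character [simp]: "norm (character d a x) = 1"
  by (simp add: character_def prod_norm[symmetric])

definition vp :: "nat \<Rightarrow> (nat \<Rightarrow> nat) \<Rightarrow> (nat \<Rightarrow> real) \<Rightarrow> (nat \<Rightarrow> real) \<Rightarrow> complex"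
  where "vp d n x \<xi> = (\<Prod>j\<in>{1..d}. vp_kernel (n j) (x j - \<xi> j))"

lemma vp_grid_l1:
  assumes "\<And>j. j \<in> {1..d} \<Longrightarrow> 4 * n j < N j"
  shows "grid_mean d N (\<lambda>\<xi>. norm (vp d n x \<xi>)) \<le> 2 ^ d"
    and "grid_mean d N (\<lambda>\<xi>. norm (vp d n \<xi> x)) \<le> 2 ^ d"
proof -
  have *: "(\<Prod>j\<in>{1..d}. f j) \<le> (2::real) ^ d" if "\<And>j. j \<in> {1..d} \<Longrightarrow> 0 \<le> f j \<and> f j \<le> 2" for f :: "nat \<Rightarrow> real"
    using prod_mono[of "{1..d}" f "\<lambda>_. 2"] that by simp
  have "grid_mean d N (\<lambda>\<xi>. norm (vp d n x \<xi>))
      = (\<Prod>j\<in>{1..d}. (\<Sum>\<tau><N j. norm (vp_kernel (n j) (x j - grid (N j) \<tau>))) / of_nat (N j))"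
    unfolding vp_def prod_norm[symmetric] by (rule grid_mean_prod)
  also have "\<dots> \<le> 2 ^ d"
    using vp_kernel_grid_l1[OF assms] assms
    by (intro * conjI) (fastforce intro!: divide_nonneg_nonneg sum_nonneg, fastforce simp: field_simps)
  finally show "grid_mean d N (\<lambda>\<xi>. norm (vp d n x \<xi>)) \<le> 2 ^ d" .
  have "grid_mean d N (\<lambda>\<xi>. norm (vp d n \<xi> x))
      = (\<Prod>j\<in>{1..d}. (\<Sum>\<tau><N j. norm (vp_kernel (n j) (grid (N j) \<tau> - x j))) / of_nat (N j))"
    unfolding vp_def prod_norm[symmetric] by (rule grid_mean_prod)
  also have "\<dots> \<le> 2 ^ d"
    using vp_kernel_grid_l1'[OF assms] assms
    by (intro * conjI) (fastforce intro!: divide_nonneg_nonneg sum_nonneg, fastforce simp: field_simps)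
  finally show "grid_mean d N (\<lambda>\<xi>. norm (vp d n \<xi> x)) \<le> 2 ^ d" .
qed

lemma norm_vp_le:
  assumes "\<And>j. j \<in> {1..d} \<Longrightarrow> 4 * n j < N j"
  shows "norm (vp d n x \<xi>) \<le> real (grid_size d N)"
proof -
  have "norm (vp_kernel (n j) (x j - \<xi> j)) \<le> real (N j)" if "j \<in> {1..d}" for j
    using norm_vp_kernel_le[of "n j" "x j - \<xi> j"] assms[OF that] by linarith
  then show ?thesis
    unfolding vp_def grid_size_def prod_norm[symmetric] of_nat_prod by (intro prod_mono) auto
qed

text \<open>
  The reproducing identity on all sufficiently fine grids is used in place of being a trigonometric polynomial of
  degree at most \<open>n j\<close> in the variable \<open>j\<close>. In this form the property visibly passes to sums and to integrals over a
  parameter, and it yields all estimates needed.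
\<close>

definition band_limited :: "nat \<Rightarrow> (nat \<Rightarrow> nat) \<Rightarrow> ((nat \<Rightarrow> real) \<Rightarrow> complex) \<Rightarrow> bool"
  where "band_limited d n h \<longleftrightarrow>
    (\<forall>N. (\<forall>j\<in>{1..d}. 4 * n j < N j) \<longrightarrow> (\<forall>x. h x = grid_mean d N (\<lambda>\<xi>. h \<xi> * vp d n x \<xi>)))"

lemma band_limitedD:
  "band_limited d n h \<Longrightarrow> (\<And>j. j \<in> {1..d} \<Longrightarrow> 4 * n j < N j) \<Longrightarrow> h x = grid_mean d N (\<lambda>\<xi>. h \<xi> * vp d n x \<xi>)"
  by (auto simp: band_limited_def)

lemma band_limited_character:
  assumes "\<And>j. j \<in> {1..d} \<Longrightarrow> \<bar>a j\<bar> \<le> int (n j)"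
  shows "band_limited d n (character d a)"
  unfolding band_limited_def
proof (intro allI impI)
  fix N x assume N: "\<forall>j\<in>{1..d}. 4 * n j < N j"
  have "grid_mean d N (\<lambda>\<xi>. character d a \<xi> * vp d n x \<xi>)
      = (\<Prod>j\<in>{1..d}. (\<Sum>\<tau><N j. cis (of_int (a j) * grid (N j) \<tau>) * vp_kernel (n j) (x j - grid (N j) \<tau>)) / of_nat (N j))"
    unfolding character_def vp_def prod.distrib[symmetric] by (rule grid_mean_prod)
  also have "\<dots> = (\<Prod>j\<in>{1..d}. cis (of_int (a j) * x j))"
  proof (rule prod.cong[OF refl])
    fix j assume j: "j \<in> {1..d}"
    then have Nj: "4 * n j < N j" using N by blast
    show "(\<Sum>\<tau><N j. cis (of_int (a j) * grid (N j) \<tau>) * vp_kernel (n j) (x j - grid (N j) \<tau>)) / of_nat (N j)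
        = cis (of_int (a j) * x j)"
      using vp_kernel_reproduces[OF Nj assms[OF j], of "x j"] Nj by simp
  qed
  finally show "character d a x = grid_mean d N (\<lambda>\<xi>. character d a \<xi> * vp d n x \<xi>)"
    by (simp add: character_def)
qed

lemma band_limited_sum:
  "(\<And>i. i \<in> I \<Longrightarrow> band_limited d n (h i)) \<Longrightarrow> band_limited d n (\<lambda>x. \<Sum>i\<in>I. h i x)"
  unfolding band_limited_def
proof (intro allI impI)
  fix N x assume h: "\<And>i. i \<in> I \<Longrightarrow> \<forall>N. (\<forall>j\<in>{1..d}. 4 * n j < N j) \<longrightarrow> (\<forall>x. h i x = grid_mean d N (\<lambda>\<xi>. h i \<xi> * vp d n x \<xi>))"
    and N: "\<forall>j\<in>{1..d}. 4 * n j < N j"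
  have "(\<Sum>i\<in>I. h i x) = (\<Sum>i\<in>I. grid_mean d N (\<lambda>\<xi>. h i \<xi> * vp d n x \<xi>))"
    by (rule sum.cong[OF refl]) (use h N in metis)
  then show "(\<Sum>i\<in>I. h i x) = grid_mean d N (\<lambda>\<xi>. (\<Sum>i\<in>I. h i \<xi>) * vp d n x \<xi>)"
    by (simp add: sum_distrib_right grid_mean_sum)
qed

lemma band_limited_cmult: "band_limited d n h \<Longrightarrow> band_limited d n (\<lambda>x. c * h x)"
  unfolding band_limited_def mult.assoc grid_mean_cmult by metis

lemma band_limited_integral:
  assumes "\<And>y. band_limited d n (\<lambda>x. h x y)" "\<And>x. integrable M (h x)"
  shows "band_limited d n (\<lambda>x. \<integral>y. h x y \<partial>M)"
  unfolding band_limited_def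
proof (intro allI impI)
  fix N x assume N: "\<forall>j\<in>{1..d}. 4 * n j < N j"
  have "(\<integral>y. h x y \<partial>M) = (\<integral>y. grid_mean d N (\<lambda>\<xi>. h \<xi> y * vp d n x \<xi>) \<partial>M)"
    using N band_limitedD[OF assms(1)] by (intro Bochner_Integration.integral_cong) auto
  also have "\<dots> = grid_mean d N (\<lambda>\<xi>. (\<integral>y. h \<xi> y \<partial>M) * vp d n x \<xi>)"
    unfolding grid_mean_def using assms(2) by simp
  finally show "(\<integral>y. h x y \<partial>M) = \<dots>" .
qed

text \<open>
  A band-limited function is bounded by its values on a grid, since the kernel has bounded grid mean.
\<close>

lemma band_limited_sup:
  assumes "band_limited d n h" and N: "\<And>j. j \<in> {1..d} \<Longrightarrow> 4 * n j < N j"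
    and "\<And>\<sigma>. \<sigma> \<in> grid_index d N \<Longrightarrow> norm (h (grid_point N \<sigma>)) \<le> B" "0 \<le> B"
  shows "norm (h x) \<le> 2 ^ d * B"
proof -
  have "norm (h x) \<le> grid_mean d N (\<lambda>\<xi>. norm (h \<xi> * vp d n x \<xi>))"
    by (subst band_limitedD[OF assms(1) N]) (auto intro: norm_grid_mean_le)
  also have "\<dots> \<le> grid_mean d N (\<lambda>\<xi>. B * norm (vp d n x \<xi>))"
    unfolding grid_mean_def norm_mult using assms(3) by (intro divide_right_mono sum_mono mult_right_mono) auto
  also have "\<dots> \<le> B * 2 ^ d"
    unfolding grid_mean_cmult using vp_grid_l1(1)[of d n N x] N assms(4) by (intro mult_left_mono) auto
  finally show ?thesis by (simp add: mult.commute)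
qed

lemma band_limited_grid_change:
  assumes "band_limited d n h" and N: "\<And>j. j \<in> {1..d} \<Longrightarrow> 4 * n j < N j"
    and N': "\<And>j. j \<in> {1..d} \<Longrightarrow> 4 * n j < N' j"
  shows "grid_mean d N' (\<lambda>\<xi>. norm (h \<xi>)) \<le> 2 ^ d * grid_mean d N (\<lambda>\<xi>. norm (h \<xi>))"
proof -
  have "norm (h \<xi>) \<le> grid_mean d N (\<lambda>\<zeta>. norm (h \<zeta>) * norm (vp d n \<xi> \<zeta>))" for \<xi>
    unfolding norm_mult[symmetric]
    by (subst band_limitedD[OF assms(1) N]) (auto intro: norm_grid_mean_le)
  then have "grid_mean d N' (\<lambda>\<xi>. norm (h \<xi>)) \<le> grid_mean d N' (\<lambda>\<xi>. grid_mean d N (\<lambda>\<zeta>. norm (h \<zeta>) * norm (vp d n \<xi> \<zeta>)))"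
    by (rule grid_mean_mono)
  also have "\<dots> = grid_mean d N (\<lambda>\<zeta>. norm (h \<zeta>) * grid_mean d N' (\<lambda>\<xi>. norm (vp d n \<xi> \<zeta>)))"
    by (subst grid_mean_swap) (simp add: grid_mean_cmult)
  also have "\<dots> \<le> grid_mean d N (\<lambda>\<zeta>. norm (h \<zeta>) * 2 ^ d)"
    using N' by (intro grid_mean_mono mult_left_mono vp_grid_l1(2)) auto
  also have "\<dots> = 2 ^ d * grid_mean d N (\<lambda>\<xi>. norm (h \<xi>))" by (simp add: grid_mean_multc)
  finally show ?thesis .
qed

text \<open>
  On the grid \<open>N'\<close> the supremum is at most the number of nodes times the mean. One factor \<open>2 ^ d\<close> is for the
  passage from the nodes to all points, the other for the change of the grid.
\<close>

lemma nikolskii: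
  assumes "band_limited d n h" and N: "\<And>j. j \<in> {1..d} \<Longrightarrow> 4 * n j < N j"
    and N': "\<And>j. j \<in> {1..d} \<Longrightarrow> 4 * n j < N' j"
  shows "norm (h x) \<le> 4 ^ d * real (grid_size d N') * grid_mean d N (\<lambda>\<xi>. norm (h \<xi>))"
proof -
  have pos: "real (grid_size d N') > 0"
    unfolding grid_size_def using N' by (simp only: of_nat_prod) (intro prod_pos, fastforce)
  let ?B = "real (grid_size d N') * grid_mean d N' (\<lambda>\<xi>. norm (h \<xi>))"
  have "norm (h (grid_point N' \<sigma>)) \<le> ?B" if "\<sigma> \<in> grid_index d N'" for \<sigma>
  proof -
    have "norm (h (grid_point N' \<sigma>)) \<le> (\<Sum>\<sigma>\<in>grid_index d N'. norm (h (grid_point N' \<sigma>)))"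
      using that by (intro member_le_sum) auto
    also have "\<dots> = ?B" using pos by (simp add: grid_mean_def)
    finally show ?thesis .
  qed
  then have "norm (h x) \<le> 2 ^ d * ?B"
    by (intro band_limited_sup[OF assms(1) N']) (auto intro!: mult_nonneg_nonneg grid_mean_nonneg)
  also have "\<dots> \<le> 2 ^ d * (real (grid_size d N') * (2 ^ d * grid_mean d N (\<lambda>\<xi>. norm (h \<xi>))))"
    using band_limited_grid_change[OF assms] by (intro mult_left_mono) auto
  also have "\<dots> = 4 ^ d * real (grid_size d N') * grid_mean d N (\<lambda>\<xi>. norm (h \<xi>))"
    by (simp add: power_mult_distrib[symmetric] mult_ac)
  finally show ?thesis .
qed

section \<open>The dyadic blocks of a smooth kernel\<close>

lemma character_shift:
  assumes "j \<in> {1..v}"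
  shows "character v a (z(j := z j + s)) = cis (of_int (a j) * s) * character v a z"
proof -
  have "character v a (z(j := z j + s)) = cis (of_int (a j) * (z j + s)) * (\<Prod>i\<in>{1..v}-{j}. cis (of_int (a i) * z i))"
    unfolding character_def by (subst prod.remove[OF _ assms]) (auto intro!: prod.cong)
  also have "\<dots> = cis (of_int (a j) * s) * (cis (of_int (a j) * z j) * (\<Prod>i\<in>{1..v}-{j}. cis (of_int (a i) * z i)))"
    by (simp add: cis_mult[symmetric] algebra_simps)
  also have "\<dots> = cis (of_int (a j) * s) * character v a z"
    unfolding character_def by (subst prod.remove[OF _ assms, of "\<lambda>j. cis (of_int (a j) * z j)"]) auto
  finally show ?thesis .
qed

lemma difference_power_trig_sum:
  assumes "j \<in> {1..v}"
  shows "(difference j s ^^ l) (\<lambda>z. \<Sum>a\<in>A. c a * character v a z)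
       = (\<lambda>z. \<Sum>a\<in>A. c a * (cis (of_int (a j) * s) - 1) ^ l * character v a z)"
proof (induction l)
  case (Suc l)
  have "(difference j s ^^ Suc l) (\<lambda>z. \<Sum>a\<in>A. c a * character v a z)
      = difference j s (\<lambda>z. \<Sum>a\<in>A. c a * (cis (of_int (a j) * s) - 1) ^ l * character v a z)"
    using Suc by simp
  also have "\<dots> = (\<lambda>z. \<Sum>a\<in>A. c a * (cis (of_int (a j) * s) - 1) ^ Suc l * character v a z)"
    unfolding difference_def character_shift[OF assms] sum_subtractf[symmetric]
    by (intro ext sum.cong refl) (simp add: algebra_simps)
  finally show ?case .
qed simp

lemma mixed_difference_trig_sum:
  assumes "e \<subseteq> {1..v}"
  shows "mixed_difference l t e (\<lambda>z. \<Sum>a\<in>A. c a * character v a z)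
       = (\<lambda>z. \<Sum>a\<in>A. c a * (\<Prod>j\<in>e. (cis (of_int (a j) * t j) - 1) ^ l) * character v a z)"
proof -
  have fin: "finite e" using assms finite_subset by blast
  have "fold (\<lambda>j. difference j (t j) ^^ l) xs (\<lambda>z. \<Sum>a\<in>A. c a * character v a z)
      = (\<lambda>z. \<Sum>a\<in>A. c a * (\<Prod>j\<leftarrow>xs. (cis (of_int (a j) * t j) - 1) ^ l) * character v a z)"
    if "set xs \<subseteq> {1..v}" for xs
    using that
  proof (induction xs arbitrary: c)
    case (Cons j xs)
    then show ?case
      using Cons.IH[of "\<lambda>a. c a * (cis (of_int (a j) * t j) - 1) ^ l"]
      by (simp add: difference_power_trig_sum mult.assoc)
  qed simp
  from this[of "sorted_list_of_set e"] assms fin show ?thesis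
    by (simp add: mixed_difference_def prod.distinct_set_conv_list[symmetric])
qed

text \<open>
  The conditions that define \<open>H_class\<close>, for the constant \<open>B\<close>, with the mean over a grid of \<open>x\<close> in place of
  the \<open>L1\<close> norm, and a genuine supremum over \<open>y\<close>.
\<close>

definition discrete_class :: "nat \<Rightarrow> real \<Rightarrow> nat \<Rightarrow> nat \<Rightarrow> real \<Rightarrow> ((nat \<Rightarrow> real) \<Rightarrow> complex) \<Rightarrow> bool"
  where "discrete_class l r d N B g \<longleftrightarrow>
    (\<forall>e\<subseteq>{1..2 * d}. \<forall>t y. grid_mean d (\<lambda>_. N) (\<lambda>\<xi>. norm (mixed_difference l t e g (join d \<xi> y)))
        \<le> B * (\<Prod>j\<in>e. \<bar>t j\<bar> powr r))"

text \<open>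
  Multiply out the product of the multipliers: every term is a mixed difference in the variables of some set \<open>e\<close>,
  and summing the bounds for these gives back a product.
\<close>

lemma discrete_class_multiplier_bound:
  assumes cls: "discrete_class l r d N B (\<lambda>z. \<Sum>a\<in>A. c a * character (2 * d) a z)"
  shows "grid_mean d (\<lambda>_. N) (\<lambda>\<xi>. norm (\<Sum>a\<in>A. c a * (\<Prod>j\<in>{1..2 * d}. multiplier l N (\<alpha> j) (\<beta> j) (a j))
             * character (2 * d) a (join d \<xi> y)))
    \<le> B * (\<Prod>j\<in>{1..2 * d}. \<bar>\<alpha> j\<bar> + (\<Sum>\<tau><N. \<bar>\<beta> j \<tau>\<bar> * \<bar>sgrid N \<tau>\<bar> powr r) / N)"
proof -
  let ?V = "{1..2 * d}" and ?g = "\<lambda>z. \<Sum>a\<in>A. c a * character (2 * d) a z"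
  let ?\<Delta> = "\<lambda>e \<tau>. mixed_difference l (\<lambda>j. sgrid N (\<tau> j)) e ?g"
  let ?E = "\<lambda>e. PiE e (\<lambda>_. {..<N})"
  have mult: "(\<Prod>j\<in>?V. multiplier l N (\<alpha> j) (\<beta> j) (a j))
     = (\<Sum>e\<in>Pow ?V. \<Sum>\<tau>\<in>?E e. of_real (\<Prod>j\<in>?V - e. \<alpha> j) * (\<Prod>j\<in>e. of_real (\<beta> j (\<tau> j) / N)) *
           (\<Prod>j\<in>e. (cis (of_int (a j) * sgrid N (\<tau> j)) - 1) ^ l))" for a
  proof -
    have "(\<Prod>j\<in>?V. multiplier l N (\<alpha> j) (\<beta> j) (a j))
      = (\<Prod>j\<in>?V. (\<Sum>\<tau><N. of_real (\<beta> j \<tau> / N) * (cis (of_int (a j) * sgrid N \<tau>) - 1) ^ l) + of_real (\<alpha> j))"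
      by (simp add: multiplier_def sum_divide_distrib add.commute)
    also have "\<dots> = (\<Sum>e\<in>Pow ?V. (\<Prod>j\<in>e. \<Sum>\<tau><N. of_real (\<beta> j \<tau> / N) * (cis (of_int (a j) * sgrid N \<tau>) - 1) ^ l)
         * (\<Prod>j\<in>?V - e. of_real (\<alpha> j)))"
      by (rule prod_add) auto
    also have "\<dots> = (\<Sum>e\<in>Pow ?V. (\<Sum>\<tau>\<in>?E e. (\<Prod>j\<in>e. of_real (\<beta> j (\<tau> j) / N) * (cis (of_int (a j) * sgrid N (\<tau> j)) - 1) ^ l))
         * (\<Prod>j\<in>?V - e. of_real (\<alpha> j)))"
      by (intro sum.cong refl arg_cong2[where f=times] prod_sum_PiE) (auto intro: finite_subset)
    also have "\<dots> = (\<Sum>e\<in>Pow ?V. \<Sum>\<tau>\<in>?E e. of_real (\<Prod>j\<in>?V - e. \<alpha> j) * (\<Prod>j\<in>e. of_real (\<beta> j (\<tau> j) / N)) *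
           (\<Prod>j\<in>e. (cis (of_int (a j) * sgrid N (\<tau> j)) - 1) ^ l))"
      unfolding sum_distrib_right prod.distrib of_real_prod by (intro sum.cong refl) (simp only: mult_ac)
    finally show ?thesis .
  qed
  have "norm (\<Sum>a\<in>A. c a * (\<Prod>j\<in>?V. multiplier l N (\<alpha> j) (\<beta> j) (a j)) * character (2 * d) a z)
     \<le> (\<Sum>e\<in>Pow ?V. \<Sum>\<tau>\<in>?E e. (\<Prod>j\<in>?V - e. \<bar>\<alpha> j\<bar>) * (\<Prod>j\<in>e. \<bar>\<beta> j (\<tau> j)\<bar> / N) * norm (?\<Delta> e \<tau> z))" for z
  proof -
    have "(\<Sum>a\<in>A. c a * (\<Prod>j\<in>?V. multiplier l N (\<alpha> j) (\<beta> j) (a j)) * character (2 * d) a z)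
      = (\<Sum>e\<in>Pow ?V. \<Sum>\<tau>\<in>?E e. of_real (\<Prod>j\<in>?V - e. \<alpha> j) * (\<Prod>j\<in>e. of_real (\<beta> j (\<tau> j) / N)) *
         (\<Sum>a\<in>A. c a * (\<Prod>j\<in>e. (cis (of_int (a j) * sgrid N (\<tau> j)) - 1) ^ l) * character (2 * d) a z))"
      unfolding mult sum_distrib_left sum_distrib_right
      by (subst sum.swap, intro sum.cong refl, subst sum.swap, intro sum.cong refl) (simp add: mult_ac)
    also have "\<dots> = (\<Sum>e\<in>Pow ?V. \<Sum>\<tau>\<in>?E e. of_real (\<Prod>j\<in>?V - e. \<alpha> j) * (\<Prod>j\<in>e. of_real (\<beta> j (\<tau> j) / N)) * ?\<Delta> e \<tau> z)"
      by (intro sum.cong refl) (subst mixed_difference_trig_sum, auto)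
    finally have "norm (\<Sum>a\<in>A. c a * (\<Prod>j\<in>?V. multiplier l N (\<alpha> j) (\<beta> j) (a j)) * character (2 * d) a z) \<le> (\<Sum>e\<in>Pow ?V. \<Sum>\<tau>\<in>?E e. norm (of_real (\<Prod>j\<in>?V - e. \<alpha> j) * (\<Prod>j\<in>e. of_real (\<beta> j (\<tau> j) / N)) * ?\<Delta> e \<tau> z))"
      by (simp only:) (rule order.trans[OF norm_sum sum_mono], rule norm_sum)
    also have "\<dots> = (\<Sum>e\<in>Pow ?V. \<Sum>\<tau>\<in>?E e. (\<Prod>j\<in>?V - e. \<bar>\<alpha> j\<bar>) * (\<Prod>j\<in>e. \<bar>\<beta> j (\<tau> j)\<bar> / N) * norm (?\<Delta> e \<tau> z))"
    proof (intro sum.cong refl)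
      fix e \<tau>
      have "norm (\<Prod>j\<in>e. complex_of_real (\<beta> j (\<tau> j) / N)) = (\<Prod>j\<in>e. \<bar>\<beta> j (\<tau> j)\<bar> / N)"
        unfolding of_real_prod[symmetric] norm_of_real abs_prod by simp
      then show "norm (of_real (\<Prod>j\<in>?V - e. \<alpha> j) * (\<Prod>j\<in>e. of_real (\<beta> j (\<tau> j) / N)) * ?\<Delta> e \<tau> z)
         = (\<Prod>j\<in>?V - e. \<bar>\<alpha> j\<bar>) * (\<Prod>j\<in>e. \<bar>\<beta> j (\<tau> j)\<bar> / N) * norm (?\<Delta> e \<tau> z)"
        unfolding norm_mult by (simp only: norm_of_real abs_prod)
    qed
    finally show ?thesis .
  qed
  then have "grid_mean d (\<lambda>_. N) (\<lambda>\<xi>. norm (\<Sum>a\<in>A. c a * (\<Prod>j\<in>?V. multiplier l N (\<alpha> j) (\<beta> j) (a j))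
             * character (2 * d) a (join d \<xi> y)))
    \<le> grid_mean d (\<lambda>_. N) (\<lambda>\<xi>. \<Sum>e\<in>Pow ?V. \<Sum>\<tau>\<in>?E e. (\<Prod>j\<in>?V - e. \<bar>\<alpha> j\<bar>) * (\<Prod>j\<in>e. \<bar>\<beta> j (\<tau> j)\<bar> / N)
          * norm (?\<Delta> e \<tau> (join d \<xi> y)))"
    by (intro grid_mean_mono)
  also have "\<dots> = (\<Sum>e\<in>Pow ?V. \<Sum>\<tau>\<in>?E e. (\<Prod>j\<in>?V - e. \<bar>\<alpha> j\<bar>) * (\<Prod>j\<in>e. \<bar>\<beta> j (\<tau> j)\<bar> / N)
          * grid_mean d (\<lambda>_. N) (\<lambda>\<xi>. norm (?\<Delta> e \<tau> (join d \<xi> y))))"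
    by (simp only: grid_mean_sum grid_mean_cmult)
  also have "\<dots> \<le> (\<Sum>e\<in>Pow ?V. \<Sum>\<tau>\<in>?E e. (\<Prod>j\<in>?V - e. \<bar>\<alpha> j\<bar>) * (\<Prod>j\<in>e. \<bar>\<beta> j (\<tau> j)\<bar> / N)
          * (B * (\<Prod>j\<in>e. \<bar>sgrid N (\<tau> j)\<bar> powr r)))"
  proof (intro sum_mono mult_left_mono)
    fix e \<tau> assume "e \<in> Pow ?V"
    then show "grid_mean d (\<lambda>_. N) (\<lambda>\<xi>. norm (?\<Delta> e \<tau> (join d \<xi> y))) \<le> B * (\<Prod>j\<in>e. \<bar>sgrid N (\<tau> j)\<bar> powr r)"
      using cls[unfolded discrete_class_def, rule_format, of e "\<lambda>j. sgrid N (\<tau> j)" y] by auto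
  qed (auto intro!: mult_nonneg_nonneg prod_nonneg)
  also have "\<dots> = B * (\<Sum>e\<in>Pow ?V. (\<Sum>\<tau>\<in>?E e. \<Prod>j\<in>e. (\<bar>\<beta> j (\<tau> j)\<bar> / N) * \<bar>sgrid N (\<tau> j)\<bar> powr r) * (\<Prod>j\<in>?V - e. \<bar>\<alpha> j\<bar>))"
    unfolding sum_distrib_left sum_distrib_right prod.distrib by (intro sum.cong refl) (simp only: mult_ac)
  also have "\<dots> = B * (\<Sum>e\<in>Pow ?V. (\<Prod>j\<in>e. \<Sum>\<tau><N. (\<bar>\<beta> j \<tau>\<bar> / N) * \<bar>sgrid N \<tau>\<bar> powr r) * (\<Prod>j\<in>?V - e. \<bar>\<alpha> j\<bar>))"
    by (intro arg_cong2[where f=times] sum.cong refl prod_sum_PiE[symmetric]) (auto intro: finite_subset)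
  also have "\<dots> = B * (\<Prod>j\<in>?V. (\<Sum>\<tau><N. (\<bar>\<beta> j \<tau>\<bar> / N) * \<bar>sgrid N \<tau>\<bar> powr r) + \<bar>\<alpha> j\<bar>)"
    by (subst prod_add) auto
  finally show ?thesis by (simp add: sum_divide_distrib add.commute)
qed

lemma norm_multiplier_le:
  "norm (multiplier l N \<alpha> \<beta> a) \<le> 2 ^ l * (\<bar>\<alpha>\<bar> + (\<Sum>\<tau><N. \<bar>\<beta> \<tau>\<bar>) / N)"
proof -
  have 1: "norm ((cis x - 1) ^ l) \<le> 2 ^ l" for x
    unfolding norm_power using norm_triangle_ineq4[of "cis x" 1] by (intro power_mono) auto
  have "norm (multiplier l N \<alpha> \<beta> a) \<le> \<bar>\<alpha>\<bar> + norm (\<Sum>\<tau><N. of_real (\<beta> \<tau>) * (cis (of_int a * sgrid N \<tau>) - 1) ^ l) / N"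
    unfolding multiplier_def by (rule order.trans[OF norm_triangle_ineq]) (simp add: norm_divide)
  also have "\<dots> \<le> \<bar>\<alpha>\<bar> + (\<Sum>\<tau><N. \<bar>\<beta> \<tau>\<bar> * 2 ^ l) / N"
    by (intro add_left_mono divide_right_mono order.trans[OF norm_sum] sum_mono)
       (auto simp: norm_mult intro!: mult_left_mono 1)
  also have "\<dots> \<le> 2 ^ l * \<bar>\<alpha>\<bar> + 2 ^ l * ((\<Sum>\<tau><N. \<bar>\<beta> \<tau>\<bar>) / N)"
    by (intro add_mono) (auto simp: sum_distrib_right[symmetric] mult_ac intro: mult_right_mono[of 1 "2 ^ l" "\<bar>\<alpha>\<bar>", simplified])
  finally show ?thesis by (simp add: distrib_left)
qed

lemma prod_double_range: "(\<Prod>j\<in>{1..2 * d}. f j) = (\<Prod>j\<in>{1..d}. f j) * (\<Prod>j\<in>{1..d}. f (j + d))"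
  for f :: "nat \<Rightarrow> 'a::comm_monoid_mult"
proof -
  have "{1..2 * d} = {1..d} \<union> {1 + d..d + d}" by auto
  then have "(\<Prod>j\<in>{1..2 * d}. f j) = (\<Prod>j\<in>{1..d}. f j) * (\<Prod>j\<in>{1 + d..d + d}. f j)"
    by (simp only:) (subst prod.union_disjoint, auto)
  also have "(\<Prod>j\<in>{1 + d..d + d}. f j) = (\<Prod>j\<in>{1..d}. f (j + d))"
    by (rule prod.shift_bounds_cl_nat_ivl)
  finally show ?thesis .
qed

lemma character_join: "character (2 * d) a (join d x y) = character d a x * character d (\<lambda>j. a (j + d)) y"
  unfolding character_def prod_double_range
  by (intro arg_cong2[where f=times] prod.cong) (auto simp: join_def)

definition trig_kernel :: "nat \<Rightarrow> nat \<Rightarrow> ((nat \<Rightarrow> int) \<Rightarrow> complex) \<Rightarrow> (nat \<Rightarrow> real) \<Rightarrow> complex"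
  where "trig_kernel v L c z = (\<Sum>a\<in>PiE {1..v} (\<lambda>_. {- int L..int L}). c a * character v a z)"

definition levels :: "nat \<Rightarrow> nat \<Rightarrow> (nat \<Rightarrow> nat) set"
  where "levels d M = PiE {1..d} (\<lambda>_. {..M})"

definition level_sum :: "nat \<Rightarrow> (nat \<Rightarrow> nat) \<Rightarrow> nat"
  where "level_sum d s = (\<Sum>j\<in>{1..d}. s j)"

text \<open>
  The coefficients \<open>b s s'\<close> belong to the block of level \<open>s\<close> in \<open>x\<close> and \<open>s'\<close> in \<open>y\<close>. The decay is stated for every
  \<open>B\<close> because the multipliers that produce the blocks do not depend on the class.
\<close>

definition block_family ::
    "nat \<Rightarrow> real \<Rightarrow> nat \<Rightarrow> nat \<Rightarrow> real \<Rightarrow> nat \<Rightarrow> nat \<Rightarrow> nat \<Rightarrow> ((nat \<Rightarrow> int) \<Rightarrow> complex)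
      \<Rightarrow> ((nat \<Rightarrow> nat) \<Rightarrow> (nat \<Rightarrow> nat) \<Rightarrow> (nat \<Rightarrow> int) \<Rightarrow> complex) \<Rightarrow> bool"
  where "block_family l r d P C M N L c b \<longleftrightarrow>
    (\<forall>a. c a = (\<Sum>s\<in>levels d M. \<Sum>s'\<in>levels d M. b s s' a)) \<and>
    (\<forall>s\<in>levels d M. \<forall>s'\<in>levels d M.
      (\<forall>a. norm (b s s' a) \<le> C * norm (c a)) \<and>
      (\<forall>a\<in>PiE {1..2 * d} (\<lambda>_. {- int L..int L}). b s s' a \<noteq> 0 \<longrightarrow>
         (\<forall>j\<in>{1..d}. \<bar>a j\<bar> \<le> int (P * 2 ^ s j) \<and> \<bar>a (j + d)\<bar> \<le> int (P * 2 ^ s' j))) \<and>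
      (\<forall>B y. 0 \<le> B \<longrightarrow> discrete_class l r d N B (trig_kernel (2 * d) L c) \<longrightarrow>
         grid_mean d (\<lambda>_. N) (\<lambda>\<xi>. norm (trig_kernel (2 * d) L (b s s') (join d \<xi> y)))
           \<le> B * C * 2 powr (- r * (level_sum d s + level_sum d s'))))"

text \<open>
  Apply the multipliers of \<open>smoothing_multipliers\<close> in each variable. The constants are independent of the number of
  levels and of the grid; only the fineness of the grid depends on \<open>M\<close>.
\<close>

lemma block_decomposition:
  fixes r :: real
  assumes "0 < r"
  shows "\<exists>P::nat. \<exists>C::real. 1 \<le> P \<and> 1 \<le> C \<and> (\<forall>M. \<exists>N0. \<forall>N\<ge>N0. \<forall>L c. L < P * 2 ^ M \<longrightarrow>
    (\<exists>b. block_family l r d P C M N L c b))"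
proof -
  obtain P C where P: "1 \<le> P" and C: "1 \<le> C"
    and mult: "\<forall>M. \<exists>N0. \<forall>N\<ge>N0. \<exists>\<alpha> \<beta>. smoothing_family l r P C M N \<alpha> \<beta>"
    using smoothing_multipliers[OF assms, of l] by blast
  define C' where "C' = C ^ (2 * d) + (2 ^ l * 2) ^ (2 * d)"
  have C': "1 \<le> C'" using one_le_power[OF C, of "2 * d"] by (simp add: C'_def add_increasing2)
  have "\<exists>N0. \<forall>N\<ge>N0. \<forall>L c. L < P * 2 ^ M \<longrightarrow> (\<exists>b. block_family l r d P C' M N L c b)" for M
  proof -
    obtain N0 where N0: "\<forall>N\<ge>N0. \<exists>\<alpha> \<beta>. smoothing_family l r P C M N \<alpha> \<beta>"
      using mult by blast
    show "\<exists>N0. \<forall>N\<ge>N0. \<forall>L c. L < P * 2 ^ M \<longrightarrow> (\<exists>b. block_family l r d P C' M N L c b)"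
    proof (intro exI[of _ N0] allI impI)
      fix N L c assume N: "N0 \<le> N" and L: "L < P * 2 ^ M"
      obtain \<alpha> \<beta> where fam: "smoothing_family l r P C M N \<alpha> \<beta>"
        using N0 N by blast
      have one: "\<And>a. (\<Sum>s\<le>M. multiplier l N (\<alpha> s) (\<beta> s) a) = 1"
        and zero: "\<And>s a. s \<le> M \<Longrightarrow> int (P * 2 ^ s) \<le> \<bar>a\<bar> \<Longrightarrow> \<bar>a\<bar> < int (P * 2 ^ M) \<Longrightarrow> multiplier l N (\<alpha> s) (\<beta> s) a = 0"
        and small: "\<And>s. s \<le> M \<Longrightarrow> \<bar>\<alpha> s\<bar> + (\<Sum>\<tau><N. \<bar>\<beta> s \<tau>\<bar> * \<bar>sgrid N \<tau>\<bar> powr r) / N \<le> C * 2 powr (- (r * s))"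
        and two: "\<And>s. s \<le> M \<Longrightarrow> \<bar>\<alpha> s\<bar> + (\<Sum>\<tau><N. \<bar>\<beta> s \<tau>\<bar>) / N \<le> 2"
        using fam unfolding smoothing_family_def by blast+
      define \<mu> where "\<mu> s a = multiplier l N (\<alpha> s) (\<beta> s) a" for s a
      define cmb where "cmb s s' j = (if j \<le> d then s j else s' (j - d))" for s s' :: "nat \<Rightarrow> nat" and j
      define b where "b s s' a = c a * (\<Prod>j\<in>{1..2 * d}. \<mu> (cmb s s' j) (a j))" for s s' a
      have b_split: "b s s' a = c a * ((\<Prod>j\<in>{1..d}. \<mu> (s j) (a j)) * (\<Prod>j\<in>{1..d}. \<mu> (s' j) (a (j + d))))" for s s' a
        unfolding b_def prod_double_range by (simp add: cmb_def)
      have total: "(\<Sum>s\<in>levels d M. \<Sum>s'\<in>levels d M. b s s' a) = c a" for a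
      proof -
        have "(\<Sum>s\<in>levels d M. \<Sum>s'\<in>levels d M. b s s' a)
          = c a * ((\<Sum>s\<in>levels d M. \<Prod>j\<in>{1..d}. \<mu> (s j) (a j)) * (\<Sum>s'\<in>levels d M. \<Prod>j\<in>{1..d}. \<mu> (s' j) (a (j + d))))"
          unfolding b_split sum_product by (simp only: sum_distrib_left)
        also have "(\<Sum>s\<in>levels d M. \<Prod>j\<in>{1..d}. \<mu> (s j) (a j)) = (\<Prod>j\<in>{1..d}. \<Sum>s\<le>M. \<mu> s (a j))"
          unfolding levels_def by (rule prod_sum_PiE[symmetric]) auto
        also have "(\<Sum>s\<in>levels d M. \<Prod>j\<in>{1..d}. \<mu> (s j) (a (j + d))) = (\<Prod>j\<in>{1..d}. \<Sum>s\<le>M. \<mu> s (a (j + d)))"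
          unfolding levels_def by (rule prod_sum_PiE[symmetric, where f="\<lambda>j s. \<mu> s (a (j + d))"]) auto
        finally show ?thesis by (simp add: \<mu>_def one)
      qed
      have le: "s j \<le> M" if "s \<in> levels d M" "j \<in> {1..d}" for s j
        using that by (auto simp: levels_def)
      have cmb_le: "cmb s s' j \<le> M" if "s \<in> levels d M" "s' \<in> levels d M" "j \<in> {1..2 * d}" for s s' j
      proof (cases "j \<le> d")
        case True then show ?thesis using that le[of s j] by (simp add: cmb_def)
      next
        case False
        then have "j - d \<in> {1..d}" using that by auto
        then show ?thesis using False that le[of s' "j - d"] by (simp add: cmb_def)
      qed
      show "\<exists>b. block_family l r d P C' M N L c b"
        unfolding block_family_def
      proof (intro exI[of _ b] conjI ballI allI impI)
        fix a show "c a = (\<Sum>s\<in>levels d M. \<Sum>s'\<in>levels d M. b s s' a)" using total by simp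
      next
        fix s s' a assume s: "s \<in> levels d M" "s' \<in> levels d M"
        have "norm (\<Prod>j\<in>{1..2 * d}. \<mu> (cmb s s' j) (a j)) \<le> (\<Prod>j\<in>{1..2 * d}. 2 ^ l * 2)"
          unfolding prod_norm[symmetric]
        proof (rule prod_mono)
          fix j assume j: "j \<in> {1..2 * d}"
          show "0 \<le> norm (\<mu> (cmb s s' j) (a j)) \<and> norm (\<mu> (cmb s s' j) (a j)) \<le> 2 ^ l * 2"
            unfolding \<mu>_def
            using order.trans[OF norm_multiplier_le mult_left_mono[OF two[OF cmb_le[OF s j]]], of l] by auto
        qed
        also have "\<dots> \<le> C'" using C by (simp add: C'_def)
        finally have "norm (\<Prod>j\<in>{1..2 * d}. \<mu> (cmb s s' j) (a j)) \<le> C'" .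
        then show "norm (b s s' a) \<le> C' * norm (c a)"
          unfolding b_def norm_mult by (subst mult.commute) (intro mult_right_mono, auto)
      next
        fix s s' a j assume s: "s \<in> levels d M" "s' \<in> levels d M"
          and a: "a \<in> PiE {1..2 * d} (\<lambda>_. {- int L..int L})" and nz: "b s s' a \<noteq> 0" and j: "j \<in> {1..d}"
        have aL: "\<bar>a i\<bar> < int (P * 2 ^ M)" if "i \<in> {1..2 * d}" for i
        proof -
          have "a i \<in> {- int L..int L}" using a that by (auto simp: PiE_iff)
          then have "\<bar>a i\<bar> \<le> int L" by auto
          also have "\<dots> < int (P * 2 ^ M)" using L by (simp only: of_nat_less_iff)
          finally show ?thesis .
        qed
        have "\<mu> (s j) (a j) \<noteq> 0" "\<mu> (s' j) (a (j + d)) \<noteq> 0"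
          using nz j unfolding b_split by auto
        then show "\<bar>a j\<bar> \<le> int (P * 2 ^ s j)" "\<bar>a (j + d)\<bar> \<le> int (P * 2 ^ s' j)"
          unfolding \<mu>_def
          using zero[of "s j" "a j"] zero[of "s' j" "a (j + d)"] aL[of j] aL[of "j + d"] le[OF s(1) j] le[OF s(2) j] j
          by (auto intro!: less_imp_le simp: not_le[symmetric] simp del: of_nat_mult of_nat_power)
      next
        fix s s' B y assume s: "s \<in> levels d M" "s' \<in> levels d M" and B: "(0::real) \<le> B"
          and cls: "discrete_class l r d N B (trig_kernel (2 * d) L c)"
        have "grid_mean d (\<lambda>_. N) (\<lambda>\<xi>. norm (trig_kernel (2 * d) L (b s s') (join d \<xi> y)))
           \<le> B * (\<Prod>j\<in>{1..2 * d}. \<bar>\<alpha> (cmb s s' j)\<bar> + (\<Sum>\<tau><N. \<bar>\<beta> (cmb s s' j) \<tau>\<bar> * \<bar>sgrid N \<tau>\<bar> powr r) / N)"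
          unfolding trig_kernel_def b_def \<mu>_def
          by (rule discrete_class_multiplier_bound) (use cls in \<open>simp add: trig_kernel_def[abs_def]\<close>)
        also have "\<dots> \<le> B * (\<Prod>j\<in>{1..2 * d}. C * 2 powr (- (r * cmb s s' j)))"
          using B small cmb_le[OF s]
          by (intro mult_left_mono prod_mono conjI) (auto intro!: add_nonneg_nonneg divide_nonneg_nonneg sum_nonneg)
        also have "(\<Prod>j\<in>{1..2 * d}. C * 2 powr (- (r * cmb s s' j))) = C ^ (2 * d) * 2 powr (\<Sum>j\<in>{1..2*d}. - (r * cmb s s' j))"
          by (simp add: prod.distrib powr_sum)
        also have "(\<Sum>j\<in>{1..2*d}. - (r * cmb s s' j)) = - r * (level_sum d s + level_sum d s')"
        proof -
          have "(\<Sum>j\<in>{1..2*d}. real (cmb s s' j)) = ln (\<Prod>j\<in>{1..2*d}. exp (real (cmb s s' j)))"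
            by (simp add: exp_sum[symmetric])
          also have "\<dots> = level_sum d s + level_sum d s'"
            unfolding prod_double_range by (simp add: cmb_def exp_sum[symmetric] exp_add[symmetric] level_sum_def)
          finally show ?thesis by (simp add: sum_negf sum_distrib_left[symmetric])
        qed
        also have "B * (C ^ (2 * d) * 2 powr (- r * (level_sum d s + level_sum d s'))) \<le> B * (C' * 2 powr (- r * (level_sum d s + level_sum d s')))"
          using B by (intro mult_left_mono mult_right_mono) (auto simp: C'_def)
        finally show "grid_mean d (\<lambda>_. N) (\<lambda>\<xi>. norm (trig_kernel (2 * d) L (b s s') (join d \<xi> y)))
           \<le> B * C' * 2 powr (- r * (level_sum d s + level_sum d s'))" by (simp add: mult.assoc)
      qed
    qed
  qed
  then show ?thesis using P C' by blast
qed

section \<open>Sums over the levels\<close>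

lemma finite_levels [simp]: "finite (levels d M)"
  by (auto simp: levels_def intro!: finite_PiE)

lemma card_levels_with_sum:
  assumes "1 \<le> d"
  shows "card {s \<in> levels d M. level_sum d s = u} \<le> (u + 1) ^ (d - 1)"
proof -
  let ?S = "{s \<in> levels d M. level_sum d s = u}" and ?\<rho> = "\<lambda>s::nat \<Rightarrow> nat. restrict s {1..d - 1}"
  have split: "level_sum d s = (\<Sum>j\<in>{1..d - 1}. s j) + s d" for s
  proof -
    have "{1..d} = insert d {1..d - 1}" "d \<notin> {1..d - 1}" using assms by auto
    then show ?thesis unfolding level_sum_def by (simp only:) simp
  qed
  have "inj_on ?\<rho> ?S"
  proof (rule inj_onI)
    fix s s' assume s: "s \<in> ?S" "s' \<in> ?S" and eq: "?\<rho> s = ?\<rho> s'"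
    have e: "s j = s' j" if "j \<in> {1..d - 1}" for j using fun_cong[OF eq, of j] that by simp
    have "(\<Sum>j\<in>{1..d - 1}. s j) = (\<Sum>j\<in>{1..d - 1}. s' j)" using e by (intro sum.cong) auto
    then have "s d = s' d" using s split[of s] split[of s'] by simp
    then have "s j = s' j" if "j \<in> {1..d}" for j using e[of j] that by (cases "j = d") auto
    then show "s = s'" using s by (intro PiE_ext[of s "{1..d}" "\<lambda>_. {..M}"]) (auto simp: levels_def)
  qed
  moreover have "?\<rho> ` ?S \<subseteq> PiE {1..d - 1} (\<lambda>_. {..u})"
  proof (rule image_subsetI)
    fix s assume s: "s \<in> ?S"
    have "s j \<le> u" if "j \<in> {1..d - 1}" for j
    proof -
      have "s j \<le> (\<Sum>j\<in>{1..d - 1}. s j)" using that by (intro member_le_sum) auto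
      then show ?thesis using s split[of s] by simp
    qed
    then show "?\<rho> s \<in> PiE {1..d - 1} (\<lambda>_. {..u})" by auto
  qed
  ultimately have "card ?S \<le> card (PiE {1..d - 1} (\<lambda>_. {..u}))"
    by (intro card_inj_on_le[of ?\<rho>]) (auto intro!: finite_PiE)
  then show ?thesis by (simp add: card_PiE)
qed

lemma sum_levels_le:
  assumes "1 \<le> d" and F: "\<And>u. 0 \<le> F u"
  shows "(\<Sum>s\<in>{s \<in> levels d M. Q (level_sum d s)}. F (level_sum d s))
      \<le> (\<Sum>u\<in>{u \<in> {..d * M}. Q u}. (real u + 1) ^ (d - 1) * F u)"
proof -
  let ?S = "{s \<in> levels d M. Q (level_sum d s)}" and ?U = "{u \<in> {..d * M}. Q u}"
  have sub: "level_sum d ` ?S \<subseteq> ?U"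
  proof (rule image_subsetI)
    fix s assume s: "s \<in> ?S"
    have "level_sum d s \<le> (\<Sum>j\<in>{1..d}. M)" unfolding level_sum_def
      using s by (intro sum_mono) (auto simp: levels_def)
    then show "level_sum d s \<in> ?U" using s by simp
  qed
  have "(\<Sum>s\<in>?S. F (level_sum d s)) = (\<Sum>u\<in>?U. \<Sum>s\<in>{s \<in> ?S. level_sum d s = u}. F (level_sum d s))"
    by (rule sum.group[symmetric]) (use sub in auto)
  also have "\<dots> = (\<Sum>u\<in>?U. real (card {s \<in> ?S. level_sum d s = u}) * F u)"
    by (intro sum.cong refl) simp
  also have "\<dots> \<le> (\<Sum>u\<in>?U. (real u + 1) ^ (d - 1) * F u)"
  proof (intro sum_mono mult_right_mono F)
    fix u
    have "card {s \<in> ?S. level_sum d s = u} \<le> card {s \<in> levels d M. level_sum d s = u}"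
      by (intro card_mono) auto
    also have "\<dots> \<le> (u + 1) ^ (d - 1)" by (rule card_levels_with_sum[OF assms(1)])
    finally have "real (card {s \<in> ?S. level_sum d s = u}) \<le> real ((u + 1) ^ (d - 1))" by (simp only: of_nat_le_iff)
    then show "real (card {s \<in> ?S. level_sum d s = u}) \<le> (real u + 1) ^ (d - 1)" by (simp add: add.commute)
  qed
  finally show ?thesis .
qed

text \<open>
  At most \<open>(u + 1) ^ (d - 1)\<close> level vectors have the sum \<open>u\<close>, and the geometric series is dominated by its last term.
\<close>

lemma sum_low_levels:
  assumes "1 \<le> d"
  shows "(\<Sum>s\<in>{s \<in> levels d M. level_sum d s \<le> m}. 2 ^ level_sum d s) \<le> 2 * 2 ^ m * (real m + 1) ^ (d - 1)"
proof -
  have "(\<Sum>s\<in>{s \<in> levels d M. level_sum d s \<le> m}. 2 ^ level_sum d s)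
     \<le> (\<Sum>u\<in>{u \<in> {..d * M}. u \<le> m}. (real u + 1) ^ (d - 1) * 2 ^ u)"
    using sum_levels_le[OF assms, of "\<lambda>u. 2 ^ u" M "\<lambda>u. u \<le> m"] by simp
  also have "\<dots> \<le> (\<Sum>u\<in>{u \<in> {..d * M}. u \<le> m}. (real m + 1) ^ (d - 1) * 2 ^ u)"
    by (intro sum_mono mult_right_mono power_mono) auto
  also have "\<dots> \<le> (\<Sum>u\<in>{..m}. (real m + 1) ^ (d - 1) * 2 ^ u)"
    by (intro sum_mono2) auto
  also have "\<dots> = (real m + 1) ^ (d - 1) * (2 ^ Suc m - 1)"
    by (simp only: sum_distrib_left[symmetric]) (simp add: lessThan_Suc_atMost[symmetric] sum_power2 geometric_sum)
  also have "\<dots> \<le> 2 * 2 ^ m * (real m + 1) ^ (d - 1)" by (simp add: algebra_simps)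
  finally show ?thesis .
qed

lemma sum_polynomial_geometric:
  assumes "0 < \<theta>"
  shows "\<exists>A\<ge>1. \<forall>n. (\<Sum>a\<le>n. (real a + 1) ^ k * 2 powr (- \<theta> * real a)) \<le> A"
proof -
  define q where "q = 2 powr (- \<theta> / (real k + 1))"
  have q: "0 < q" "q < 1"
    using assms powr_less_mono[of "- \<theta> / (real k + 1)" 0 2] by (auto simp: q_def)
  have part: "(\<Sum>i\<le>n. q ^ i) \<le> 1 / (1 - q)" for n
  proof -
    have "(1 - q) * (\<Sum>i\<le>n. q ^ i) = 1 - q ^ Suc n" by (simp add: sum_gp_basic)
    also have "\<dots> \<le> 1" using q by simp
    finally show ?thesis using q by (simp add: field_simps)
  qed
  have one: "1 \<le> 1 / (1 - q)" using q by (simp add: field_simps)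
  have summand: "(real a + 1) ^ k * 2 powr (- \<theta> * real a) \<le> (1 / (1 - q)) ^ k * q ^ a" for a
  proof -
    have "2 powr (- \<theta> * real a) = q powr ((real k + 1) * real a)"
      using q by (simp add: q_def powr_powr)
    also have "\<dots> = q ^ ((k + 1) * a)" using q
      by (metis (no_types, opaque_lifting) powr_realpow of_nat_mult of_nat_add of_nat_1)
    also have "\<dots> = (q ^ a) ^ k * q ^ a" by (simp add: power_mult[symmetric] power_add[symmetric] algebra_simps)
    finally have "(real a + 1) ^ k * 2 powr (- \<theta> * real a) = ((real a + 1) * q ^ a) ^ k * q ^ a"
      by (simp add: power_mult_distrib)
    moreover have "(real a + 1) * q ^ a \<le> 1 / (1 - q)"
    proof -
      have "(real a + 1) * q ^ a = (\<Sum>i\<le>a. q ^ a)" by simp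
      also have "\<dots> \<le> (\<Sum>i\<le>a. q ^ i)" using q by (intro sum_mono power_decreasing) auto
      finally show ?thesis using part[of a] by linarith
    qed
    ultimately show ?thesis using q by (auto intro!: mult_right_mono power_mono)
  qed
  show ?thesis
  proof (intro exI[of _ "(1 / (1 - q)) ^ k * (1 / (1 - q))"] conjI allI)
    show "1 \<le> (1 / (1 - q)) ^ k * (1 / (1 - q))"
      using one_le_power[OF one, of "Suc k"] by (simp add: mult.commute)
    fix n
    have "(\<Sum>a\<le>n. (real a + 1) ^ k * 2 powr (- \<theta> * real a)) \<le> (\<Sum>a\<le>n. (1 / (1 - q)) ^ k * q ^ a)"
      by (intro sum_mono summand)
    also have "\<dots> = (1 / (1 - q)) ^ k * (\<Sum>a\<le>n. q ^ a)" by (simp only: sum_distrib_left)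
    also have "\<dots> \<le> (1 / (1 - q)) ^ k * (1 / (1 - q))"
      using part q by (intro mult_left_mono) auto
    finally show "(\<Sum>a\<le>n. (real a + 1) ^ k * 2 powr (- \<theta> * real a)) \<le> \<dots>" .
  qed
qed

text \<open>
  For \<open>u = m + a\<close> use \<open>(u + 1) ^ (d - 1) \<le> (m + 1) ^ (d - 1) * (a + 1) ^ (d - 1)\<close>: the exponential decay in \<open>a\<close> beats the
  polynomial.
\<close>

lemma sum_high_levels:
  assumes "1 \<le> d" "0 < \<theta>"
  shows "\<exists>A\<ge>1. \<forall>m M. (\<Sum>s\<in>{s \<in> levels d M. m \<le> level_sum d s}. 2 powr (- \<theta> * (real (level_sum d s) - real m)))
      \<le> A * (real m + 1) ^ (d - 1)"
proof -
  obtain A where A: "A \<ge> 1" "\<And>n. (\<Sum>a\<le>n. (real a + 1) ^ (d - 1) * 2 powr (- \<theta> * real a)) \<le> A"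
    using sum_polynomial_geometric[OF assms(2), of "d - 1"] by blast
  show ?thesis
  proof (intro exI[of _ A] conjI allI A(1))
    fix m M
    have "(\<Sum>s\<in>{s \<in> levels d M. m \<le> level_sum d s}. 2 powr (- \<theta> * (real (level_sum d s) - real m)))
       \<le> (\<Sum>u\<in>{u \<in> {..d * M}. m \<le> u}. (real u + 1) ^ (d - 1) * 2 powr (- \<theta> * (real u - real m)))"
      by (rule sum_levels_le[OF assms(1), of "\<lambda>u. 2 powr (- \<theta> * (real u - real m))"]) simp
    also have "\<dots> \<le> (\<Sum>u\<in>(\<lambda>a. a + m) ` {..d * M}. (real u + 1) ^ (d - 1) * 2 powr (- \<theta> * (real u - real m)))"
    proof (intro sum_mono2)
      show "{u \<in> {..d * M}. m \<le> u} \<subseteq> (\<lambda>a. a + m) ` {..d * M}"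
      proof
        fix u assume "u \<in> {u \<in> {..d * M}. m \<le> u}"
        then show "u \<in> (\<lambda>a. a + m) ` {..d * M}" by (intro image_eqI[of _ _ "u - m"]) auto
      qed
    qed auto
    also have "\<dots> = (\<Sum>a\<le>d * M. (real (a + m) + 1) ^ (d - 1) * 2 powr (- \<theta> * (real (a + m) - real m)))"
      by (subst sum.reindex) (auto simp: inj_on_def)
    also have "\<dots> \<le> (\<Sum>a\<le>d * M. ((real a + 1) * (real m + 1)) ^ (d - 1) * 2 powr (- \<theta> * real a))"
      by (intro sum_mono mult_mono power_mono) (auto simp: algebra_simps)
    also have "\<dots> = (real m + 1) ^ (d - 1) * (\<Sum>a\<le>d * M. (real a + 1) ^ (d - 1) * 2 powr (- \<theta> * real a))"
      by (simp add: sum_distrib_left power_mult_distrib mult_ac)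
    also have "\<dots> \<le> (real m + 1) ^ (d - 1) * A" by (intro mult_left_mono A) auto
    finally show "(\<Sum>s\<in>{s \<in> levels d M. m \<le> level_sum d s}. 2 powr (- \<theta> * (real (level_sum d s) - real m)))
      \<le> A * (real m + 1) ^ (d - 1)" by (simp add: mult.commute)
  qed
qed

section \<open>Coverings and their addition\<close>

text \<open>
  These functions are the centres of the coverings. They are bounded everywhere, so that uniform distances can be
  used in place of essential suprema.
\<close>

definition bounded_periodic :: "nat \<Rightarrow> ((nat \<Rightarrow> real) \<Rightarrow> complex) \<Rightarrow> bool"
  where "bounded_periodic d f \<longleftrightarrow> f \<in> borel_measurable (torus d) \<and> periodic d f \<and> (\<exists>B. \<forall>x. norm (f x) \<le> B)"

lemma bounded_periodic_zero: "bounded_periodic d (\<lambda>x. 0)"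
  by (auto simp: bounded_periodic_def periodic_def)

lemma bounded_periodic_add: "bounded_periodic d f \<Longrightarrow> bounded_periodic d g \<Longrightarrow> bounded_periodic d (\<lambda>x. f x + g x)"
proof -
  assume f: "bounded_periodic d f" and g: "bounded_periodic d g"
  then obtain A B where "\<And>x. norm (f x) \<le> A" "\<And>x. norm (g x) \<le> B" by (auto simp: bounded_periodic_def)
  then have "\<And>x. norm (f x + g x) \<le> A + B" by (intro norm_triangle_mono) auto
  then show ?thesis using f g unfolding bounded_periodic_def periodic_def by auto
qed

lemma bounded_periodic_cmult: "bounded_periodic d f \<Longrightarrow> bounded_periodic d (\<lambda>x. c * f x)"
proof -
  assume f: "bounded_periodic d f"
  then obtain B where "\<And>x. norm (f x) \<le> B" by (auto simp: bounded_periodic_def)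
  then have "\<And>x. norm (c * f x) \<le> norm c * B" by (auto simp: norm_mult intro: mult_left_mono)
  then show ?thesis using f by (auto simp: bounded_periodic_def periodic_def)
qed

lemma bounded_periodic_sum: "(\<And>i. i \<in> I \<Longrightarrow> bounded_periodic d (f i)) \<Longrightarrow> bounded_periodic d (\<lambda>x. \<Sum>i\<in>I. f i x)"
  by (induction I rule: infinite_finite_induct) (auto intro: bounded_periodic_zero bounded_periodic_add)

lemma sets_torus: "sets (torus d) = sets (PiM {1..d} (\<lambda>_. borel))"
  unfolding torus_def by (rule sets_PiM_cong) auto

lemma space_torus: "space (torus d) = PiE {1..d} (\<lambda>_. UNIV)"
  by (simp add: torus_def space_PiM)

lemma measurable_torus_component: "j \<in> {1..d} \<Longrightarrow> (\<lambda>x. x j) \<in> borel_measurable (torus d)"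
  unfolding torus_def using measurable_component_singleton[of j "{1..d}" "\<lambda>_. uniform_measure lborel {0..2 * pi}"]
  by (simp cong: measurable_cong_sets)

lemma bounded_periodic_prod:
  assumes cont: "\<And>j. j \<in> {1..d} \<Longrightarrow> g j \<in> borel_measurable borel"
    and per: "\<And>j u. j \<in> {1..d} \<Longrightarrow> g j (u + 2 * pi) = g j u"
    and bdd: "\<And>j u. j \<in> {1..d} \<Longrightarrow> norm (g j u) \<le> B j"
  shows "bounded_periodic d (\<lambda>x. \<Prod>j\<in>{1..d}. g j (x j) :: complex)"
  unfolding bounded_periodic_def
proof (intro conjI exI allI)
  have "(\<lambda>x. g j (x j)) \<in> borel_measurable (torus d)" if "j \<in> {1..d}" for j
    using measurable_compose[OF measurable_torus_component[OF that] cont[OF that]] .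
  then show "(\<lambda>x. \<Prod>j\<in>{1..d}. g j (x j)) \<in> borel_measurable (torus d)"
    by (intro borel_measurable_prod) auto
  show "periodic d (\<lambda>x. \<Prod>j\<in>{1..d}. g j (x j))"
    unfolding periodic_def by (intro ballI prod.cong refl) (auto simp: per)
  show "norm (\<Prod>j\<in>{1..d}. g j (x j)) \<le> (\<Prod>j\<in>{1..d}. B j)" for x
    unfolding prod_norm[symmetric] using bdd by (intro prod_mono) auto
qed

lemma cis_periodic_int: "cis (of_int a * (u + 2 * pi)) = cis (of_int a * u)"
proof -
  have "cis (of_int a * (u + 2 * pi)) = cis (of_int a * u) * cis (2 * pi * of_int a)"
    by (simp add: cis_mult algebra_simps)
  then show ?thesis by simp
qed

lemma cis_measurable: "(\<lambda>u. cis (of_int a * u)) \<in> borel_measurable borel"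
  by (intro borel_measurable_continuous_onI continuous_intros)

lemma bounded_periodic_character: "bounded_periodic d (character d a)"
  unfolding character_def[abs_def]
  by (rule bounded_periodic_prod[where g="\<lambda>j u. cis (of_int (a j) * u)" and B="\<lambda>_. 1"])
    (simp_all add: cis_measurable cis_periodic_int del: distrib_left)

lemma bounded_periodic_vp: "bounded_periodic d (\<lambda>x. vp d n x \<xi>)"
  unfolding vp_def
proof (rule bounded_periodic_prod[where g="\<lambda>j u. vp_kernel (n j) (u - \<xi> j)" and B="\<lambda>j. 4 * real (n j) + 1"])
  fix j u
  have dm: "dirichlet A \<in> borel_measurable borel" for A
    unfolding dirichlet_def[abs_def] by (intro borel_measurable_sum cis_measurable)
  then have "(\<lambda>u. dirichlet A (u - \<xi> j)) \<in> borel_measurable borel" for A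
    by (intro measurable_compose[of "\<lambda>u. u - \<xi> j" borel borel "dirichlet A"]) auto
  then show "(\<lambda>u. vp_kernel (n j) (u - \<xi> j)) \<in> borel_measurable borel"
    unfolding vp_kernel_def by (intro borel_measurable_divide borel_measurable_times borel_measurable_const)
  have "dirichlet A (v + 2 * pi) = dirichlet A v" for A v
    unfolding dirichlet_def by (simp add: cis_periodic_int)
  from this[of _ "u - \<xi> j"] have "dirichlet A (u + 2 * pi - \<xi> j) = dirichlet A (u - \<xi> j)" for A
    by (simp add: algebra_simps)
  then show "vp_kernel (n j) (u + 2 * pi - \<xi> j) = vp_kernel (n j) (u - \<xi> j)"
    by (simp add: vp_kernel_def)
  show "norm (vp_kernel (n j) (u - \<xi> j)) \<le> 4 * real (n j) + 1" by (rule norm_vp_kernel_le)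
qed

text \<open>
  The number \<open>c\<close> is the binary logarithm of the size of the covering, which makes \<open>c\<close> and \<open>\<epsilon>\<close> additive.
\<close>

definition covered :: "nat \<Rightarrow> ((nat \<Rightarrow> real) \<Rightarrow> complex) set \<Rightarrow> real \<Rightarrow> real \<Rightarrow> bool"
  where "covered d A c \<epsilon> \<longleftrightarrow> (\<exists>Y. finite Y \<and> real (card Y) \<le> 2 powr c \<and> (\<forall>g\<in>Y. bounded_periodic d g) \<and>
    (\<forall>f\<in>A. \<exists>g\<in>Y. \<forall>x. norm (f x - g x) \<le> \<epsilon>))"

lemma covered_mono: "covered d A c \<epsilon> \<Longrightarrow> B \<subseteq> A \<Longrightarrow> c \<le> c' \<Longrightarrow> \<epsilon> \<le> \<epsilon>' \<Longrightarrow> covered d B c' \<epsilon>'"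
  unfolding covered_def by (meson order.trans powr_mono subsetD one_le_numeral)

text \<open>
  Both summands depend on the same parameter \<open>\<phi>\<close>, but the sums of the centres need not come from a common one.
\<close>

lemma covered_add:
  assumes "covered d (F ` \<Phi>) c1 \<epsilon>1" "covered d (G ` \<Phi>) c2 \<epsilon>2"
  shows "covered d ((\<lambda>\<phi> x. F \<phi> x + G \<phi> x) ` \<Phi>) (c1 + c2) (\<epsilon>1 + \<epsilon>2)"
proof -
  obtain Y1 where Y1: "finite Y1" "real (card Y1) \<le> 2 powr c1" "\<forall>g\<in>Y1. bounded_periodic d g"
    "\<forall>f\<in>F ` \<Phi>. \<exists>g\<in>Y1. \<forall>x. norm (f x - g x) \<le> \<epsilon>1"
    using assms(1) unfolding covered_def by blast
  obtain Y2 where Y2: "finite Y2" "real (card Y2) \<le> 2 powr c2" "\<forall>g\<in>Y2. bounded_periodic d g"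
    "\<forall>f\<in>G ` \<Phi>. \<exists>g\<in>Y2. \<forall>x. norm (f x - g x) \<le> \<epsilon>2"
    using assms(2) unfolding covered_def by blast
  let ?Y = "(\<lambda>(f, g) x. f x + g x) ` (Y1 \<times> Y2)"
  have "card ?Y \<le> card Y1 * card Y2"
    using card_image_le[of "Y1 \<times> Y2"] Y1(1) Y2(1) by (simp add: card_cartesian_product)
  then have "real (card ?Y) \<le> real (card Y1) * real (card Y2)" unfolding of_nat_mult[symmetric] of_nat_le_iff .
  also have "\<dots> \<le> 2 powr c1 * 2 powr c2" using Y1(2) Y2(2) by (intro mult_mono) auto
  finally have "real (card ?Y) \<le> 2 powr (c1 + c2)" by (simp add: powr_add)
  moreover have "\<exists>g\<in>?Y. \<forall>x. norm (F \<phi> x + G \<phi> x - g x) \<le> \<epsilon>1 + \<epsilon>2" if "\<phi> \<in> \<Phi>" for \<phi>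
  proof -
    from bspec[OF Y1(4) imageI[OF that]] obtain g1
      where g1: "g1 \<in> Y1" "\<forall>x. norm (F \<phi> x - g1 x) \<le> \<epsilon>1" by (elim bexE)
    from bspec[OF Y2(4) imageI[OF that]] obtain g2
      where g2: "g2 \<in> Y2" "\<forall>x. norm (G \<phi> x - g2 x) \<le> \<epsilon>2" by (elim bexE)
    have "norm (F \<phi> x + G \<phi> x - (g1 x + g2 x)) \<le> \<epsilon>1 + \<epsilon>2" for x
      unfolding add_diff_add using g1(2) g2(2) by (intro norm_triangle_mono) auto
    moreover have "(\<lambda>x. g1 x + g2 x) \<in> ?Y" by (rule image_eqI[of _ _ "(g1, g2)"]) (use g1 g2 in auto)
    ultimately show ?thesis by (intro bexI[of _ "\<lambda>x. g1 x + g2 x"]) auto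
  qed
  moreover have "\<forall>g\<in>?Y. bounded_periodic d g" using Y1(3) Y2(3) by (auto intro: bounded_periodic_add)
  moreover have "finite ?Y" using Y1(1) Y2(1) by simp
  ultimately show ?thesis unfolding covered_def by (intro exI[of _ ?Y] conjI ballI) auto
qed

lemma covered_sum:
  assumes "finite I" "\<And>i. i \<in> I \<Longrightarrow> covered d (F i ` \<Phi>) (c i) (\<epsilon> i)"
  shows "covered d ((\<lambda>\<phi> x. \<Sum>i\<in>I. F i \<phi> x) ` \<Phi>) (\<Sum>i\<in>I. c i) (\<Sum>i\<in>I. \<epsilon> i)"
  using assms
proof (induction I rule: finite_induct)
  case empty
  show ?case unfolding covered_def by (rule exI[of _ "{\<lambda>_. 0}"]) (auto intro: bounded_periodic_zero)
next
  case (insert i I)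
  then show ?case
    using covered_add[of d "F i" \<Phi> "c i" "\<epsilon> i" "\<lambda>\<phi> x. \<Sum>i\<in>I. F i \<phi> x"] by simp
qed

section \<open>Lattice points in an l1 ball\<close>

text \<open>
  Rounding towards 0, so that rounding does not increase \<open>l1\<close> norms.
\<close>

lemma integer_rounding: "\<exists>z::int. \<bar>real_of_int z\<bar> \<le> \<bar>x\<bar> \<and> \<bar>x - real_of_int z\<bar> \<le> 1"
proof (cases "0 \<le> x")
  case True
  then have "0 \<le> \<lfloor>x\<rfloor>" by simp
  then show ?thesis using True by (intro exI[of _ "\<lfloor>x\<rfloor>"]) linarith
next
  case False
  then have "\<lceil>x\<rceil> \<le> 0" by (simp add: ceiling_le_zero)
  then show ?thesis using False by (intro exI[of _ "\<lceil>x\<rceil>"]) linarith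
qed

text \<open>
  Chernoff's argument: each point of the ball has weight \<open>2 powr (p * (m - l1 norm)) \<ge> 1\<close>. The sum of the weights over all
  integer vectors factorizes into one-dimensional geometric series, each of them at most \<open>1 + 4 / 2 ^ p\<close>.
\<close>

lemma card_integer_l1_ball:
  fixes m :: real
  assumes "finite I" "1 \<le> p"
  shows "real (card {z \<in> PiE I (\<lambda>_. {- int b..int b}). (\<Sum>i\<in>I. \<bar>real_of_int (z i)\<bar>) \<le> m})
     \<le> 2 powr (real p * m + 6 * (1 / 2) ^ p * real (card I))"
proof -
  define x where "x = (1 / 2 :: real) ^ p"
  have x: "0 < x" "x \<le> 1 / 2"
    using assms(2) power_decreasing[of 1 p "1 / 2 :: real"] by (auto simp: x_def)
  have x_powr: "x = 2 powr (- real p)" by (simp add: x_def powr_minus powr_realpow power_one_over inverse_eq_divide)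
  let ?P = "PiE I (\<lambda>_. {- int b..int b})"
  let ?V = "{z \<in> ?P. (\<Sum>i\<in>I. \<bar>real_of_int (z i)\<bar>) \<le> m}"
  have geo: "(\<Sum>z\<in>{- int b..int b}. x ^ nat \<bar>z\<bar>) \<le> 1 + 4 * x - 4 * x ^ Suc b" for b
  proof (induction b)
    case (Suc b)
    have "{- int (Suc b)..int (Suc b)} = insert (- int (Suc b)) (insert (int (Suc b)) {- int b..int b})" by auto
    then have "(\<Sum>z\<in>{- int (Suc b)..int (Suc b)}. x ^ nat \<bar>z\<bar>) = 2 * x ^ Suc b + (\<Sum>z\<in>{- int b..int b}. x ^ nat \<bar>z\<bar>)"
      by (simp only:) (subst sum.insert, auto simp: nat_add_distrib)
    also have "\<dots> \<le> 1 + 4 * x - 2 * x ^ Suc b" using Suc by simp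
    also have "\<dots> \<le> 1 + 4 * x - 4 * x ^ Suc (Suc b)"
      using x mult_right_mono[of x "1 / 2" "x ^ Suc b"] by simp
    finally show ?case .
  qed simp
  have exp4: "1 + 4 * x \<le> 2 powr (6 * x)"
  proof -
    have "4 * x \<le> 6 * x * ln 2" using ln2_ge_two_thirds x by (simp add: field_simps)
    then have "exp (4 * x) \<le> 2 powr (6 * x)" by (simp add: powr_def)
    then show ?thesis using exp_ge_add_one_self[of "4 * x"] by linarith
  qed
  have fin: "finite ?P" using assms(1) by (intro finite_PiE) auto
  have "real (card ?V) = (\<Sum>z\<in>?V. 1)" by simp
  also have "\<dots> \<le> (\<Sum>z\<in>?V. 2 powr (real p * m) * (\<Prod>i\<in>I. x ^ nat \<bar>z i\<bar>))"
  proof (rule sum_mono)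
    fix z assume z: "z \<in> ?V"
    have "(\<Prod>i\<in>I. x ^ nat \<bar>z i\<bar>) = (\<Prod>i\<in>I. 2 powr (- real p * \<bar>real_of_int (z i)\<bar>))"
      by (intro prod.cong refl) (simp add: x_powr powr_powr powr_realpow[symmetric])
    also have "\<dots> = 2 powr (- real p * (\<Sum>i\<in>I. \<bar>real_of_int (z i)\<bar>))"
      by (simp add: powr_sum sum_distrib_left assms(1))
    finally have "2 powr (real p * m) * (\<Prod>i\<in>I. x ^ nat \<bar>z i\<bar>) = 2 powr (real p * (m - (\<Sum>i\<in>I. \<bar>real_of_int (z i)\<bar>)))"
      by (simp add: powr_add[symmetric] algebra_simps)
    moreover have "1 \<le> \<dots>" using z by (intro ge_one_powr_ge_zero) auto
    ultimately show "1 \<le> 2 powr (real p * m) * (\<Prod>i\<in>I. x ^ nat \<bar>z i\<bar>)" by simp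
  qed
  also have "\<dots> \<le> (\<Sum>z\<in>?P. 2 powr (real p * m) * (\<Prod>i\<in>I. x ^ nat \<bar>z i\<bar>))"
    using fin x by (intro sum_mono2) (auto intro!: mult_nonneg_nonneg prod_nonneg)
  also have "\<dots> = 2 powr (real p * m) * (\<Prod>i\<in>I. \<Sum>z\<in>{- int b..int b}. x ^ nat \<bar>z\<bar>)"
    unfolding sum_distrib_left[symmetric] by (subst prod_sum_PiE) (auto simp: assms(1))
  also have "\<dots> \<le> 2 powr (real p * m) * (\<Prod>i\<in>I. 2 powr (6 * x))"
  proof (intro mult_left_mono prod_mono conjI)
    show "(\<Sum>z\<in>{- int b..int b}. x ^ nat \<bar>z\<bar>) \<le> 2 powr (6 * x)"
      using geo[of b] exp4 x by (smt (verit) zero_le_power)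
  qed (use x in \<open>auto intro!: sum_nonneg\<close>)
  also have "\<dots> = 2 powr (real p * m + 6 * x * real (card I))"
    by (simp add: powr_add powr_powr[symmetric] powr_realpow)
  finally show ?thesis by (simp add: x_def)
qed

section \<open>Coverings by quantized coefficients\<close>

lemma covered_by_finite_family:
  assumes "finite V" "real (card V) \<le> 2 powr c" "\<And>z. z \<in> V \<Longrightarrow> bounded_periodic d (G z)"
    and "\<And>f. f \<in> A \<Longrightarrow> \<exists>z\<in>V. \<forall>x. norm (f x - G z x) \<le> \<epsilon>"
  shows "covered d A c \<epsilon>"
  unfolding covered_def
proof (intro exI[of _ "G ` V"] conjI ballI)
  have "card (G ` V) \<le> card V" by (rule card_image_le[OF assms(1)])
  then show "real (card (G ` V)) \<le> 2 powr c" using assms(2) by linarith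
  fix f assume "f \<in> A"
  from assms(4)[OF this] show "\<exists>g\<in>G ` V. \<forall>x. norm (f x - g x) \<le> \<epsilon>" by blast
qed (use assms in auto)

definition toward_zero :: "real \<Rightarrow> int"
  where "toward_zero x = (SOME z. \<bar>real_of_int z\<bar> \<le> \<bar>x\<bar> \<and> \<bar>x - real_of_int z\<bar> \<le> 1)"

lemma toward_zero: "\<bar>real_of_int (toward_zero x)\<bar> \<le> \<bar>x\<bar>" "\<bar>x - real_of_int (toward_zero x)\<bar> \<le> 1"
  using someI_ex[OF integer_rounding[of x]] unfolding toward_zero_def by auto

text \<open>
  The real and imaginary parts are rounded separately; the boolean index tells them apart.
\<close>

definition quantized_sum ::
    "'a set \<Rightarrow> ('a \<Rightarrow> (nat \<Rightarrow> real) \<Rightarrow> complex) \<Rightarrow> real \<Rightarrow> ('a \<times> bool \<Rightarrow> int) \<Rightarrow> (nat \<Rightarrow> real) \<Rightarrow> complex"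
  where "quantized_sum \<Gamma> w \<eta> z x =
    (\<Sum>\<sigma>\<in>\<Gamma>. Complex (\<eta> * real_of_int (z (\<sigma>, False))) (\<eta> * real_of_int (z (\<sigma>, True))) * w \<sigma> x)"

definition quantize :: "'a set \<Rightarrow> real \<Rightarrow> ('a \<Rightarrow> complex) \<Rightarrow> 'a \<times> bool \<Rightarrow> int"
  where "quantize \<Gamma> \<eta> v =
    (\<lambda>(\<sigma>, k)\<in>\<Gamma> \<times> UNIV. toward_zero ((if k then Im (v \<sigma>) else Re (v \<sigma>)) / \<eta>))"

lemma quantize_error:
  assumes "0 < \<eta>"
  shows "norm ((\<Sum>\<sigma>\<in>\<Gamma>. v \<sigma> * w \<sigma> x) - quantized_sum \<Gamma> w \<eta> (quantize \<Gamma> \<eta> v) x)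
      \<le> 2 * \<eta> * (\<Sum>\<sigma>\<in>\<Gamma>. norm (w \<sigma> x))"
proof -
  have r: "\<bar>a - \<eta> * real_of_int (toward_zero (a / \<eta>))\<bar> \<le> \<eta>" for a
  proof -
    have "\<bar>a - \<eta> * real_of_int (toward_zero (a / \<eta>))\<bar> = \<eta> * \<bar>a / \<eta> - real_of_int (toward_zero (a / \<eta>))\<bar>"
      using assms by (simp add: abs_mult_pos' right_diff_distrib)
    also have "\<dots> \<le> \<eta> * 1" using assms by (intro mult_left_mono toward_zero) auto
    finally show ?thesis by simp
  qed
  let ?q = "\<lambda>\<sigma>. Complex (\<eta> * real_of_int (quantize \<Gamma> \<eta> v (\<sigma>, False))) (\<eta> * real_of_int (quantize \<Gamma> \<eta> v (\<sigma>, True)))"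
  have q: "norm (v \<sigma> - ?q \<sigma>) \<le> 2 * \<eta>" if "\<sigma> \<in> \<Gamma>" for \<sigma>
  proof -
    have "norm (v \<sigma> - ?q \<sigma>) \<le> \<bar>Re (v \<sigma> - ?q \<sigma>)\<bar> + \<bar>Im (v \<sigma> - ?q \<sigma>)\<bar>" by (rule cmod_le)
    also have "\<dots> \<le> \<eta> + \<eta>" using r[of "Re (v \<sigma>)"] r[of "Im (v \<sigma>)"] that by (intro add_mono) (auto simp: quantize_def)
    finally show ?thesis by simp
  qed
  have "norm ((\<Sum>\<sigma>\<in>\<Gamma>. v \<sigma> * w \<sigma> x) - quantized_sum \<Gamma> w \<eta> (quantize \<Gamma> \<eta> v) x)
      = norm (\<Sum>\<sigma>\<in>\<Gamma>. (v \<sigma> - ?q \<sigma>) * w \<sigma> x)"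
    by (simp only: quantized_sum_def sum_subtractf[symmetric] left_diff_distrib)
  also have "\<dots> \<le> (\<Sum>\<sigma>\<in>\<Gamma>. 2 * \<eta> * norm (w \<sigma> x))"
    by (rule sum_norm_le) (auto simp: norm_mult intro!: mult_right_mono q)
  finally show ?thesis by (simp only: sum_distrib_left)
qed

lemma bounded_periodic_quantized_sum: "(\<And>\<sigma>. \<sigma> \<in> \<Gamma> \<Longrightarrow> bounded_periodic d (w \<sigma>)) \<Longrightarrow> bounded_periodic d (quantized_sum \<Gamma> w \<eta> z)"
  unfolding quantized_sum_def[abs_def] by (intro bounded_periodic_sum bounded_periodic_cmult)

text \<open>
  Rounding of every coefficient separately, for coefficients of which only the supremum is known; \<open>E\<close> is the number
  of bits for a real coefficient.
\<close>

lemma covered_box: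
  assumes fin: "finite \<Gamma>" and w: "\<And>\<sigma>. \<sigma> \<in> \<Gamma> \<Longrightarrow> bounded_periodic d (w \<sigma>)"
    and W: "\<And>x. (\<Sum>\<sigma>\<in>\<Gamma>. norm (w \<sigma> x)) \<le> W" and "0 < \<eta>" "0 \<le> B" and E: "2 * B / \<eta> + 1 \<le> 2 powr E"
    and A: "\<And>f. f \<in> A \<Longrightarrow> \<exists>v. (\<forall>\<sigma>\<in>\<Gamma>. norm (v \<sigma>) \<le> B) \<and> (\<forall>x. f x = (\<Sum>\<sigma>\<in>\<Gamma>. v \<sigma> * w \<sigma> x))"
  shows "covered d A (2 * real (card \<Gamma>) * E) (2 * \<eta> * W)"
proof -
  define b where "b = nat \<lfloor>B / \<eta>\<rfloor>"
  have b: "real b \<le> B / \<eta>" using assms by (simp add: b_def)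
  let ?I = "\<Gamma> \<times> (UNIV :: bool set)"
  let ?V = "PiE ?I (\<lambda>_. {- int b..int b})"
  have cI: "card ?I = 2 * card \<Gamma>" by (simp add: card_cartesian_product)
  have finI: "finite ?I" using fin by simp
  show ?thesis
  proof (rule covered_by_finite_family[where V="?V" and G="quantized_sum \<Gamma> w \<eta>"])
    show "finite ?V" using finI by (intro finite_PiE) auto
    have "card ?V = (2 * b + 1) ^ (2 * card \<Gamma>)"
    proof -
      have "card {- int b..int b} = 2 * b + 1" by (simp add: nat_eq_iff2)
      then show ?thesis using finI by (simp only: card_PiE prod_constant cI)
    qed
    then have "real (card ?V) = (2 * real b + 1) ^ (2 * card \<Gamma>)" by (simp add: add.commute)
    also have "\<dots> \<le> (2 powr E) ^ (2 * card \<Gamma>)" using b E by (intro power_mono) auto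
    also have "\<dots> = 2 powr (2 * real (card \<Gamma>) * E)"
      by (simp add: powr_realpow[symmetric] powr_powr mult_ac)
    finally show "real (card ?V) \<le> 2 powr (2 * real (card \<Gamma>) * E)" .
    show "bounded_periodic d (quantized_sum \<Gamma> w \<eta> z)" for z by (rule bounded_periodic_quantized_sum[OF w])
    fix f assume "f \<in> A"
    then obtain v where v: "\<And>\<sigma>. \<sigma> \<in> \<Gamma> \<Longrightarrow> norm (v \<sigma>) \<le> B" "\<And>x. f x = (\<Sum>\<sigma>\<in>\<Gamma>. v \<sigma> * w \<sigma> x)"
      using A by blast
    have "quantize \<Gamma> \<eta> v \<in> ?V"
    proof (rule PiE_I)
      fix i assume i: "i \<in> ?I"
      obtain \<sigma> k where ik: "i = (\<sigma>, k)" "\<sigma> \<in> \<Gamma>" using i by auto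
      let ?a = "(if k then Im (v \<sigma>) else Re (v \<sigma>)) / \<eta>"
      have "\<bar>if k then Im (v \<sigma>) else Re (v \<sigma>)\<bar> \<le> B"
        using v(1)[OF ik(2)] abs_Re_le_cmod[of "v \<sigma>"] abs_Im_le_cmod[of "v \<sigma>"] by auto
      then have "\<bar>?a\<bar> \<le> B / \<eta>" using assms(4) by (auto simp: abs_divide intro: divide_right_mono)
      then have "\<bar>real_of_int (toward_zero ?a)\<bar> \<le> B / \<eta>" using toward_zero(1)[of ?a] by linarith
      then have "\<bar>toward_zero ?a\<bar> \<le> \<lfloor>B / \<eta>\<rfloor>" by (simp add: le_floor_iff)
      moreover have "0 \<le> B / \<eta>" using assms by simp
      ultimately have "\<bar>toward_zero ?a\<bar> \<le> int b" unfolding b_def by linarith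
      moreover have "quantize \<Gamma> \<eta> v i = toward_zero ?a" using ik by (simp add: quantize_def)
      ultimately show "quantize \<Gamma> \<eta> v i \<in> {- int b..int b}" by auto
    qed (auto simp: quantize_def)
    moreover have "norm (f x - quantized_sum \<Gamma> w \<eta> (quantize \<Gamma> \<eta> v) x) \<le> 2 * \<eta> * W" for x
      using quantize_error[OF assms(4), where \<Gamma>=\<Gamma> and v=v and w=w and x=x] mult_left_mono[OF W[of x], of "2 * \<eta>"] assms(4)
      unfolding v(2) by linarith
    ultimately show "\<exists>z\<in>?V. \<forall>x. norm (f x - quantized_sum \<Gamma> w \<eta> z x) \<le> 2 * \<eta> * W" by blast
  qed
qed

text \<open>
  Only the mean modulus \<open>\<rho>\<close> of the coefficients is known. The step of the rounding is larger than \<open>\<rho>\<close> by a factor of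
  order \<open>2 ^ p\<close>; most coefficients become 0, and a coefficient costs about \<open>p / 2 ^ p\<close> bits on average.
\<close>

lemma covered_l1:
  assumes fin: "finite \<Gamma>" and w: "\<And>\<sigma>. \<sigma> \<in> \<Gamma> \<Longrightarrow> bounded_periodic d (w \<sigma>)"
    and W: "\<And>x. (\<Sum>\<sigma>\<in>\<Gamma>. norm (w \<sigma> x)) \<le> W" and "0 < \<rho>" "1 \<le> p"
    and A: "\<And>f. f \<in> A \<Longrightarrow> \<exists>v. (\<Sum>\<sigma>\<in>\<Gamma>. norm (v \<sigma>)) \<le> real (card \<Gamma>) * \<rho> \<and> (\<forall>x. f x = (\<Sum>\<sigma>\<in>\<Gamma>. v \<sigma> * w \<sigma> x))"
  shows "covered d A ((real p + 12) * (1 / 2) ^ p * real (card \<Gamma>)) (4 * 2 ^ p * \<rho> * W)"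
proof -
  \<comment> \<open>The factor 2 accounts for the real and the imaginary part.\<close>
  define \<eta> where "\<eta> = 2 * 2 ^ p * \<rho>"
  have \<eta>: "0 < \<eta>" using assms(4) by (simp add: \<eta>_def)
  define m where "m = (1 / 2) ^ p * real (card \<Gamma>)"
  define b where "b = nat \<lfloor>m\<rfloor>"
  let ?I = "\<Gamma> \<times> (UNIV :: bool set)"
  let ?V = "{z \<in> PiE ?I (\<lambda>_. {- int b..int b}). (\<Sum>i\<in>?I. \<bar>real_of_int (z i)\<bar>) \<le> m}"
  have cI: "real (card ?I) = 2 * real (card \<Gamma>)" by (simp add: card_cartesian_product)
  have finI: "finite ?I" using fin by simp
  have "covered d A ((real p + 12) * (1 / 2) ^ p * real (card \<Gamma>)) (2 * \<eta> * W)"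
  proof (rule covered_by_finite_family[where V="?V" and G="quantized_sum \<Gamma> w \<eta>"])
    show "finite ?V" using finI by (intro finite_Collect_conjI disjI1) (auto intro!: finite_PiE)
    have "real p * m + 6 * (1 / 2) ^ p * real (card ?I) = (real p + 12) * (1 / 2) ^ p * real (card \<Gamma>)"
      unfolding cI by (simp add: m_def algebra_simps)
    then show "real (card ?V) \<le> 2 powr ((real p + 12) * (1 / 2) ^ p * real (card \<Gamma>))"
      using card_integer_l1_ball[OF finI assms(5), of b m] by simp
    show "bounded_periodic d (quantized_sum \<Gamma> w \<eta> z)" for z by (rule bounded_periodic_quantized_sum[OF w])
    fix f assume "f \<in> A"
    then obtain v where v: "(\<Sum>\<sigma>\<in>\<Gamma>. norm (v \<sigma>)) \<le> real (card \<Gamma>) * \<rho>" "\<And>x. f x = (\<Sum>\<sigma>\<in>\<Gamma>. v \<sigma> * w \<sigma> x)"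
      using A by blast
    let ?z = "quantize \<Gamma> \<eta> v"
    have l1: "(\<Sum>i\<in>?I. \<bar>real_of_int (?z i)\<bar>) \<le> m"
    proof -
      have "(\<Sum>i\<in>?I. \<bar>real_of_int (?z i)\<bar>) = (\<Sum>\<sigma>\<in>\<Gamma>. \<Sum>k\<in>UNIV. \<bar>real_of_int (?z (\<sigma>, k))\<bar>)"
        by (simp add: sum.cartesian_product)
      also have "\<dots> = (\<Sum>\<sigma>\<in>\<Gamma>. \<bar>real_of_int (toward_zero (Im (v \<sigma>) / \<eta>))\<bar> + \<bar>real_of_int (toward_zero (Re (v \<sigma>) / \<eta>))\<bar>)"
        by (intro sum.cong refl) (simp add: UNIV_bool quantize_def)
      also have "\<dots> \<le> (\<Sum>\<sigma>\<in>\<Gamma>. norm (v \<sigma>) / \<eta> + norm (v \<sigma>) / \<eta>)"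
      proof (intro sum_mono add_mono)
        fix \<sigma>
        show "\<bar>real_of_int (toward_zero (Im (v \<sigma>) / \<eta>))\<bar> \<le> norm (v \<sigma>) / \<eta>"
          using toward_zero(1)[of "Im (v \<sigma>) / \<eta>"] abs_Im_le_cmod[of "v \<sigma>"] \<eta>
          by (auto simp: abs_divide intro: order.trans[OF _ divide_right_mono])
        show "\<bar>real_of_int (toward_zero (Re (v \<sigma>) / \<eta>))\<bar> \<le> norm (v \<sigma>) / \<eta>"
          using toward_zero(1)[of "Re (v \<sigma>) / \<eta>"] abs_Re_le_cmod[of "v \<sigma>"] \<eta>
          by (auto simp: abs_divide intro: order.trans[OF _ divide_right_mono])
      qed
      also have "\<dots> = 2 * (\<Sum>\<sigma>\<in>\<Gamma>. norm (v \<sigma>)) / \<eta>" by (simp add: sum_divide_distrib sum_distrib_left)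
      also have "\<dots> \<le> 2 * (real (card \<Gamma>) * \<rho>) / \<eta>" using v(1) \<eta> by (intro divide_right_mono mult_left_mono) auto
      also have "\<dots> = m" using assms(4) by (simp add: m_def \<eta>_def power_one_over field_simps)
      finally show ?thesis .
    qed
    have "?z \<in> PiE ?I (\<lambda>_. {- int b..int b})"
    proof (rule PiE_I)
      fix i assume i: "i \<in> ?I"
      have "\<bar>real_of_int (?z i)\<bar> \<le> (\<Sum>i\<in>?I. \<bar>real_of_int (?z i)\<bar>)"
        using finI i by (intro member_le_sum) auto
      then have "\<bar>real_of_int (?z i)\<bar> \<le> m" using l1 by linarith
      then have "\<bar>?z i\<bar> \<le> \<lfloor>m\<rfloor>" by (simp add: le_floor_iff)
      moreover have "0 \<le> m" by (simp add: m_def)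
      ultimately have "\<bar>?z i\<bar> \<le> int b" unfolding b_def by linarith
      then show "?z i \<in> {- int b..int b}" by auto
    qed (auto simp: quantize_def)
    with l1 have "?z \<in> ?V" by simp
    moreover have "norm (f x - quantized_sum \<Gamma> w \<eta> ?z x) \<le> 2 * \<eta> * W" for x
      using quantize_error[OF \<eta>, where \<Gamma>=\<Gamma> and v=v and w=w and x=x] mult_left_mono[OF W[of x], of "2 * \<eta>"] \<eta>
      unfolding v(2) by linarith
    ultimately show "\<exists>z\<in>?V. \<forall>x. norm (f x - quantized_sum \<Gamma> w \<eta> z x) \<le> 2 * \<eta> * W" by blast
  qed
  then show ?thesis by (simp add: \<eta>_def mult_ac)
qed

lemma band_limited_grid_sum:
  assumes "band_limited d n h" "\<And>j. j \<in> {1..d} \<Longrightarrow> 4 * n j < N j"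
  shows "h x = (\<Sum>\<sigma>\<in>grid_index d N. h (grid_point N \<sigma>) * (1 / of_nat (grid_size d N) * vp d n x (grid_point N \<sigma>)))"
  using band_limitedD[OF assms, of x] by (simp add: grid_mean_def sum_divide_distrib)

lemma vp_grid_weights:
  assumes "\<And>j. j \<in> {1..d} \<Longrightarrow> 4 * n j < N j"
  shows "(\<Sum>\<sigma>\<in>grid_index d N. norm (1 / of_nat (grid_size d N) * vp d n x (grid_point N \<sigma>))) \<le> 2 ^ d"
  using vp_grid_l1(1)[OF assms, where x=x] by (simp add: grid_mean_def norm_mult norm_divide sum_divide_distrib)

lemma covered_band_limited_box:
  assumes N: "\<And>j. j \<in> {1..d} \<Longrightarrow> 4 * n j < N j" and "0 < \<eta>" "0 \<le> B" "2 * B / \<eta> + 1 \<le> 2 powr E"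
    and A: "\<And>h. h \<in> A \<Longrightarrow> band_limited d n h" "\<And>h x. h \<in> A \<Longrightarrow> norm (h x) \<le> B"
  shows "covered d A (2 * real (grid_size d N) * E) (2 * \<eta> * 2 ^ d)"
  unfolding card_grid_index[symmetric]
proof (rule covered_box[where w="\<lambda>\<sigma> x. 1 / of_nat (grid_size d N) * vp d n x (grid_point N \<sigma>)"])
  fix h assume "h \<in> A"
  then show "\<exists>v. (\<forall>\<sigma>\<in>grid_index d N. norm (v \<sigma>) \<le> B) \<and>
      (\<forall>x. h x = (\<Sum>\<sigma>\<in>grid_index d N. v \<sigma> * (1 / of_nat (grid_size d N) * vp d n x (grid_point N \<sigma>))))"
    by (intro exI[of _ "\<lambda>\<sigma>. h (grid_point N \<sigma>)"] conjI allI ballI A(2) band_limited_grid_sum[OF A(1) N])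
next
  show "bounded_periodic d (\<lambda>x. 1 / of_nat (grid_size d N) * vp d n x (grid_point N \<sigma>))" for \<sigma>
    by (intro bounded_periodic_cmult bounded_periodic_vp)
  show "(\<Sum>\<sigma>\<in>grid_index d N. norm (1 / of_nat (grid_size d N) * vp d n x (grid_point N \<sigma>))) \<le> 2 ^ d" for x
    by (rule vp_grid_weights[OF N])
qed (use assms in auto)

lemma covered_band_limited_l1:
  assumes N: "\<And>j. j \<in> {1..d} \<Longrightarrow> 4 * n j < N j" and "0 < \<rho>" "1 \<le> p"
    and A: "\<And>h. h \<in> A \<Longrightarrow> band_limited d n h" "\<And>h. h \<in> A \<Longrightarrow> grid_mean d N (\<lambda>\<xi>. norm (h \<xi>)) \<le> \<rho>"
  shows "covered d A ((real p + 12) * (1 / 2) ^ p * real (grid_size d N)) (4 * 2 ^ p * \<rho> * 2 ^ d)"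
proof -
  have pos: "real (grid_size d N) > 0"
    unfolding grid_size_def using N by (simp only: of_nat_prod) (intro prod_pos, fastforce)
  show ?thesis
    unfolding card_grid_index[symmetric]
  proof (rule covered_l1[where w="\<lambda>\<sigma> x. 1 / of_nat (grid_size d N) * vp d n x (grid_point N \<sigma>)"])
    fix h assume h: "h \<in> A"
    have "(\<Sum>\<sigma>\<in>grid_index d N. norm (h (grid_point N \<sigma>))) \<le> real (card (grid_index d N)) * \<rho>"
      using A(2)[OF h] pos by (simp add: grid_mean_def card_grid_index field_simps)
    then show "\<exists>v. (\<Sum>\<sigma>\<in>grid_index d N. norm (v \<sigma>)) \<le> real (card (grid_index d N)) * \<rho> \<and>
        (\<forall>x. h x = (\<Sum>\<sigma>\<in>grid_index d N. v \<sigma> * (1 / of_nat (grid_size d N) * vp d n x (grid_point N \<sigma>))))"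
      by (intro exI[of _ "\<lambda>\<sigma>. h (grid_point N \<sigma>)"] conjI allI band_limited_grid_sum[OF A(1)[OF h] N])
  next
    show "bounded_periodic d (\<lambda>x. 1 / of_nat (grid_size d N) * vp d n x (grid_point N \<sigma>))" for \<sigma>
      by (intro bounded_periodic_cmult bounded_periodic_vp)
    show "(\<Sum>\<sigma>\<in>grid_index d N. norm (1 / of_nat (grid_size d N) * vp d n x (grid_point N \<sigma>))) \<le> 2 ^ d" for x
      by (rule vp_grid_weights[OF N])
  qed (use assms in auto)
qed

section \<open>Coverings of single groups of blocks\<close>

text \<open>
  A constant for \<open>sum_high_levels\<close>. Naming it lets the constants of all later estimates be written down before the
  kernel is given.
\<close>

definition level_tail_bound :: "nat \<Rightarrow> real \<Rightarrow> real \<Rightarrow> bool"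
  where "level_tail_bound d \<theta> A \<longleftrightarrow> 1 \<le> A \<and>
    (\<forall>m M. (\<Sum>s\<in>{s \<in> levels d M. m \<le> level_sum d s}. 2 powr (- \<theta> * (real (level_sum d s) - real m)))
      \<le> A * (real m + 1) ^ (d - 1))"

lemma level_tail_bound_exists: "1 \<le> d \<Longrightarrow> 0 < \<theta> \<Longrightarrow> \<exists>A. level_tail_bound d \<theta> A"
  unfolding level_tail_bound_def using sum_high_levels by blast

lemma level_tail_bound_total:
  assumes "level_tail_bound d \<theta> A" "S \<subseteq> levels d M"
  shows "(\<Sum>s\<in>S. 2 powr (- \<theta> * real (level_sum d s))) \<le> A"
proof -
  have "(\<Sum>s\<in>S. 2 powr (- \<theta> * real (level_sum d s)))
     \<le> (\<Sum>s\<in>{s \<in> levels d M. 0 \<le> level_sum d s}. 2 powr (- \<theta> * (real (level_sum d s) - real 0)))"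
    using assms(2) by (simp only: of_nat_0 diff_zero) (intro sum_mono2, auto)
  also have "\<dots> \<le> A * (real 0 + 1) ^ (d - 1)"
    using assms(1) unfolding level_tail_bound_def by blast
  finally show ?thesis by simp
qed

definition L1_ball :: "nat \<Rightarrow> ((nat \<Rightarrow> real) \<Rightarrow> complex) set"
  where "L1_ball d = {\<phi>. integrable (torus d) \<phi> \<and> (\<integral>y. norm (\<phi> y) \<partial>torus d) \<le> 1}"

lemma bounded_times_integrable:
  fixes f \<phi> :: "_ \<Rightarrow> complex"
  assumes "integrable M \<phi>" "f \<in> borel_measurable M" "\<And>y. norm (f y) \<le> B"
  shows "integrable M (\<lambda>y. f y * \<phi> y)"
proof (rule Bochner_Integration.integrable_bound)
  show "integrable M (\<lambda>y. of_real B * \<phi> y)" using assms(1) by simp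
  show "(\<lambda>y. f y * \<phi> y) \<in> borel_measurable M" using assms by (intro borel_measurable_times) auto
  show "AE y in M. norm (f y * \<phi> y) \<le> norm (of_real B * \<phi> y)"
    using assms(3) by (intro AE_I2) (auto simp: norm_mult intro!: mult_right_mono intro: order.trans[OF _ abs_ge_self])
qed

lemma L1_ball_integral_le:
  assumes \<phi>: "\<phi> \<in> L1_ball d" and "f \<in> borel_measurable (torus d)" and B: "\<And>y. norm (f y) \<le> B"
  shows "norm (\<integral>y. f y * \<phi> y \<partial>torus d) \<le> B"
proof -
  have int: "integrable (torus d) \<phi>" using \<phi> by (simp add: L1_ball_def)
  have "0 \<le> B" using B[of undefined] norm_ge_zero order.trans by blast
  have "norm (\<integral>y. f y * \<phi> y \<partial>torus d) \<le> (\<integral>y. norm (f y * \<phi> y) \<partial>torus d)"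
    by (rule integral_norm_bound)
  also have "\<dots> \<le> (\<integral>y. B * norm (\<phi> y) \<partial>torus d)"
  proof (rule integral_mono)
    show "integrable (torus d) (\<lambda>y. norm (f y * \<phi> y))"
      by (rule integrable_norm[OF bounded_times_integrable[OF int assms(2) B]])
    show "integrable (torus d) (\<lambda>y. B * norm (\<phi> y))" using int by simp
    show "norm (f y * \<phi> y) \<le> B * norm (\<phi> y)" for y
      unfolding norm_mult by (intro mult_right_mono B) auto
  qed
  also have "\<dots> = B * (\<integral>y. norm (\<phi> y) \<partial>torus d)" by simp
  also have "\<dots> \<le> B" using \<phi> \<open>0 \<le> B\<close> by (simp add: L1_ball_def mult_left_le)
  finally show ?thesis .
qed

text \<open>
  What the covering argument needs to know of the blocks \<open>D s s'\<close> of a kernel: their spectra, and their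
  size in the mean over \<open>x\<close>, uniformly in \<open>y\<close>.
\<close>

locale kernel_blocks =
  fixes d :: nat and r :: real and P M N :: nat and C :: real
    and D :: "(nat \<Rightarrow> nat) \<Rightarrow> (nat \<Rightarrow> nat) \<Rightarrow> (nat \<Rightarrow> real) \<Rightarrow> (nat \<Rightarrow> real) \<Rightarrow> complex"
  assumes d: "1 \<le> d" and r: "1 < r" and P: "1 \<le> P" and C: "1 \<le> C" and N: "4 * (P * 2 ^ M) < N"
    and band_x: "\<And>s s' y. s \<in> levels d M \<Longrightarrow> s' \<in> levels d M \<Longrightarrow> band_limited d (\<lambda>j. P * 2 ^ s j) (\<lambda>x. D s s' x y)"
    and band_y: "\<And>s s' x. s \<in> levels d M \<Longrightarrow> s' \<in> levels d M \<Longrightarrow> band_limited d (\<lambda>j. P * 2 ^ s' j) (\<lambda>y. D s s' x y)"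
    and mean: "\<And>s s' y. s \<in> levels d M \<Longrightarrow> s' \<in> levels d M \<Longrightarrow>
      grid_mean d (\<lambda>_. N) (\<lambda>\<xi>. norm (D s s' \<xi> y)) \<le> C * 2 powr (- r * (real (level_sum d s) + real (level_sum d s')))"
    and bounded_periodic_x: "\<And>s s' y. s \<in> levels d M \<Longrightarrow> s' \<in> levels d M \<Longrightarrow> bounded_periodic d (\<lambda>x. D s s' x y)"
    and meas_y: "\<And>s s' x. s \<in> levels d M \<Longrightarrow> s' \<in> levels d M \<Longrightarrow> (\<lambda>y. D s s' x y) \<in> borel_measurable (torus d)"
begin

definition "q = (5 * real P) ^ d"
definition "K = 4 ^ d * q * C"

lemma q_ge_1: "1 \<le> q" unfolding q_def using P by (intro one_le_power) simp

lemma K_pos: "0 < K" using q_ge_1 C by (simp add: K_def)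

text \<open>
  The factor 5 makes this grid fine enough for functions of the level \<open>s\<close>, while the number of nodes stays of the
  order of their dimension.
\<close>

definition nodes :: "(nat \<Rightarrow> nat) \<Rightarrow> nat \<Rightarrow> nat"
  where "nodes s = (\<lambda>j. 5 * (P * 2 ^ s j))"

lemma grid_size_nodes: "real (grid_size d (nodes s)) = q * 2 ^ level_sum d s"
  by (simp add: grid_size_def nodes_def q_def level_sum_def prod.distrib power_sum power_mult_distrib mult_ac)

lemma nodes_fine: "4 * (P * 2 ^ s j) < nodes s j"
  using P by (simp add: nodes_def)

lemma N_fine: "s \<in> levels d M \<Longrightarrow> j \<in> {1..d} \<Longrightarrow> 4 * (P * 2 ^ s j) < N"
proof -
  assume "s \<in> levels d M" "j \<in> {1..d}"
  then have "s j \<le> M" by (auto simp: levels_def)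
  then have "4 * (P * 2 ^ s j) \<le> 4 * (P * 2 ^ M)" by simp
  then show ?thesis using N by linarith
qed

lemma sup_from_mean:
  assumes s: "s \<in> levels d M" and "band_limited d (\<lambda>j. P * 2 ^ s j) h"
    and "grid_mean d (\<lambda>_. N) (\<lambda>\<xi>. norm (h \<xi>)) \<le> C * 2 powr (- r * (real (level_sum d s) + real w))"
  shows "norm (h x) \<le> K * (2 powr ((1 - r) * level_sum d s) * 2 powr (- r * w))"
proof -
  have "norm (h x) \<le> 4 ^ d * real (grid_size d (nodes s)) * grid_mean d (\<lambda>_. N) (\<lambda>\<xi>. norm (h \<xi>))"
    by (rule nikolskii[OF assms(2) N_fine[OF s] nodes_fine[of s]])
  also have "\<dots> \<le> 4 ^ d * real (grid_size d (nodes s)) * (C * 2 powr (- r * (real (level_sum d s) + real w)))"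
    using assms(3) by (intro mult_left_mono) auto
  also have "\<dots> = K * (2 powr (real (level_sum d s)) * 2 powr (- r * (real (level_sum d s) + real w)))"
    by (simp add: grid_size_nodes K_def powr_realpow)
  also have "2 powr (real (level_sum d s)) * 2 powr (- r * (real (level_sum d s) + real w))
      = 2 powr ((1 - r) * level_sum d s) * 2 powr (- r * w)"
    by (simp add: powr_add[symmetric] algebra_simps)
  finally show ?thesis .
qed

lemma norm_D_le:
  "s \<in> levels d M \<Longrightarrow> s' \<in> levels d M \<Longrightarrow>
    norm (D s s' x y) \<le> K * (2 powr ((1 - r) * level_sum d s) * 2 powr (- r * level_sum d s'))"
  by (rule sup_from_mean[OF _ band_x mean])

definition I :: "(nat \<Rightarrow> nat) \<Rightarrow> (nat \<Rightarrow> nat) \<Rightarrow> ((nat \<Rightarrow> real) \<Rightarrow> complex) \<Rightarrow> (nat \<Rightarrow> real) \<Rightarrow> complex"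
  where "I s s' \<phi> x = (\<integral>y. D s s' x y * \<phi> y \<partial>torus d)"

lemma integrable_D:
  "s \<in> levels d M \<Longrightarrow> s' \<in> levels d M \<Longrightarrow> \<phi> \<in> L1_ball d \<Longrightarrow> integrable (torus d) (\<lambda>y. D s s' x y * \<phi> y)"
  by (rule bounded_times_integrable[OF _ meas_y norm_D_le]) (auto simp: L1_ball_def)

lemma norm_I_le:
  "s \<in> levels d M \<Longrightarrow> s' \<in> levels d M \<Longrightarrow> \<phi> \<in> L1_ball d \<Longrightarrow>
    norm (I s s' \<phi> x) \<le> K * (2 powr ((1 - r) * level_sum d s) * 2 powr (- r * level_sum d s'))"
  unfolding I_def by (rule L1_ball_integral_le[OF _ meas_y norm_D_le])

lemma band_limited_I:
  assumes "s \<in> levels d M" "s' \<in> levels d M" "\<phi> \<in> L1_ball d"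
  shows "band_limited d (\<lambda>j. P * 2 ^ s j) (I s s' \<phi>)"
  unfolding I_def[abs_def]
proof (rule band_limited_integral)
  fix y
  have "band_limited d (\<lambda>j. P * 2 ^ s j) (\<lambda>x. \<phi> y * D s s' x y)"
    by (intro band_limited_cmult band_x assms)
  then show "band_limited d (\<lambda>j. P * 2 ^ s j) (\<lambda>x. D s s' x y * \<phi> y)" by (simp add: mult.commute)
qed (rule integrable_D[OF assms])

text \<open>
  The mean over \<open>x\<close> of the block is bounded uniformly in \<open>y\<close>, and \<open>\<phi>\<close> has \<open>L1\<close> norm at most 1.
\<close>

lemma mean_I_le:
  assumes "s \<in> levels d M" "s' \<in> levels d M" "\<phi> \<in> L1_ball d"
  shows "grid_mean d (\<lambda>_. N) (\<lambda>\<xi>. norm (I s s' \<phi> \<xi>)) \<le> C * 2 powr (- r * (real (level_sum d s) + real (level_sum d s')))"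
proof -
  let ?\<rho> = "C * 2 powr (- r * (real (level_sum d s) + real (level_sum d s')))"
  have int: "integrable (torus d) (\<lambda>y. norm (D s s' x y) * norm (\<phi> y))" for x
    using integrable_norm[OF integrable_D[OF assms]] by (simp add: norm_mult)
  have int\<phi>: "integrable (torus d) (\<lambda>y. norm (\<phi> y))" using assms(3) by (simp add: L1_ball_def)
  have "grid_mean d (\<lambda>_. N) (\<lambda>\<xi>. norm (I s s' \<phi> \<xi>)) \<le> grid_mean d (\<lambda>_. N) (\<lambda>\<xi>. \<integral>y. norm (D s s' \<xi> y) * norm (\<phi> y) \<partial>torus d)"
    unfolding I_def norm_mult[symmetric] by (intro grid_mean_mono integral_norm_bound)
  also have "\<dots> = (\<integral>y. grid_mean d (\<lambda>_. N) (\<lambda>\<xi>. norm (D s s' \<xi> y)) * norm (\<phi> y) \<partial>torus d)"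
    unfolding grid_mean_multc[symmetric] unfolding grid_mean_def using int by simp
  also have "\<dots> \<le> (\<integral>y. ?\<rho> * norm (\<phi> y) \<partial>torus d)"
  proof (rule integral_mono)
    show "integrable (torus d) (\<lambda>y. grid_mean d (\<lambda>_. N) (\<lambda>\<xi>. norm (D s s' \<xi> y)) * norm (\<phi> y))"
      unfolding grid_mean_multc[symmetric] unfolding grid_mean_def using int by simp
    show "grid_mean d (\<lambda>_. N) (\<lambda>\<xi>. norm (D s s' \<xi> y)) * norm (\<phi> y) \<le> ?\<rho> * norm (\<phi> y)" for y
      by (intro mult_right_mono mean assms) auto
  qed (use int\<phi> in simp)
  also have "\<dots> = ?\<rho> * (\<integral>y. norm (\<phi> y) \<partial>torus d)" by simp
  also have "\<dots> \<le> ?\<rho>" using assms(3) C by (simp add: L1_ball_def mult_left_le)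
  finally show ?thesis .
qed

lemma norm_row_sum_le:
  assumes "level_tail_bound d r A" "s \<in> levels d M" "\<phi> \<in> L1_ball d"
  shows "norm (\<Sum>s'\<in>levels d M. I s s' \<phi> x) \<le> K * A"
proof -
  have one: "2 powr ((1 - r) * level_sum d s) \<le> 1"
    using r powr_mono[of "(1 - r) * level_sum d s" 0 2] by (simp add: mult_nonpos_nonneg)
  have "norm (\<Sum>s'\<in>levels d M. I s s' \<phi> x) \<le> (\<Sum>s'\<in>levels d M. K * (1 * 2 powr (- r * level_sum d s')))"
  proof (rule sum_norm_le)
    fix s' assume "s' \<in> levels d M"
    then have "norm (I s s' \<phi> x) \<le> K * (2 powr ((1 - r) * level_sum d s) * 2 powr (- r * level_sum d s'))"
      by (rule norm_I_le[OF assms(2) _ assms(3)])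
    also have "\<dots> \<le> K * (1 * 2 powr (- r * level_sum d s'))"
      using one K_pos by (intro mult_left_mono mult_right_mono) auto
    finally show "norm (I s s' \<phi> x) \<le> K * (1 * 2 powr (- r * level_sum d s'))" .
  qed
  also have "\<dots> = K * (\<Sum>s'\<in>levels d M. 2 powr (- r * level_sum d s'))" by (simp add: sum_distrib_left)
  also have "\<dots> \<le> K * A" using K_pos level_tail_bound_total[OF assms(1), of "levels d M" M] by (intro mult_left_mono) auto
  finally show ?thesis .
qed

lemma norm_column_sum_le:
  assumes "level_tail_bound d (r - 1) A" "s' \<in> levels d M" "S \<subseteq> levels d M"
  shows "norm (\<Sum>s\<in>S. D s s' x y) \<le> K * A"
proof -
  have one: "2 powr (- r * level_sum d s') \<le> 1"
    using r powr_mono[of "- r * level_sum d s'" 0 2] by simp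
  have "norm (\<Sum>s\<in>S. D s s' x y) \<le> (\<Sum>s\<in>S. K * (2 powr (- (r - 1) * level_sum d s) * 1))"
  proof (rule sum_norm_le)
    fix s assume "s \<in> S"
    then have "norm (D s s' x y) \<le> K * (2 powr ((1 - r) * level_sum d s) * 2 powr (- r * level_sum d s'))"
      using assms(3) by (intro norm_D_le assms(2)) auto
    also have "\<dots> \<le> K * (2 powr ((1 - r) * level_sum d s) * 1)"
      using one K_pos by (intro mult_left_mono) auto
    finally show "norm (D s s' x y) \<le> K * (2 powr (- (r - 1) * level_sum d s) * 1)" by simp
  qed
  also have "\<dots> = K * (\<Sum>s\<in>S. 2 powr (- (r - 1) * level_sum d s))" by (simp add: sum_distrib_left)
  also have "\<dots> \<le> K * A" using K_pos level_tail_bound_total[OF assms(1,3)] by (intro mult_left_mono) auto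
  finally show ?thesis .
qed

text \<open>
  All blocks with the level \<open>s\<close> in \<open>x\<close> are taken together: their sum is one bounded function of that level, determined
  by its grid values.
\<close>

lemma covered_low_x:
  assumes A: "level_tail_bound d r A" and s: "s \<in> levels d M" and \<eta>: "0 < \<eta>" and E: "2 * (K * A) / \<eta> + 1 \<le> 2 powr E"
  shows "covered d ((\<lambda>\<phi> x. \<Sum>s'\<in>levels d M. I s s' \<phi> x) ` L1_ball d) (2 * (q * 2 ^ level_sum d s) * E) (2 * \<eta> * 2 ^ d)"
  unfolding grid_size_nodes[symmetric]
proof (rule covered_band_limited_box[where n="\<lambda>j. P * 2 ^ s j" and B="K * A", OF nodes_fine[of s] \<eta> _ E])
  show "0 \<le> K * A" using K_pos A by (simp add: level_tail_bound_def)
  fix h assume "h \<in> (\<lambda>\<phi> x. \<Sum>s'\<in>levels d M. I s s' \<phi> x) ` L1_ball d"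
  then obtain \<phi> where h: "h = (\<lambda>x. \<Sum>s'\<in>levels d M. I s s' \<phi> x)" and \<phi>: "\<phi> \<in> L1_ball d" by auto
  show "band_limited d (\<lambda>j. P * 2 ^ s j) h" unfolding h by (intro band_limited_sum band_limited_I s \<phi>)
  show "norm (h x) \<le> K * A" for x unfolding h by (rule norm_row_sum_le[OF A s \<phi>])
qed

text \<open>
  The blocks with a fixed level in \<open>y\<close> see \<open>\<phi>\<close> only through its integrals against the translates of the kernel
  \<open>vp\<close> at the nodes. These integrals are rounded. The errors are multiplied by the suprema of the
  blocks, whose sum over \<open>s\<close> converges because \<open>r > 1\<close>.
\<close>

lemma covered_low_y:
  assumes A: "level_tail_bound d (r - 1) A" and s': "s' \<in> levels d M" and S: "S \<subseteq> levels d M"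
    and \<eta>: "0 < \<eta>" and E: "2 * (q * 2 ^ level_sum d s') / \<eta> + 1 \<le> 2 powr E"
  shows "covered d ((\<lambda>\<phi> x. \<Sum>s\<in>S. I s s' \<phi> x) ` L1_ball d) (2 * (q * 2 ^ level_sum d s') * E) (2 * \<eta> * (K * A))"
proof -
  let ?n = "\<lambda>j. P * 2 ^ s' j" and ?\<Lambda> = "grid_size d (nodes s')"
  have \<Lambda>: "0 < real ?\<Lambda>" using q_ge_1 by (simp add: grid_size_nodes)
  let ?w = "\<lambda>\<sigma> x. 1 / of_nat ?\<Lambda> * (\<Sum>s\<in>S. D s s' x (grid_point (nodes s') \<sigma>))"
  have "covered d ((\<lambda>\<phi> x. \<Sum>s\<in>S. I s s' \<phi> x) ` L1_ball d) (2 * real (card (grid_index d (nodes s'))) * E) (2 * \<eta> * (K * A))"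
  proof (rule covered_box[where w="?w" and B="real ?\<Lambda>", OF _ _ _ \<eta>])
    show "2 * real ?\<Lambda> / \<eta> + 1 \<le> 2 powr E" using E by (simp add: grid_size_nodes)
    show "bounded_periodic d (?w \<sigma>)" for \<sigma> using S by (intro bounded_periodic_cmult bounded_periodic_sum bounded_periodic_x s') auto
    fix x
    have "(\<Sum>\<sigma>\<in>grid_index d (nodes s'). norm (?w \<sigma> x)) \<le> (\<Sum>\<sigma>\<in>grid_index d (nodes s'). 1 / real ?\<Lambda> * (K * A))"
      unfolding norm_mult by (intro sum_mono mult_mono norm_column_sum_le[OF A s' S]) (auto simp: norm_divide)
    also have "\<dots> = K * A" using \<Lambda> by (simp add: card_grid_index)
    finally show "(\<Sum>\<sigma>\<in>grid_index d (nodes s'). norm (?w \<sigma> x)) \<le> K * A" .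
  next
    fix f assume "f \<in> (\<lambda>\<phi> x. \<Sum>s\<in>S. I s s' \<phi> x) ` L1_ball d"
    then obtain \<phi> where f: "f = (\<lambda>x. \<Sum>s\<in>S. I s s' \<phi> x)" and \<phi>: "\<phi> \<in> L1_ball d" by auto
    let ?b = "\<lambda>\<sigma>. \<integral>y. vp d ?n y (grid_point (nodes s') \<sigma>) * \<phi> y \<partial>torus d"
    have vp_meas: "(\<lambda>y. vp d ?n y \<xi>) \<in> borel_measurable (torus d)" for \<xi> using bounded_periodic_vp by (auto simp: bounded_periodic_def)
    have vp_int: "integrable (torus d) (\<lambda>y. vp d ?n y \<xi> * \<phi> y)" for \<xi>
      by (rule bounded_times_integrable[OF _ vp_meas norm_vp_le[OF nodes_fine[of s']]]) (use \<phi> in \<open>simp add: L1_ball_def\<close>)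
    have "norm (?b \<sigma>) \<le> real ?\<Lambda>" for \<sigma>
      by (rule L1_ball_integral_le[OF \<phi> vp_meas norm_vp_le[OF nodes_fine[of s']]])
    moreover have "f x = (\<Sum>\<sigma>\<in>grid_index d (nodes s'). ?b \<sigma> * ?w \<sigma> x)" for x
    proof -
      have "I s s' \<phi> x = (\<Sum>\<sigma>\<in>grid_index d (nodes s'). ?b \<sigma> * (1 / of_nat ?\<Lambda> * D s s' x (grid_point (nodes s') \<sigma>)))"
        if s: "s \<in> S" for s
      proof -
        have "I s s' \<phi> x = (\<integral>y. (\<Sum>\<sigma>\<in>grid_index d (nodes s').
            D s s' x (grid_point (nodes s') \<sigma>) * (1 / of_nat ?\<Lambda> * vp d ?n y (grid_point (nodes s') \<sigma>))) * \<phi> y \<partial>torus d)"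
          unfolding I_def using s S
          by (subst band_limited_grid_sum[OF band_y[OF _ s'] nodes_fine[of s']]) auto
        also have "\<dots> = (\<integral>y. (\<Sum>\<sigma>\<in>grid_index d (nodes s').
            (1 / of_nat ?\<Lambda> * D s s' x (grid_point (nodes s') \<sigma>)) * (vp d ?n y (grid_point (nodes s') \<sigma>) * \<phi> y)) \<partial>torus d)"
          unfolding sum_distrib_right by (simp only: mult_ac)
        also have "\<dots> = (\<Sum>\<sigma>\<in>grid_index d (nodes s'). (1 / of_nat ?\<Lambda> * D s s' x (grid_point (nodes s') \<sigma>)) * ?b \<sigma>)"
          using vp_int by simp
        finally show ?thesis by (simp only: mult_ac)
      qed
      then have "f x = (\<Sum>s\<in>S. \<Sum>\<sigma>\<in>grid_index d (nodes s'). ?b \<sigma> * (1 / of_nat ?\<Lambda> * D s s' x (grid_point (nodes s') \<sigma>)))"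
        unfolding f by (intro sum.cong) auto
      also have "\<dots> = (\<Sum>\<sigma>\<in>grid_index d (nodes s'). ?b \<sigma> * ?w \<sigma> x)"
        by (subst sum.swap) (simp only: sum_distrib_left)
      finally show ?thesis .
    qed
    ultimately show "\<exists>v. (\<forall>\<sigma>\<in>grid_index d (nodes s'). norm (v \<sigma>) \<le> real ?\<Lambda>) \<and>
        (\<forall>x. f x = (\<Sum>\<sigma>\<in>grid_index d (nodes s'). v \<sigma> * ?w \<sigma> x))" by (intro exI[of _ ?b]) simp
  qed simp_all
  then show ?thesis by (simp only: card_grid_index grid_size_nodes)
qed

text \<open>
  The transfer between grids turns the bound for the mean over the fine grid into one over the \<open>2 ^ level_sum d s\<close> nodes
  (up to a constant) that determine the function.
\<close>

lemma covered_high: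
  assumes s: "s \<in> levels d M" "s' \<in> levels d M" and p: "1 \<le> p"
  shows "covered d (I s s' ` L1_ball d) ((real p + 12) * (1 / 2) ^ p * (q * 2 ^ level_sum d s))
     (4 * 2 ^ p * (2 ^ d * (C * 2 powr (- r * (real (level_sum d s) + real (level_sum d s'))))) * 2 ^ d)"
  unfolding grid_size_nodes[symmetric]
proof (rule covered_band_limited_l1[where n="\<lambda>j. P * 2 ^ s j", OF nodes_fine[of s] _ p])
  show "0 < 2 ^ d * (C * 2 powr (- r * (real (level_sum d s) + real (level_sum d s'))))" using C by simp
  fix h assume "h \<in> I s s' ` L1_ball d"
  then obtain \<phi> where h: "h = I s s' \<phi>" and \<phi>: "\<phi> \<in> L1_ball d" by auto
  show bl: "band_limited d (\<lambda>j. P * 2 ^ s j) h" unfolding h by (rule band_limited_I[OF s \<phi>])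
  have "grid_mean d (nodes s) (\<lambda>\<xi>. norm (h \<xi>)) \<le> 2 ^ d * grid_mean d (\<lambda>_. N) (\<lambda>\<xi>. norm (h \<xi>))"
    by (rule band_limited_grid_change[OF bl N_fine[OF s(1)] nodes_fine[of s]])
  also have "\<dots> \<le> 2 ^ d * (C * 2 powr (- r * (real (level_sum d s) + real (level_sum d s'))))"
    unfolding h by (intro mult_left_mono mean_I_le[OF s \<phi>]) auto
  finally show "grid_mean d (nodes s) (\<lambda>\<xi>. norm (h \<xi>)) \<le> \<dots>" .
qed

end

section \<open>Coverings of all blocks together\<close>

context kernel_blocks
begin

definition "low m = {s \<in> levels d M. level_sum d s \<le> m}"
definition "high m = {s \<in> levels d M. m < level_sum d s}"

lemma low_high: "low m \<subseteq> levels d M" "high m \<subseteq> levels d M" "low m \<union> high m = levels d M" "low m \<inter> high m = {}"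
  "finite (low m)" "finite (high m)"
  by (auto simp: low_def high_def)

lemma sum_low: "(\<Sum>s\<in>low m. 2 ^ level_sum d s) \<le> 2 * 2 ^ m * (real m + 1) ^ (d - 1)"
  unfolding low_def by (rule sum_low_levels[OF d])

lemma card_low: "real (card (low m)) \<le> 2 * 2 powr (real d * real m)"
proof -
  have "real (card (low m)) = (\<Sum>s\<in>low m. 1)" by simp
  also have "\<dots> \<le> (\<Sum>s\<in>low m. 2 ^ level_sum d s)" by (intro sum_mono) simp
  also have "\<dots> \<le> 2 * 2 ^ m * (real m + 1) ^ (d - 1)" by (rule sum_low)
  also have "\<dots> \<le> 2 * 2 ^ m * (2 ^ m) ^ (d - 1)"
  proof (intro mult_left_mono power_mono)
    have "Suc m \<le> 2 ^ m" by (simp add: Suc_leI)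
    then show "real m + 1 \<le> 2 ^ m" by (metis of_nat_Suc of_nat_le_iff of_nat_numeral of_nat_power add.commute)
  qed auto
  also have "\<dots> = 2 * (2 ^ m) ^ d" using d by (cases d) auto
  also have "\<dots> = 2 * 2 powr (real d * real m)" by (simp add: powr_realpow[symmetric] powr_powr mult.commute)
  finally show ?thesis .
qed

lemma sum_high:
  assumes "level_tail_bound d \<theta> A"
  shows "(\<Sum>s\<in>high m. 2 powr (- \<theta> * (real (level_sum d s) - real m))) \<le> A * (real m + 1) ^ (d - 1)"
proof -
  have "(\<Sum>s\<in>high m. 2 powr (- \<theta> * (real (level_sum d s) - real m)))
     \<le> (\<Sum>s\<in>{s \<in> levels d M. m \<le> level_sum d s}. 2 powr (- \<theta> * (real (level_sum d s) - real m)))"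
    by (intro sum_mono2) (auto simp: high_def)
  also have "\<dots> \<le> A * (real m + 1) ^ (d - 1)"
    using assms unfolding level_tail_bound_def by blast
  finally show ?thesis .
qed

lemma sum_high_high:
  assumes "level_tail_bound d \<theta> A"
  shows "(\<Sum>(s, s')\<in>high m \<times> high m. 2 powr (- \<theta> * ((real (level_sum d s) - real m) + (real (level_sum d s') - real m))))
      \<le> A\<^sup>2 * (real m + 1) ^ (2 * (d - 1))"
proof -
  let ?f = "\<lambda>s. 2 powr (- \<theta> * (real (level_sum d s) - real m))"
  have "(\<Sum>(s, s')\<in>high m \<times> high m. 2 powr (- \<theta> * ((real (level_sum d s) - real m) + (real (level_sum d s') - real m))))
     = (\<Sum>(s, s')\<in>high m \<times> high m. ?f s * ?f s')"
    by (intro sum.cong refl) (auto simp: powr_add[symmetric] algebra_simps)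
  also have "\<dots> = (\<Sum>s\<in>high m. ?f s) * (\<Sum>s\<in>high m. ?f s)"
    by (simp add: sum_product sum.cartesian_product)
  also have "\<dots> \<le> (A * (real m + 1) ^ (d - 1)) * (A * (real m + 1) ^ (d - 1))"
    using assms by (intro mult_mono sum_high sum_nonneg) (auto simp: level_tail_bound_def)
  also have "\<dots> = A\<^sup>2 * (real m + 1) ^ (2 * (d - 1))"
    by (simp add: power2_eq_square power_add[symmetric] mult_2 mult_ac)
  finally show ?thesis .
qed

text \<open>
  With \<open>t\<close> measuring how far the block lies beyond the level \<open>m\<close>, both the number of bits and the error decay
  exponentially in \<open>t\<close>; for this, \<open>p\<close> exceeds \<open>level_sum d s - m\<close> by about \<open>\<delta> * t\<close>. The hypothesis \<open>r > 1\<close> leaves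
  room for that loss in the error.
\<close>

lemma covered_high_high:
  assumes s: "s \<in> high m" "s' \<in> high m" and \<delta>: "\<delta> = (r - 1) / 2"
    and t: "t = (real (level_sum d s) - real m) + (real (level_sum d s') - real m)"
  shows "covered d (I s s' ` L1_ball d) (q * (14 + \<delta>) * (2 / (\<delta> * ln 2)) * 2 ^ m * 2 powr (- (\<delta> / 2) * t))
     (8 * 4 ^ d * C * 2 powr (- 2 * r * m) * 2 powr (- \<delta> * t))"
proof -
  have \<delta>0: "0 < \<delta>" using r by (simp add: \<delta>)
  define a where "a = level_sum d s - m"
  define c where "c = nat \<lceil>\<delta> * t\<rceil>"
  \<comment> \<open>The part \<open>a\<close> reduces \<open>2 ^ level_sum d s\<close> to \<open>2 ^ m\<close>, and \<open>c\<close> gives the decay in \<open>t\<close>.\<close>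
  define p where "p = a + c"
  have lev: "s \<in> levels d M" "s' \<in> levels d M" using s by (auto simp: high_def)
  have gt: "m < level_sum d s" "m < level_sum d s'" using s by (auto simp: high_def)
  have a: "real a = real (level_sum d s) - real m" "1 \<le> a" using gt by (auto simp: a_def)
  have t1: "1 \<le> t" "real a \<le> t" using a gt by (auto simp: t)
  have c: "\<delta> * t \<le> real c" "real c \<le> \<delta> * t + 1"
  proof -
    have "0 \<le> \<delta> * t" using \<delta>0 t1 by simp
    then show "\<delta> * t \<le> real c" "real c \<le> \<delta> * t + 1" unfolding c_def by linarith+
  qed
  have lin: "t \<le> 2 / (\<delta> * ln 2) * 2 powr (\<delta> / 2 * t)"
  proof -
    have "\<delta> / 2 * t * ln 2 \<le> exp (\<delta> / 2 * t * ln 2)" using exp_ge_add_one_self[of "\<delta> / 2 * t * ln 2"] by linarith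
    then have "\<delta> / 2 * t * ln 2 \<le> 2 powr (\<delta> / 2 * t)" by (simp add: powr_def)
    then show ?thesis using \<delta>0 by (simp add: field_simps)
  qed
  have half: "(1 / 2) ^ p * 2 ^ level_sum d s \<le> 2 ^ m * 2 powr (- \<delta> * t)"
  proof -
    have "(1 / 2) ^ p * 2 ^ level_sum d s = 2 powr (real (level_sum d s) - real p)"
      by (simp add: powr_diff powr_realpow power_one_over)
    also have "\<dots> \<le> 2 powr (real m + - \<delta> * t)" using a c by (intro powr_mono) (auto simp: p_def)
    also have "\<dots> = 2 ^ m * 2 powr (- \<delta> * t)" by (simp only: powr_add) (simp add: powr_realpow)
    finally show ?thesis .
  qed
  have "covered d (I s s' ` L1_ball d) ((real p + 12) * (1 / 2) ^ p * (q * 2 ^ level_sum d s))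
     (4 * 2 ^ p * (2 ^ d * (C * 2 powr (- r * (real (level_sum d s) + real (level_sum d s'))))) * 2 ^ d)"
    by (rule covered_high[OF lev]) (use a in \<open>simp add: p_def\<close>)
  then show ?thesis
  proof (rule covered_mono)
    have "real p + 12 \<le> (14 + \<delta>) * t" using t1 c by (simp add: p_def algebra_simps)
    also have "\<dots> \<le> (14 + \<delta>) * (2 / (\<delta> * ln 2) * 2 powr (\<delta> / 2 * t))"
      using lin \<delta>0 by (intro mult_left_mono) auto
    finally have p12: "real p + 12 \<le> (14 + \<delta>) * (2 / (\<delta> * ln 2) * 2 powr (\<delta> / 2 * t))" .
    have "(real p + 12) * (1 / 2) ^ p * (q * 2 ^ level_sum d s) = q * ((real p + 12) * ((1 / 2) ^ p * 2 ^ level_sum d s))"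
      by (simp only: mult_ac)
    also have "\<dots> \<le> q * ((14 + \<delta>) * (2 / (\<delta> * ln 2) * 2 powr (\<delta> / 2 * t)) * (2 ^ m * 2 powr (- \<delta> * t)))"
      using q_ge_1 \<delta>0 by (intro mult_left_mono mult_mono[OF p12 half]) auto
    also have "\<dots> = q * (14 + \<delta>) * (2 / (\<delta> * ln 2)) * 2 ^ m * (2 powr (\<delta> / 2 * t) * 2 powr (- \<delta> * t))"
      by (simp only: mult_ac)
    also have "2 powr (\<delta> / 2 * t) * 2 powr (- \<delta> * t) = 2 powr (- (\<delta> / 2) * t)"
      by (simp add: powr_add[symmetric] field_simps)
    finally show "(real p + 12) * (1 / 2) ^ p * (q * 2 ^ level_sum d s)
        \<le> q * (14 + \<delta>) * (2 / (\<delta> * ln 2)) * 2 ^ m * 2 powr (- (\<delta> / 2) * t)" .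
    have rr: "r = 1 + 2 * \<delta>" by (simp add: \<delta> field_simps)
    have "2 ^ p * 2 powr (- r * (real (level_sum d s) + real (level_sum d s')))
        = 2 powr (real p - r * (2 * real m + t))"
      by (simp add: powr_realpow[symmetric] powr_add[symmetric] t)
    also have "\<dots> \<le> 2 powr (1 + - 2 * r * m + - \<delta> * t)"
    proof (rule powr_mono)
      have "real p \<le> t + \<delta> * t + 1" using t1 c by (simp add: p_def)
      moreover have "r * (2 * real m + t) = 2 * r * m + t + 2 * (\<delta> * t)" unfolding rr by (simp add: algebra_simps)
      ultimately show "real p - r * (2 * real m + t) \<le> 1 + - 2 * r * m + - \<delta> * t" by simp
    qed simp
    also have "\<dots> = 2 * (2 powr (- 2 * r * m) * 2 powr (- \<delta> * t))" by (simp only: powr_add) simp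
    finally have e: "2 ^ p * 2 powr (- r * (real (level_sum d s) + real (level_sum d s'))) \<le> 2 * (2 powr (- 2 * r * m) * 2 powr (- \<delta> * t))" .
    have "4 * 2 ^ p * (2 ^ d * (C * 2 powr (- r * (real (level_sum d s) + real (level_sum d s'))))) * 2 ^ d
       = 4 * (2 ^ d * 2 ^ d) * C * (2 ^ p * 2 powr (- r * (real (level_sum d s) + real (level_sum d s'))))" by (simp only: mult_ac)
    also have "\<dots> \<le> 4 * (2 ^ d * 2 ^ d) * C * (2 * (2 powr (- 2 * r * m) * 2 powr (- \<delta> * t)))"
      using e C by (intro mult_left_mono) auto
    also have "\<dots> = 8 * 4 ^ d * C * 2 powr (- 2 * r * m) * 2 powr (- \<delta> * t)"
      by (simp add: power_mult_distrib[symmetric])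
    finally show "4 * 2 ^ p * (2 ^ d * (C * 2 powr (- r * (real (level_sum d s) + real (level_sum d s'))))) * 2 ^ d
       \<le> 8 * 4 ^ d * C * 2 powr (- 2 * r * m) * 2 powr (- \<delta> * t)" .
  qed simp
qed

text \<open>
  Three groups: \<open>s\<close> low; \<open>s\<close> high and \<open>s'\<close> low; both high. The first two groups are summed over the other index before they are
  rounded, so that they cost about \<open>2 ^ m * (m + 1) ^ (d - 1)\<close> coefficients of \<open>e0 * (m + 1)\<close> bits each.
\<close>

lemma covered_blocks:
  assumes d2: "d \<le> 2" and A1: "level_tail_bound d r A1" and A2: "level_tail_bound d (r - 1) A2"
    and A3: "level_tail_bound d ((r - 1) / 4) A3" and A4: "level_tail_bound d ((r - 1) / 2) A4"
    and \<delta>: "\<delta> = (r - 1) / 2" and e0: "e0 = log 2 (2 * (q + K * A1) + 1) + 2 * r + d + 1"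
  shows "covered d ((\<lambda>\<phi> x. \<Sum>s\<in>levels d M. \<Sum>s'\<in>levels d M. I s s' \<phi> x) ` L1_ball d)
     ((8 * q * e0 + q * (14 + \<delta>) * (2 / (\<delta> * ln 2)) * A3\<^sup>2) * 2 ^ m * (real m + 1) ^ d)
     ((4 * (2 ^ d + K * A2) + 8 * 4 ^ d * C * A4\<^sup>2) * 2 powr (- 2 * r * m) * (real m + 1) ^ (2 * (d - 1)))"
proof -
  have \<delta>0: "0 < \<delta>" using r by (simp add: \<delta>)
  have Apos: "1 \<le> A1" "1 \<le> A2" using A1 A2 by (auto simp: level_tail_bound_def)
  \<comment> \<open>The error \<open>2 powr (- 2 * r * m)\<close>, divided by the number of low levels, which is at most of the order \<open>2 powr (d * m)\<close>.\<close>
  define \<eta> where "\<eta> = 2 powr (- (2 * r + d) * m)"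
  have \<eta>: "0 < \<eta>" by (simp add: \<eta>_def)
  define E where "E = e0 * (real m + 1)"
  define Bc where "Bc = q + K * A1"
  have Bc: "0 < Bc" "q \<le> Bc" "K * A1 \<le> Bc" using q_ge_1 K_pos Apos by (auto simp: Bc_def add_nonneg_pos)
  have logpos: "0 \<le> log 2 (2 * Bc + 1)" using Bc by simp
  have e0pos: "0 < e0" using logpos r unfolding e0 Bc_def by simp
  have Epos: "0 < E" using e0pos by (simp add: E_def)
  have Econd: "2 * X / \<eta> + 1 \<le> 2 powr E" if X: "X \<le> Bc * 2 ^ m" "0 \<le> X" for X
  proof -
    have "2 * X / \<eta> = 2 * X * 2 powr ((2 * r + d) * m)" 
      unfolding \<eta>_def by (simp only: minus_mult_left[symmetric] powr_minus divide_inverse inverse_inverse_eq)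
    also have "\<dots> \<le> 2 * (Bc * 2 ^ m) * 2 powr ((2 * r + d) * m)" using X by (intro mult_right_mono mult_left_mono) auto
    also have "\<dots> = 2 * Bc * 2 powr ((2 * r + d + 1) * m)"
      by (simp add: powr_realpow[symmetric] powr_add[symmetric] algebra_simps)
    finally have "2 * X / \<eta> + 1 \<le> 2 * Bc * 2 powr ((2 * r + d + 1) * m) + 2 powr ((2 * r + d + 1) * m)"
      using r by (intro add_mono) (auto intro: ge_one_powr_ge_zero)
    also have "\<dots> = (2 * Bc + 1) * 2 powr ((2 * r + d + 1) * m)" by (simp add: algebra_simps)
    also have "\<dots> = 2 powr (log 2 (2 * Bc + 1) + (2 * r + d + 1) * m)" using Bc by (simp add: powr_add)
    also have "\<dots> \<le> 2 powr E"
    proof (rule powr_mono)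
      have "(2 * r + d + 1) * m \<le> e0 * m" using logpos unfolding e0 Bc_def by (intro mult_right_mono) auto
      moreover have "log 2 (2 * Bc + 1) \<le> e0" using r unfolding e0 Bc_def by simp
      ultimately show "log 2 (2 * Bc + 1) + (2 * r + d + 1) * m \<le> E" by (simp add: E_def distrib_left)
    qed simp
    finally show ?thesis .
  qed
  have low_count: "(\<Sum>s\<in>low m. 2 * (q * 2 ^ level_sum d s) * E) \<le> 4 * q * e0 * 2 ^ m * (real m + 1) ^ d"
  proof -
    have "(\<Sum>s\<in>low m. 2 * (q * 2 ^ level_sum d s) * E) = 2 * q * E * (\<Sum>s\<in>low m. 2 ^ level_sum d s)"
      by (simp add: sum_distrib_left mult_ac)
    also have "\<dots> \<le> 2 * q * E * (2 * 2 ^ m * (real m + 1) ^ (d - 1))"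
      using q_ge_1 Epos by (intro mult_left_mono sum_low) auto
    also have "\<dots> = 4 * q * e0 * 2 ^ m * ((real m + 1) * (real m + 1) ^ (d - 1))" by (simp add: E_def)
    also have "(real m + 1) * (real m + 1) ^ (d - 1) = (real m + 1) ^ d" using d by (cases d) auto
    finally show ?thesis .
  qed
  have low_error: "(\<Sum>s\<in>low m. 2 * \<eta> * W) \<le> 4 * W * 2 powr (- 2 * r * m)" if "0 \<le> W" for W
  proof -
    have "(\<Sum>s\<in>low m. 2 * \<eta> * W) = real (card (low m)) * (2 * \<eta> * W)" by simp
    also have "\<dots> \<le> 2 * 2 powr (real d * real m) * (2 * \<eta> * W)" using \<eta> that by (intro mult_right_mono card_low) auto
    also have "\<dots> = 4 * W * (2 powr (real d * real m) * 2 powr (- (2 * r + d) * m))" by (simp add: \<eta>_def)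
    also have "2 powr (real d * real m) * 2 powr (- (2 * r + d) * m) = 2 powr (- 2 * r * m)"
      by (simp add: powr_add[symmetric] algebra_simps)
    finally show ?thesis .
  qed
  have level_le: "2 ^ level_sum d s \<le> (2::real) ^ m" if "s \<in> low m" for s
    using that by (simp add: low_def)

  have part1: "covered d ((\<lambda>\<phi> x. \<Sum>s\<in>low m. \<Sum>s'\<in>levels d M. I s s' \<phi> x) ` L1_ball d)
     (\<Sum>s\<in>low m. 2 * (q * 2 ^ level_sum d s) * E) (\<Sum>s\<in>low m. 2 * \<eta> * 2 ^ d)"
  proof (rule covered_sum[where F="\<lambda>s \<phi> x. \<Sum>s'\<in>levels d M. I s s' \<phi> x"])
    fix s assume s: "s \<in> low m"
    have "K * A1 * 1 \<le> Bc * 2 ^ m" using Bc K_pos Apos by (intro mult_mono) auto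
    then show "covered d ((\<lambda>\<phi> x. \<Sum>s'\<in>levels d M. I s s' \<phi> x) ` L1_ball d) (2 * (q * 2 ^ level_sum d s) * E) (2 * \<eta> * 2 ^ d)"
      using s low_high(1) K_pos Apos by (intro covered_low_x[OF A1 _ \<eta> Econd]) auto
  qed (rule low_high)
  have part2: "covered d ((\<lambda>\<phi> x. \<Sum>s'\<in>low m. \<Sum>s\<in>high m. I s s' \<phi> x) ` L1_ball d)
     (\<Sum>s\<in>low m. 2 * (q * 2 ^ level_sum d s) * E) (\<Sum>s\<in>low m. 2 * \<eta> * (K * A2))"
  proof (rule covered_sum[where F="\<lambda>s' \<phi> x. \<Sum>s\<in>high m. I s s' \<phi> x"])
    fix s' assume s': "s' \<in> low m"
    have "q * 2 ^ level_sum d s' \<le> Bc * 2 ^ m" using Bc q_ge_1 level_le[OF s'] by (intro mult_mono) auto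
    then show "covered d ((\<lambda>\<phi> x. \<Sum>s\<in>high m. I s s' \<phi> x) ` L1_ball d) (2 * (q * 2 ^ level_sum d s') * E) (2 * \<eta> * (K * A2))"
      using s' low_high(1,2) q_ge_1 by (intro covered_low_y[OF A2 _ _ \<eta> Econd]) auto
  qed (rule low_high)
  let ?t = "\<lambda>s s'. (real (level_sum d s) - real m) + (real (level_sum d s') - real m)"
  have part3: "covered d ((\<lambda>\<phi> x. \<Sum>i\<in>high m \<times> high m. I (fst i) (snd i) \<phi> x) ` L1_ball d)
     (\<Sum>i\<in>high m \<times> high m. q * (14 + \<delta>) * (2 / (\<delta> * ln 2)) * 2 ^ m * 2 powr (- (\<delta> / 2) * ?t (fst i) (snd i)))
     (\<Sum>i\<in>high m \<times> high m. 8 * 4 ^ d * C * 2 powr (- 2 * r * m) * 2 powr (- \<delta> * ?t (fst i) (snd i)))"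
  proof (rule covered_sum[where F="\<lambda>i. I (fst i) (snd i)"])
    fix i assume "i \<in> high m \<times> high m"
    then have "fst i \<in> high m" "snd i \<in> high m" by auto
    then show "covered d (I (fst i) (snd i) ` L1_ball d)
      (q * (14 + \<delta>) * (2 / (\<delta> * ln 2)) * 2 ^ m * 2 powr (- (\<delta> / 2) * ?t (fst i) (snd i)))
      (8 * 4 ^ d * C * 2 powr (- 2 * r * m) * 2 powr (- \<delta> * ?t (fst i) (snd i)))"
      by (rule covered_high_high[OF _ _ \<delta> refl])
  qed (use low_high in auto)
  have count3: "(\<Sum>i\<in>high m \<times> high m. q * (14 + \<delta>) * (2 / (\<delta> * ln 2)) * 2 ^ m * 2 powr (- (\<delta> / 2) * ?t (fst i) (snd i)))
      \<le> q * (14 + \<delta>) * (2 / (\<delta> * ln 2)) * A3\<^sup>2 * 2 ^ m * (real m + 1) ^ d"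
  proof -
    have "(\<Sum>i\<in>high m \<times> high m. 2 powr (- (\<delta> / 2) * ?t (fst i) (snd i))) \<le> A3\<^sup>2 * (real m + 1) ^ (2 * (d - 1))"
      using sum_high_high[OF A3, of m] by (simp add: \<delta> case_prod_beta)
    \<comment> \<open>For \<open>d \<le> 2\<close> one has \<open>2 * (d - 1) \<le> d\<close>.\<close>
    also have "\<dots> \<le> A3\<^sup>2 * (real m + 1) ^ d" using d2 by (intro mult_left_mono power_increasing) auto
    finally have "q * (14 + \<delta>) * (2 / (\<delta> * ln 2)) * 2 ^ m * (\<Sum>i\<in>high m \<times> high m. 2 powr (- (\<delta> / 2) * ?t (fst i) (snd i)))
      \<le> q * (14 + \<delta>) * (2 / (\<delta> * ln 2)) * 2 ^ m * (A3\<^sup>2 * (real m + 1) ^ d)"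
      using q_ge_1 \<delta>0 by (intro mult_left_mono) auto
    then show ?thesis unfolding sum_distrib_left by (simp only: mult_ac)
  qed
  have error3: "(\<Sum>i\<in>high m \<times> high m. 8 * 4 ^ d * C * 2 powr (- 2 * r * m) * 2 powr (- \<delta> * ?t (fst i) (snd i)))
      \<le> 8 * 4 ^ d * C * A4\<^sup>2 * 2 powr (- 2 * r * m) * (real m + 1) ^ (2 * (d - 1))"
  proof -
    have "(\<Sum>i\<in>high m \<times> high m. 2 powr (- \<delta> * ?t (fst i) (snd i))) \<le> A4\<^sup>2 * (real m + 1) ^ (2 * (d - 1))"
      using sum_high_high[OF A4, of m] by (simp add: \<delta> case_prod_beta)
    then have "8 * 4 ^ d * C * 2 powr (- 2 * r * m) * (\<Sum>i\<in>high m \<times> high m. 2 powr (- \<delta> * ?t (fst i) (snd i)))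
      \<le> 8 * 4 ^ d * C * 2 powr (- 2 * r * m) * (A4\<^sup>2 * (real m + 1) ^ (2 * (d - 1)))"
      using C by (intro mult_left_mono) auto
    then show ?thesis unfolding sum_distrib_left by (simp only: mult_ac)
  qed
  have split: "(\<Sum>s\<in>levels d M. \<Sum>s'\<in>levels d M. I s s' \<phi> x) =
      ((\<Sum>s\<in>low m. \<Sum>s'\<in>levels d M. I s s' \<phi> x) + (\<Sum>s'\<in>low m. \<Sum>s\<in>high m. I s s' \<phi> x))
      + (\<Sum>i\<in>high m \<times> high m. I (fst i) (snd i) \<phi> x)" for \<phi> x
  proof -
    have un: "(\<Sum>s\<in>levels d M. f s) = (\<Sum>s\<in>low m. f s) + (\<Sum>s\<in>high m. f s)" for f :: "_ \<Rightarrow> complex"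
      unfolding low_high(3)[of m, symmetric] using low_high by (intro sum.union_disjoint) auto
    have "(\<Sum>s\<in>high m. \<Sum>s'\<in>levels d M. I s s' \<phi> x)
       = (\<Sum>s'\<in>low m. \<Sum>s\<in>high m. I s s' \<phi> x) + (\<Sum>s\<in>high m. \<Sum>s'\<in>high m. I s s' \<phi> x)"
      unfolding un sum.distrib by (subst sum.swap) simp
    moreover have "(\<Sum>s\<in>high m. \<Sum>s'\<in>high m. I s s' \<phi> x) = (\<Sum>i\<in>high m \<times> high m. I (fst i) (snd i) \<phi> x)"
      by (simp add: sum.cartesian_product case_prod_beta)
    ultimately show ?thesis using un[of "\<lambda>s. \<Sum>s'\<in>levels d M. I s s' \<phi> x"] by simp
  qed
  show ?thesis
    unfolding split
  proof (rule covered_mono[OF covered_add[OF covered_add[OF part1 part2] part3] order.refl])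
    show "(\<Sum>s\<in>low m. 2 * (q * 2 ^ level_sum d s) * E) + (\<Sum>s\<in>low m. 2 * (q * 2 ^ level_sum d s) * E)
       + (\<Sum>i\<in>high m \<times> high m. q * (14 + \<delta>) * (2 / (\<delta> * ln 2)) * 2 ^ m * 2 powr (- (\<delta> / 2) * ?t (fst i) (snd i)))
       \<le> (8 * q * e0 + q * (14 + \<delta>) * (2 / (\<delta> * ln 2)) * A3\<^sup>2) * 2 ^ m * (real m + 1) ^ d"
      using add_mono[OF add_mono[OF low_count low_count] count3] by (simp only: distrib_right)
    have "4 * W * 2 powr (- 2 * r * m) \<le> 4 * W * 2 powr (- 2 * r * m) * (real m + 1) ^ (2 * (d - 1))" if "0 \<le> W" for W
      using that mult_left_mono[of 1 "(real m + 1) ^ (2 * (d - 1))" "4 * W * 2 powr (- 2 * r * m)"] by simp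
    then have le: "(\<Sum>s\<in>low m. 2 * \<eta> * W) \<le> 4 * W * 2 powr (- 2 * r * m) * (real m + 1) ^ (2 * (d - 1))" if "0 \<le> W" for W
      using low_error[OF that] that by (meson order.trans)
    have KA2: "0 \<le> K * A2" using K_pos Apos by simp
    have eq: "4 * 2 ^ d * 2 powr (- 2 * r * m) * (real m + 1) ^ (2 * (d - 1))
       + 4 * (K * A2) * 2 powr (- 2 * r * m) * (real m + 1) ^ (2 * (d - 1))
       + 8 * 4 ^ d * C * A4\<^sup>2 * 2 powr (- 2 * r * m) * (real m + 1) ^ (2 * (d - 1))
       = (4 * (2 ^ d + K * A2) + 8 * 4 ^ d * C * A4\<^sup>2) * 2 powr (- 2 * r * m) * (real m + 1) ^ (2 * (d - 1))"
      by (simp only: distrib_right distrib_left)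
    show "(\<Sum>s\<in>low m. 2 * \<eta> * 2 ^ d) + (\<Sum>s\<in>low m. 2 * \<eta> * (K * A2))
       + (\<Sum>i\<in>high m \<times> high m. 8 * 4 ^ d * C * 2 powr (- 2 * r * m) * 2 powr (- \<delta> * ?t (fst i) (snd i)))
       \<le> (4 * (2 ^ d + K * A2) + 8 * 4 ^ d * C * A4\<^sup>2) * 2 powr (- 2 * r * m) * (real m + 1) ^ (2 * (d - 1))"
      using add_mono[OF add_mono[OF le[of "2 ^ d"] le[OF KA2]] error3] unfolding eq by simp
  qed
qed

text \<open>
  For \<open>r > 1\<close> the suprema of the blocks decay geometrically in the total level.
\<close>

lemma norm_tail_le:
  assumes A: "level_tail_bound d ((r - 1) / 2) A"
  shows "norm (\<Sum>i\<in>{i \<in> levels d M \<times> levels d M. m \<le> level_sum d (fst i) + level_sum d (snd i)}. D (fst i) (snd i) x y)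
      \<le> K * A\<^sup>2 * 2 powr (- ((r - 1) / 2) * m)"
proof -
  define \<delta> where "\<delta> = (r - 1) / 2"
  have \<delta>: "0 < \<delta>" "r = 1 + 2 * \<delta>" using r by (auto simp: \<delta>_def field_simps)
  let ?S = "{i \<in> levels d M \<times> levels d M. m \<le> level_sum d (fst i) + level_sum d (snd i)}"
  let ?f = "\<lambda>s. 2 powr (- \<delta> * real (level_sum d s))"
  have "norm (\<Sum>i\<in>?S. D (fst i) (snd i) x y) \<le> (\<Sum>i\<in>?S. K * 2 powr (- \<delta> * m) * (?f (fst i) * ?f (snd i)))"
  proof (rule sum_norm_le)
    fix i assume i: "i \<in> ?S"
    let ?u = "real (level_sum d (fst i))" and ?w = "real (level_sum d (snd i))"
    have "norm (D (fst i) (snd i) x y) \<le> K * (2 powr ((1 - r) * ?u) * 2 powr (- r * ?w))"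
      using i by (intro norm_D_le) auto
    also have "\<dots> = K * 2 powr ((1 - r) * ?u + - r * ?w)" by (simp only: powr_add)
    also have "\<dots> \<le> K * 2 powr (- \<delta> * m + (- \<delta> * ?u + - \<delta> * ?w))"
    proof (intro mult_left_mono powr_mono)
      have "real m \<le> ?u + ?w" using i by auto
      then have "\<delta> * m \<le> \<delta> * ?u + \<delta> * ?w" using \<delta> by (metis distrib_left mult_left_mono less_imp_le)
      moreover have "r * ?w = ?w + 2 * (\<delta> * ?w)" "(1 - r) * ?u = - 2 * (\<delta> * ?u)" unfolding \<delta>(2) by (auto simp: algebra_simps)
      moreover have "0 \<le> ?w" by simp
      ultimately show "(1 - r) * ?u + - r * ?w \<le> - \<delta> * m + (- \<delta> * ?u + - \<delta> * ?w)" by simp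
    qed (use K_pos in auto)
    finally show "norm (D (fst i) (snd i) x y) \<le> K * 2 powr (- \<delta> * m) * (?f (fst i) * ?f (snd i))"
      by (simp only: powr_add mult.assoc)
  qed
  also have "\<dots> \<le> (\<Sum>i\<in>levels d M \<times> levels d M. K * 2 powr (- \<delta> * m) * (?f (fst i) * ?f (snd i)))"
    using K_pos by (intro sum_mono2) auto
  also have "\<dots> = K * 2 powr (- \<delta> * m) * ((\<Sum>s\<in>levels d M. ?f s) * (\<Sum>s\<in>levels d M. ?f s))"
    unfolding sum_product sum.cartesian_product unfolding sum_distrib_left by (simp only: case_prod_beta)
  also have "\<dots> \<le> K * 2 powr (- \<delta> * m) * (A * A)"
    using K_pos level_tail_bound_total[OF A[folded \<delta>_def] order.refl, of M] A
    by (intro mult_left_mono mult_mono) (auto intro: sum_nonneg simp: level_tail_bound_def)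
  finally show ?thesis by (simp add: \<delta>_def power2_eq_square mult_ac)
qed

lemma sum_blocks_pairs:
  "(\<Sum>s\<in>levels d M. \<Sum>s'\<in>levels d M. f s s') = (\<Sum>i\<in>levels d M \<times> levels d M. f (fst i) (snd i))"
  for f :: "_ \<Rightarrow> _ \<Rightarrow> complex"
  by (simp add: sum.cartesian_product case_prod_beta)

end

section \<open>Smooth trigonometric kernels\<close>

lemma trig_kernel_join:
  "trig_kernel (2 * d) L c (join d x y) =
    (\<Sum>a\<in>PiE {1..2 * d} (\<lambda>_. {- int L..int L}). c a * (character d a x * character d (\<lambda>j. a (j + d)) y))"
  unfolding trig_kernel_def character_join ..

lemma band_limited_trig_sum:
  assumes "\<And>a. a \<in> A \<Longrightarrow> c a \<noteq> 0 \<Longrightarrow> band_limited d n (h a)"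
  shows "band_limited d n (\<lambda>x. \<Sum>a\<in>A. c a * h a x)"
proof (rule band_limited_sum)
  fix a assume "a \<in> A"
  show "band_limited d n (\<lambda>x. c a * h a x)"
  proof (cases "c a = 0")
    case True
    then show ?thesis by (simp add: band_limited_def grid_mean_def)
  next
    case False
    then show ?thesis using assms[OF \<open>a \<in> A\<close>] by (intro band_limited_cmult)
  qed
qed

lemma kernel_blocks_of_block_family:
  assumes fam: "block_family l r d P C M N L c b" and cls: "discrete_class l r d N B (trig_kernel (2 * d) L c)"
    and "1 \<le> d" "1 < r" "1 \<le> P" "1 \<le> C" "1 \<le> B" "4 * (P * 2 ^ M) < N"
  shows "kernel_blocks d r P M N (B * C) (\<lambda>s s' x y. trig_kernel (2 * d) L (b s s') (join d x y))"
proof unfold_locales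
  fix s s' assume s: "s \<in> levels d M" "s' \<in> levels d M"
  have supp: "\<bar>a j\<bar> \<le> int (P * 2 ^ s j) \<and> \<bar>a (j + d)\<bar> \<le> int (P * 2 ^ s' j)"
    if "a \<in> PiE {1..2 * d} (\<lambda>_. {- int L..int L})" "b s s' a \<noteq> 0" "j \<in> {1..d}" for a j
    using fam s that unfolding block_family_def by blast
  show "band_limited d (\<lambda>j. P * 2 ^ s j) (\<lambda>x. trig_kernel (2 * d) L (b s s') (join d x y))" for y
  proof -
    have "band_limited d (\<lambda>j. P * 2 ^ s j) (\<lambda>x. \<Sum>a\<in>PiE {1..2 * d} (\<lambda>_. {- int L..int L}).
        b s s' a * (character d (\<lambda>j. a (j + d)) y * character d a x))"
      using supp by (intro band_limited_trig_sum band_limited_cmult band_limited_character) blast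
    then show ?thesis unfolding trig_kernel_join by (simp only: mult_ac)
  qed
  show "band_limited d (\<lambda>j. P * 2 ^ s' j) (\<lambda>y. trig_kernel (2 * d) L (b s s') (join d x y))" for x
    unfolding trig_kernel_join
    using supp by (intro band_limited_trig_sum band_limited_cmult band_limited_character) blast
  show "bounded_periodic d (\<lambda>x. trig_kernel (2 * d) L (b s s') (join d x y))" for y
  proof -
    have "bounded_periodic d (\<lambda>x. \<Sum>a\<in>PiE {1..2 * d} (\<lambda>_. {- int L..int L}).
        b s s' a * (character d (\<lambda>j. a (j + d)) y * character d a x))"
      by (intro bounded_periodic_sum bounded_periodic_cmult bounded_periodic_character)
    then show ?thesis unfolding trig_kernel_join by (simp only: mult_ac)
  qed
  have "bounded_periodic d (\<lambda>y. trig_kernel (2 * d) L (b s s') (join d x y))" for x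
    unfolding trig_kernel_join by (intro bounded_periodic_sum bounded_periodic_cmult bounded_periodic_character)
  then show "(\<lambda>y. trig_kernel (2 * d) L (b s s') (join d x y)) \<in> borel_measurable (torus d)" for x
    by (simp add: bounded_periodic_def)
  show "grid_mean d (\<lambda>_. N) (\<lambda>\<xi>. norm (trig_kernel (2 * d) L (b s s') (join d \<xi> y)))
      \<le> B * C * 2 powr (- r * (real (level_sum d s) + real (level_sum d s')))" for y
  proof -
    have "\<forall>s\<in>levels d M. \<forall>s'\<in>levels d M. \<forall>B y. 0 \<le> B \<longrightarrow> discrete_class l r d N B (trig_kernel (2 * d) L c) \<longrightarrow>
        grid_mean d (\<lambda>_. N) (\<lambda>\<xi>. norm (trig_kernel (2 * d) L (b s s') (join d \<xi> y)))
         \<le> B * C * 2 powr (- r * (level_sum d s + level_sum d s'))"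
      using fam unfolding block_family_def by blast
    from this[rule_format, OF s _ cls, of y] show ?thesis using \<open>1 \<le> B\<close> by simp
  qed
qed (use assms mult_mono[of 1 B 1 C] in auto)

lemma trig_kernel_sum_blocks:
  assumes "block_family l r d P C M N L c b"
  shows "trig_kernel (2 * d) L c z = (\<Sum>s\<in>levels d M. \<Sum>s'\<in>levels d M. trig_kernel (2 * d) L (b s s') z)"
proof -
  have c: "c a = (\<Sum>s\<in>levels d M. \<Sum>s'\<in>levels d M. b s s' a)" for a
    using assms unfolding block_family_def by blast
  have "trig_kernel (2 * d) L c z = (\<Sum>a\<in>PiE {1..2 * d} (\<lambda>_. {- int L..int L}).
      \<Sum>s\<in>levels d M. \<Sum>s'\<in>levels d M. b s s' a * character (2 * d) a z)"
    unfolding trig_kernel_def sum_distrib_right[symmetric] c[symmetric] ..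
  also have "\<dots> = (\<Sum>s\<in>levels d M. \<Sum>s'\<in>levels d M. trig_kernel (2 * d) L (b s s') z)"
    unfolding trig_kernel_def by (subst sum.swap, intro sum.cong refl, subst sum.swap) (rule refl)
  finally show ?thesis .
qed

text \<open>
  Membership in the discrete class on all sufficiently fine grids. How fine may depend on the kernel, since no
  estimate below depends on the number of nodes.
\<close>

definition smooth_kernel :: "nat \<Rightarrow> real \<Rightarrow> nat \<Rightarrow> real \<Rightarrow> nat \<Rightarrow> ((nat \<Rightarrow> int) \<Rightarrow> complex) \<Rightarrow> bool"
  where "smooth_kernel l r d B L c \<longleftrightarrow> (\<exists>N1. \<forall>N\<ge>N1. discrete_class l r d N B (trig_kernel (2 * d) L c))"

text \<open>
  Since \<open>L < 2 ^ L\<close>, the levels up to \<open>L\<close> exhaust the spectrum of a kernel of degree \<open>L\<close>. All the constants come from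
  the decomposition and from sums over levels, so that they depend neither on \<open>L\<close> nor on the grid.
\<close>

lemma covered_smooth_kernel:
  fixes r :: real
  assumes d: "1 \<le> d" "d \<le> 2" and r: "1 < r"
  shows "\<exists>C1\<ge>1. \<exists>C2\<ge>1. \<exists>C3\<ge>1. \<forall>L c. smooth_kernel l r d 1 L c \<longrightarrow>
    (\<forall>m. covered d ((\<lambda>\<phi> x. \<integral>y. trig_kernel (2 * d) L c (join d x y) * \<phi> y \<partial>torus d) ` L1_ball d)
      (C1 * 2 ^ m * (real m + 1) ^ d) (C2 * 2 powr (- 2 * r * m) * (real m + 1) ^ (2 * (d - 1)))) \<and>
    (\<forall>x y. norm (trig_kernel (2 * d) L c (join d x y)) \<le> C3)"
proof -
  have "0 < r" using r by simp
  from block_decomposition[OF this, where d=d and l=l]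
  obtain P C where P: "1 \<le> P" and C: "1 \<le> C" and fam: "\<forall>M. \<exists>N0. \<forall>N\<ge>N0. \<forall>L c. L < P * 2 ^ M \<longrightarrow>
    (\<exists>b. block_family l r d P C M N L c b)"
    by (elim exE conjE)
  obtain A1 A2 A3 A4 where A: "level_tail_bound d r A1" "level_tail_bound d (r - 1) A2"
    "level_tail_bound d ((r - 1) / 4) A3" "level_tail_bound d ((r - 1) / 2) A4"
    using level_tail_bound_exists[OF d(1), of r] level_tail_bound_exists[OF d(1), of "r - 1"]
      level_tail_bound_exists[OF d(1), of "(r - 1) / 4"] level_tail_bound_exists[OF d(1), of "(r - 1) / 2"] r
    by auto
  define Q where "Q = (5 * real P) ^ d"
  define Kc where "Kc = 4 ^ d * Q * C"
  define \<delta> where "\<delta> = (r - 1) / 2"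
  define e0 where "e0 = log 2 (2 * (Q + Kc * A1) + 1) + 2 * r + d + 1"
  define C1 where "C1 = 8 * Q * e0 + Q * (14 + \<delta>) * (2 / (\<delta> * ln 2)) * A3\<^sup>2"
  define C2 where "C2 = 4 * (2 ^ d + Kc * A2) + 8 * 4 ^ d * C * A4\<^sup>2"
  define C3 where "C3 = Kc * A4\<^sup>2"
  have Q: "1 \<le> Q" unfolding Q_def using P by (intro one_le_power) simp
  have "4 ^ d * 1 * 1 \<le> Kc" unfolding Kc_def using Q C by (intro mult_mono) auto
  then have Kc: "1 \<le> Kc" using one_le_power[of "4::real" d] by linarith
  have A_ge: "1 \<le> A1" "1 \<le> A2" "1 \<le> A4" using A by (auto simp: level_tail_bound_def)
  have \<delta>: "0 < \<delta>" using r by (simp add: \<delta>_def)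
  have "0 \<le> Kc * A1" using Kc A_ge by simp
  then have "0 \<le> 2 * (Q + Kc * A1)" using Q Kc A_ge by (intro mult_nonneg_nonneg add_nonneg_nonneg) auto
  then have "1 \<le> 2 * (Q + Kc * A1) + 1" by (rule le_add_same_cancel2[THEN iffD2])
  then have "0 \<le> log 2 (2 * (Q + Kc * A1) + 1)" by simp
  then have "1 \<le> e0" using r by (simp add: e0_def)
  then have "1 * 1 \<le> Q * e0" using Q by (intro mult_mono) auto
  moreover have "0 \<le> Q * (14 + \<delta>) * (2 / (\<delta> * ln 2)) * A3\<^sup>2" using Q \<delta> by simp
  moreover have "1 \<le> 8 * Q * e0 + w" if "1 * 1 \<le> Q * e0" "0 \<le> w" for w
    using that by simp
  ultimately have C1: "1 \<le> C1" unfolding C1_def by blast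
  have C2: "1 \<le> C2"
  proof -
    have "0 \<le> Kc * A2" "0 \<le> 8 * 4 ^ d * C * A4\<^sup>2" "(1::real) \<le> 2 ^ d" using Kc A_ge C by auto
    moreover have "1 \<le> 4 * (u + v) + w" if "0 \<le> v" "0 \<le> w" "1 \<le> u" for u v w :: real
      using that by simp
    ultimately show ?thesis unfolding C2_def by blast
  qed
  have C3: "1 \<le> C3" unfolding C3_def using mult_mono[OF Kc one_le_power[OF A_ge(3), of 2]] Kc by simp
  have "(\<forall>m. covered d ((\<lambda>\<phi> x. \<integral>y. trig_kernel (2 * d) L c (join d x y) * \<phi> y \<partial>torus d) ` L1_ball d)
      (C1 * 2 ^ m * (real m + 1) ^ d) (C2 * 2 powr (- 2 * r * m) * (real m + 1) ^ (2 * (d - 1)))) \<and>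
    (\<forall>x y. norm (trig_kernel (2 * d) L c (join d x y)) \<le> C3)"
    if smooth: "smooth_kernel l r d 1 L c" for L c
  proof -
    obtain N1 where N1: "\<And>N. N1 \<le> N \<Longrightarrow> discrete_class l r d N 1 (trig_kernel (2 * d) L c)"
      using smooth by (auto simp: smooth_kernel_def)
    obtain N0 where N0: "\<And>N. N0 \<le> N \<Longrightarrow> \<exists>b. block_family l r d P C L N L c b"
    proof -
      have "L < 2 ^ L" by simp
      also have "2 ^ L \<le> P * 2 ^ L" using P by simp
      finally show ?thesis using fam that by blast
    qed
    define N where "N = max (max N0 N1) (4 * (P * 2 ^ L) + 1)"
    have N: "N0 \<le> N" "N1 \<le> N" "4 * (P * 2 ^ L) < N" by (auto simp: N_def)
    obtain b where b: "block_family l r d P C L N L c b" using N0[OF N(1)] by blast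
    let ?D = "\<lambda>s s' x y. trig_kernel (2 * d) L (b s s') (join d x y)"
    interpret kb: kernel_blocks d r P L N C ?D
      using kernel_blocks_of_block_family[OF b N1[OF N(2)] d(1) r P C _ N(3)] by simp
    have const: "kb.q = Q" "kb.K = Kc" by (auto simp: kb.q_def kb.K_def Q_def Kc_def)
    have conv: "(\<integral>y. trig_kernel (2 * d) L c (join d x y) * \<phi> y \<partial>torus d)
        = (\<Sum>s\<in>levels d L. \<Sum>s'\<in>levels d L. kb.I s s' \<phi> x)" if "\<phi> \<in> L1_ball d" for \<phi> x
    proof -
      have "(\<integral>y. trig_kernel (2 * d) L c (join d x y) * \<phi> y \<partial>torus d)
         = (\<integral>y. (\<Sum>s\<in>levels d L. \<Sum>s'\<in>levels d L. ?D s s' x y * \<phi> y) \<partial>torus d)"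
        unfolding trig_kernel_sum_blocks[OF b] sum_distrib_right ..
      also have "\<dots> = (\<Sum>s\<in>levels d L. \<Sum>s'\<in>levels d L. kb.I s s' \<phi> x)"
        unfolding kb.I_def using kb.integrable_D that
        by (subst Bochner_Integration.integral_sum, force intro: Bochner_Integration.integrable_sum,
            intro sum.cong refl Bochner_Integration.integral_sum) auto
      finally show ?thesis .
    qed
    have cov: "covered d ((\<lambda>\<phi> x. \<integral>y. trig_kernel (2 * d) L c (join d x y) * \<phi> y \<partial>torus d) ` L1_ball d)
      (C1 * 2 ^ m * (real m + 1) ^ d) (C2 * 2 powr (- 2 * r * m) * (real m + 1) ^ (2 * (d - 1)))" for m
    proof -
      have "(\<lambda>\<phi> x. \<integral>y. trig_kernel (2 * d) L c (join d x y) * \<phi> y \<partial>torus d) ` L1_ball d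
         = (\<lambda>\<phi> x. \<Sum>s\<in>levels d L. \<Sum>s'\<in>levels d L. kb.I s s' \<phi> x) ` L1_ball d"
        by (intro image_cong refl ext conv)
      then show ?thesis
        using kb.covered_blocks[OF d(2) A \<delta>_def, of e0 m] unfolding const C1_def C2_def e0_def by simp
    qed
    have "norm (trig_kernel (2 * d) L c (join d x y)) \<le> C3" for x y
      using kb.norm_tail_le[OF A(4), where m=0 and x=x and y=y]
      unfolding trig_kernel_sum_blocks[OF b] kb.sum_blocks_pairs const C3_def by simp
    then show ?thesis using cov by blast
  qed
  then show ?thesis using C1 C2 C3 by blast
qed

text \<open>
  A compactness principle: low blocks are controlled by finitely many coefficients, and high blocks are uniformly small.
  The constant 2 is that for a difference of two kernels of the class.
\<close>

lemma smooth_kernel_small: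
  fixes r \<epsilon> :: real
  assumes d: "1 \<le> d" and r: "1 < r" and \<epsilon>: "0 < \<epsilon>"
  shows "\<exists>R::nat. \<exists>\<delta>>0. \<forall>L c. smooth_kernel l r d 2 L c \<longrightarrow>
    (\<forall>a\<in>PiE {1..2 * d} (\<lambda>_. {- int R..int R}). norm (c a) \<le> \<delta>) \<longrightarrow>
    (\<forall>x y. norm (trig_kernel (2 * d) L c (join d x y)) \<le> \<epsilon>)"
proof -
  have "0 < r" using r by simp
  from block_decomposition[OF this, where d=d and l=l]
  obtain P C where P: "1 \<le> P" and C: "1 \<le> C" and fam: "\<forall>M. \<exists>N0. \<forall>N\<ge>N0. \<forall>L c. L < P * 2 ^ M \<longrightarrow>
    (\<exists>b. block_family l r d P C M N L c b)"
    by (elim exE conjE)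
  obtain A where A: "level_tail_bound d ((r - 1) / 2) A"
    using level_tail_bound_exists[OF d, of "(r - 1) / 2"] r by auto
  define Kc where "Kc = 4 ^ d * (5 * real P) ^ d * (2 * C)"
  define \<theta> where "\<theta> = 2 powr (- ((r - 1) / 2))"
  have \<theta>: "0 < \<theta>" "\<theta> < 1" using r powr_less_mono[of "- ((r - 1) / 2)" 0 2] by (auto simp: \<theta>_def)
  have KA: "0 < Kc * A\<^sup>2" using P C A by (simp add: Kc_def level_tail_bound_def)
  obtain m where "\<theta> ^ m < \<epsilon> / 2 / (Kc * A\<^sup>2)"
    using real_arch_pow_inv[of "\<epsilon> / 2 / (Kc * A\<^sup>2)" \<theta>] KA \<epsilon> \<theta> by auto
  then have m: "Kc * A\<^sup>2 * \<theta> ^ m \<le> \<epsilon> / 2" using KA by (simp add: field_simps)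
  have \<theta>m: "2 powr (- ((r - 1) / 2) * m) = \<theta> ^ m"
    using \<theta>(1) by (simp add: \<theta>_def powr_powr flip: powr_realpow)
  \<comment> \<open>The box of radius \<open>R\<close> contains the spectra of all blocks of total level below \<open>m\<close>.\<close>
  define R where "R = P * 2 ^ m"
  let ?F = "PiE {1..2 * d} (\<lambda>_. {- int R..int R})"
  have finF: "finite ?F" by (intro finite_PiE) auto
  define n where "n = real (card (levels d m \<times> levels d m)) * (real (card ?F) * C)"
  define \<delta> where "\<delta> = \<epsilon> / 2 / (n + 1)"
  have n: "0 \<le> n" using C by (simp add: n_def)
  have \<delta>: "0 < \<delta>" using n \<epsilon> by (simp add: \<delta>_def)
  have n\<delta>: "n * \<delta> \<le> \<epsilon> / 2"
  proof -
    have "n * \<delta> \<le> (n + 1) * \<delta>" using \<delta> by (simp add: distrib_right)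
    also have "\<dots> = \<epsilon> / 2" using n unfolding \<delta>_def by (intro nonzero_mult_div_cancel_left[of "n + 1", unfolded times_divide_eq_right[symmetric]]) simp
    finally show ?thesis .
  qed
  have "norm (trig_kernel (2 * d) L c (join d x y)) \<le> \<epsilon>"
    if smooth: "smooth_kernel l r d 2 L c" and small: "\<forall>a\<in>?F. norm (c a) \<le> \<delta>" for L c x y
  proof -
    obtain N1 where N1: "\<And>N. N1 \<le> N \<Longrightarrow> discrete_class l r d N 2 (trig_kernel (2 * d) L c)"
      using smooth by (auto simp: smooth_kernel_def)
    obtain N0 where N0: "\<And>N. N0 \<le> N \<Longrightarrow> \<exists>b. block_family l r d P C L N L c b"
    proof -
      have "L < 2 ^ L" by simp
      also have "2 ^ L \<le> P * 2 ^ L" using P by simp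
      finally show ?thesis using fam that by blast
    qed
    define N where "N = max (max N0 N1) (4 * (P * 2 ^ L) + 1)"
    have N: "N0 \<le> N" "N1 \<le> N" "4 * (P * 2 ^ L) < N" by (auto simp: N_def)
    obtain b where b: "block_family l r d P C L N L c b" using N0[OF N(1)] by blast
    let ?D = "\<lambda>s s' x y. trig_kernel (2 * d) L (b s s') (join d x y)"
    interpret kb: kernel_blocks d r P L N "2 * C" ?D
      by (rule kernel_blocks_of_block_family[OF b N1[OF N(2)] d r P C _ N(3)]) simp
    have const: "kb.K = Kc" by (simp add: kb.q_def kb.K_def Kc_def)
    let ?U = "levels d L \<times> levels d L" and ?w = "\<lambda>i. level_sum d (fst i) + level_sum d (snd i)"
    have large: "norm (\<Sum>i\<in>{i \<in> ?U. m \<le> ?w i}. ?D (fst i) (snd i) x y) \<le> \<epsilon> / 2"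
      using kb.norm_tail_le[OF A, where m=m and x=x and y=y] m unfolding const \<theta>m by linarith
    have block: "norm (?D (fst i) (snd i) x y) \<le> real (card ?F) * (C * \<delta>)" if i: "i \<in> ?U" "?w i < m" for i
    proof -
      let ?G = "PiE {1..2 * d} (\<lambda>_. {- int L..int L})"
      let ?b = "b (fst i) (snd i)"
      have finG: "finite ?G" by (intro finite_PiE) auto
      have sub: "{a \<in> ?G. ?b a \<noteq> 0} \<subseteq> ?F"
      proof
        fix a assume a: "a \<in> {a \<in> ?G. ?b a \<noteq> 0}"
        have lev: "P * 2 ^ fst i j \<le> R" "P * 2 ^ snd i j \<le> R" if "j \<in> {1..d}" for j
        proof -
          have "fst i j \<le> level_sum d (fst i)" "snd i j \<le> level_sum d (snd i)"
            unfolding level_sum_def using that by (auto intro!: member_le_sum)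
          then have "fst i j \<le> m" "snd i j \<le> m" using i(2) by auto
          then show "P * 2 ^ fst i j \<le> R" "P * 2 ^ snd i j \<le> R" by (auto simp: R_def)
        qed
        have supp: "\<bar>a j\<bar> \<le> int (P * 2 ^ fst i j) \<and> \<bar>a (j + d)\<bar> \<le> int (P * 2 ^ snd i j)" if "j \<in> {1..d}" for j
          using b i(1) a that unfolding block_family_def by (cases i) auto
        have "\<bar>a j\<bar> \<le> int R" if "j \<in> {1..2 * d}" for j
        proof (cases "j \<le> d")
          case True
          then show ?thesis using supp[of j] lev[of j] that by (auto intro: order.trans simp del: of_nat_mult of_nat_power)
        next
          case False
          then have "j - d \<in> {1..d}" "j = (j - d) + d" using that by auto
          then show ?thesis using supp[of "j - d"] lev[of "j - d"]
            by (metis (no_types, lifting) of_nat_le_iff order.trans)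
        qed
        then have "a j \<in> {- int R..int R}" if "j \<in> {1..2 * d}" for j
          using that by (simp add: abs_le_iff minus_le_iff)
        then show "a \<in> ?F" using a by (auto simp: PiE_iff)
      qed
      have nonzero: "?D (fst i) (snd i) x y = (\<Sum>a\<in>{a \<in> ?G. ?b a \<noteq> 0}. ?b a * character (2 * d) a (join d x y))"
        unfolding trig_kernel_def using finG by (intro sum.mono_neutral_right) auto
      have "norm (?D (fst i) (snd i) x y) \<le> (\<Sum>a\<in>{a \<in> ?G. ?b a \<noteq> 0}. C * \<delta>)"
        unfolding nonzero
      proof (rule sum_norm_le)
        fix a assume a: "a \<in> {a \<in> ?G. ?b a \<noteq> 0}"
        have "norm (?b a) \<le> C * norm (c a)" using b i(1) unfolding block_family_def by (cases i) auto
        also have "\<dots> \<le> C * \<delta>" using a sub small C by (intro mult_left_mono) auto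
        finally show "norm (?b a * character (2 * d) a (join d x y)) \<le> C * \<delta>" by (simp add: norm_mult)
      qed
      also have "\<dots> \<le> real (card ?F) * (C * \<delta>)"
        using card_mono[OF finF sub] C \<delta> by (auto intro!: mult_right_mono)
      finally show ?thesis .
    qed
    have "norm (\<Sum>i\<in>{i \<in> ?U. ?w i < m}. ?D (fst i) (snd i) x y) \<le> (\<Sum>i\<in>{i \<in> ?U. ?w i < m}. real (card ?F) * (C * \<delta>))"
      by (rule sum_norm_le) (use block in auto)
    also have "\<dots> \<le> real (card (levels d m \<times> levels d m)) * (real (card ?F) * (C * \<delta>))"
    proof -
      have sub: "{i \<in> ?U. ?w i < m} \<subseteq> levels d m \<times> levels d m"
      proof
        fix i assume i: "i \<in> {i \<in> ?U. ?w i < m}"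
        have "fst i j \<le> m" "snd i j \<le> m" if "j \<in> {1..d}" for j
        proof -
          have "fst i j \<le> level_sum d (fst i)" "snd i j \<le> level_sum d (snd i)"
            unfolding level_sum_def using that by (auto intro!: member_le_sum)
          then show "fst i j \<le> m" "snd i j \<le> m" using i by auto
        qed
        then show "i \<in> levels d m \<times> levels d m" using i by (cases i) (auto simp: levels_def PiE_iff)
      qed
      have "card {i \<in> ?U. ?w i < m} \<le> card (levels d m \<times> levels d m)"
        by (rule card_mono[OF _ sub]) simp
      then have "real (card {i \<in> ?U. ?w i < m}) \<le> real (card (levels d m \<times> levels d m))"
        by (simp only: of_nat_le_iff)
      then show ?thesis unfolding sum_constant using C \<delta> by (intro mult_right_mono) auto
    qed
    also have "\<dots> = n * \<delta>" by (simp add: n_def)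
    also have "\<dots> \<le> \<epsilon> / 2" by (rule n\<delta>)
    finally have few: "norm (\<Sum>i\<in>{i \<in> ?U. ?w i < m}. ?D (fst i) (snd i) x y) \<le> \<epsilon> / 2" .
    have "trig_kernel (2 * d) L c (join d x y) = (\<Sum>i\<in>?U. ?D (fst i) (snd i) x y)"
      unfolding trig_kernel_sum_blocks[OF b] by (rule kb.sum_blocks_pairs)
    also have "\<dots> = (\<Sum>i\<in>{i \<in> ?U. ?w i < m} \<union> {i \<in> ?U. m \<le> ?w i}. ?D (fst i) (snd i) x y)"
      by (rule sum.cong) auto
    also have "\<dots> = (\<Sum>i\<in>{i \<in> ?U. ?w i < m}. ?D (fst i) (snd i) x y) + (\<Sum>i\<in>{i \<in> ?U. m \<le> ?w i}. ?D (fst i) (snd i) x y)"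
      by (rule sum.union_disjoint) auto
    finally show ?thesis using norm_triangle_mono[OF few large] by simp
  qed
  then show ?thesis using \<delta> by blast
qed

section \<open>Translation invariance on the torus\<close>

abbreviation circle :: "real measure"
  where "circle \<equiv> uniform_measure lborel {0..2 * pi}"

lemma prob_space_circle: "prob_space circle"
  by (rule prob_space_uniform_measure) auto

interpretation circle: prob_space circle
  by (rule prob_space_circle)

interpretation circles: product_sigma_finite "\<lambda>_::nat. circle"
  by standard

lemma prob_space_torus: "prob_space (torus d)"
  unfolding torus_def by (intro prob_space_PiM prob_space_circle)

lemma nn_integral_circle:
  assumes "f \<in> borel_measurable borel"
  shows "(\<integral>\<^sup>+u. f u \<partial>circle) = (\<integral>\<^sup>+u. f u * indicator {0..<2 * pi} u \<partial>lborel) / ennreal (2 * pi)"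
proof -
  have "(\<integral>\<^sup>+u. f u \<partial>circle) = (\<integral>\<^sup>+u. f u * indicator {0..2 * pi} u \<partial>lborel) / ennreal (2 * pi)"
    using assms by (subst nn_integral_uniform_measure) auto
  also have "(\<integral>\<^sup>+u. f u * indicator {0..2 * pi} u \<partial>lborel) = (\<integral>\<^sup>+u. f u * indicator {0..<2 * pi} u \<partial>lborel)"
  proof (rule nn_integral_cong_AE)
    show "AE u in lborel. f u * indicator {0..2 * pi} u = f u * indicator {0..<2 * pi} u"
      using AE_lborel_singleton[of "2 * pi"] by eventually_elim (auto simp: indicator_def)
  qed
  finally show ?thesis .
qed

definition wrap :: "real \<Rightarrow> real"
  where "wrap u = u - 2 * pi * of_int \<lfloor>u / (2 * pi)\<rfloor>"

lemma wrap_measurable [measurable]: "wrap \<in> borel_measurable borel"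
  unfolding wrap_def[abs_def] by measurable

lemma wrap_add_int: "wrap (u + 2 * pi * of_int k) = wrap u"
proof -
  have "\<lfloor>(u + 2 * pi * of_int k) / (2 * pi)\<rfloor> = \<lfloor>u / (2 * pi)\<rfloor> + k"
    by (simp add: add_divide_distrib)
  then show ?thesis by (simp add: wrap_def algebra_simps)
qed

lemma wrap_range: "0 \<le> wrap u" "wrap u < 2 * pi"
proof -
  have p: "0 < 2 * pi" by simp
  have "of_int \<lfloor>u / (2 * pi)\<rfloor> \<le> u / (2 * pi)" "u / (2 * pi) < of_int \<lfloor>u / (2 * pi)\<rfloor> + 1" by linarith+
  then have "of_int \<lfloor>u / (2 * pi)\<rfloor> * (2 * pi) \<le> u" "u < (of_int \<lfloor>u / (2 * pi)\<rfloor> + 1) * (2 * pi)"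
    unfolding pos_le_divide_eq[OF p] pos_divide_less_eq[OF p] by auto
  then show "0 \<le> wrap u" "wrap u < 2 * pi" by (simp_all add: wrap_def algebra_simps)
qed

lemma wrap_id: "0 \<le> u \<Longrightarrow> u < 2 * pi \<Longrightarrow> wrap u = u"
proof -
  assume "0 \<le> u" "u < 2 * pi"
  then have "\<lfloor>u / (2 * pi)\<rfloor> = 0" by (simp add: floor_eq_iff)
  then show ?thesis by (simp add: wrap_def)
qed

text \<open>
  A translate of the fundamental interval is reassembled from two pieces by \<open>wrap\<close>.
\<close>

lemma nn_integral_circle_shift:
  assumes [measurable]: "f \<in> borel_measurable borel"
  shows "(\<integral>\<^sup>+u. f (wrap (u + c)) \<partial>circle) = (\<integral>\<^sup>+u. f u \<partial>circle)"
proof -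
  define c' where "c' = wrap c"
  have c': "0 \<le> c'" "c' < 2 * pi" using wrap_range by (auto simp: c'_def)
  define g where "g v = f (wrap v)" for v
  have [measurable]: "g \<in> borel_measurable borel" unfolding g_def by measurable
  have g_per: "g (v + 2 * pi) = g v" for v using wrap_add_int[of v 1] by (simp add: g_def)
  have "wrap (u + c) = wrap (u + c')" for u
    using wrap_add_int[of "u + c'" "\<lfloor>c / (2 * pi)\<rfloor>"] by (simp add: c'_def wrap_def[of c])
  then have "(\<integral>\<^sup>+u. f (wrap (u + c)) \<partial>circle) = (\<integral>\<^sup>+u. g (c' + u) \<partial>circle)"
    by (simp add: g_def add.commute)
  also have "\<dots> = (\<integral>\<^sup>+u. g (c' + u) * indicator {0..<2 * pi} u \<partial>lborel) / ennreal (2 * pi)"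
    by (rule nn_integral_circle) measurable
  also have "(\<integral>\<^sup>+u. g (c' + u) * indicator {0..<2 * pi} u \<partial>lborel) = (\<integral>\<^sup>+v. g v * indicator {c'..<c' + 2 * pi} v \<partial>lborel)"
  proof -
    have "(\<integral>\<^sup>+v. g v * indicator {c'..<c' + 2 * pi} v \<partial>lborel)
        = (\<integral>\<^sup>+v. g v * indicator {c'..<c' + 2 * pi} v \<partial>distr lborel borel ((+) c'))"
      by (simp only: lborel_distr_plus)
    also have "\<dots> = (\<integral>\<^sup>+u. g (c' + u) * indicator {c'..<c' + 2 * pi} (c' + u) \<partial>lborel)"
      by (rule nn_integral_distr) measurable
    also have "\<dots> = (\<integral>\<^sup>+u. g (c' + u) * indicator {0..<2 * pi} u \<partial>lborel)"
      by (intro nn_integral_cong) (auto simp: indicator_def)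
    finally show ?thesis ..
  qed
  also have "\<dots> = (\<integral>\<^sup>+v. g v * indicator {c'..<2 * pi} v + g v * indicator {2 * pi..<2 * pi + c'} v \<partial>lborel)"
    using c' by (intro nn_integral_cong) (auto simp: indicator_def)
  also have "\<dots> = (\<integral>\<^sup>+v. g v * indicator {c'..<2 * pi} v \<partial>lborel) + (\<integral>\<^sup>+v. g v * indicator {2 * pi..<2 * pi + c'} v \<partial>lborel)"
    by (rule nn_integral_add) measurable
  also have "(\<integral>\<^sup>+v. g v * indicator {2 * pi..<2 * pi + c'} v \<partial>lborel) = (\<integral>\<^sup>+v. g v * indicator {0..<c'} v \<partial>lborel)"
  proof -
    have "(\<integral>\<^sup>+v. g v * indicator {2 * pi..<2 * pi + c'} v \<partial>lborel)
        = (\<integral>\<^sup>+v. g v * indicator {2 * pi..<2 * pi + c'} v \<partial>distr lborel borel ((+) (2 * pi)))"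
      by (simp only: lborel_distr_plus)
    also have "\<dots> = (\<integral>\<^sup>+u. g (2 * pi + u) * indicator {2 * pi..<2 * pi + c'} (2 * pi + u) \<partial>lborel)"
      by (rule nn_integral_distr) measurable
    also have "\<dots> = (\<integral>\<^sup>+v. g v * indicator {0..<c'} v \<partial>lborel)"
      using g_per by (intro nn_integral_cong) (auto simp: indicator_def add.commute)
    finally show ?thesis .
  qed
  also have "(\<integral>\<^sup>+v. g v * indicator {c'..<2 * pi} v \<partial>lborel) + (\<integral>\<^sup>+v. g v * indicator {0..<c'} v \<partial>lborel)
      = (\<integral>\<^sup>+v. g v * indicator {c'..<2 * pi} v + g v * indicator {0..<c'} v \<partial>lborel)"
    by (rule nn_integral_add[symmetric]) measurable
  also have "\<dots> = (\<integral>\<^sup>+v. f v * indicator {0..<2 * pi} v \<partial>lborel)"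
    using c' by (intro nn_integral_cong) (auto simp: indicator_def g_def wrap_id)
  finally show ?thesis using nn_integral_circle[OF assms] by simp
qed

lemma distr_circle_shift: "distr circle circle (\<lambda>u. wrap (u + c)) = circle"
proof (rule measure_eqI)
  fix A assume "A \<in> sets (distr circle circle (\<lambda>u. wrap (u + c)))"
  then have A [measurable]: "A \<in> sets borel" by simp
  have "emeasure (distr circle circle (\<lambda>u. wrap (u + c))) A = (\<integral>\<^sup>+u. indicator A u \<partial>distr circle circle (\<lambda>u. wrap (u + c)))"
    by simp
  also have "\<dots> = (\<integral>\<^sup>+u. indicator A (wrap (u + c)) \<partial>circle)"
    by (rule nn_integral_distr) measurable
  also have "\<dots> = (\<integral>\<^sup>+u. indicator A u \<partial>circle)" by (rule nn_integral_circle_shift) measurable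
  finally show "emeasure (distr circle circle (\<lambda>u. wrap (u + c))) A = emeasure circle A" by simp
qed simp

definition torus_shift :: "nat \<Rightarrow> (nat \<Rightarrow> real) \<Rightarrow> (nat \<Rightarrow> real) \<Rightarrow> nat \<Rightarrow> real"
  where "torus_shift d c z = (\<lambda>i\<in>{1..d}. z i + c i)"

definition torus_wrap :: "nat \<Rightarrow> (nat \<Rightarrow> real) \<Rightarrow> nat \<Rightarrow> real"
  where "torus_wrap d z = (\<lambda>i\<in>{1..d}. wrap (z i))"

lemma measurable_torus:
  assumes "\<And>i. i \<in> {1..d} \<Longrightarrow> (\<lambda>x. f x i) \<in> borel_measurable M"
    and "\<And>x. x \<in> space M \<Longrightarrow> f x \<in> PiE {1..d} (\<lambda>_. UNIV)"
  shows "f \<in> measurable M (torus d)"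
proof -
  have "f \<in> measurable M (PiM {1..d} (\<lambda>_. borel))"
    using assms by (intro measurable_PiM_single') (auto simp: PiE_iff)
  then show ?thesis by (simp cong: measurable_cong_sets add: sets_torus)
qed

lemma measurable_wrap_shift: "(\<lambda>z. torus_wrap d (torus_shift d c z)) \<in> measurable (torus d) (torus d)"
proof (rule measurable_torus)
  fix i assume i: "i \<in> {1..d}"
  have "(\<lambda>x. wrap (x i + c i)) \<in> borel_measurable (torus d)"
    using measurable_compose[OF measurable_torus_component[OF i], of "\<lambda>u. wrap (u + c i)" borel] by simp
  then show "(\<lambda>x. torus_wrap d (torus_shift d c x) i) \<in> borel_measurable (torus d)"
    using i by (simp add: torus_wrap_def torus_shift_def)
qed (auto simp: torus_wrap_def)

text \<open>
  Translation does not map the fundamental cube into itself, hence the composition with \<open>torus_wrap\<close>; periodic functions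
  do not notice the latter.
\<close>

lemma distr_torus_shift:
  "distr (torus d) (torus d) (\<lambda>z. torus_wrap d (torus_shift d c z)) = torus d"
  unfolding torus_def
proof (rule circles.PiM_eqI)
  fix A :: "nat \<Rightarrow> real set" assume A: "\<And>i. i \<in> {1..d} \<Longrightarrow> A i \<in> sets circle"
  have Ab: "A i \<in> sets borel" if "i \<in> {1..d}" for i using A[OF that] by simp
  let ?P = "PiM {1..d} (\<lambda>_. circle)" and ?S = "\<lambda>z. torus_wrap d (torus_shift d c z)"
  have m: "?S \<in> measurable ?P ?P" using measurable_wrap_shift[of d c] by (simp add: torus_def)
  have pre: "?S -` PiE {1..d} A \<inter> space ?P = PiE {1..d} (\<lambda>i. (\<lambda>u. wrap (u + c i)) -` A i)"
    by (auto simp: space_PiM PiE_iff torus_wrap_def torus_shift_def)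
  have "emeasure (distr ?P ?P ?S) (PiE {1..d} A) = emeasure ?P (PiE {1..d} (\<lambda>i. (\<lambda>u. wrap (u + c i)) -` A i))"
    unfolding pre[symmetric] by (rule emeasure_distr[OF m]) (auto intro!: sets_PiM_I_finite A)
  also have "\<dots> = (\<Prod>i\<in>{1..d}. emeasure circle ((\<lambda>u. wrap (u + c i)) -` A i))"
  proof (rule circles.emeasure_PiM)
    fix i assume i: "i \<in> {1..d}"
    have "(\<lambda>u. wrap (u + c i)) -` A i \<inter> space borel \<in> sets borel"
      by (rule measurable_sets[OF _ Ab[OF i]]) measurable
    then show "(\<lambda>u. wrap (u + c i)) -` A i \<in> sets circle" by simp
  qed simp
  also have "\<dots> = (\<Prod>i\<in>{1..d}. emeasure circle (A i))"
  proof (rule prod.cong[OF refl])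
    fix i assume i: "i \<in> {1..d}"
    have "emeasure (distr circle circle (\<lambda>u. wrap (u + c i))) (A i)
      = emeasure circle ((\<lambda>u. wrap (u + c i)) -` A i \<inter> space circle)"
      by (rule emeasure_distr) (use A[OF i] in measurable)
    then show "emeasure circle ((\<lambda>u. wrap (u + c i)) -` A i) = emeasure circle (A i)"
      by (simp add: distr_circle_shift)
  qed
  finally show "emeasure (distr ?P ?P ?S) (PiE {1..d} A) = (\<Prod>i\<in>{1..d}. emeasure circle (A i))" .
qed simp_all

lemma periodic_shift_int:
  assumes "periodic d f" "x \<in> PiE {1..d} (\<lambda>_. UNIV)" "j \<in> {1..d}"
  shows "f (x(j := x j + 2 * pi * of_int k)) = f x"
proof -
  have nat: "f (x(j := x j + 2 * pi * real n)) = f x" if "x \<in> PiE {1..d} (\<lambda>_. UNIV)" for n x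
    using that
  proof (induction n)
    case (Suc n)
    let ?y = "x(j := x j + 2 * pi * real n)"
    have y: "?y \<in> PiE {1..d} (\<lambda>_. UNIV)" using Suc.prems assms(3) by (auto simp: PiE_iff extensional_def)
    have "f (x(j := x j + 2 * pi * real (Suc n))) = f (?y(j := ?y j + 2 * pi))"
      by (simp add: algebra_simps)
    also have "\<dots> = f ?y" using assms(1,3) y unfolding periodic_def by blast
    also have "\<dots> = f x" by (rule Suc.IH[OF Suc.prems])
    finally show ?case .
  qed simp
  show ?thesis
  proof (cases "0 \<le> k")
    case True
    then show ?thesis using nat[OF assms(2), of "nat k"] by simp
  next
    case False
    let ?y = "x(j := x j + 2 * pi * of_int k)"
    have y: "?y \<in> PiE {1..d} (\<lambda>_. UNIV)" using assms(2,3) by (auto simp: PiE_iff extensional_def)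
    have "f (?y(j := ?y j + 2 * pi * real (nat (- k)))) = f ?y" by (rule nat[OF y])
    then show ?thesis using False by simp
  qed
qed

lemma periodic_wrap:
  assumes "periodic d f" "x \<in> PiE {1..d} (\<lambda>_. UNIV)"
  shows "f (torus_wrap d x) = f x"
proof -
  have "f (\<lambda>i. if i \<in> S then wrap (x i) else x i) = f x" if "S \<subseteq> {1..d}" for S
    using finite_subset[OF that finite_atLeastAtMost] that
  proof (induction S rule: finite_induct)
    case (insert j S)
    let ?y = "\<lambda>i. if i \<in> S then wrap (x i) else x i"
    have y: "?y \<in> PiE {1..d} (\<lambda>_. UNIV)" using assms(2) insert.prems by (auto simp: PiE_iff extensional_def)
    have "(\<lambda>i. if i \<in> insert j S then wrap (x i) else x i) = ?y(j := ?y j + 2 * pi * of_int (- \<lfloor>x j / (2 * pi)\<rfloor>))"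
      using insert.hyps by (auto simp: wrap_def)
    then show ?case using periodic_shift_int[OF assms(1) y, of j "- \<lfloor>x j / (2 * pi)\<rfloor>"] insert by simp
  qed simp
  note this[OF order.refl] moreover have "torus_wrap d x = (\<lambda>i. if i \<in> {1..d} then wrap (x i) else x i)"
    using assms(2) by (auto simp: torus_wrap_def PiE_iff extensional_def)
  ultimately show ?thesis by simp
qed

lemma torus_shift_PiE [simp]: "torus_shift d c z \<in> PiE {1..d} (\<lambda>_. UNIV)"
  by (simp add: torus_shift_def)

lemma periodic_torus_shift:
  assumes "periodic d f"
  shows "f (torus_shift d c z) = f (torus_wrap d (torus_shift d c z))"
  by (rule periodic_wrap[OF assms torus_shift_PiE, symmetric])

definition periodic_L1 :: "nat \<Rightarrow> ((nat \<Rightarrow> real) \<Rightarrow> complex) \<Rightarrow> bool"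
  where "periodic_L1 d f \<longleftrightarrow> periodic d f \<and> integrable (torus d) f"

lemma periodic_L1_measurable: "periodic_L1 d f \<Longrightarrow> f \<in> borel_measurable (torus d)"
  by (auto simp: periodic_L1_def)

lemma integral_torus_shift:
  assumes "periodic d f" "f \<in> borel_measurable (torus d)"
  shows "(\<integral>z. f (torus_shift d c z) \<partial>torus d) = (\<integral>z. f z \<partial>torus d)"
proof -
  have "(\<integral>z. f z \<partial>torus d) = (\<integral>z. f z \<partial>distr (torus d) (torus d) (\<lambda>z. torus_wrap d (torus_shift d c z)))"
    by (simp only: distr_torus_shift)
  also have "\<dots> = (\<integral>z. f (torus_wrap d (torus_shift d c z)) \<partial>torus d)"
    by (rule integral_distr[OF measurable_wrap_shift assms(2)])
  finally show ?thesis by (simp only: periodic_torus_shift[OF assms(1), symmetric])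
qed

lemma integrable_torus_shift:
  assumes "periodic d f" "integrable (torus d) f"
  shows "integrable (torus d) (\<lambda>z. f (torus_shift d c z))"
proof -
  have "integrable (distr (torus d) (torus d) (\<lambda>z. torus_wrap d (torus_shift d c z))) f"
    using assms(2) by (simp only: distr_torus_shift)
  then have "integrable (torus d) (\<lambda>z. f (torus_wrap d (torus_shift d c z)))"
    by (rule integrable_distr[OF measurable_wrap_shift])
  then show ?thesis by (simp only: periodic_torus_shift[OF assms(1), symmetric])
qed

lemma periodic_shifted: "periodic d f \<Longrightarrow> periodic d (\<lambda>z. f (torus_shift d c z))"
proof -
  assume f: "periodic d f"
  have "torus_shift d c (x(j := x j + 2 * pi)) = (torus_shift d c x)(j := torus_shift d c x j + 2 * pi)"
    if "j \<in> {1..d}" for j x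
    using that by (auto simp: torus_shift_def)
  moreover have "f ((torus_shift d c x)(j := torus_shift d c x j + 2 * pi)) = f (torus_shift d c x)"
    if "j \<in> {1..d}" for j x
    using f torus_shift_PiE that unfolding periodic_def by blast
  ultimately show ?thesis unfolding periodic_def by (intro ballI) (simp only:)
qed

lemma periodic_L1_shift: "periodic_L1 d f \<Longrightarrow> periodic_L1 d (\<lambda>z. f (torus_shift d c z))"
  unfolding periodic_L1_def by (auto intro: periodic_shifted integrable_torus_shift)

lemma periodic_L1_add: "periodic_L1 d f \<Longrightarrow> periodic_L1 d g \<Longrightarrow> periodic_L1 d (\<lambda>z. f z + g z)"
  unfolding periodic_L1_def periodic_def by auto

lemma periodic_L1_diff: "periodic_L1 d f \<Longrightarrow> periodic_L1 d g \<Longrightarrow> periodic_L1 d (\<lambda>z. f z - g z)"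
  unfolding periodic_L1_def periodic_def by auto

lemma periodic_L1_cmult: "periodic_L1 d f \<Longrightarrow> periodic_L1 d (\<lambda>z. c * f z)"
  unfolding periodic_L1_def periodic_def by auto

section \<open>Duality for the mixed norm\<close>

lemma Lp_norm_1: "Lp_norm 1 M g = (\<integral>\<^sup>+x. g x \<partial>M)"
proof -
  have "enn_power a 1 = a" for a by (cases a) (auto simp: enn_power_def)
  then show ?thesis by (simp add: Lp_norm_def)
qed

text \<open>
  The easy half of duality. In a variable with exponent \<open>\<infinity>\<close>, an average with respect to the probability density
  \<open>\<psi> j\<close> is at most the essential supremum.
\<close>

lemma nn_integral_le_iter_norm:
  fixes g :: "(nat \<Rightarrow> real) \<Rightarrow> ennreal" and \<psi> :: "nat \<Rightarrow> real \<Rightarrow> ennreal"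
  assumes g: "g \<in> borel_measurable (PiM {1..v} (\<lambda>_. circle))"
    and \<psi>: "\<And>j. \<psi> j \<in> borel_measurable borel" "\<And>j. (\<integral>\<^sup>+u. \<psi> j u \<partial>circle) = 1"
    and q: "\<And>j. q j = 1 \<and> \<psi> j = (\<lambda>_. 1) \<or> q j = \<infinity>"
    and "n \<le> v" "x \<in> extensional {1..v}"
  shows "(\<integral>\<^sup>+z. g (\<lambda>i. if i \<in> {1..n} then z i else x i) * (\<Prod>j\<in>{1..n}. \<psi> j (z j)) \<partial>PiM {1..n} (\<lambda>_. circle))
      \<le> iter_norm q n g x"
  using assms(5,6)
proof (induction n arbitrary: x)
  case 0
  then show ?case by (simp add: PiM_empty nn_integral_count_space_finite)
next
  case (Suc n)
  let ?P = "\<lambda>n. PiM {1..n} (\<lambda>_. circle)"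
  let ?u = "\<lambda>z i. if i \<in> {1..Suc n} then z i else x i"
  have ins: "{1..Suc n} = insert (Suc n) {1..n}" by auto
  have meas: "(\<lambda>z. g (?u z) * (\<Prod>j\<in>{1..Suc n}. \<psi> j (z j))) \<in> borel_measurable (?P (Suc n))"
  proof -
    have "?u \<in> measurable (?P (Suc n)) (PiM {1..v} (\<lambda>_. circle))"
    proof (rule measurable_PiM_single')
      fix i assume i: "i \<in> {1..v}"
      show "(\<lambda>z. ?u z i) \<in> measurable (?P (Suc n)) circle"
        by (cases "i \<in> {1..Suc n}") (auto intro: measurable_component_singleton)
    qed (use Suc.prems in \<open>auto simp: extensional_def PiE_iff\<close>)
    then have 1: "(\<lambda>z. g (?u z)) \<in> borel_measurable (?P (Suc n))" by (rule measurable_compose[OF _ g])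
    have 2: "(\<lambda>z. \<psi> j (z j)) \<in> borel_measurable (?P (Suc n))" if "j \<in> {1..Suc n}" for j
    proof -
      have "\<psi> j \<in> borel_measurable circle" using \<psi>(1)[of j] by (simp cong: measurable_cong_sets)
      then show ?thesis by (rule measurable_compose[OF measurable_component_singleton[OF that]])
    qed
    show ?thesis using 1 2 by (intro borel_measurable_times_ennreal borel_measurable_prod_ennreal) auto
  qed
  have "(\<integral>\<^sup>+z. g (?u z) * (\<Prod>j\<in>{1..Suc n}. \<psi> j (z j)) \<partial>?P (Suc n))
     = (\<integral>\<^sup>+s. \<integral>\<^sup>+z. g (?u (z(Suc n := s))) * (\<Prod>j\<in>{1..Suc n}. \<psi> j ((z(Suc n := s)) j)) \<partial>?P n \<partial>circle)"
    using meas unfolding ins by (intro circles.product_nn_integral_insert_rev) auto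
  also have "\<dots> = (\<integral>\<^sup>+s. \<integral>\<^sup>+z. \<psi> (Suc n) s * (g (\<lambda>i. if i \<in> {1..n} then z i else (x(Suc n := s)) i) * (\<Prod>j\<in>{1..n}. \<psi> j (z j))) \<partial>?P n \<partial>circle)"
  proof (intro nn_integral_cong)
    fix s z
    have "?u (z(Suc n := s)) = (\<lambda>i. if i \<in> {1..n} then z i else (x(Suc n := s)) i)" by auto
    moreover have "(\<Prod>j\<in>{1..Suc n}. \<psi> j ((z(Suc n := s)) j)) = \<psi> (Suc n) s * (\<Prod>j\<in>{1..n}. \<psi> j (z j))"
      unfolding ins by (subst prod.insert) (auto intro!: prod.cong)
    ultimately show "g (?u (z(Suc n := s))) * (\<Prod>j\<in>{1..Suc n}. \<psi> j ((z(Suc n := s)) j))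
       = \<psi> (Suc n) s * (g (\<lambda>i. if i \<in> {1..n} then z i else (x(Suc n := s)) i) * (\<Prod>j\<in>{1..n}. \<psi> j (z j)))"
      by (simp only: mult_ac)
  qed
  also have "\<dots> = (\<integral>\<^sup>+s. \<psi> (Suc n) s * (\<integral>\<^sup>+z. g (\<lambda>i. if i \<in> {1..n} then z i else (x(Suc n := s)) i) * (\<Prod>j\<in>{1..n}. \<psi> j (z j)) \<partial>?P n) \<partial>circle)"
  proof (intro nn_integral_cong nn_integral_cmult)
    fix s
    have x': "x(Suc n := s) \<in> extensional {1..v}" using Suc.prems by (auto simp: extensional_def)
    have "(\<lambda>z i. if i \<in> {1..n} then z i else (x(Suc n := s)) i) \<in> measurable (?P n) (PiM {1..v} (\<lambda>_. circle))"
    proof (rule measurable_PiM_single')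
      fix i assume i: "i \<in> {1..v}"
      show "(\<lambda>z. if i \<in> {1..n} then z i else (x(Suc n := s)) i) \<in> measurable (?P n) circle"
        by (cases "i \<in> {1..n}") (auto intro: measurable_component_singleton)
    qed (use Suc.prems x' in \<open>auto simp: extensional_def PiE_iff\<close>)
    then have 1: "(\<lambda>z. g (\<lambda>i. if i \<in> {1..n} then z i else (x(Suc n := s)) i)) \<in> borel_measurable (?P n)"
      by (rule measurable_compose[OF _ g])
    have 2: "(\<lambda>z. \<psi> j (z j)) \<in> borel_measurable (?P n)" if "j \<in> {1..n}" for j
    proof -
      have "\<psi> j \<in> borel_measurable circle" using \<psi>(1)[of j] by (simp cong: measurable_cong_sets)
      then show ?thesis by (rule measurable_compose[OF measurable_component_singleton[OF that]])
    qed
    show "(\<lambda>z. g (\<lambda>i. if i \<in> {1..n} then z i else (x(Suc n := s)) i) * (\<Prod>j\<in>{1..n}. \<psi> j (z j))) \<in> borel_measurable (?P n)"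
      using 1 2 by (intro borel_measurable_times_ennreal borel_measurable_prod_ennreal) auto
  qed
  also have "\<dots> \<le> (\<integral>\<^sup>+s. \<psi> (Suc n) s * iter_norm q n g (x(Suc n := s)) \<partial>circle)"
  proof (intro nn_integral_mono mult_left_mono Suc.IH)
    fix s show "x(Suc n := s) \<in> extensional {1..v}" using Suc.prems by (auto simp: extensional_def)
  qed (use Suc.prems in auto)
  also have "\<dots> \<le> iter_norm q (Suc n) g x"
    using q[of "Suc n"]
  proof
    assume "q (Suc n) = 1 \<and> \<psi> (Suc n) = (\<lambda>_. 1)"
    then show ?thesis by (simp add: Lp_norm_1)
  next
    assume qi: "q (Suc n) = \<infinity>"
    let ?E = "esssup circle (\<lambda>s. iter_norm q n g (x(Suc n := s)))"
    have "(\<integral>\<^sup>+s. \<psi> (Suc n) s * iter_norm q n g (x(Suc n := s)) \<partial>circle) \<le> (\<integral>\<^sup>+s. \<psi> (Suc n) s * ?E \<partial>circle)"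
      using esssup_AE[of "\<lambda>s. iter_norm q n g (x(Suc n := s))" circle]
      by (intro nn_integral_mono_AE) (auto elim!: eventually_mono intro: mult_left_mono)
    also have "\<dots> = (\<integral>\<^sup>+s. \<psi> (Suc n) s \<partial>circle) * ?E" using \<psi>(1)[of "Suc n"] by (intro nn_integral_multc) (simp cong: measurable_cong_sets)
    also have "\<dots> = ?E" by (simp add: \<psi>(2))
    finally show ?thesis using qi by (simp add: Lp_norm_def)
  qed
  finally show ?case .
qed

corollary nn_integral_le_mixed_norm:
  fixes f :: "(nat \<Rightarrow> real) \<Rightarrow> complex" and \<psi> :: "nat \<Rightarrow> real \<Rightarrow> ennreal"
  assumes f: "f \<in> borel_measurable (torus v)"
    and \<psi>: "\<And>j. \<psi> j \<in> borel_measurable borel" "\<And>j. (\<integral>\<^sup>+u. \<psi> j u \<partial>circle) = 1"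
    and q: "\<And>j. q j = 1 \<and> \<psi> j = (\<lambda>_. 1) \<or> q j = \<infinity>"
  shows "(\<integral>\<^sup>+z. ennreal (norm (f z)) * (\<Prod>j\<in>{1..v}. \<psi> j (z j)) \<partial>torus v) \<le> mixed_norm q v f"
proof -
  have "(\<integral>\<^sup>+z. ennreal (norm (f z)) * (\<Prod>j\<in>{1..v}. \<psi> j (z j)) \<partial>torus v)
    = (\<integral>\<^sup>+z. ennreal (norm (f (\<lambda>i. if i \<in> {1..v} then z i else undefined))) * (\<Prod>j\<in>{1..v}. \<psi> j (z j)) \<partial>PiM {1..v} (\<lambda>_. circle))"
    unfolding torus_def
  proof (intro nn_integral_cong)
    fix z assume "z \<in> space (PiM {1..v} (\<lambda>_. circle))"
    then have "(\<lambda>i. if i \<in> {1..v} then z i else undefined) = z" by (auto simp: space_PiM PiE_iff extensional_def)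
    then show "ennreal (norm (f z)) * (\<Prod>j\<in>{1..v}. \<psi> j (z j)) =
      ennreal (norm (f (\<lambda>i. if i \<in> {1..v} then z i else undefined))) * (\<Prod>j\<in>{1..v}. \<psi> j (z j))" by simp
  qed
  also have "\<dots> \<le> mixed_norm q v f"
    unfolding mixed_norm_def
    using nn_integral_le_iter_norm[of "\<lambda>z. ennreal (norm (f z))" v \<psi> q v "\<lambda>_. undefined"] f \<psi> q
    by (auto simp: torus_def extensional_def)
  finally show ?thesis .
qed

section \<open>Fejer means\<close>

definition fejer :: "nat \<Rightarrow> real \<Rightarrow> real"
  where "fejer n u = (norm (dirichlet {0..<int n} u))\<^sup>2 / real n"

lemma fejer_nonneg: "0 \<le> fejer n u"
  by (simp add: fejer_def)

lemma fejer_minus: "fejer n (- u) = fejer n u"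
  by (simp add: fejer_def norm_dirichlet_minus)

lemma fejer_periodic: "fejer n (u + 2 * pi * of_int k) = fejer n u"
proof -
  have "cis (of_int a * (u + 2 * pi * of_int k)) = cis (of_int a * u)" for a
  proof -
    have "cis (of_int a * (u + 2 * pi * of_int k)) = cis (of_int a * u) * cis (2 * pi * of_int (a * k))"
      by (simp add: cis_mult algebra_simps)
    then show ?thesis by simp
  qed
  then show ?thesis unfolding fejer_def dirichlet_def by simp
qed

lemma fejer_wrap: "fejer n (wrap u) = fejer n u"
  using fejer_periodic[of n u "- \<lfloor>u / (2 * pi)\<rfloor>"] by (simp add: wrap_def)

lemma fejer_measurable: "fejer n \<in> borel_measurable borel"
proof -
  have "dirichlet {0..<int n} \<in> borel_measurable borel"
    unfolding dirichlet_def[abs_def] by (intro borel_measurable_sum cis_measurable)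
  then show ?thesis unfolding fejer_def[abs_def] by measurable
qed

lemma fejer_le: "fejer n u \<le> real n"
proof (cases "n = 0")
  case False
  have "norm (dirichlet {0..<int n} u) \<le> real n" using norm_dirichlet_le[of "{0..<int n}" u] by simp
  then have "(norm (dirichlet {0..<int n} u))\<^sup>2 \<le> (real n)\<^sup>2" by (intro power_mono) auto
  then show ?thesis using False by (simp add: fejer_def power2_eq_square pos_divide_le_eq)
qed (simp add: fejer_def)

lemma fejer_grid:
  assumes "0 < n" "n \<le> N"
  shows "(\<Sum>\<tau><N. fejer n (u - grid N \<tau>)) = real N"
  unfolding fejer_def sum_divide_distrib[symmetric] using assms by (subst dirichlet_grid_l2) auto

lemma fejer_decay:
  assumes "0 < n" "\<bar>t\<bar> \<le> pi"
  shows "fejer n t * t\<^sup>2 \<le> 16 / real n"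
proof -
  have "(norm (dirichlet {0..<int n} t) * \<bar>t\<bar>)\<^sup>2 \<le> 4\<^sup>2"
    by (intro power_mono norm_dirichlet_decay assms) auto
  then show ?thesis using assms(1) by (simp add: fejer_def power_mult_distrib divide_right_mono)
qed

lemma fejer_measurable_circle: "(\<lambda>u. fejer n (u + c)) \<in> borel_measurable circle"
  using measurable_compose[of "\<lambda>u. u + c" borel borel "fejer n" borel] fejer_measurable
  by (simp cong: measurable_cong_sets)

lemma fejer_integrable: "integrable circle (\<lambda>u. fejer n (u + c))"
  by (rule circle.integrable_const_bound[where B="real n"])
     (auto simp: fejer_nonneg fejer_le fejer_measurable_circle)

lemma fejer_integral_1:
  assumes "0 < n"
  shows "(\<integral>u. fejer n u \<partial>circle) = 1"
proof -
  have fm: "fejer n \<in> borel_measurable circle" using fejer_measurable_circle[of n 0] by simp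
  have wm: "(\<lambda>u. wrap (u + c)) \<in> measurable circle circle" for c
  proof -
    have "(\<lambda>u. wrap (u + c)) \<in> borel_measurable borel" by measurable
    then show ?thesis by (simp cong: measurable_cong_sets)
  qed
  have shift: "(\<integral>u. fejer n (u + c) \<partial>circle) = (\<integral>u. fejer n u \<partial>circle)" for c
  proof -
    have "(\<integral>u. fejer n u \<partial>circle) = (\<integral>u. fejer n u \<partial>distr circle circle (\<lambda>u. wrap (u + c)))"
      by (simp only: distr_circle_shift)
    also have "\<dots> = (\<integral>u. fejer n (wrap (u + c)) \<partial>circle)" by (rule integral_distr[OF wm fm])
    finally show ?thesis by (simp only: fejer_wrap)
  qed
  have "real n * (\<integral>u. fejer n u \<partial>circle) = (\<Sum>\<tau><n. \<integral>u. fejer n (u + - grid n \<tau>) \<partial>circle)"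
    by (simp only: shift) simp
  also have "\<dots> = (\<integral>u. (\<Sum>\<tau><n. fejer n (u + - grid n \<tau>)) \<partial>circle)"
    by (rule Bochner_Integration.integral_sum[symmetric]) (rule fejer_integrable)
  also have "\<dots> = (\<integral>u. real n \<partial>circle)"
    using fejer_grid[OF assms order.refl] by simp
  also have "\<dots> = real n" by (simp add: circle.prob_space)
  finally show ?thesis using assms by simp
qed

lemma fejer_nn_integral:
  assumes "0 < n"
  shows "(\<integral>\<^sup>+u. ennreal (fejer n (u - c)) \<partial>circle) = 1"
proof -
  have "(\<integral>\<^sup>+u. ennreal (fejer n (u - c)) \<partial>circle) = (\<integral>\<^sup>+u. ennreal (fejer n (wrap (u + - c))) \<partial>circle)"
    by (simp add: fejer_wrap)
  also have "\<dots> = (\<integral>\<^sup>+u. ennreal (fejer n u) \<partial>circle)"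
    by (rule nn_integral_circle_shift) (use fejer_measurable in measurable)
  also have "\<dots> = ennreal (\<integral>u. fejer n u \<partial>circle)"
    by (rule nn_integral_eq_integral) (use fejer_integrable[of n 0] fejer_nonneg in auto)
  finally show ?thesis using fejer_integral_1[OF assms] by simp
qed

text \<open>
  The normalized autocorrelation of the indicator of \<open>{0..<n}\<close>; for \<open>0 < n\<close> and \<open>\<bar>a\<bar> \<le> n\<close> this is \<open>1 - \<bar>a\<bar> / n\<close>.
\<close>

definition fejer_coeff :: "nat \<Rightarrow> int \<Rightarrow> real"
  where "fejer_coeff n a = real (card {p \<in> {0..<int n} \<times> {0..<int n}. fst p - snd p = a}) / real n"

lemma fejer_expansion:
  assumes "n \<le> L"
  shows "complex_of_real (fejer n u) = (\<Sum>a\<in>{- int L..int L}. of_real (fejer_coeff n a) * cis (of_int a * u))"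
proof -
  let ?A = "{0..<int n}"
  have "complex_of_real ((norm (dirichlet ?A u))\<^sup>2) = (\<Sum>b\<in>?A. \<Sum>b'\<in>?A. cis (of_int (b - b') * u))"
    unfolding complex_norm_square dirichlet_def cnj_sum sum_product
    by (intro sum.cong refl) (simp add: cis_cnj cis_mult algebra_simps)
  also have "\<dots> = (\<Sum>p\<in>?A \<times> ?A. cis (of_int (fst p - snd p) * u))"
    by (simp add: sum.cartesian_product case_prod_beta)
  also have "\<dots> = (\<Sum>a\<in>{- int L..int L}. \<Sum>p\<in>{p \<in> ?A \<times> ?A. fst p - snd p = a}. cis (of_int (fst p - snd p) * u))"
    using assms by (intro sum.group[symmetric]) auto
  also have "\<dots> = (\<Sum>a\<in>{- int L..int L}. of_nat (card {p \<in> ?A \<times> ?A. fst p - snd p = a}) * cis (of_int a * u))"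
    by (intro sum.cong refl) simp
  finally show ?thesis by (simp add: fejer_def fejer_coeff_def sum_divide_distrib)
qed

lemma fejer_coeff_eq:
  assumes "\<bar>a\<bar> \<le> int n"
  shows "fejer_coeff n a = (real n - \<bar>real_of_int a\<bar>) / real n"
proof -
  have "{p \<in> {0..<int n} \<times> {0..<int n}. fst p - snd p = a} = (\<lambda>b. (b + a, b)) ` {max 0 (- a)..<min (int n) (int n - a)}"
    by (auto simp: image_iff)
  then have "card {p \<in> {0..<int n} \<times> {0..<int n}. fst p - snd p = a} = card {max 0 (- a)..<min (int n) (int n - a)}"
    by (simp only:) (intro card_image inj_onI, auto)
  also have "\<dots> = nat (int n - \<bar>a\<bar>)" using assms by auto
  finally show ?thesis using assms by (simp add: fejer_coeff_def)
qed

lemma fejer_coeff_tendsto: "(\<lambda>n. fejer_coeff n a) \<longlonglongrightarrow> 1"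
proof -
  have "(\<lambda>n. 1 - \<bar>real_of_int a\<bar> * (1 / real n)) \<longlonglongrightarrow> 1 - \<bar>real_of_int a\<bar> * 0"
    by (intro tendsto_intros lim_1_over_n)
  moreover have "\<forall>\<^sub>F n in sequentially. 1 - \<bar>real_of_int a\<bar> * (1 / real n) = fejer_coeff n a"
    using eventually_ge_at_top[of "nat \<bar>a\<bar> + 1"]
  proof eventually_elim
    case (elim n)
    then show ?case by (subst fejer_coeff_eq) (auto simp: field_simps)
  qed
  ultimately show ?thesis by (simp add: tendsto_cong)
qed

definition fejer_prod :: "nat \<Rightarrow> nat \<Rightarrow> (nat \<Rightarrow> real) \<Rightarrow> real"
  where "fejer_prod n v z = (\<Prod>j\<in>{1..v}. fejer n (z j))"

lemma fejer_prod_nonneg: "0 \<le> fejer_prod n v z"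
  unfolding fejer_prod_def by (intro prod_nonneg) (simp add: fejer_nonneg)

lemma bounded_periodic_fejer_prod: "bounded_periodic v (\<lambda>w. of_real (fejer_prod n v (\<lambda>j. w j - z j)))"
proof -
  have "bounded_periodic v (\<lambda>w. \<Prod>j\<in>{1..v}. complex_of_real (fejer n (w j - z j)))"
  proof (rule bounded_periodic_prod[where g="\<lambda>j u. complex_of_real (fejer n (u - z j))" and B="\<lambda>_. real n"])
    fix j u
    show "(\<lambda>u. complex_of_real (fejer n (u - z j))) \<in> borel_measurable borel"
      using measurable_compose[of "\<lambda>u. u - z j" borel borel "fejer n" borel] fejer_measurable by simp
    show "complex_of_real (fejer n (u + 2 * pi - z j)) = complex_of_real (fejer n (u - z j))"
      using fejer_periodic[of n "u - z j" 1] by (simp add: algebra_simps)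
    show "norm (complex_of_real (fejer n (u - z j))) \<le> real n"
      by (simp add: fejer_nonneg fejer_le)
  qed
  then show ?thesis by (simp add: fejer_prod_def)
qed

definition mollify :: "nat \<Rightarrow> nat \<Rightarrow> ((nat \<Rightarrow> real) \<Rightarrow> complex) \<Rightarrow> (nat \<Rightarrow> real) \<Rightarrow> complex"
  where "mollify n v f z = (\<integral>w. f (torus_shift v z w) * of_real (fejer_prod n v w) \<partial>torus v)"

lemma integrable_times_bounded_periodic:
  assumes "integrable (torus v) f" "bounded_periodic v h"
  shows "integrable (torus v) (\<lambda>w. f w * h w)"
proof -
  obtain B where "\<And>x. norm (h x) \<le> B" using assms(2) by (auto simp: bounded_periodic_def)
  then have "integrable (torus v) (\<lambda>w. h w * f w)"
    using assms by (intro bounded_times_integrable[of _ f h B]) (auto simp: bounded_periodic_def)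
  then show ?thesis by (simp add: mult.commute)
qed

lemma mollify_integrable:
  "periodic_L1 v f \<Longrightarrow> integrable (torus v) (\<lambda>w. f (torus_shift v z w) * of_real (fejer_prod n v w))"
  using integrable_times_bounded_periodic[OF _ bounded_periodic_fejer_prod[where z="\<lambda>_. 0"]] integrable_torus_shift
  by (auto simp: periodic_L1_def)

lemma mollify_convolution:
  assumes "periodic_L1 v f"
  shows "mollify n v f z = (\<integral>w. f w * of_real (fejer_prod n v (\<lambda>j. w j - z j)) \<partial>torus v)"
proof -
  let ?h = "\<lambda>w. f w * of_real (fejer_prod n v (\<lambda>j. w j - z j))"
  have per: "periodic v ?h" using assms bounded_periodic_fejer_prod[of v n z] by (auto simp: periodic_L1_def bounded_periodic_def periodic_def)
  have meas: "?h \<in> borel_measurable (torus v)"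
    using periodic_L1_measurable[OF assms] bounded_periodic_fejer_prod[of v n z] by (intro borel_measurable_times) (auto simp: bounded_periodic_def)
  have "(\<integral>w. ?h w \<partial>torus v) = (\<integral>w. ?h (torus_shift v z w) \<partial>torus v)"
    by (rule integral_torus_shift[OF per meas, symmetric])
  also have "\<dots> = mollify n v f z"
    unfolding mollify_def
  proof (intro Bochner_Integration.integral_cong refl)
    fix w
    have "fejer_prod n v (\<lambda>j. torus_shift v z w j - z j) = fejer_prod n v w"
      unfolding fejer_prod_def by (intro prod.cong) (auto simp: torus_shift_def)
    then show "?h (torus_shift v z w) = f (torus_shift v z w) * of_real (fejer_prod n v w)" by simp
  qed
  finally show ?thesis ..
qed

definition fourier :: "nat \<Rightarrow> ((nat \<Rightarrow> real) \<Rightarrow> complex) \<Rightarrow> (nat \<Rightarrow> int) \<Rightarrow> complex"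
  where "fourier v f a = (\<integral>w. f w * character v (\<lambda>j. - a j) w \<partial>torus v)"

definition mollified_coeff :: "nat \<Rightarrow> nat \<Rightarrow> ((nat \<Rightarrow> real) \<Rightarrow> complex) \<Rightarrow> (nat \<Rightarrow> int) \<Rightarrow> complex"
  where "mollified_coeff n v f a = of_real (\<Prod>j\<in>{1..v}. fejer_coeff n (a j)) * fourier v f a"

lemma mollify_trig_kernel:
  assumes "periodic_L1 v f" "n \<le> L"
  shows "mollify n v f = trig_kernel v L (mollified_coeff n v f)"
proof
  fix z
  let ?A = "PiE {1..v} (\<lambda>_. {- int L..int L})"
  have "complex_of_real (fejer_prod n v (\<lambda>j. w j - z j))
     = (\<Sum>a\<in>?A. of_real (\<Prod>j\<in>{1..v}. fejer_coeff n (a j)) * character v a z * character v (\<lambda>j. - a j) w)" for w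
  proof -
    have "fejer n (w j - z j) = fejer n (z j - w j)" for j using fejer_minus[of n "z j - w j"] by simp
    then have "complex_of_real (fejer_prod n v (\<lambda>j. w j - z j)) = (\<Prod>j\<in>{1..v}. complex_of_real (fejer n (z j - w j)))"
      by (simp add: fejer_prod_def)
    also have "\<dots> = (\<Prod>j\<in>{1..v}. \<Sum>a\<in>{- int L..int L}. of_real (fejer_coeff n a) * cis (of_int a * (z j - w j)))"
      unfolding fejer_expansion[OF assms(2)] ..
    also have "\<dots> = (\<Sum>a\<in>?A. \<Prod>j\<in>{1..v}. of_real (fejer_coeff n (a j)) * cis (of_int (a j) * (z j - w j)))"
      by (rule prod_sum_PiE) auto
    also have "\<dots> = (\<Sum>a\<in>?A. of_real (\<Prod>j\<in>{1..v}. fejer_coeff n (a j)) * character v a z * character v (\<lambda>j. - a j) w)"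
      unfolding character_def of_real_prod prod.distrib[symmetric] mult.assoc
      by (intro sum.cong prod.cong refl) (simp add: cis_mult algebra_simps)
    finally show ?thesis .
  qed
  then have "mollify n v f z = (\<integral>w. (\<Sum>a\<in>?A. (of_real (\<Prod>j\<in>{1..v}. fejer_coeff n (a j)) * character v a z) *
      (f w * character v (\<lambda>j. - a j) w)) \<partial>torus v)"
    unfolding mollify_convolution[OF assms(1)] by (simp only: sum_distrib_left mult_ac)
  also have "\<dots> = (\<Sum>a\<in>?A. \<integral>w. (of_real (\<Prod>j\<in>{1..v}. fejer_coeff n (a j)) * character v a z) *
      (f w * character v (\<lambda>j. - a j) w) \<partial>torus v)"
    using integrable_times_bounded_periodic[OF _ bounded_periodic_character] assms(1)
    by (intro Bochner_Integration.integral_sum integrable_mult_right) (auto simp: periodic_L1_def)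
  also have "\<dots> = trig_kernel v L (mollified_coeff n v f) z"
    unfolding trig_kernel_def mollified_coeff_def fourier_def by (intro sum.cong refl) simp
  finally show "mollify n v f z = trig_kernel v L (mollified_coeff n v f) z" .
qed

lemma upd_in_PiE: "z \<in> PiE {1..v} (\<lambda>_. UNIV) \<Longrightarrow> j \<in> {1..v} \<Longrightarrow> z(j := s) \<in> PiE {1..v} (\<lambda>_. UNIV)"
  by (auto simp: PiE_iff extensional_def)

lemma coordinate_shift:
  assumes "z \<in> PiE {1..v} (\<lambda>_. UNIV)" "j \<in> {1..v}"
  shows "z(j := z j + s) = torus_shift v ((\<lambda>_. 0)(j := s)) z"
  using assms by (auto simp: torus_shift_def PiE_iff extensional_def)

lemma periodic_L1_coordinate_shift:
  assumes "periodic_L1 v f" "j \<in> {1..v}"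
  shows "periodic_L1 v (\<lambda>z. f (z(j := z j + s)))"
proof -
  have g: "periodic_L1 v (\<lambda>z. f (torus_shift v ((\<lambda>_. 0)(j := s)) z))" by (rule periodic_L1_shift[OF assms(1)])
  have eq: "f (z(j := z j + s)) = f (torus_shift v ((\<lambda>_. 0)(j := s)) z)" if "z \<in> PiE {1..v} (\<lambda>_. UNIV)" for z
    using coordinate_shift[OF that assms(2)] by simp
  have "integrable (torus v) (\<lambda>z. f (z(j := z j + s))) \<longleftrightarrow> integrable (torus v) (\<lambda>z. f (torus_shift v ((\<lambda>_. 0)(j := s)) z))"
    by (rule Bochner_Integration.integrable_cong) (auto simp: space_torus intro!: eq)
  moreover have "periodic v (\<lambda>z. f (z(j := z j + s)))"
    using g unfolding periodic_L1_def periodic_def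
  proof (intro ballI, elim conjE)
    fix x :: "nat \<Rightarrow> real" and i assume x: "x \<in> PiE {1..v} (\<lambda>_. UNIV)" and i: "i \<in> {1..v}"
      and p: "\<forall>x\<in>PiE {1..v} (\<lambda>_. UNIV). \<forall>i\<in>{1..v}. f (torus_shift v ((\<lambda>_. 0)(j := s)) (x(i := x i + 2 * pi))) = f (torus_shift v ((\<lambda>_. 0)(j := s)) x)"
    show "f ((x(i := x i + 2 * pi))(j := (x(i := x i + 2 * pi)) j + s)) = f (x(j := x j + s))"
      using bspec[OF bspec[OF p x] i] eq[OF upd_in_PiE[OF x i]] eq[OF x] by (simp del: fun_upd_apply)
  qed
  ultimately show ?thesis using g by (simp add: periodic_L1_def)
qed

lemma periodic_L1_difference: "periodic_L1 v f \<Longrightarrow> j \<in> {1..v} \<Longrightarrow> periodic_L1 v (difference j s f)"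
  unfolding difference_def by (intro periodic_L1_diff periodic_L1_coordinate_shift)

lemma periodic_L1_difference_power: "periodic_L1 v f \<Longrightarrow> j \<in> {1..v} \<Longrightarrow> periodic_L1 v ((difference j s ^^ m) f)"
  by (induction m) (auto intro: periodic_L1_difference)

lemma periodic_L1_fold_difference:
  "set xs \<subseteq> {1..v} \<Longrightarrow> periodic_L1 v f \<Longrightarrow> periodic_L1 v (fold (\<lambda>j. difference j (t j) ^^ l) xs f)"
proof (induction xs arbitrary: f)
  case (Cons j xs)
  then have "j \<in> {1..v}" "set xs \<subseteq> {1..v}" by auto
  then show ?case using Cons.IH[OF _ periodic_L1_difference_power[OF Cons.prems(2)]] by simp
qed simp

lemma periodic_L1_mixed_difference: "e \<subseteq> {1..v} \<Longrightarrow> periodic_L1 v f \<Longrightarrow> periodic_L1 v (mixed_difference l t e f)"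
  unfolding mixed_difference_def using finite_subset[of e "{1..v}"]
  by (intro periodic_L1_fold_difference) auto

lemma mollify_difference:
  assumes "periodic_L1 v f" "j \<in> {1..v}"
  shows "mollify n v (difference j s f) = difference j s (mollify n v f)"
proof
  fix z
  have shift: "torus_shift v (z(j := z j + s)) w = (torus_shift v z w)(j := torus_shift v z w j + s)" for w
    using assms(2) by (auto simp: torus_shift_def)
  have i1: "integrable (torus v) (\<lambda>w. f ((torus_shift v z w)(j := torus_shift v z w j + s)) * of_real (fejer_prod n v w))"
    unfolding shift[symmetric] by (rule mollify_integrable[OF assms(1)])
  show "mollify n v (difference j s f) z = difference j s (mollify n v f) z"
    unfolding difference_def mollify_def shift left_diff_distrib
    by (rule Bochner_Integration.integral_diff[OF i1 mollify_integrable[OF assms(1)]])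
qed

lemma mollify_difference_power:
  assumes "periodic_L1 v f" "j \<in> {1..v}"
  shows "mollify n v ((difference j s ^^ m) f) = (difference j s ^^ m) (mollify n v f)"
proof (induction m)
  case (Suc m)
  then show ?case using mollify_difference[OF periodic_L1_difference_power[OF assms] assms(2)] by simp
qed simp

lemma mollify_mixed_difference:
  assumes "periodic_L1 v f" "e \<subseteq> {1..v}"
  shows "mollify n v (mixed_difference l t e f) = mixed_difference l t e (mollify n v f)"
proof -
  have "mollify n v (fold (\<lambda>j. difference j (t j) ^^ l) xs f) = fold (\<lambda>j. difference j (t j) ^^ l) xs (mollify n v f)"
    if "set xs \<subseteq> {1..v}" "periodic_L1 v f" for xs f
    using that
  proof (induction xs arbitrary: f)
    case (Cons j xs)
    then show ?case using periodic_L1_difference_power[of v f j] mollify_difference_power[of v f j] by simp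
  qed simp
  moreover have "set (sorted_list_of_set e) \<subseteq> {1..v}" using assms(2) finite_subset[OF assms(2)] by auto
  ultimately show ?thesis using assms(1) unfolding mixed_difference_def by blast
qed

lemma fejer_prod_grid_mean:
  assumes "0 < n" "n \<le> N"
  shows "grid_mean d (\<lambda>_. N) (\<lambda>\<xi>. fejer_prod n d (\<lambda>j. w j - \<xi> j)) = 1"
proof -
  have "grid_mean d (\<lambda>_. N) (\<lambda>\<xi>. fejer_prod n d (\<lambda>j. w j - \<xi> j))
     = (\<Prod>j\<in>{1..d}. (\<Sum>\<tau><N. fejer n (w j - grid N \<tau>)) / of_nat N)"
    unfolding fejer_prod_def by (rule grid_mean_prod)
  then show ?thesis using assms by (simp add: fejer_grid)
qed

lemma fejer_prod_join:
  "fejer_prod n (2 * d) (\<lambda>j. w j - join d x y j)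
    = fejer_prod n d (\<lambda>j. w j - x j) * fejer_prod n d (\<lambda>j. w (j + d) - y j)"
  unfolding fejer_prod_def prod_double_range
  by (intro arg_cong2[where f=times] prod.cong) (auto simp: join_def)

text \<open>
  For \<open>n \<le> N\<close> the mean over the grid of \<open>x\<close> of the translated Fejer kernels is exactly 1, so that the grid acts like the
  integral over \<open>x\<close>. What remains in \<open>y\<close> is a product of probability densities, and duality applies.
\<close>

lemma mollify_grid_mean_le:
  assumes f: "periodic_L1 (2 * d) f" and n: "0 < n" "n \<le> N"
    and B: "mixed_norm (\<lambda>j. if j \<le> d then 1 else \<infinity>) (2 * d) f \<le> ennreal B" "0 \<le> B"
  shows "grid_mean d (\<lambda>_. N) (\<lambda>\<xi>. norm (mollify n (2 * d) f (join d \<xi> y))) \<le> B"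
proof -
  let ?T = "torus (2 * d)"
  let ?\<Psi> = "\<lambda>w. fejer_prod n d (\<lambda>j. w (j + d) - y j)"
  define \<psi> where "\<psi> j u = (if j \<le> d then 1 else ennreal (fejer n (u - y (j - d))))" for j u
  have int: "integrable ?T (\<lambda>w. norm (f w) * (fejer_prod n d (\<lambda>j. w j - \<xi> j) * ?\<Psi> w))" for \<xi>
  proof -
    have "integrable ?T (\<lambda>w. norm (f w * of_real (fejer_prod n (2 * d) (\<lambda>j. w j - join d \<xi> y j))))"
      using f by (intro integrable_norm integrable_times_bounded_periodic bounded_periodic_fejer_prod) (auto simp: periodic_L1_def)
    then show ?thesis
      by (simp add: norm_mult fejer_prod_join abs_mult fejer_prod_nonneg)
  qed
  have "norm (mollify n (2 * d) f (join d \<xi> y)) \<le> (\<integral>w. norm (f w) * (fejer_prod n d (\<lambda>j. w j - \<xi> j) * ?\<Psi> w) \<partial>?T)" for \<xi>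
  proof -
    have "norm (mollify n (2 * d) f (join d \<xi> y))
       \<le> (\<integral>w. norm (f w * of_real (fejer_prod n (2 * d) (\<lambda>j. w j - join d \<xi> y j))) \<partial>?T)"
      unfolding mollify_convolution[OF f] by (rule integral_norm_bound)
    then show ?thesis by (simp add: norm_mult fejer_prod_join abs_mult fejer_prod_nonneg)
  qed
  then have "grid_mean d (\<lambda>_. N) (\<lambda>\<xi>. norm (mollify n (2 * d) f (join d \<xi> y)))
     \<le> grid_mean d (\<lambda>_. N) (\<lambda>\<xi>. \<integral>w. norm (f w) * (fejer_prod n d (\<lambda>j. w j - \<xi> j) * ?\<Psi> w) \<partial>?T)"
    by (rule grid_mean_mono)
  also have "\<dots> = (\<integral>w. grid_mean d (\<lambda>_. N) (\<lambda>\<xi>. norm (f w) * (fejer_prod n d (\<lambda>j. w j - \<xi> j) * ?\<Psi> w)) \<partial>?T)"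
    unfolding grid_mean_def using int by simp
  also have "\<dots> = (\<integral>w. norm (f w) * ?\<Psi> w \<partial>?T)"
    by (simp only: grid_mean_cmult grid_mean_multc fejer_prod_grid_mean[OF n] mult_1)
  finally have 1: "grid_mean d (\<lambda>_. N) (\<lambda>\<xi>. norm (mollify n (2 * d) f (join d \<xi> y))) \<le> (\<integral>w. norm (f w) * ?\<Psi> w \<partial>?T)" .
  have int': "integrable ?T (\<lambda>w. norm (f w) * ?\<Psi> w)"
  proof -
    have "integrable ?T (\<lambda>w. grid_mean d (\<lambda>_. N) (\<lambda>\<xi>. norm (f w) * (fejer_prod n d (\<lambda>j. w j - \<xi> j) * ?\<Psi> w)))"
      unfolding grid_mean_def using int by simp
    then show ?thesis
      by (simp only: grid_mean_cmult grid_mean_multc fejer_prod_grid_mean[OF n] mult_1)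
  qed
  have "ennreal (\<integral>w. norm (f w) * ?\<Psi> w \<partial>?T) = (\<integral>\<^sup>+w. ennreal (norm (f w) * ?\<Psi> w) \<partial>?T)"
    by (rule nn_integral_eq_integral[symmetric, OF int']) (auto intro!: AE_I2 mult_nonneg_nonneg fejer_prod_nonneg)
  also have "\<dots> = (\<integral>\<^sup>+w. ennreal (norm (f w)) * (\<Prod>j\<in>{1..2 * d}. \<psi> j (w j)) \<partial>?T)"
  proof (rule nn_integral_cong)
    fix w
    have "(\<Prod>j\<in>{1..2 * d}. \<psi> j (w j)) = (\<Prod>j\<in>{1..d}. ennreal (fejer n (w (j + d) - y j)))"
      unfolding prod_double_range by (simp add: \<psi>_def)
    also have "\<dots> = ennreal (?\<Psi> w)"
      unfolding fejer_prod_def by (rule prod_ennreal) (simp add: fejer_nonneg)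
    finally show "ennreal (norm (f w) * ?\<Psi> w) = ennreal (norm (f w)) * (\<Prod>j\<in>{1..2 * d}. \<psi> j (w j))"
      by (simp add: ennreal_mult fejer_prod_nonneg)
  qed
  also have "\<dots> \<le> mixed_norm (\<lambda>j. if j \<le> d then 1 else \<infinity>) (2 * d) f"
  proof (rule nn_integral_le_mixed_norm[OF periodic_L1_measurable[OF f]])
    fix j
    have "(\<lambda>u. fejer n (u - y (j - d))) \<in> borel_measurable borel"
      using measurable_compose[of "\<lambda>u. u - y (j - d)" borel borel "fejer n" borel] fejer_measurable by simp
    then show "\<psi> j \<in> borel_measurable borel" unfolding \<psi>_def[abs_def] by (cases "j \<le> d") auto
    show "(\<integral>\<^sup>+u. \<psi> j u \<partial>circle) = 1"
      using fejer_nn_integral[OF n(1)] circle.emeasure_space_1 by (cases "j \<le> d") (auto simp: \<psi>_def)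
    show "(if j \<le> d then 1 else \<infinity>) = (1::ennreal) \<and> \<psi> j = (\<lambda>_. 1) \<or> (if j \<le> d then 1 else \<infinity>) = (\<infinity>::ennreal)"
      by (cases "j \<le> d") (auto simp: \<psi>_def)
  qed
  also have "\<dots> \<le> ennreal B" by (rule B)
  finally have "(\<integral>w. norm (f w) * ?\<Psi> w \<partial>?T) \<le> B" using B(2) by (simp add: ennreal_le_iff)
  with 1 show ?thesis by linarith
qed

lemma H_class_D:
  assumes "K \<in> H_class l r d 1 \<infinity>"
  shows "K \<in> borel_measurable (torus (2 * d))" "periodic (2 * d) K"
    "\<And>e t. e \<subseteq> {1..2 * d} \<Longrightarrow> mixed_norm (\<lambda>j. if j \<le> d then 1 else \<infinity>) (2 * d) (mixed_difference l t e K)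
        \<le> ennreal (\<Prod>j\<in>e. \<bar>t j\<bar> powr r)"
    "mixed_norm (\<lambda>j. if j \<le> d then 1 else \<infinity>) (2 * d) K \<le> 1"
proof -
  show m: "K \<in> borel_measurable (torus (2 * d))" "periodic (2 * d) K"
    "\<And>e t. e \<subseteq> {1..2 * d} \<Longrightarrow> mixed_norm (\<lambda>j. if j \<le> d then 1 else \<infinity>) (2 * d) (mixed_difference l t e K)
        \<le> ennreal (\<Prod>j\<in>e. \<bar>t j\<bar> powr r)"
    using assms unfolding H_class_def mixed_Lp_def Let_def mem_Collect_eq by blast+
  show "mixed_norm (\<lambda>j. if j \<le> d then 1 else \<infinity>) (2 * d) K \<le> 1"
    using m(3)[of "{}"] by (simp add: mixed_difference_def)
qed

lemma nn_integral_norm_le_mixed_norm: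
  assumes "f \<in> borel_measurable (torus (2 * d))"
  shows "(\<integral>\<^sup>+z. ennreal (norm (f z)) \<partial>torus (2 * d)) \<le> mixed_norm (\<lambda>j. if j \<le> d then 1 else \<infinity>) (2 * d) f"
  using nn_integral_le_mixed_norm[OF assms, of "\<lambda>_ _. 1" "\<lambda>j. if j \<le> d then 1 else \<infinity>"]
    circle.emeasure_space_1 by simp

lemma H_class_periodic_L1:
  assumes "K \<in> H_class l r d 1 \<infinity>"
  shows "periodic_L1 (2 * d) K"
proof -
  have "(\<integral>\<^sup>+z. ennreal (norm (K z)) \<partial>torus (2 * d)) \<le> 1"
    using nn_integral_norm_le_mixed_norm[OF H_class_D(1)[OF assms]] H_class_D(4)[OF assms] by (rule order.trans)
  also have "\<dots> < \<infinity>" by simp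
  finally show ?thesis using H_class_D(1,2)[OF assms] by (auto simp: periodic_L1_def intro!: integrableI_bounded)
qed

text \<open>
  Mollification commutes with the mixed differences.
\<close>

lemma mollify_smooth_kernel:
  assumes "K \<in> H_class l r d 1 \<infinity>" "0 < n" "n \<le> L"
  shows "smooth_kernel l r d 1 L (mollified_coeff n (2 * d) K)"
  unfolding smooth_kernel_def discrete_class_def
proof (intro exI[of _ n] allI impI)
  fix N e t y assume N: "n \<le> N" and e: "e \<subseteq> {1..2 * d}"
  have K: "periodic_L1 (2 * d) K" by (rule H_class_periodic_L1[OF assms(1)])
  show "grid_mean d (\<lambda>_. N) (\<lambda>\<xi>. norm (mixed_difference l t e (trig_kernel (2 * d) L (mollified_coeff n (2 * d) K)) (join d \<xi> y)))
      \<le> 1 * (\<Prod>j\<in>e. \<bar>t j\<bar> powr r)"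
    unfolding mollify_trig_kernel[OF K assms(3), symmetric] mollify_mixed_difference[OF K e, symmetric] mult_1
    by (rule mollify_grid_mean_le[OF periodic_L1_mixed_difference[OF e K] assms(2) N H_class_D(3)[OF assms(1) e]])
       (auto intro: prod_nonneg)
qed

section \<open>Marchaud's inequality in L1\<close>

definition L1 :: "nat \<Rightarrow> ((nat \<Rightarrow> real) \<Rightarrow> complex) \<Rightarrow> real"
  where "L1 v f = (\<integral>z. norm (f z) \<partial>torus v)"

lemma L1_nonneg: "0 \<le> L1 v f"
  by (simp add: L1_def)

lemma L1_cong: "(\<And>z. z \<in> PiE {1..v} (\<lambda>_. UNIV) \<Longrightarrow> f z = g z) \<Longrightarrow> L1 v f = L1 v g"
  unfolding L1_def by (intro Bochner_Integration.integral_cong) (auto simp: space_torus)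

lemma L1_add_le: "periodic_L1 v f \<Longrightarrow> periodic_L1 v g \<Longrightarrow> L1 v (\<lambda>z. f z + g z) \<le> L1 v f + L1 v g"
proof -
  assume fg: "periodic_L1 v f" "periodic_L1 v g"
  have "L1 v (\<lambda>z. f z + g z) \<le> (\<integral>z. norm (f z) + norm (g z) \<partial>torus v)"
    unfolding L1_def
    by (rule integral_mono) (use fg in \<open>auto simp: periodic_L1_def intro: norm_triangle_ineq\<close>)
  also have "\<dots> = L1 v f + L1 v g"
    unfolding L1_def using fg by (intro Bochner_Integration.integral_add) (auto simp: periodic_L1_def)
  finally show ?thesis .
qed

lemma L1_cmult: "L1 v (\<lambda>z. c * f z) = norm c * L1 v f"
  by (simp add: L1_def norm_mult)

lemma L1_diff_le: "periodic_L1 v f \<Longrightarrow> periodic_L1 v g \<Longrightarrow> L1 v (\<lambda>z. f z - g z) \<le> L1 v f + L1 v g"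
  using L1_add_le[of v f "\<lambda>z. - 1 * g z"] periodic_L1_cmult[of v g "- 1"] L1_cmult[of v "- 1" g] by simp

lemma L1_shift:
  assumes "periodic_L1 v f"
  shows "L1 v (\<lambda>z. f (torus_shift v c z)) = L1 v f"
proof -
  have "(\<integral>z. complex_of_real (norm (f (torus_shift v c z))) \<partial>torus v) = (\<integral>z. complex_of_real (norm (f z)) \<partial>torus v)"
    by (rule integral_torus_shift[of v "\<lambda>z. complex_of_real (norm (f z))"])
       (use assms periodic_L1_measurable[OF assms] in \<open>auto simp: periodic_L1_def periodic_def\<close>)
  then show ?thesis by (simp add: L1_def)
qed

lemma L1_coordinate_shift:
  assumes "periodic_L1 v f" "j \<in> {1..v}"
  shows "L1 v (\<lambda>z. f (z(j := z j + s))) = L1 v f"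
  using L1_cong[of v "\<lambda>z. f (z(j := z j + s))" "\<lambda>z. f (torus_shift v ((\<lambda>_. 0)(j := s)) z)"]
    coordinate_shift[OF _ assms(2)] L1_shift[OF assms(1)] by simp

lemma L1_difference_le:
  assumes "periodic_L1 v f" "j \<in> {1..v}"
  shows "L1 v (difference j s f) \<le> 2 * L1 v f"
  unfolding difference_def
  using L1_diff_le[OF periodic_L1_coordinate_shift[OF assms] assms(1), of s] L1_coordinate_shift[OF assms, of s] by simp

lemma L1_difference_power_le:
  assumes "periodic_L1 v f" "j \<in> {1..v}"
  shows "L1 v ((difference j s ^^ m) f) \<le> 2 ^ m * L1 v f"
proof (induction m)
  case (Suc m)
  have "L1 v ((difference j s ^^ Suc m) f) \<le> 2 * L1 v ((difference j s ^^ m) f)"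
    using L1_difference_le[OF periodic_L1_difference_power[OF assms] assms(2)] by simp
  with Suc show ?case by simp
qed simp

text \<open>
  The symbol \<open>z + 1\<close> next to the symbol \<open>z - 1\<close> of the difference; \<open>z\<^sup>2 - 1 = (z - 1) * (z + 1)\<close> is the reason for its use.
\<close>

definition shift_sum :: "nat \<Rightarrow> real \<Rightarrow> ((nat \<Rightarrow> real) \<Rightarrow> complex) \<Rightarrow> (nat \<Rightarrow> real) \<Rightarrow> complex"
  where "shift_sum j s f = (\<lambda>z. f (z(j := z j + s)) + f z)"

lemma difference_double: "difference j (2 * s) f = difference j s (shift_sum j s f)"
  by (auto simp: difference_def shift_sum_def algebra_simps)

lemma shift_sum_difference: "shift_sum j s (difference j s f) = difference j s (shift_sum j s f)"
  by (auto simp: difference_def shift_sum_def)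

lemma shift_sum_power_difference:
  "(shift_sum j s ^^ m) (difference j s f) = difference j s ((shift_sum j s ^^ m) f)"
  by (induction m) (auto simp: shift_sum_difference)

lemma difference_double_power:
  "(difference j (2 * s) ^^ m) f = (shift_sum j s ^^ m) ((difference j s ^^ m) f)"
proof (induction m)
  case (Suc m)
  have "(difference j (2 * s) ^^ Suc m) f = difference j (2 * s) ((shift_sum j s ^^ m) ((difference j s ^^ m) f))"
    using Suc by simp
  also have "\<dots> = difference j s (shift_sum j s ((shift_sum j s ^^ m) ((difference j s ^^ m) f)))"
    by (rule difference_double)
  also have "\<dots> = (shift_sum j s ^^ Suc m) (difference j s ((difference j s ^^ m) f))"
    by (simp only: shift_sum_power_difference) simp
  finally show ?case by simp
qed simp

lemma periodic_L1_shift_sum: "periodic_L1 v f \<Longrightarrow> j \<in> {1..v} \<Longrightarrow> periodic_L1 v (shift_sum j s f)"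
  unfolding shift_sum_def by (intro periodic_L1_add periodic_L1_coordinate_shift)

lemma periodic_L1_shift_sum_power: "periodic_L1 v f \<Longrightarrow> j \<in> {1..v} \<Longrightarrow> periodic_L1 v ((shift_sum j s ^^ m) f)"
  by (induction m) (auto intro: periodic_L1_shift_sum)

text \<open>
  The operator \<open>(shift + Id) ^ m - 2 ^ m * Id\<close> is divisible by \<open>shift - Id\<close>, with a quotient of norm at most
  \<open>m * 2 ^ m\<close>.
\<close>

lemma shift_sum_power_approx:
  assumes "periodic_L1 v h" "j \<in> {1..v}"
  shows "L1 v (\<lambda>z. (shift_sum j s ^^ m) h z - 2 ^ m * h z) \<le> real m * 2 ^ m * L1 v (difference j s h)"
proof (induction m)
  case 0
  show ?case by (simp add: L1_def)
next
  case (Suc m)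
  let ?u = "\<lambda>z. (shift_sum j s ^^ m) h z - 2 ^ m * h z"
  have u: "periodic_L1 v ?u" by (intro periodic_L1_diff periodic_L1_cmult periodic_L1_shift_sum_power assms)
  have D: "periodic_L1 v (difference j s h)" by (rule periodic_L1_difference[OF assms])
  have "(\<lambda>z. (shift_sum j s ^^ Suc m) h z - 2 ^ Suc m * h z) = (\<lambda>z. (?u (z(j := z j + s)) + ?u z) + 2 ^ m * difference j s h z)"
    by (auto simp: shift_sum_def difference_def algebra_simps)
  then have "L1 v (\<lambda>z. (shift_sum j s ^^ Suc m) h z - 2 ^ Suc m * h z)
      \<le> L1 v (\<lambda>z. ?u (z(j := z j + s)) + ?u z) + L1 v (\<lambda>z. 2 ^ m * difference j s h z)"
    using L1_add_le[OF periodic_L1_add[OF periodic_L1_coordinate_shift[OF u assms(2)] u] periodic_L1_cmult[OF D, of "2 ^ m"]] by simp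
  also have "\<dots> \<le> (L1 v ?u + L1 v ?u) + 2 ^ m * L1 v (difference j s h)"
  proof (rule add_mono)
    have "L1 v (\<lambda>z. ?u (z(j := z j + s)) + ?u z) \<le> L1 v (\<lambda>z. ?u (z(j := z j + s))) + L1 v ?u"
      by (rule L1_add_le[OF periodic_L1_coordinate_shift[OF u assms(2)] u])
    also have "L1 v (\<lambda>z. ?u (z(j := z j + s))) = L1 v ?u" by (rule L1_coordinate_shift[OF u assms(2)])
    finally show "L1 v (\<lambda>z. ?u (z(j := z j + s)) + ?u z) \<le> L1 v ?u + L1 v ?u" .
  qed (simp add: L1_cmult norm_power)
  also have "\<dots> \<le> 2 * (real m * 2 ^ m * L1 v (difference j s h)) + 2 ^ Suc m * L1 v (difference j s h)"
  proof (rule add_mono)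
    show "L1 v ?u + L1 v ?u \<le> 2 * (real m * 2 ^ m * L1 v (difference j s h))" using Suc by simp
    show "2 ^ m * L1 v (difference j s h) \<le> 2 ^ Suc m * L1 v (difference j s h)"
      by (intro mult_right_mono L1_nonneg) simp
  qed
  also have "\<dots> = real (Suc m) * 2 ^ Suc m * L1 v (difference j s h)" by (simp add: algebra_simps)
  finally show ?case .
qed

text \<open>
  A difference with the doubled step is the difference with the step \<open>s\<close> followed by \<open>(shift + Id) ^ m\<close>, which is close to
  \<open>2 ^ m\<close> up to a further difference.
\<close>

lemma marchaud_step:
  assumes "periodic_L1 v f" "j \<in> {1..v}"
  shows "2 ^ m * L1 v ((difference j s ^^ m) f)
      \<le> L1 v ((difference j (2 * s) ^^ m) f) + real m * 2 ^ m * L1 v ((difference j s ^^ Suc m) f)"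
proof -
  let ?h = "(difference j s ^^ m) f"
  have h: "periodic_L1 v ?h" by (rule periodic_L1_difference_power[OF assms])
  let ?A = "(shift_sum j s ^^ m) ?h"
  have A: "periodic_L1 v ?A" by (rule periodic_L1_shift_sum_power[OF h assms(2)])
  have "2 ^ m * L1 v ?h = L1 v (\<lambda>z. 2 ^ m * ?h z)" by (simp add: L1_cmult norm_power)
  also have "\<dots> = L1 v (\<lambda>z. ?A z - (?A z - 2 ^ m * ?h z))" by simp
  also have "\<dots> \<le> L1 v ?A + L1 v (\<lambda>z. ?A z - 2 ^ m * ?h z)"
    by (intro L1_diff_le periodic_L1_diff periodic_L1_cmult A h)
  also have "\<dots> \<le> L1 v ?A + real m * 2 ^ m * L1 v (difference j s ?h)"
    by (intro add_left_mono shift_sum_power_approx h assms(2))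
  finally show ?thesis by (simp add: difference_double_power)
qed

text \<open>
  Iterate \<open>marchaud_step\<close>: doubling the step increases \<open>sqrt \<bar>s\<bar>\<close> by the factor \<open>sqrt 2 < 2\<close>, so that the recursion contracts
  and the trivial bound for the first term disappears in the limit.
\<close>

lemma lower_order_modulus:
  assumes f: "periodic_L1 v f" "j \<in> {1..v}" and m: "1 \<le> m" and C: "0 \<le> C"
    and bound: "\<And>s. L1 v ((difference j s ^^ Suc m) f) \<le> C * sqrt \<bar>s\<bar>"
  shows "L1 v ((difference j s ^^ m) f) \<le> 4 * (real m * C) * sqrt \<bar>s\<bar>"
proof -
  let ?\<eta> = "\<lambda>s. L1 v ((difference j s ^^ m) f)"
  have rec: "?\<eta> s \<le> ?\<eta> (2 * s) / 2 + real m * C * sqrt \<bar>s\<bar>" for s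
  proof -
    have "2 ^ m * ?\<eta> s \<le> ?\<eta> (2 * s) + real m * 2 ^ m * (C * sqrt \<bar>s\<bar>)"
      using marchaud_step[OF f, where m=m and s=s] mult_left_mono[OF bound[of s], of "real m * 2 ^ m"] by simp
    then have "?\<eta> s \<le> ?\<eta> (2 * s) / 2 ^ m + real m * (C * sqrt \<bar>s\<bar>)" by (simp add: field_simps)
    also have "?\<eta> (2 * s) / 2 ^ m \<le> ?\<eta> (2 * s) / 2 ^ 1"
      using m L1_nonneg by (intro divide_left_mono power_increasing) auto
    finally show ?thesis by simp
  qed
  let ?B = "2 ^ m * L1 v f"
  have iter: "?\<eta> s \<le> ?B / 2 ^ k + 4 * (real m * C) * sqrt \<bar>s\<bar>" for k s
  proof (induction k arbitrary: s)
    case 0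
    have "0 \<le> 4 * (real m * C) * sqrt \<bar>s\<bar>" using C by simp
    then show ?case
      unfolding power_0 div_by_1 by (rule add_increasing2[OF _ L1_difference_power_le[OF f]])
  next
    case (Suc k)
    have "?\<eta> s \<le> (?B / 2 ^ k + 4 * (real m * C) * sqrt \<bar>2 * s\<bar>) / 2 + real m * C * sqrt \<bar>s\<bar>"
      by (rule order.trans[OF rec add_right_mono[OF divide_right_mono[OF Suc.IH]]]) simp
    also have "sqrt \<bar>2 * s\<bar> \<le> 3 / 2 * sqrt \<bar>s\<bar>"
    proof -
      have "sqrt 2 \<le> 3 / 2" by (rule real_le_lsqrt) (auto simp: power2_eq_square)
      then show ?thesis unfolding abs_mult real_sqrt_mult abs_numeral by (intro mult_right_mono) auto
    qed
    also have "(?B / 2 ^ k + 4 * (real m * C) * (3 / 2 * sqrt \<bar>s\<bar>)) / 2 + real m * C * sqrt \<bar>s\<bar>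
        = ?B / 2 ^ Suc k + 4 * (real m * C) * sqrt \<bar>s\<bar>" by (simp add: field_simps)
    finally show ?case using C by (simp add: mult_left_mono)
  qed
  have "(\<lambda>k. ?B * (1 / 2) ^ k + 4 * (real m * C) * sqrt \<bar>s\<bar>) \<longlonglongrightarrow> ?B * 0 + 4 * (real m * C) * sqrt \<bar>s\<bar>"
    by (intro tendsto_intros LIMSEQ_power_zero) auto
  then have "(\<lambda>k. ?B * (1 / 2) ^ k + 4 * (real m * C) * sqrt \<bar>s\<bar>) \<longlonglongrightarrow> 4 * (real m * C) * sqrt \<bar>s\<bar>"
    by simp
  moreover have "?\<eta> s \<le> ?B * (1 / 2) ^ k + 4 * (real m * C) * sqrt \<bar>s\<bar>" for k
    using iter[of s k] by (simp add: power_one_over)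
  ultimately show ?thesis by (intro LIMSEQ_le_const) auto
qed

lemma first_order_modulus:
  assumes f: "periodic_L1 v f" "j \<in> {1..v}" and l: "1 \<le> l" and C: "0 \<le> C"
    and bound: "\<And>s. L1 v ((difference j s ^^ l) f) \<le> C * sqrt \<bar>s\<bar>"
  shows "\<exists>C'\<ge>0. \<forall>s. L1 v (difference j s f) \<le> C' * sqrt \<bar>s\<bar>"
  using l C bound
proof (induction l arbitrary: C rule: dec_induct)
  case base
  then show ?case by auto
next
  case (step m)
  have "0 \<le> 4 * (real m * C)" using step.prems(1) by simp
  moreover have "L1 v ((difference j s ^^ m) f) \<le> 4 * (real m * C) * sqrt \<bar>s\<bar>" for s
    by (rule lower_order_modulus[OF f step.hyps(1) step.prems(1) step.prems(2)])
  ultimately show ?case by (rule step.IH)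
qed

text \<open>
  The order \<open>1 / 2\<close> is an arbitrary choice below 1: at the order 1 the iteration would produce a logarithm.
\<close>

lemma H_class_modulus:
  assumes K: "K \<in> H_class l r d 1 \<infinity>" and j: "j \<in> {1..2 * d}" and r: "1 < r" and l: "1 \<le> l"
  shows "\<exists>C\<ge>0. \<forall>s. L1 (2 * d) (difference j s K) \<le> C * sqrt \<bar>s\<bar>"
proof (rule first_order_modulus[OF H_class_periodic_L1[OF K] j l])
  have g: "periodic_L1 (2 * d) K" by (rule H_class_periodic_L1[OF K])
  have norm1: "ennreal (L1 (2 * d) f) \<le> mixed_norm (\<lambda>j. if j \<le> d then 1 else \<infinity>) (2 * d) f" if "periodic_L1 (2 * d) f" for f
  proof -
    have "ennreal (L1 (2 * d) f) = (\<integral>\<^sup>+z. ennreal (norm (f z)) \<partial>torus (2 * d))"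
      unfolding L1_def using that by (intro nn_integral_eq_integral[symmetric]) (auto simp: periodic_L1_def)
    then show ?thesis using nn_integral_norm_le_mixed_norm[OF periodic_L1_measurable[OF that]] by simp
  qed
  have K1: "L1 (2 * d) K \<le> 1"
    using order.trans[OF norm1[OF g] H_class_D(4)[OF K]] by simp
  show "0 \<le> (2::real) ^ l" by simp
  fix s
  have eq: "mixed_difference l (\<lambda>_. s) {j} K = (difference j s ^^ l) K" by (simp add: mixed_difference_def)
  have small: "L1 (2 * d) ((difference j s ^^ l) K) \<le> \<bar>s\<bar> powr r"
    using order.trans[OF norm1[OF periodic_L1_difference_power[OF g j]] H_class_D(3)[OF K, of "{j}" "\<lambda>_. s", unfolded eq]] j
    by simp
  have large: "L1 (2 * d) ((difference j s ^^ l) K) \<le> 2 ^ l"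
    using order.trans[OF L1_difference_power_le[OF g j] mult_left_mono[OF K1]] by simp
  show "L1 (2 * d) ((difference j s ^^ l) K) \<le> 2 ^ l * sqrt \<bar>s\<bar>"
  proof (cases "\<bar>s\<bar> \<le> 1")
    case True
    have "\<bar>s\<bar> powr r \<le> \<bar>s\<bar> powr (1 / 2)" using r True by (intro powr_mono') auto
    also have "\<dots> = 1 * sqrt \<bar>s\<bar>" by (simp add: powr_half_sqrt)
    also have "\<dots> \<le> 2 ^ l * sqrt \<bar>s\<bar>" by (intro mult_right_mono) auto
    finally show ?thesis using small by linarith
  next
    case False
    then have "2 ^ l * 1 \<le> 2 ^ l * sqrt \<bar>s\<bar>" by (intro mult_left_mono) auto
    then show ?thesis using large by linarith
  qed
qed

text \<open>
  Shift one coordinate after another.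
\<close>

lemma L1_shift_diff_le:
  assumes f: "periodic_L1 v f" and S: "S \<subseteq> {1..v}"
  shows "L1 v (\<lambda>z. f (torus_shift v (\<lambda>i. if i \<in> S then w i else 0) z) - f z) \<le> (\<Sum>j\<in>S. L1 v (difference j (w j) f))"
  using finite_subset[OF S finite_atLeastAtMost] S
proof (induction S rule: finite_induct)
  case empty
  have "L1 v (\<lambda>z. f (torus_shift v (\<lambda>i. if i \<in> {} then w i else 0) z) - f z) = L1 v (\<lambda>_. 0)"
  proof (rule L1_cong)
    fix z assume "z \<in> PiE {1..v} (\<lambda>_. UNIV :: real set)"
    then have "torus_shift v (\<lambda>i. if i \<in> {} then w i else 0) z = z"
      by (auto simp: torus_shift_def PiE_iff extensional_def)
    then show "f (torus_shift v (\<lambda>i. if i \<in> {} then w i else 0) z) - f z = 0" by simp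
  qed
  then show ?case by (simp add: L1_def)
next
  case (insert j S)
  let ?c = "\<lambda>S i. if i \<in> S then w i else 0"
  have j: "j \<in> {1..v}" using insert.prems by auto
  have D: "periodic_L1 v (difference j (w j) f)" by (rule periodic_L1_difference[OF f j])
  have "(\<lambda>z. f (torus_shift v (?c (insert j S)) z) - f z)
      = (\<lambda>z. difference j (w j) f (torus_shift v (?c S) z) + (f (torus_shift v (?c S) z) - f z))"
  proof
    fix z
    have "torus_shift v (?c (insert j S)) z = (torus_shift v (?c S) z)(j := torus_shift v (?c S) z j + w j)"
      using insert.hyps j by (auto simp: torus_shift_def)
    then show "f (torus_shift v (?c (insert j S)) z) - f z
       = difference j (w j) f (torus_shift v (?c S) z) + (f (torus_shift v (?c S) z) - f z)"
      by (simp add: difference_def)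
  qed
  then have "L1 v (\<lambda>z. f (torus_shift v (?c (insert j S)) z) - f z)
      \<le> L1 v (\<lambda>z. difference j (w j) f (torus_shift v (?c S) z)) + L1 v (\<lambda>z. f (torus_shift v (?c S) z) - f z)"
    using L1_add_le[OF periodic_L1_shift[OF D] periodic_L1_diff[OF periodic_L1_shift[OF f] f]] by simp
  also have "\<dots> \<le> L1 v (difference j (w j) f) + (\<Sum>j\<in>S. L1 v (difference j (w j) f))"
    using insert.IH insert.prems L1_shift[OF D] by simp
  finally show ?case using insert.hyps by simp
qed

corollary L1_torus_shift_diff_le:
  assumes f: "periodic_L1 v f"
  shows "L1 v (\<lambda>z. f (torus_shift v w z) - f z) \<le> (\<Sum>j\<in>{1..v}. L1 v (difference j (w j) f))"
proof -
  have "torus_shift v (\<lambda>i. if i \<in> {1..v} then w i else 0) z = torus_shift v w z" for z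
    by (auto simp: torus_shift_def)
  then show ?thesis using L1_shift_diff_le[OF f order.refl, of w] by simp
qed

lemma L1_difference_periodic:
  assumes f: "periodic_L1 v f" "j \<in> {1..v}"
  shows "L1 v (difference j (u - 2 * pi) f) = L1 v (difference j u f)"
proof (rule L1_cong)
  fix z assume z: "z \<in> PiE {1..v} (\<lambda>_. UNIV :: real set)"
  have "f ((z(j := z j + u))(j := (z(j := z j + u)) j + 2 * pi * of_int (- 1))) = f (z(j := z j + u))"
    using f z by (intro periodic_shift_int[of v] upd_in_PiE) (auto simp: periodic_L1_def)
  then show "difference j (u - 2 * pi) f z = difference j u f z" by (simp add: difference_def algebra_simps)
qed

text \<open>
  A substitute for Hoelder's inequality that reduces the modulus \<open>sqrt\<close> to the second moment of the Fejer kernel.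
\<close>

lemma sqrt_split:
  assumes "0 < \<epsilon>" "0 \<le> m"
  shows "sqrt m \<le> \<epsilon> + m\<^sup>2 / \<epsilon> ^ 3"
proof (cases "sqrt m \<le> \<epsilon>")
  case True
  then show ?thesis using assms by (simp add: add_increasing2)
next
  case False
  define x where "x = sqrt m"
  have x: "\<epsilon> < x" "m = x\<^sup>2" using False assms by (auto simp: x_def)
  have "x * \<epsilon> ^ 3 \<le> x * x ^ 3" using x assms by (intro mult_left_mono power_mono) auto
  then have "x \<le> x ^ 4 / \<epsilon> ^ 3" using assms by (simp add: pos_le_divide_eq power_numeral_reduce)
  then show ?thesis using assms x by (simp add: x_def[symmetric] power_mult[symmetric])
qed

text \<open>
  Split the square root by \<open>sqrt_split\<close>; the kernel has mean 1 and its product with the square of the distance to 0 on the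
  circle is at most \<open>16 / n\<close>.
\<close>

lemma fejer_modulus_integral:
  assumes n: "0 < n" and \<epsilon>: "0 < \<epsilon>" and C: "0 \<le> C"
  shows "(\<integral>\<^sup>+u. ennreal (fejer n u * (C * sqrt (min \<bar>u\<bar> \<bar>u - 2 * pi\<bar>))) \<partial>circle)
      \<le> ennreal (C * (\<epsilon> + 16 / (real n * \<epsilon> ^ 3)))"
proof -
  let ?b = "\<lambda>u. C * sqrt (min \<bar>u\<bar> \<bar>u - 2 * pi\<bar>)"
  have point: "fejer n u * ?b u \<le> C * (\<epsilon> * fejer n u + 16 / (real n * \<epsilon> ^ 3))" if "\<bar>t\<bar> \<le> pi" "fejer n t = fejer n u" "?b u \<le> C * sqrt \<bar>t\<bar>" for u t
  proof -
    have "fejer n u * ?b u \<le> fejer n t * (C * sqrt \<bar>t\<bar>)"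
      unfolding that(2)[symmetric] by (intro mult_left_mono that(3) fejer_nonneg)
    also have "\<dots> \<le> fejer n t * (C * (\<epsilon> + \<bar>t\<bar>\<^sup>2 / \<epsilon> ^ 3))"
      using sqrt_split[OF \<epsilon>, of "\<bar>t\<bar>"] C fejer_nonneg by (intro mult_left_mono) auto
    also have "\<dots> = C * (\<epsilon> * fejer n t + (fejer n t * t\<^sup>2) / \<epsilon> ^ 3)" by (simp add: algebra_simps)
    also have "\<dots> \<le> C * (\<epsilon> * fejer n t + (16 / real n) / \<epsilon> ^ 3)"
      using fejer_decay[OF n that(1)] C \<epsilon> by (intro mult_left_mono add_left_mono divide_right_mono) auto
    finally show ?thesis using that by simp
  qed
  have "AE u in circle. u \<in> {0..2 * pi}"
    by (rule AE_uniform_measureI) auto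
  then have "(\<integral>\<^sup>+u. ennreal (fejer n u * ?b u) \<partial>circle)
      \<le> (\<integral>\<^sup>+u. ennreal (C * (\<epsilon> * fejer n u + 16 / (real n * \<epsilon> ^ 3))) \<partial>circle)"
  proof (intro nn_integral_mono_AE, eventually_elim)
    case (elim u)
    show "ennreal (fejer n u * ?b u) \<le> ennreal (C * (\<epsilon> * fejer n u + 16 / (real n * \<epsilon> ^ 3)))"
    proof (cases "u \<le> pi")
      case True
      then show ?thesis using elim C by (intro ennreal_leI point[of u u] mult_left_mono) auto
    next
      case False
      then show ?thesis using elim C fejer_periodic[of n u "- 1"]
        by (intro ennreal_leI point[of "u - 2 * pi" u] mult_left_mono) auto
    qed
  qed
  also have "\<dots> = ennreal (\<integral>u. C * (\<epsilon> * fejer n u + 16 / (real n * \<epsilon> ^ 3)) \<partial>circle)"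
  proof (rule nn_integral_eq_integral)
    show "integrable circle (\<lambda>u. C * (\<epsilon> * fejer n u + 16 / (real n * \<epsilon> ^ 3)))"
      using fejer_integrable[of n 0] by simp
  qed (use C \<epsilon> fejer_nonneg in auto)
  also have "(\<integral>u. C * (\<epsilon> * fejer n u + 16 / (real n * \<epsilon> ^ 3)) \<partial>circle) = C * (\<epsilon> + 16 / (real n * \<epsilon> ^ 3))"
    using fejer_integrable[of n 0] fejer_integral_1[OF n] circle.prob_space by simp
  finally show ?thesis .
qed

lemma measurable_torus_shift_pair:
  "(\<lambda>p. torus_shift v (fst p) (snd p)) \<in> measurable (torus v \<Otimes>\<^sub>M torus v) (torus v)"
proof (rule measurable_torus)
  fix i assume i: "i \<in> {1..v}"
  have "(\<lambda>p. snd p i + fst p i) \<in> borel_measurable (torus v \<Otimes>\<^sub>M torus v)"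
    using measurable_compose[OF measurable_snd measurable_torus_component[OF i]]
      measurable_compose[OF measurable_fst measurable_torus_component[OF i]]
    by (intro borel_measurable_add) auto
  then show "(\<lambda>p. torus_shift v (fst p) (snd p) i) \<in> borel_measurable (torus v \<Otimes>\<^sub>M torus v)"
    using i by (simp add: torus_shift_def)
qed (rule torus_shift_PiE)

lemma torus_shift_commute: "torus_shift v z w = torus_shift v w z"
  by (auto simp: torus_shift_def)

section \<open>Uniform approximation by Fejer means\<close>

lemma bounded_periodic_trig_kernel: "bounded_periodic v (trig_kernel v L c)"
  unfolding trig_kernel_def[abs_def] by (intro bounded_periodic_sum bounded_periodic_cmult bounded_periodic_character)

lemma bounded_periodic_periodic_L1:
  assumes "bounded_periodic v f"
  shows "periodic_L1 v f"
proof -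
  interpret prob_space "torus v" by (rule prob_space_torus)
  obtain B where "\<And>x. norm (f x) \<le> B" using assms by (auto simp: bounded_periodic_def)
  then show ?thesis using assms
    by (auto simp: periodic_L1_def bounded_periodic_def intro!: integrable_const_bound[where B=B])
qed

lemma periodic_L1_mollify: "periodic_L1 v f \<Longrightarrow> periodic_L1 v (mollify n v f)"
  by (simp add: mollify_trig_kernel[OF _ order.refl] bounded_periodic_periodic_L1 bounded_periodic_trig_kernel)

lemma nn_integral_fejer_prod_times:
  assumes n: "0 < n" and j: "j \<in> {1..v}" and b: "b \<in> borel_measurable borel" "\<And>u. 0 \<le> b u"
  shows "(\<integral>\<^sup>+w. ennreal (fejer_prod n v w * b (w j)) \<partial>torus v) = (\<integral>\<^sup>+u. ennreal (fejer n u * b u) \<partial>circle)"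
proof -
  let ?g = "\<lambda>i u. ennreal (if i = j then fejer n u * b u else fejer n u)"
  have g: "?g i \<in> borel_measurable circle" for i
  proof -
    have "?g i \<in> borel_measurable borel" using fejer_measurable b(1) by (cases "i = j") auto
    then show ?thesis by (simp cong: measurable_cong_sets)
  qed
  have "(\<integral>\<^sup>+w. ennreal (fejer_prod n v w * b (w j)) \<partial>torus v) = (\<integral>\<^sup>+w. (\<Prod>i\<in>{1..v}. ?g i (w i)) \<partial>PiM {1..v} (\<lambda>_. circle))"
    unfolding torus_def
  proof (rule nn_integral_cong)
    fix w :: "nat \<Rightarrow> real"
    have "(\<Prod>i\<in>{1..v}. ?g i (w i)) = ennreal (\<Prod>i\<in>{1..v}. if i = j then fejer n (w i) * b (w i) else fejer n (w i))"
      by (rule prod_ennreal) (auto simp: fejer_nonneg b)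
    also have "(\<Prod>i\<in>{1..v}. if i = j then fejer n (w i) * b (w i) else fejer n (w i)) = fejer_prod n v w * b (w j)"
    proof -
      have "(\<Prod>i\<in>{1..v}. if i = j then fejer n (w i) * b (w i) else fejer n (w i))
         = (\<Prod>i\<in>{1..v}. fejer n (w i) * (if i = j then b (w i) else 1))"
        by (rule prod.cong) auto
      also have "\<dots> = fejer_prod n v w * b (w j)"
        unfolding prod.distrib fejer_prod_def using j by simp
      finally show ?thesis .
    qed
    finally show "ennreal (fejer_prod n v w * b (w j)) = (\<Prod>i\<in>{1..v}. ?g i (w i))" ..
  qed
  also have "\<dots> = (\<Prod>i\<in>{1..v}. \<integral>\<^sup>+u. ?g i u \<partial>circle)"
    by (rule circles.product_nn_integral_prod) (use g in auto)
  also have "\<dots> = (\<Prod>i\<in>{1..v}. if i = j then (\<integral>\<^sup>+u. ennreal (fejer n u * b u) \<partial>circle) else 1)"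
    using fejer_nn_integral[OF n, of 0] by (intro prod.cong) auto
  finally show ?thesis using j by simp
qed

lemma fejer_prod_measurable: "fejer_prod n v \<in> borel_measurable (torus v)"
proof -
  have "(\<lambda>w. complex_of_real (fejer_prod n v w)) \<in> borel_measurable (torus v)"
    using bounded_periodic_fejer_prod[of v n "\<lambda>_. 0"] by (simp add: bounded_periodic_def)
  from measurable_compose[OF this borel_measurable_Re] show ?thesis by simp
qed

lemma integral_fejer_prod:
  assumes "0 < n"
  shows "(\<integral>w. fejer_prod n v w \<partial>torus v) = 1"
proof -
  have "(\<integral>\<^sup>+w. ennreal (fejer_prod n v w) \<partial>torus v) = (\<integral>\<^sup>+w. (\<Prod>i\<in>{1..v}. ennreal (fejer n (w i))) \<partial>PiM {1..v} (\<lambda>_. circle))"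
    unfolding torus_def fejer_prod_def by (intro nn_integral_cong prod_ennreal[symmetric] fejer_nonneg)
  also have "\<dots> = (\<Prod>i\<in>{1..v}. \<integral>\<^sup>+u. ennreal (fejer n u) \<partial>circle)"
    by (rule circles.product_nn_integral_prod) (use fejer_measurable_circle[of n 0] in auto)
  also have "\<dots> = 1" using fejer_nn_integral[OF assms, of 0] by simp
  finally have "(\<integral>\<^sup>+w. ennreal (fejer_prod n v w) \<partial>torus v) = 1" .
  then show ?thesis by (subst integral_eq_nn_integral) (auto simp: fejer_prod_nonneg fejer_prod_measurable)
qed

text \<open>
  Minkowski's inequality, with the difference split into its coordinates. Steps \<open>u\<close> and \<open>u - 2 * pi\<close> are equivalent, and the smaller
  one is used.
\<close>

lemma L1_mollify_le:
  assumes f: "periodic_L1 v f" and n: "0 < n" and \<epsilon>: "0 < \<epsilon>" and C: "0 \<le> C"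
    and modulus: "\<And>j s. j \<in> {1..v} \<Longrightarrow> L1 v (difference j s f) \<le> C * sqrt \<bar>s\<bar>"
  shows "L1 v (\<lambda>z. mollify n v f z - f z) \<le> real v * (C * (\<epsilon> + 16 / (real n * \<epsilon> ^ 3)))"
proof -
  interpret T: prob_space "torus v" by (rule prob_space_torus)
  interpret TT: pair_prob_space "torus v" "torus v" ..
  let ?b = "\<lambda>u. C * sqrt (min \<bar>u\<bar> \<bar>u - 2 * pi\<bar>)"
  have b0: "0 \<le> ?b u" for u using C by simp
  have bm: "?b \<in> borel_measurable borel" by measurable
  have mod_b: "L1 v (difference j u f) \<le> ?b u" if "j \<in> {1..v}" for j u
    using modulus[OF that, of u] modulus[OF that, of "u - 2 * pi"] L1_difference_periodic[OF f that, of u]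
    by (simp add: min_def)
  let ?\<Phi> = "fejer_prod n v"
  have \<Phi>m: "?\<Phi> \<in> borel_measurable (torus v)" by (rule fejer_prod_measurable)
  have fm: "f \<in> borel_measurable (torus v)" by (rule periodic_L1_measurable[OF f])
  have m: "periodic_L1 v (\<lambda>z. mollify n v f z - f z)" by (intro periodic_L1_diff periodic_L1_mollify f)
  have point: "ennreal (norm (mollify n v f z - f z))
      \<le> (\<integral>\<^sup>+w. ennreal (norm (f (torus_shift v z w) - f z) * ?\<Phi> w) \<partial>torus v)" for z
  proof -
    have \<Phi>i: "integrable (torus v) (\<lambda>w. complex_of_real (?\<Phi> w))"
      using bounded_periodic_periodic_L1[OF bounded_periodic_fejer_prod[of v n "\<lambda>_. 0"]] by (simp add: periodic_L1_def)
    have "(\<integral>w. complex_of_real (?\<Phi> w) \<partial>torus v) = 1"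
      using integral_fejer_prod[OF n, of v] by simp
    then have "mollify n v f z - f z = mollify n v f z - (\<integral>w. f z * complex_of_real (?\<Phi> w) \<partial>torus v)" by simp
    also have "\<dots> = (\<integral>w. f (torus_shift v z w) * of_real (?\<Phi> w) - f z * complex_of_real (?\<Phi> w) \<partial>torus v)"
      unfolding mollify_def using \<Phi>i mollify_integrable[OF f]
      by (intro Bochner_Integration.integral_diff[symmetric]) auto
    finally have eq: "mollify n v f z - f z = (\<integral>w. (f (torus_shift v z w) - f z) * of_real (?\<Phi> w) \<partial>torus v)"
      by (simp only: left_diff_distrib)
    have "integrable (torus v) (\<lambda>w. (f (torus_shift v z w) - f z) * of_real (?\<Phi> w))"
      unfolding left_diff_distrib using \<Phi>i mollify_integrable[OF f] by (intro Bochner_Integration.integrable_diff) auto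
    from integral_norm_bound_ennreal[OF this] show ?thesis
      unfolding eq by (simp add: norm_mult fejer_prod_nonneg)
  qed
  have shift_m: "(\<lambda>p. f (torus_shift v (fst p) (snd p))) \<in> borel_measurable (torus v \<Otimes>\<^sub>M torus v)"
    by (rule measurable_compose[OF measurable_torus_shift_pair fm])
  have joint: "(\<lambda>(w, z). ennreal (norm (f (torus_shift v z w) - f z) * ?\<Phi> w)) \<in> borel_measurable (torus v \<Otimes>\<^sub>M torus v)"
  proof -
    have eq: "(\<lambda>(w, z). ennreal (norm (f (torus_shift v z w) - f z) * ?\<Phi> w))
        = (\<lambda>p. ennreal (norm (f (torus_shift v (fst p) (snd p)) - f (snd p)) * ?\<Phi> (fst p)))"
    proof
      fix p :: "(nat \<Rightarrow> real) \<times> (nat \<Rightarrow> real)"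
      show "(case p of (w, z) \<Rightarrow> ennreal (norm (f (torus_shift v z w) - f z) * ?\<Phi> w))
          = ennreal (norm (f (torus_shift v (fst p) (snd p)) - f (snd p)) * ?\<Phi> (fst p))"
        using torus_shift_commute[of v "snd p" "fst p"] by (simp add: case_prod_beta)
    qed
    have 1: "(\<lambda>p. f (snd p)) \<in> borel_measurable (torus v \<Otimes>\<^sub>M torus v)"
      by (rule measurable_compose[OF measurable_snd fm])
    have 2: "(\<lambda>p. ?\<Phi> (fst p)) \<in> borel_measurable (torus v \<Otimes>\<^sub>M torus v)"
      by (rule measurable_compose[OF measurable_fst \<Phi>m])
    show ?thesis
      unfolding eq by (intro measurable_compose[OF _ measurable_ennreal] borel_measurable_times
          measurable_compose[OF _ borel_measurable_norm] borel_measurable_diff shift_m 1 2)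
  qed
  have "ennreal (L1 v (\<lambda>z. mollify n v f z - f z)) = (\<integral>\<^sup>+z. ennreal (norm (mollify n v f z - f z)) \<partial>torus v)"
    unfolding L1_def using m by (intro nn_integral_eq_integral[symmetric]) (auto simp: periodic_L1_def)
  also have "\<dots> \<le> (\<integral>\<^sup>+z. \<integral>\<^sup>+w. ennreal (norm (f (torus_shift v z w) - f z) * ?\<Phi> w) \<partial>torus v \<partial>torus v)"
    by (intro nn_integral_mono point)
  also have "\<dots> = (\<integral>\<^sup>+w. \<integral>\<^sup>+z. ennreal (norm (f (torus_shift v z w) - f z) * ?\<Phi> w) \<partial>torus v \<partial>torus v)"
    by (rule TT.Fubini'[OF joint])
  also have "\<dots> \<le> (\<integral>\<^sup>+w. (\<Sum>j\<in>{1..v}. ennreal (?\<Phi> w * ?b (w j))) \<partial>torus v)"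
  proof (rule nn_integral_mono)
    fix w
    let ?h = "\<lambda>z. f (torus_shift v w z) - f z"
    have h: "periodic_L1 v ?h" by (intro periodic_L1_diff periodic_L1_shift f)
    have "(\<integral>\<^sup>+z. ennreal (norm (f (torus_shift v z w) - f z) * ?\<Phi> w) \<partial>torus v)
       = (\<integral>\<^sup>+z. ennreal (norm (?h z)) * ennreal (?\<Phi> w) \<partial>torus v)"
      by (simp only: torus_shift_commute[of v _ w] ennreal_mult[OF norm_ge_zero fejer_prod_nonneg])
    also have "\<dots> = (\<integral>\<^sup>+z. ennreal (norm (?h z)) \<partial>torus v) * ennreal (?\<Phi> w)"
      by (rule nn_integral_multc[OF measurable_compose[OF measurable_compose[OF periodic_L1_measurable[OF h]
          borel_measurable_norm] measurable_ennreal]])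
    also have "(\<integral>\<^sup>+z. ennreal (norm (?h z)) \<partial>torus v) = ennreal (L1 v ?h)"
      unfolding L1_def using h by (intro nn_integral_eq_integral) (auto simp: periodic_L1_def)
    also have "ennreal (L1 v ?h) * ennreal (?\<Phi> w) = ennreal (L1 v ?h * ?\<Phi> w)"
      by (simp only: ennreal_mult[OF L1_nonneg fejer_prod_nonneg])
    also have "\<dots> \<le> ennreal (\<Sum>j\<in>{1..v}. ?\<Phi> w * ?b (w j))"
    proof (rule ennreal_leI)
      have "L1 v ?h \<le> (\<Sum>j\<in>{1..v}. ?b (w j))"
        by (rule order.trans[OF L1_torus_shift_diff_le[OF f] sum_mono[OF mod_b]])
      then have "L1 v ?h * ?\<Phi> w \<le> (\<Sum>j\<in>{1..v}. ?b (w j)) * ?\<Phi> w"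
        by (intro mult_right_mono fejer_prod_nonneg)
      then show "L1 v ?h * ?\<Phi> w \<le> (\<Sum>j\<in>{1..v}. ?\<Phi> w * ?b (w j))"
        by (simp only: sum_distrib_right mult.commute[of "?\<Phi> w"])
    qed
    also have "\<dots> = (\<Sum>j\<in>{1..v}. ennreal (?\<Phi> w * ?b (w j)))"
      by (rule sum_ennreal[symmetric]) (intro mult_nonneg_nonneg fejer_prod_nonneg b0)
    finally show "(\<integral>\<^sup>+z. ennreal (norm (f (torus_shift v z w) - f z) * ?\<Phi> w) \<partial>torus v)
       \<le> (\<Sum>j\<in>{1..v}. ennreal (?\<Phi> w * ?b (w j)))" .
  qed
  also have "\<dots> = (\<Sum>j\<in>{1..v}. \<integral>\<^sup>+w. ennreal (?\<Phi> w * ?b (w j)) \<partial>torus v)"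
  proof (rule nn_integral_sum)
    fix j assume j: "j \<in> {1..v}"
    have "(\<lambda>w. ?b (w j)) \<in> borel_measurable (torus v)"
      by (rule measurable_compose[OF measurable_torus_component[OF j] bm])
    then show "(\<lambda>w. ennreal (?\<Phi> w * ?b (w j))) \<in> borel_measurable (torus v)" using \<Phi>m by measurable
  qed
  also have "\<dots> = (\<Sum>j\<in>{1..v}. \<integral>\<^sup>+u. ennreal (fejer n u * ?b u) \<partial>circle)"
    by (intro sum.cong refl nn_integral_fejer_prod_times[OF n _ bm b0])
  also have "\<dots> \<le> (\<Sum>j\<in>{1..v}. ennreal (C * (\<epsilon> + 16 / (real n * \<epsilon> ^ 3))))"
    by (intro sum_mono fejer_modulus_integral[OF n \<epsilon> C])
  also have "\<dots> = ennreal (real v * (C * (\<epsilon> + 16 / (real n * \<epsilon> ^ 3))))"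
    using C \<epsilon> by (subst sum_ennreal) (auto intro!: mult_nonneg_nonneg add_nonneg_nonneg)
  finally show ?thesis using C \<epsilon> by (subst (asm) ennreal_le_iff) (auto intro!: mult_nonneg_nonneg add_nonneg_nonneg)
qed

lemma mollify_L1_tendsto:
  assumes K: "K \<in> H_class l r d 1 \<infinity>" and r: "1 < r" and l: "1 \<le> l"
  shows "(\<lambda>n. L1 (2 * d) (\<lambda>z. mollify n (2 * d) K z - K z)) \<longlonglongrightarrow> 0"
proof -
  let ?V = "{1..2 * d}"
  have "\<forall>j\<in>?V. \<exists>C\<ge>0. \<forall>s. L1 (2 * d) (difference j s K) \<le> C * sqrt \<bar>s\<bar>"
    using H_class_modulus[OF K _ r l] by blast
  then obtain c where c: "\<And>j. j \<in> ?V \<Longrightarrow> 0 \<le> c j" "\<And>j s. j \<in> ?V \<Longrightarrow> L1 (2 * d) (difference j s K) \<le> c j * sqrt \<bar>s\<bar>"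
    unfolding bchoice_iff by blast
  define C where "C = (\<Sum>j\<in>?V. c j)"
  have C: "0 \<le> C" unfolding C_def by (intro sum_nonneg c)
  have modulus: "L1 (2 * d) (difference j s K) \<le> C * sqrt \<bar>s\<bar>" if "j \<in> ?V" for j s
  proof -
    have "c j \<le> C" unfolding C_def using that c(1) by (intro member_le_sum) auto
    then have "c j * sqrt \<bar>s\<bar> \<le> C * sqrt \<bar>s\<bar>" by (intro mult_right_mono) auto
    then show ?thesis using c(2)[OF that, of s] by linarith
  qed
  define A where "A = real (2 * d) * C"
  have A: "0 \<le> A" using C by (simp add: A_def)
  have bound: "L1 (2 * d) (\<lambda>z. mollify n (2 * d) K z - K z) \<le> A * (\<epsilon> + 16 / (real n * \<epsilon> ^ 3))" if "0 < n" "0 < \<epsilon>" for n \<epsilon>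
    using L1_mollify_le[OF H_class_periodic_L1[OF K] that C modulus] by (simp add: A_def mult.assoc)
  show ?thesis
  proof (rule LIMSEQ_I)
    fix e :: real assume e: "0 < e"
    define \<epsilon> where "\<epsilon> = e / (4 * (A + 1))"
    have \<epsilon>: "0 < \<epsilon>" using e A by (simp add: \<epsilon>_def)
    obtain n0 where n0: "16 / \<epsilon> ^ 4 < real n0" using reals_Archimedean2 by blast
    have "norm (L1 (2 * d) (\<lambda>z. mollify n (2 * d) K z - K z) - 0) < e" if n: "max 1 n0 \<le> n" for n
    proof -
      have n': "0 < real n" "16 / \<epsilon> ^ 4 < real n" using n n0 by auto
      have "16 < real n * \<epsilon> ^ 4" using n'(2) \<epsilon> by (simp add: pos_divide_less_eq)
      then have "16 \<le> \<epsilon> * (real n * \<epsilon> ^ 3)" by (simp add: power_numeral_reduce mult_ac)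
      then have "16 / (real n * \<epsilon> ^ 3) \<le> \<epsilon>" using n'(1) \<epsilon> by (simp add: pos_divide_le_eq)
      then have "A * (\<epsilon> + 16 / (real n * \<epsilon> ^ 3)) \<le> A * (\<epsilon> + \<epsilon>)" using A by (intro mult_left_mono) auto
      also have "\<dots> \<le> (A + 1) * (2 * \<epsilon>)" using \<epsilon> A by (simp add: algebra_simps)
      also have "\<dots> = e / 2"
      proof -
        have "A + 1 \<noteq> 0" using A by simp
        then show ?thesis unfolding \<epsilon>_def by (simp add: divide_simps)
      qed
      also have "\<dots> < e" using e by simp
      finally show ?thesis using bound[of n \<epsilon>] n \<epsilon> L1_nonneg[of "2 * d" "\<lambda>z. mollify n (2 * d) K z - K z"] by simp
    qed
    then show "\<exists>no. \<forall>n\<ge>no. norm (L1 (2 * d) (\<lambda>z. mollify n (2 * d) K z - K z) - 0) < e" by blast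
  qed
qed

lemma grid_mean_add: "grid_mean d N (\<lambda>\<xi>. f \<xi> + g \<xi>) = grid_mean d N f + grid_mean d N g"
  by (simp add: grid_mean_def sum.distrib add_divide_distrib)

lemma trig_kernel_diff: "trig_kernel v L (\<lambda>a. c a - c' a) z = trig_kernel v L c z - trig_kernel v L c' z"
  by (simp add: trig_kernel_def left_diff_distrib sum_subtractf)

lemma smooth_kernel_diff:
  assumes "smooth_kernel l r d B L c" "smooth_kernel l r d B' L c'"
  shows "smooth_kernel l r d (B + B') L (\<lambda>a. c a - c' a)"
proof -
  obtain N1 where N1: "\<And>N. N1 \<le> N \<Longrightarrow> discrete_class l r d N B (trig_kernel (2 * d) L c)"
    using assms(1) by (auto simp: smooth_kernel_def)
  obtain N2 where N2: "\<And>N. N2 \<le> N \<Longrightarrow> discrete_class l r d N B' (trig_kernel (2 * d) L c')"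
    using assms(2) by (auto simp: smooth_kernel_def)
  have "discrete_class l r d N (B + B') (trig_kernel (2 * d) L (\<lambda>a. c a - c' a))" if "max N1 N2 \<le> N" for N
    unfolding discrete_class_def
  proof (intro allI impI)
    fix e t y assume e: "e \<subseteq> {1..2 * d}"
    let ?\<Delta> = "\<lambda>c. mixed_difference l t e (trig_kernel (2 * d) L c)"
    have "?\<Delta> (\<lambda>a. c a - c' a) z = ?\<Delta> c z - ?\<Delta> c' z" for z
      unfolding trig_kernel_def[abs_def] mixed_difference_trig_sum[OF e]
      by (simp add: left_diff_distrib sum_subtractf)
    then have "norm (?\<Delta> (\<lambda>a. c a - c' a) z) \<le> norm (?\<Delta> c z) + norm (?\<Delta> c' z)" for z
      by (simp add: norm_triangle_ineq4)
    then have "grid_mean d (\<lambda>_. N) (\<lambda>\<xi>. norm (?\<Delta> (\<lambda>a. c a - c' a) (join d \<xi> y)))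
      \<le> grid_mean d (\<lambda>_. N) (\<lambda>\<xi>. norm (?\<Delta> c (join d \<xi> y)) + norm (?\<Delta> c' (join d \<xi> y)))"
      by (intro grid_mean_mono)
    also have "\<dots> \<le> B * (\<Prod>j\<in>e. \<bar>t j\<bar> powr r) + B' * (\<Prod>j\<in>e. \<bar>t j\<bar> powr r)"
      unfolding grid_mean_add using N1[of N] N2[of N] that e
      by (intro add_mono) (auto simp: discrete_class_def)
    finally show "grid_mean d (\<lambda>_. N) (\<lambda>\<xi>. norm (?\<Delta> (\<lambda>a. c a - c' a) (join d \<xi> y))) \<le> (B + B') * (\<Prod>j\<in>e. \<bar>t j\<bar> powr r)"
      by (simp add: distrib_right)
  qed
  then show ?thesis unfolding smooth_kernel_def by blast
qed

text \<open>
  The difference of two Fejer means is in the class with the constant 2, and its low coefficients tend to 0.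
\<close>

lemma mollify_uniformly_Cauchy:
  assumes K: "K \<in> H_class l r d 1 \<infinity>" and d: "1 \<le> d" and r: "1 < r" and \<epsilon>: "0 < \<epsilon>"
  shows "\<exists>n0\<ge>1. \<forall>n\<ge>n0. \<forall>m\<ge>n0. \<forall>x y. norm (mollify n (2 * d) K (join d x y) - mollify m (2 * d) K (join d x y)) \<le> \<epsilon>"
proof -
  let ?v = "2 * d"
  obtain R \<delta> where \<delta>: "0 < \<delta>" and small: "\<And>L c. smooth_kernel l r d 2 L c \<Longrightarrow>
    (\<forall>a\<in>PiE {1..2 * d} (\<lambda>_. {- int R..int R}). norm (c a) \<le> \<delta>) \<Longrightarrow>
    (\<forall>x y. norm (trig_kernel (2 * d) L c (join d x y)) \<le> \<epsilon>)"
    using smooth_kernel_small[OF d r \<epsilon>, of l] by blast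
  let ?F = "PiE {1..?v} (\<lambda>_. {- int R..int R})"
  have "\<forall>\<^sub>F n in sequentially. \<forall>a\<in>?F. dist (mollified_coeff n ?v K a) (fourier ?v K a) < \<delta> / 2"
  proof (rule eventually_ball_finite)
    show "finite ?F" by (intro finite_PiE) auto
    show "\<forall>a\<in>?F. \<forall>\<^sub>F n in sequentially. dist (mollified_coeff n ?v K a) (fourier ?v K a) < \<delta> / 2"
    proof
      fix a
      have "(\<lambda>n. complex_of_real (\<Prod>j\<in>{1..?v}. fejer_coeff n (a j)) * fourier ?v K a)
          \<longlonglongrightarrow> complex_of_real (\<Prod>j\<in>{1..?v}. 1) * fourier ?v K a"
        by (intro tendsto_intros tendsto_prod fejer_coeff_tendsto)
      then have "(\<lambda>n. mollified_coeff n ?v K a) \<longlonglongrightarrow> fourier ?v K a" by (simp add: mollified_coeff_def)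
      then show "\<forall>\<^sub>F n in sequentially. dist (mollified_coeff n ?v K a) (fourier ?v K a) < \<delta> / 2"
        by (rule tendstoD) (use \<delta> in simp)
    qed
  qed
  then obtain n1 where n1: "\<And>n a. n1 \<le> n \<Longrightarrow> a \<in> ?F \<Longrightarrow> dist (mollified_coeff n ?v K a) (fourier ?v K a) < \<delta> / 2"
    unfolding eventually_sequentially by blast
  have "norm (mollify n ?v K (join d x y) - mollify m ?v K (join d x y)) \<le> \<epsilon>"
    if nm: "max 1 n1 \<le> n" "max 1 n1 \<le> m" for n m x y
  proof -
    let ?L = "max n m"
    let ?c = "\<lambda>a. mollified_coeff n ?v K a - mollified_coeff m ?v K a"
    have pos: "0 < n" "0 < m" using nm by linarith+
    have two: "1 + 1 = (2::real)" by (rule one_add_one)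
    have c: "smooth_kernel l r d 2 ?L ?c"
      by (rule smooth_kernel_diff[OF mollify_smooth_kernel[OF K pos(1) max.cobounded1]
            mollify_smooth_kernel[OF K pos(2) max.cobounded2], unfolded two])
    have n1m: "n1 \<le> n" "n1 \<le> m" using nm by linarith+
    have coeff: "\<forall>a\<in>?F. norm (?c a) \<le> \<delta>"
    proof
      fix a assume a: "a \<in> ?F"
      have "dist (mollified_coeff n ?v K a) (mollified_coeff m ?v K a) < \<delta>"
        by (rule dist_triangle_half_l[OF n1[OF n1m(1) a] n1[OF n1m(2) a]])
      then show "norm (?c a) \<le> \<delta>" by (simp only: dist_norm less_imp_le)
    qed
    have "norm (trig_kernel ?v ?L ?c (join d x y)) \<le> \<epsilon>" by (rule small[OF c coeff, rule_format])
    then show ?thesis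
      by (simp only: trig_kernel_diff mollify_trig_kernel[OF H_class_periodic_L1[OF K] max.cobounded1, of n m]
          mollify_trig_kernel[OF H_class_periodic_L1[OF K] max.cobounded2, of m n])
  qed
  then show ?thesis by (intro exI[of _ "max 1 n1"]) auto
qed

text \<open>
  A subsequence of the Fejer means converges to \<open>K\<close> almost everywhere, which identifies their uniform limit.
\<close>

lemma mollify_approx_AE:
  assumes K: "K \<in> H_class l r d 1 \<infinity>" and d: "1 \<le> d" and r: "1 < r" and l: "1 \<le> l" and \<epsilon>: "0 < \<epsilon>"
  shows "\<exists>n\<ge>1. AE z in torus (2 * d). norm (K z - mollify n (2 * d) K z) \<le> \<epsilon>"
proof -
  let ?v = "2 * d"
  obtain n0 where n0: "1 \<le> n0" "\<And>n x y. n0 \<le> n \<Longrightarrow> norm (mollify n ?v K (join d x y) - mollify n0 ?v K (join d x y)) \<le> \<epsilon>"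
    using mollify_uniformly_Cauchy[OF K d r \<epsilon>] by blast
  have "\<exists>\<rho>. strict_mono \<rho> \<and> (AE z in torus ?v. (\<lambda>n. mollify (\<rho> n) ?v K z - K z) \<longlonglongrightarrow> 0)"
  proof (rule tendsto_L1_AE_subseq[of "torus ?v" "\<lambda>n z. mollify n ?v K z - K z"])
    show "integrable (torus ?v) (\<lambda>z. mollify n ?v K z - K z)" for n
      using periodic_L1_diff[OF periodic_L1_mollify[OF H_class_periodic_L1[OF K]] H_class_periodic_L1[OF K]] by (simp add: periodic_L1_def)
    show "(\<lambda>n. \<integral>z. norm (mollify n ?v K z - K z) \<partial>torus ?v) \<longlonglongrightarrow> 0"
      using mollify_L1_tendsto[OF K r l] by (simp add: L1_def)
  qed
  then obtain \<rho> where \<rho>: "strict_mono \<rho>" "AE z in torus ?v. (\<lambda>n. mollify (\<rho> n) ?v K z - K z) \<longlonglongrightarrow> 0" by blast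
  have "AE z in torus ?v. z \<in> space (torus ?v)" by (rule AE_space)
  with \<rho>(2) have "AE z in torus ?v. norm (K z - mollify n0 ?v K z) \<le> \<epsilon>"
  proof eventually_elim
    case (elim z)
    have z: "join d z (\<lambda>j. z (j + d)) = z"
      using elim(2) by (auto simp: join_def space_torus PiE_iff extensional_def)
    have lim: "(\<lambda>n. (mollify (\<rho> n) ?v K z - K z) + (K z - mollify n0 ?v K z)) \<longlonglongrightarrow> 0 + (K z - mollify n0 ?v K z)"
      by (intro tendsto_intros elim(1))
    have "norm (mollify (\<rho> n) ?v K z - mollify n0 ?v K z) \<le> \<epsilon>" if "n0 \<le> n" for n
      using n0(2)[of "\<rho> n" z "\<lambda>j. z (j + d)"] seq_suble[OF \<rho>(1), of n] that unfolding z by linarith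
    then have "\<forall>\<^sub>F n in sequentially. norm ((mollify (\<rho> n) ?v K z - K z) + (K z - mollify n0 ?v K z)) \<le> \<epsilon>"
      unfolding eventually_sequentially by (intro exI[of _ n0]) simp
    from tendsto_upperbound[OF tendsto_norm[OF lim] this] show ?case by simp
  qed
  then show ?thesis using n0(1) by blast
qed

section \<open>From coverings to entropy numbers\<close>

lemma measurable_join:
  "(\<lambda>p. join d (fst p) (snd p)) \<in> measurable (torus d \<Otimes>\<^sub>M torus d) (torus (2 * d))"
proof (rule measurable_torus)
  fix i assume i: "i \<in> {1..2 * d}"
  show "(\<lambda>p. join d (fst p) (snd p) i) \<in> borel_measurable (torus d \<Otimes>\<^sub>M torus d)"
  proof (cases "i \<le> d")
    case True
    then have "(\<lambda>p. fst p i) \<in> borel_measurable (torus d \<Otimes>\<^sub>M torus d)"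
      using i by (intro measurable_compose[OF measurable_fst measurable_torus_component]) auto
    then show ?thesis using True i by (simp add: join_def)
  next
    case False
    then have "(\<lambda>p. snd p (i - d)) \<in> borel_measurable (torus d \<Otimes>\<^sub>M torus d)"
      using i by (intro measurable_compose[OF measurable_snd measurable_torus_component]) auto
    then show ?thesis using False i by (simp add: join_def)
  qed
qed (auto simp: join_def)

lemma distr_join:
  "distr (torus d \<Otimes>\<^sub>M torus d) (torus (2 * d)) (\<lambda>p. join d (fst p) (snd p)) = torus (2 * d)"
proof -
  interpret T: prob_space "torus d" by (rule prob_space_torus)
  have "distr (torus d \<Otimes>\<^sub>M torus d) (torus (2 * d)) (\<lambda>p. join d (fst p) (snd p)) = PiM {1..2 * d} (\<lambda>_. circle)"
  proof (rule circles.PiM_eqI)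
    fix A :: "nat \<Rightarrow> real set" assume A: "\<And>i. i \<in> {1..2 * d} \<Longrightarrow> A i \<in> sets circle"
    let ?X = "PiE {1..d} A" and ?Y = "PiE {1..d} (\<lambda>i. A (i + d))"
    have X: "?X \<in> sets (torus d)" "?Y \<in> sets (torus d)"
      unfolding torus_def using A by (auto intro!: sets_PiM_I_finite)
    have pre: "(\<lambda>p. join d (fst p) (snd p)) -` PiE {1..2 * d} A \<inter> space (torus d \<Otimes>\<^sub>M torus d) = ?X \<times> ?Y"
    proof (intro set_eqI iffI)
      fix p assume p: "p \<in> (\<lambda>p. join d (fst p) (snd p)) -` PiE {1..2 * d} A \<inter> space (torus d \<Otimes>\<^sub>M torus d)"
      have sp: "fst p \<in> PiE {1..d} (\<lambda>_. UNIV)" "snd p \<in> PiE {1..d} (\<lambda>_. UNIV)"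
        using p by (auto simp: space_pair_measure space_torus)
      have a: "join d (fst p) (snd p) i \<in> A i" if "i \<in> {1..2 * d}" for i using p that by (auto simp: PiE_iff)
      have "fst p i \<in> A i" if "i \<in> {1..d}" for i using a[of i] that by (auto simp: join_def)
      moreover have "snd p i \<in> A (i + d)" if "i \<in> {1..d}" for i using a[of "i + d"] that by (auto simp: join_def)
      ultimately have "fst p \<in> ?X" "snd p \<in> ?Y" using sp by (auto simp: PiE_iff)
      then show "p \<in> ?X \<times> ?Y" by (cases p) auto
    next
      fix p assume p: "p \<in> ?X \<times> ?Y"
      have "join d (fst p) (snd p) i \<in> A i" if "i \<in> {1..2 * d}" for i
      proof (cases "i \<le> d")
        case True
        then show ?thesis using p that by (auto simp: join_def PiE_iff)
      next
        case False
        have Y: "snd p \<in> ?Y" using p by auto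
        have "i - d \<in> {1..d}" using False that by auto
        from PiE_mem[OF Y this] have "snd p (i - d) \<in> A (i - d + d)" .
        then show ?thesis using False that by (auto simp: join_def)
      qed
      then show "p \<in> (\<lambda>p. join d (fst p) (snd p)) -` PiE {1..2 * d} A \<inter> space (torus d \<Otimes>\<^sub>M torus d)"
        using p by (auto simp: space_pair_measure space_torus PiE_iff join_def)
    qed
    have "emeasure (distr (torus d \<Otimes>\<^sub>M torus d) (torus (2 * d)) (\<lambda>p. join d (fst p) (snd p))) (PiE {1..2 * d} A)
       = emeasure (torus d \<Otimes>\<^sub>M torus d) (?X \<times> ?Y)"
      unfolding pre[symmetric] by (rule emeasure_distr[OF measurable_join]) (unfold torus_def, auto intro!: sets_PiM_I_finite A)
    also have "\<dots> = emeasure (torus d) ?X * emeasure (torus d) ?Y"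
      by (rule T.emeasure_pair_measure_Times[OF X])
    also have "\<dots> = (\<Prod>i\<in>{1..d}. emeasure circle (A i)) * (\<Prod>i\<in>{1..d}. emeasure circle (A (i + d)))"
      unfolding torus_def using A by (intro arg_cong2[where f=times] circles.emeasure_PiM) auto
    finally show "emeasure (distr (torus d \<Otimes>\<^sub>M torus d) (torus (2 * d)) (\<lambda>p. join d (fst p) (snd p))) (PiE {1..2 * d} A)
        = (\<Prod>i\<in>{1..2 * d}. emeasure circle (A i))"
      unfolding prod_double_range .
  qed (auto simp: torus_def)
  then show ?thesis by (simp add: torus_def)
qed

lemma AE_join:
  assumes "AE z in torus (2 * d). Q z"
  shows "AE x in torus d. AE y in torus d. Q (join d x y)"
proof -
  interpret T: prob_space "torus d" by (rule prob_space_torus)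
  interpret TT: pair_prob_space "torus d" "torus d" ..
  have "AE z in distr (torus d \<Otimes>\<^sub>M torus d) (torus (2 * d)) (\<lambda>p. join d (fst p) (snd p)). Q z"
    using assms by (simp only: distr_join)
  then have "AE p in torus d \<Otimes>\<^sub>M torus d. Q (join d (fst p) (snd p))"
    by (rule AE_distrD[OF measurable_join])
  from TT.AE_pair[OF this] show ?thesis by simp
qed

lemma bounded_periodic_torus_Lp: "bounded_periodic d f \<Longrightarrow> f \<in> torus_Lp \<infinity> d"
proof -
  assume f: "bounded_periodic d f"
  then obtain B where B: "\<And>x. norm (f x) \<le> B" by (auto simp: bounded_periodic_def)
  have m: "(\<lambda>x. ennreal (norm (f x))) \<in> borel_measurable (torus d)" using f by (auto simp: bounded_periodic_def)
  have "torus_norm \<infinity> d f \<le> ennreal B"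
    unfolding torus_norm_def Lp_norm_def using B by (auto intro!: esssup_I[OF m] AE_I2 ennreal_leI)
  also have "\<dots> < \<infinity>" by simp
  finally show ?thesis using f by (auto simp: torus_Lp_def bounded_periodic_def)
qed

lemma enumerate_finite:
  assumes "finite Y" "Y \<noteq> {}" "card Y \<le> n"
  shows "\<exists>y. y ` {1..n} = Y"
proof -
  obtain h where h: "bij_betw h {0..<card Y} Y" using ex_bij_betw_nat_finite[OF assms(1)] by blast
  have pos: "0 < card Y" using assms by (simp add: card_gt_0_iff)
  have im: "h ` {0..<card Y} = Y" using h by (simp add: bij_betw_def)
  show ?thesis
  proof (intro exI[of _ "\<lambda>j. h (if j - 1 < card Y then j - 1 else 0)"] equalityI subsetI)
    fix g assume "g \<in> (\<lambda>j. h (if j - 1 < card Y then j - 1 else 0)) ` {1..n}"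
    then show "g \<in> Y" using im pos by auto
  next
    fix g assume "g \<in> Y"
    then have "g \<in> h ` {0..<card Y}" by (simp only: im)
    then obtain i where i: "i < card Y" "g = h i" by auto
    then show "g \<in> (\<lambda>j. h (if j - 1 < card Y then j - 1 else 0)) ` {1..n}"
      using assms(3) by (intro image_eqI[of _ _ "i + 1"]) auto
  qed
qed

lemma L1_ballI:
  assumes "\<phi> \<in> torus_Lp 1 d" "torus_norm 1 d \<phi> \<le> 1"
  shows "\<phi> \<in> L1_ball d"
proof -
  have m: "\<phi> \<in> borel_measurable (torus d)" using assms(1) by (simp add: torus_Lp_def)
  have nn: "(\<integral>\<^sup>+x. ennreal (norm (\<phi> x)) \<partial>torus d) \<le> 1" using assms(2) by (simp add: torus_norm_def Lp_norm_1)
  then have int: "integrable (torus d) \<phi>" using m by (intro integrableI_bounded) (auto intro: le_less_trans)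
  have "ennreal (\<integral>x. norm (\<phi> x) \<partial>torus d) = (\<integral>\<^sup>+x. ennreal (norm (\<phi> x)) \<partial>torus d)"
    using int by (intro nn_integral_eq_integral[symmetric]) auto
  then have "ennreal (\<integral>x. norm (\<phi> x) \<partial>torus d) \<le> 1" using nn by simp
  then show ?thesis using int by (simp add: L1_ball_def)
qed

text \<open>
  Replacing \<open>K\<close> by \<open>G\<close> moves the functions of the class by at most \<open>\<epsilon>\<close>, because \<open>\<phi>\<close> has \<open>L1\<close> norm at most 1; the covering
  adds another \<open>\<epsilon>\<close>.
\<close>

lemma entropy_number_le_of_covered:
  fixes K G :: "(nat \<Rightarrow> real) \<Rightarrow> complex"
  assumes K: "K \<in> borel_measurable (torus (2 * d))" "periodic (2 * d) K" and G: "bounded_periodic (2 * d) G"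
    and close: "AE z in torus (2 * d). norm (K z - G z) \<le> \<epsilon>" and "0 \<le> \<epsilon>"
    and cov: "covered d ((\<lambda>\<phi> x. \<integral>y. G (join d x y) * \<phi> y \<partial>torus d) ` L1_ball d) (real k) \<epsilon>"
  shows "entropy_number k (W_class d K 1) (torus_Lp \<infinity> d) (torus_norm \<infinity> d) \<le> ennreal (2 * \<epsilon>)"
proof -
  interpret T: prob_space "torus d" by (rule prob_space_torus)
  let ?F = "\<lambda>H \<phi> x. \<integral>y. H (join d x y) * \<phi> y \<partial>torus d"
  obtain Y where Y: "finite Y" "real (card Y) \<le> 2 powr real k" "\<forall>g\<in>Y. bounded_periodic d g"
    "\<forall>f\<in>?F G ` L1_ball d. \<exists>g\<in>Y. \<forall>x. norm (f x - g x) \<le> \<epsilon>"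
    using cov unfolding covered_def by blast
  have "(\<lambda>_. 0) \<in> L1_ball d" by (simp add: L1_ball_def)
  then have ne: "Y \<noteq> {}" using Y(4) by blast
  have "real (card Y) \<le> real (2 ^ k)" using Y(2) by (simp add: powr_realpow)
  then have "card Y \<le> 2 ^ k" by (simp only: of_nat_le_iff)
  then obtain e where e: "e ` {1..(2::nat) ^ k} = Y" using enumerate_finite[OF Y(1) ne] by blast
  obtain B where B: "\<And>z. norm (G z) \<le> B" using G by (auto simp: bounded_periodic_def)
  have slice: "(\<lambda>y. H (join d x y)) \<in> borel_measurable (torus d)"
    if "H \<in> borel_measurable (torus (2 * d))" "x \<in> space (torus d)" for H :: "_ \<Rightarrow> complex" and x
    using measurable_compose[OF measurable_Pair1'[OF that(2)] measurable_compose[OF measurable_join that(1)]] by simp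
  have Gm: "G \<in> borel_measurable (torus (2 * d))" using G by (simp add: bounded_periodic_def)
  have W: "\<exists>g\<in>Y. f \<in> norm_ball (torus_Lp \<infinity> d) (torus_norm \<infinity> d) g (ennreal (2 * \<epsilon>))" if f: "f \<in> W_class d K 1" for f
  proof -
    obtain \<phi> where \<phi>f: "f = ?F K \<phi>" "\<phi> \<in> torus_Lp 1 d" "torus_norm 1 d \<phi> \<le> 1"
      using f by (auto simp: W_class_def)
    have \<phi>: "\<phi> \<in> L1_ball d" by (rule L1_ballI[OF \<phi>f(2,3)])
    then have int: "integrable (torus d) \<phi>" "(\<integral>y. norm (\<phi> y) \<partial>torus d) \<le> 1" by (auto simp: L1_ball_def)
    from bspec[OF Y(4) imageI[OF \<phi>]] obtain g where g: "g \<in> Y" "\<forall>x. norm (?F G \<phi> x - g x) \<le> \<epsilon>" by (elim bexE)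
    have gt: "bounded_periodic d g" using Y(3) g(1) by blast
    have fm: "f \<in> borel_measurable (torus d)"
    proof -
      have "(\<lambda>p. K (join d (fst p) (snd p)) * \<phi> (snd p)) \<in> borel_measurable (torus d \<Otimes>\<^sub>M torus d)"
        using measurable_compose[OF measurable_join K(1)] measurable_compose[OF measurable_snd borel_measurable_integrable[OF int(1)]]
        by (intro borel_measurable_times)
      then have "case_prod (\<lambda>x y. K (join d x y) * \<phi> y) \<in> borel_measurable (torus d \<Otimes>\<^sub>M torus d)"
        by (simp add: case_prod_beta)
      then show ?thesis unfolding \<phi>f(1) by (rule T.borel_measurable_lebesgue_integral)
    qed
    have fp: "periodic d f"
      unfolding periodic_def \<phi>f(1)
    proof (intro ballI)
      fix x :: "nat \<Rightarrow> real" and j assume j: "j \<in> {1..d}"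
      have "K (join d (x(j := x j + 2 * pi)) y) = K (join d x y)" for y
      proof -
        have "join d (x(j := x j + 2 * pi)) y = (join d x y)(j := join d x y j + 2 * pi)"
          using j by (auto simp: join_def)
        moreover have "join d x y \<in> PiE {1..2 * d} (\<lambda>_. UNIV)" by (auto simp: join_def)
        moreover have "j \<in> {1..2 * d}" using j by auto
        ultimately show ?thesis using K(2) unfolding periodic_def by simp
      qed
      then show "?F K \<phi> (x(j := x j + 2 * pi)) = ?F K \<phi> x" by (simp only:)
    qed
    have "AE x in torus d. x \<in> space (torus d)" by (rule AE_space)
    with AE_join[OF close] have near: "AE x in torus d. norm (f x - g x) \<le> 2 * \<epsilon>"
    proof eventually_elim
      case (elim x)
      let ?E = "\<lambda>y. (K (join d x y) - G (join d x y)) * \<phi> y"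
      have Gi: "integrable (torus d) (\<lambda>y. G (join d x y) * \<phi> y)"
        by (rule bounded_times_integrable[OF int(1) slice[OF Gm elim(2)] B])
      have Ei: "integrable (torus d) ?E"
      proof (rule Bochner_Integration.integrable_bound)
        show "integrable (torus d) (\<lambda>y. of_real \<epsilon> * \<phi> y)" using int(1) by simp
        show "?E \<in> borel_measurable (torus d)"
          using slice[OF Gm elim(2)] slice[OF K(1) elim(2)] int(1) by (intro borel_measurable_times borel_measurable_diff) auto
        show "AE y in torus d. norm (?E y) \<le> norm (of_real \<epsilon> * \<phi> y)"
          using elim(1) by eventually_elim (use assms(5) in \<open>auto simp: norm_mult intro: mult_right_mono\<close>)
      qed
      have "f x = (\<integral>y. ?E y + G (join d x y) * \<phi> y \<partial>torus d)" unfolding \<phi>f(1) by (simp add: algebra_simps)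
      then have "f x - ?F G \<phi> x = (\<integral>y. ?E y \<partial>torus d)"
        using Bochner_Integration.integral_add[OF Ei Gi] by simp
      moreover have "norm (\<integral>y. ?E y \<partial>torus d) \<le> (\<integral>y. \<epsilon> * norm (\<phi> y) \<partial>torus d)"
      proof (rule order.trans[OF integral_norm_bound integral_mono_AE])
        show "AE y in torus d. norm (?E y) \<le> \<epsilon> * norm (\<phi> y)"
          using elim(1) by eventually_elim (auto simp: norm_mult intro: mult_right_mono)
      qed (use Ei int(1) in auto)
      moreover have "(\<integral>y. \<epsilon> * norm (\<phi> y) \<partial>torus d) \<le> \<epsilon>" using int(2) assms(5) by (simp add: mult_left_le)
      ultimately have "norm (f x - ?F G \<phi> x) \<le> \<epsilon>" by simp
      moreover have "norm (?F G \<phi> x - g x) \<le> \<epsilon>" using g(2) by blast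
      ultimately show ?case using norm_triangle_mono[of "f x - ?F G \<phi> x" \<epsilon> "?F G \<phi> x - g x" \<epsilon>] by simp
    qed
    have gm: "g \<in> borel_measurable (torus d)" using gt by (simp add: bounded_periodic_def)
    have "torus_norm \<infinity> d (f - g) \<le> ennreal (2 * \<epsilon>)"
      unfolding torus_norm_def Lp_norm_def using near fm gm
      by (auto intro!: esssup_I elim!: eventually_mono ennreal_leI)
    moreover have "f \<in> torus_Lp \<infinity> d"
    proof -
      obtain B' where B': "\<And>x. norm (g x) \<le> B'" using gt by (auto simp: bounded_periodic_def)
      have "AE x in torus d. ennreal (norm (f x)) \<le> ennreal (2 * \<epsilon> + B')"
        using near
      proof eventually_elim
        case (elim x)
        then have "norm (f x) \<le> 2 * \<epsilon> + B'" using norm_triangle_mono[OF elim B', of x] by simp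
        then show ?case by (rule ennreal_leI)
      qed
      then have "torus_norm \<infinity> d f \<le> ennreal (2 * \<epsilon> + B')"
        unfolding torus_norm_def Lp_norm_def using fm by (auto intro!: esssup_I)
      also have "\<dots> < \<infinity>" by simp
      finally show ?thesis using fm fp by (simp add: torus_Lp_def)
    qed
    ultimately show ?thesis using g(1) by (auto simp: norm_ball_def)
  qed
  show ?thesis
    unfolding entropy_number_def
  proof (rule Inf_lower, rule CollectI, intro exI[of _ e] conjI ballI subsetI)
    fix j assume "j \<in> {1..(2::nat) ^ k}"
    then have "e j \<in> Y" using e by blast
    then show "e j \<in> torus_Lp \<infinity> d" using Y(3) bounded_periodic_torus_Lp by blast
  next
    fix f assume "f \<in> W_class d K 1"
    from W[OF this] show "f \<in> (\<Union>j\<in>{1..2 ^ k}. norm_ball (torus_Lp \<infinity> d) (torus_norm \<infinity> d) (e j) (ennreal (2 * \<epsilon>)))"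
      unfolding e[symmetric] by auto
  qed
qed

text \<open>
  Take the largest \<open>m\<close> for which the first inequality holds. Its failure for \<open>m + 1\<close> bounds \<open>2 ^ m\<close> from below by a
  constant times \<open>k / (m + 1) ^ d\<close>, and \<open>2 ^ m \<le> k\<close> bounds \<open>m + 1\<close> by the logarithm.
\<close>

lemma choose_level:
  fixes C :: real
  assumes C: "1 \<le> C" "C \<le> real k" and d: "1 \<le> d" and r: "0 < r"
  shows "\<exists>m. C * 2 ^ m * (real m + 1) ^ d \<le> real k \<and>
    2 powr (- 2 * r * m) * (real m + 1) ^ (2 * (d - 1))
      \<le> (2 * 2 ^ d * C) powr (2 * r) * real k powr (- 2 * r) * (ln (2 * real k) / ln 2) powr (2 * r * real d + real (2 * (d - 1)))"
proof -
  let ?Q = "\<lambda>m::nat. C * 2 ^ m * (real m + 1) ^ d \<le> real k"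
  have le_k: "2 ^ m \<le> real k" if "?Q m" for m
  proof -
    have "1 * 2 ^ m * 1 \<le> C * 2 ^ m * (real m + 1) ^ d" using C by (intro mult_mono) auto
    then have "1 * 2 ^ m * 1 \<le> real k" using that by (rule order.trans)
    then show ?thesis by simp
  qed
  have lt_k: "m < k" if "?Q m" for m
  proof -
    have "real m < 2 ^ m" by (rule of_nat_less_two_power)
    then show ?thesis using le_k[OF that] by linarith
  qed
  define m where "m = (GREATEST m. ?Q m)"
  have Q0: "?Q 0" using C by simp
  have Qm: "?Q m" unfolding m_def by (rule GreatestI_nat[of ?Q 0 k]) (use Q0 lt_k less_imp_le in auto)
  have nQ: "\<not> ?Q (Suc m)"
  proof
    assume "?Q (Suc m)"
    then have "Suc m \<le> m" unfolding m_def by (intro Greatest_le_nat[of ?Q _ k]) (use lt_k less_imp_le in auto)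
    then show False by simp
  qed
  define w where "w = real m + 1"
  have w: "1 \<le> w" by (simp add: w_def)
  have k: "1 \<le> real k" using C by linarith
  have upper: "real k \<le> (2 * 2 ^ d * C) * (2 ^ m * w ^ d)"
  proof -
    have "real k \<le> C * 2 ^ Suc m * (real (Suc m) + 1) ^ d" using nQ by simp
    also have "\<dots> \<le> C * 2 ^ Suc m * (2 * w) ^ d" using C by (intro mult_left_mono power_mono) (auto simp: w_def)
    also have "\<dots> = (2 * 2 ^ d * C) * (2 ^ m * w ^ d)" by (simp add: power_mult_distrib mult_ac)
    finally show ?thesis .
  qed
  have w_log: "w \<le> ln (2 * real k) / ln 2"
  proof -
    have "2 powr w = 2 * 2 ^ m" by (simp add: w_def powr_add powr_realpow)
    also have "\<dots> \<le> 2 * real k" using le_k[OF Qm] by simp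
    finally have "ln (2 powr w) \<le> ln (2 * real k)" using k by (subst ln_le_cancel_iff) auto
    then show ?thesis by (simp add: ln_powr pos_le_divide_eq)
  qed
  have "2 powr (- 2 * r * m) * w ^ (2 * (d - 1))
      \<le> ((2 * 2 ^ d * C) powr (2 * r) * real k powr (- 2 * r) * w powr (2 * r * d)) * w powr real (2 * (d - 1))"
  proof -
    have "real k powr (2 * r) \<le> ((2 * 2 ^ d * C) * (2 ^ m * w ^ d)) powr (2 * r)"
      using upper r k by (intro powr_mono2) auto
    also have "\<dots> = (2 * 2 ^ d * C) powr (2 * r) * (2 powr (2 * r * m) * w powr (2 * r * d))"
    proof -
      have "(2 ^ m) powr (2 * r) = 2 powr (2 * r * m)" by (simp add: powr_powr mult_ac flip: powr_realpow)
      moreover have "(w ^ d) powr (2 * r) = w powr (2 * r * d)" using w by (simp add: powr_powr mult_ac flip: powr_realpow)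
      ultimately show ?thesis using C w by (simp add: powr_mult)
    qed
    finally have up: "real k powr (2 * r) \<le> (2 * 2 ^ d * C) powr (2 * r) * (2 powr (2 * r * m) * w powr (2 * r * d))" .
    have pos: "0 < 2 powr (- 2 * r * m) * real k powr (- 2 * r)" using k by simp
    have kk: "real k powr (2 * r) * real k powr (- 2 * r) = 1" using k by (simp add: powr_add[symmetric])
    have mm: "2 powr (2 * r * m) * 2 powr (- 2 * r * m) = (1::real)" by (simp add: powr_add[symmetric])
    have "2 powr (- 2 * r * m) = real k powr (2 * r) * (2 powr (- 2 * r * m) * real k powr (- 2 * r))"
      using kk by (simp add: mult_ac)
    also have "\<dots> \<le> (2 * 2 ^ d * C) powr (2 * r) * (2 powr (2 * r * m) * w powr (2 * r * d)) * (2 powr (- 2 * r * m) * real k powr (- 2 * r))"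
      by (rule mult_right_mono[OF up less_imp_le[OF pos]])
    also have "\<dots> = (2 powr (2 * r * m) * 2 powr (- 2 * r * m)) * ((2 * 2 ^ d * C) powr (2 * r) * real k powr (- 2 * r) * w powr (2 * r * d))"
      by (simp only: mult_ac)
    finally have "2 powr (- 2 * r * m) \<le> (2 * 2 ^ d * C) powr (2 * r) * real k powr (- 2 * r) * w powr (2 * r * d)"
      unfolding mm by simp
    moreover have "w ^ (2 * (d - 1)) = w powr real (2 * (d - 1))" using w by (subst powr_realpow[symmetric]) auto
    ultimately show ?thesis using w by (simp add: mult_right_mono)
  qed
  also have "\<dots> = (2 * 2 ^ d * C) powr (2 * r) * real k powr (- 2 * r) * w powr (2 * r * real d + real (2 * (d - 1)))"
    by (simp only: powr_add mult.assoc)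
  also have "\<dots> \<le> (2 * 2 ^ d * C) powr (2 * r) * real k powr (- 2 * r) * (ln (2 * real k) / ln 2) powr (2 * r * real d + real (2 * (d - 1)))"
    using w w_log r by (intro mult_left_mono powr_mono2) auto
  finally show ?thesis using Qm by (intro exI[of _ m]) (simp add: w_def)
qed

text \<open>
  For \<open>k\<close> above a constant this is \<open>covered_smooth_kernel\<close> at the level of \<open>choose_level\<close>. For the finitely many other
  \<open>k\<close> the zero function is a sufficient covering.
\<close>

lemma entropy_bound:
  fixes r :: real
  assumes d: "1 \<le> d" "d \<le> 2" and r: "1 < r" and l: "1 \<le> l"
  shows "\<exists>C>0. \<forall>k\<ge>1. \<forall>K\<in>H_class l r d 1 \<infinity>.
    entropy_number k (W_class d K 1) (torus_Lp \<infinity> d) (torus_norm \<infinity> d)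
      \<le> ennreal (C * real k powr (- 2 * r) * ln (2 * real k) powr (2 * r * real d + real (2 * (d - 1))))"
proof -
  obtain C1 C2 C3 where C: "1 \<le> C1" "1 \<le> C2" "1 \<le> C3" and ker: "\<And>L c. smooth_kernel l r d 1 L c \<Longrightarrow>
    (\<forall>m. covered d ((\<lambda>\<phi> x. \<integral>y. trig_kernel (2 * d) L c (join d x y) * \<phi> y \<partial>torus d) ` L1_ball d)
      (C1 * 2 ^ m * (real m + 1) ^ d) (C2 * 2 powr (- 2 * r * m) * (real m + 1) ^ (2 * (d - 1)))) \<and>
    (\<forall>x y. norm (trig_kernel (2 * d) L c (join d x y)) \<le> C3)"
    using covered_smooth_kernel[OF d r, of l] by blast
  define \<gamma> where "\<gamma> = 2 * r * real d + real (2 * (d - 1))"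
  have \<gamma>: "0 \<le> \<gamma>" using r by (simp add: \<gamma>_def)
  have ln2: "0 < ln (2::real)" by simp
  have r0: "0 < r" using r by simp
  define Ca where "Ca = 2 * C2 * (2 * 2 ^ d * C1) powr (2 * r) / ln 2 powr \<gamma>"
  define Cb where "Cb = 2 * C3 * C1 powr (2 * r) / ln 2 powr \<gamma>"
  have Ca: "0 < Ca" and Cb: "0 < Cb" using C by (auto simp: Ca_def Cb_def)
  have "entropy_number k (W_class d K 1) (torus_Lp \<infinity> d) (torus_norm \<infinity> d)
      \<le> ennreal ((Ca + Cb) * real k powr (- 2 * r) * ln (2 * real k) powr \<gamma>)"
    if k: "1 \<le> k" and K: "K \<in> H_class l r d 1 \<infinity>" for k K
  proof -
    let ?G = "\<lambda>n. mollify n (2 * d) K"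
    have lnk: "ln 2 \<le> ln (2 * real k)" using k by simp
    have step: "entropy_number k (W_class d K 1) (torus_Lp \<infinity> d) (torus_norm \<infinity> d) \<le> ennreal (2 * \<epsilon>)"
      if \<epsilon>: "0 < \<epsilon>" and cov: "\<And>n. 1 \<le> n \<Longrightarrow>
        covered d ((\<lambda>\<phi> x. \<integral>y. ?G n (join d x y) * \<phi> y \<partial>torus d) ` L1_ball d) (real k) \<epsilon>" for \<epsilon>
    proof -
      obtain n where n: "1 \<le> n" "AE z in torus (2 * d). norm (K z - ?G n z) \<le> \<epsilon>"
        using mollify_approx_AE[OF K d(1) r l \<epsilon>] by blast
      have "bounded_periodic (2 * d) (?G n)" by (simp add: mollify_trig_kernel[OF H_class_periodic_L1[OF K] order.refl] bounded_periodic_trig_kernel)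
      then show ?thesis
        by (rule entropy_number_le_of_covered[OF H_class_D(1,2)[OF K] _ n(2) less_imp_le[OF \<epsilon>] cov[OF n(1)]])
    qed
    have smooth: "smooth_kernel l r d 1 n (mollified_coeff n (2 * d) K)" if "1 \<le> n" for n
      using that by (intro mollify_smooth_kernel[OF K]) auto
    have G: "?G n = trig_kernel (2 * d) n (mollified_coeff n (2 * d) K)" for n
      by (rule mollify_trig_kernel[OF H_class_periodic_L1[OF K] order.refl])
    show ?thesis
    proof (cases "C1 \<le> real k")
      case True
      obtain m where m: "C1 * 2 ^ m * (real m + 1) ^ d \<le> real k"
        "2 powr (- 2 * r * m) * (real m + 1) ^ (2 * (d - 1))
          \<le> (2 * 2 ^ d * C1) powr (2 * r) * real k powr (- 2 * r) * (ln (2 * real k) / ln 2) powr \<gamma>"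
        using choose_level[OF C(1) True d(1) r0] unfolding \<gamma>_def by blast
      let ?\<epsilon> = "C2 * 2 powr (- 2 * r * m) * (real m + 1) ^ (2 * (d - 1))"
      have "0 < ?\<epsilon>" using C by (intro mult_pos_pos) auto
      then have "entropy_number k (W_class d K 1) (torus_Lp \<infinity> d) (torus_norm \<infinity> d) \<le> ennreal (2 * ?\<epsilon>)"
      proof (rule step)
        fix n :: nat assume "1 \<le> n"
        then show "covered d ((\<lambda>\<phi> x. \<integral>y. ?G n (join d x y) * \<phi> y \<partial>torus d) ` L1_ball d) (real k) ?\<epsilon>"
          unfolding G using ker[OF smooth] covered_mono[OF _ order.refl m(1) order.refl] by blast
      qed
      also have "\<dots> \<le> ennreal ((Ca + Cb) * real k powr (- 2 * r) * ln (2 * real k) powr \<gamma>)"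
      proof (rule ennreal_leI)
        have "2 * ?\<epsilon> = 2 * C2 * (2 powr (- 2 * r * m) * (real m + 1) ^ (2 * (d - 1)))" by simp
        also have "\<dots> \<le> 2 * C2 * ((2 * 2 ^ d * C1) powr (2 * r) * real k powr (- 2 * r) * (ln (2 * real k) / ln 2) powr \<gamma>)"
          using m(2) C by (intro mult_left_mono) auto
        also have "(ln (2 * real k) / ln 2) powr \<gamma> = ln (2 * real k) powr \<gamma> / ln 2 powr \<gamma>"
          by (rule powr_divide)
        also have "2 * C2 * ((2 * 2 ^ d * C1) powr (2 * r) * real k powr (- 2 * r) * (ln (2 * real k) powr \<gamma> / ln 2 powr \<gamma>))
            = Ca * real k powr (- 2 * r) * ln (2 * real k) powr \<gamma>" by (simp add: Ca_def)
        also have "\<dots> \<le> (Ca + Cb) * real k powr (- 2 * r) * ln (2 * real k) powr \<gamma>"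
          using Cb by (intro mult_right_mono) auto
        finally show "2 * ?\<epsilon> \<le> (Ca + Cb) * real k powr (- 2 * r) * ln (2 * real k) powr \<gamma>" .
      qed
      finally show ?thesis .
    next
      case False
      have "0 < C3" using C by simp
      then have "entropy_number k (W_class d K 1) (torus_Lp \<infinity> d) (torus_norm \<infinity> d) \<le> ennreal (2 * C3)"
      proof (rule step)
        fix n :: nat assume n: "1 \<le> n"
        have bound: "norm (?G n (join d x y)) \<le> C3" for x y
          unfolding G using ker[OF smooth[OF n]] by blast
        have meas: "(\<lambda>y. ?G n (join d x y)) \<in> borel_measurable (torus d)" for x
        proof -
          have "bounded_periodic d (\<lambda>y. ?G n (join d x y))"
            unfolding G trig_kernel_join by (intro bounded_periodic_sum bounded_periodic_cmult bounded_periodic_character)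
          then show ?thesis by (simp add: bounded_periodic_def)
        qed
        show "covered d ((\<lambda>\<phi> x. \<integral>y. ?G n (join d x y) * \<phi> y \<partial>torus d) ` L1_ball d) (real k) C3"
          unfolding covered_def
        proof (intro exI[of _ "{\<lambda>_. 0}"] conjI ballI)
          show "real (card {\<lambda>_::nat \<Rightarrow> real. 0 :: complex}) \<le> 2 powr real k" by (simp add: powr_realpow)
          fix f assume "f \<in> (\<lambda>\<phi> x. \<integral>y. ?G n (join d x y) * \<phi> y \<partial>torus d) ` L1_ball d"
          then obtain \<phi> where \<phi>: "f = (\<lambda>x. \<integral>y. ?G n (join d x y) * \<phi> y \<partial>torus d)" "\<phi> \<in> L1_ball d" by auto
          have "norm (f x) \<le> C3" for x unfolding \<phi>(1) by (rule L1_ball_integral_le[OF \<phi>(2) meas bound])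
          then show "\<exists>g\<in>{\<lambda>_. 0}. \<forall>x. norm (f x - g x) \<le> C3" by simp
        qed (auto intro: bounded_periodic_zero)
      qed
      also have "\<dots> \<le> ennreal ((Ca + Cb) * real k powr (- 2 * r) * ln (2 * real k) powr \<gamma>)"
      proof (rule ennreal_leI)
        have "ln 2 powr \<gamma> \<le> ln (2 * real k) powr \<gamma>" using lnk ln2 \<gamma> by (intro powr_mono2) auto
        moreover have "C1 powr (- 2 * r) \<le> real k powr (- 2 * r)" using False k r by (intro powr_mono2') auto
        ultimately have "Cb * C1 powr (- 2 * r) * ln 2 powr \<gamma> \<le> (Ca + Cb) * real k powr (- 2 * r) * ln (2 * real k) powr \<gamma>"
          using Ca Cb by (intro mult_mono) auto
        moreover have "Cb * C1 powr (- 2 * r) * ln 2 powr \<gamma> = 2 * C3"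
        proof -
          have "C1 powr (2 * r) * C1 powr (- 2 * r) = 1" using C by (simp add: powr_add[symmetric])
          moreover have "Cb * C1 powr (- 2 * r) * ln 2 powr \<gamma> = 2 * C3 * (C1 powr (2 * r) * C1 powr (- 2 * r)) * (ln 2 powr \<gamma> / ln 2 powr \<gamma>)"
            by (simp add: Cb_def)
          ultimately show ?thesis using ln2 by simp
        qed
        ultimately show "2 * C3 \<le> (Ca + Cb) * real k powr (- 2 * r) * ln (2 * real k) powr \<gamma>" by simp
      qed
      finally show ?thesis .
    qed
  qed
  then show ?thesis using Ca Cb unfolding \<gamma>_def by (intro exI[of _ "Ca + Cb"]) auto
qed

theorem theorem1p2:
  fixes r :: real and l :: nat
  assumes "r > 1" and "real l > r"
  shows "\<exists>C::real. C > 0 \<and> (\<forall>k::nat. k \<ge> 1 \<longrightarrow>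
    (SUP K \<in> H_class l r 1 1 \<infinity>.
        entropy_number k (W_class 1 K 1) (torus_Lp \<infinity> 1) (torus_norm \<infinity> 1))
      \<le> ennreal (C * real k powr (- 2 * r) * ln (2 * real k) powr (2 * r)) \<and>
    (SUP K \<in> H_class l r 2 1 \<infinity>.
        entropy_number k (W_class 2 K 1) (torus_Lp \<infinity> 2) (torus_norm \<infinity> 2))
      \<le> ennreal (C * real k powr (- 2 * r) * ln (2 * real k) powr (4 * r + 5 / 2)))"
proof -
  have l: "1 \<le> l" using assms by linarith
  obtain C1 where C1: "0 < C1" and bound1: "\<And>k K. 1 \<le> k \<Longrightarrow> K \<in> H_class l r 1 1 \<infinity> \<Longrightarrow>
      entropy_number k (W_class 1 K 1) (torus_Lp \<infinity> 1) (torus_norm \<infinity> 1)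
        \<le> ennreal (C1 * real k powr (- 2 * r) * ln (2 * real k) powr (2 * r * real 1 + real (2 * (1 - 1))))"
    using entropy_bound[of 1 r l] assms(1) l by auto
  obtain C2 where C2: "0 < C2" and bound2: "\<And>k K. 1 \<le> k \<Longrightarrow> K \<in> H_class l r 2 1 \<infinity> \<Longrightarrow>
      entropy_number k (W_class 2 K 1) (torus_Lp \<infinity> 2) (torus_norm \<infinity> 2)
        \<le> ennreal (C2 * real k powr (- 2 * r) * ln (2 * real k) powr (2 * r * real 2 + real (2 * (2 - 1))))"
    using entropy_bound[of 2 r l] assms(1) l by auto
  \<comment> \<open>For \<open>d = 2\<close> the power of the logarithm is smaller by \<open>1 / 2\<close> than claimed; \<open>ln (2 * k) \<ge> ln 2\<close> makes up for it.\<close>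
  define C where "C = C1 + C2 / ln 2 powr (1 / 2)"
  have C: "C1 \<le> C" "C2 / ln 2 powr (1 / 2) \<le> C" "0 < C" using C1 C2 by (simp_all add: C_def add_pos_pos)
  have "(SUP K \<in> H_class l r 1 1 \<infinity>. entropy_number k (W_class 1 K 1) (torus_Lp \<infinity> 1) (torus_norm \<infinity> 1))
      \<le> ennreal (C * real k powr (- 2 * r) * ln (2 * real k) powr (2 * r))"
    if k: "1 \<le> k" for k
  proof (rule SUP_least)
    fix K assume "K \<in> H_class l r 1 1 \<infinity>"
    from bound1[OF k this] have "entropy_number k (W_class 1 K 1) (torus_Lp \<infinity> 1) (torus_norm \<infinity> 1)
        \<le> ennreal (C1 * real k powr (- 2 * r) * ln (2 * real k) powr (2 * r))" by simp
    also have "\<dots> \<le> ennreal (C * real k powr (- 2 * r) * ln (2 * real k) powr (2 * r))"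
      by (intro ennreal_leI mult_right_mono C(1)) auto
    finally show "entropy_number k (W_class 1 K 1) (torus_Lp \<infinity> 1) (torus_norm \<infinity> 1)
        \<le> ennreal (C * real k powr (- 2 * r) * ln (2 * real k) powr (2 * r))" .
  qed
  moreover have "(SUP K \<in> H_class l r 2 1 \<infinity>. entropy_number k (W_class 2 K 1) (torus_Lp \<infinity> 2) (torus_norm \<infinity> 2))
      \<le> ennreal (C * real k powr (- 2 * r) * ln (2 * real k) powr (4 * r + 5 / 2))"
    if k: "1 \<le> k" for k
  proof (rule SUP_least)
    fix K assume "K \<in> H_class l r 2 1 \<infinity>"
    from bound2[OF k this] have "entropy_number k (W_class 2 K 1) (torus_Lp \<infinity> 2) (torus_norm \<infinity> 2)
        \<le> ennreal (C2 * real k powr (- 2 * r) * ln (2 * real k) powr (4 * r + 2))" by (simp add: mult.commute)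
    also have "\<dots> \<le> ennreal (C * real k powr (- 2 * r) * ln (2 * real k) powr (4 * r + 5 / 2))"
    proof (rule ennreal_leI)
      let ?x = "ln (2 * real k)"
      have "ln 2 \<le> ?x" using k by simp
      then have "ln 2 powr (1 / 2) \<le> ?x powr (1 / 2)" by (intro powr_mono2) auto
      then have "1 \<le> ?x powr (1 / 2) / ln 2 powr (1 / 2)" by (simp add: pos_le_divide_eq)
      then have "(C2 * real k powr (- 2 * r) * ?x powr (4 * r + 2)) * 1
          \<le> (C2 * real k powr (- 2 * r) * ?x powr (4 * r + 2)) * (?x powr (1 / 2) / ln 2 powr (1 / 2))"
        using C2 by (intro mult_left_mono) auto
      also have "\<dots> = C2 / ln 2 powr (1 / 2) * real k powr (- 2 * r) * (?x powr (4 * r + 2) * ?x powr (1 / 2))"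
        by simp
      also have "?x powr (4 * r + 2) * ?x powr (1 / 2) = ?x powr (4 * r + 5 / 2)"
        by (simp add: powr_add[symmetric] add.commute)
      also have "C2 / ln 2 powr (1 / 2) * real k powr (- 2 * r) * ?x powr (4 * r + 5 / 2)
          \<le> C * real k powr (- 2 * r) * ?x powr (4 * r + 5 / 2)"
        by (intro mult_right_mono C(2)) auto
      finally show "C2 * real k powr (- 2 * r) * ?x powr (4 * r + 2)
          \<le> C * real k powr (- 2 * r) * ?x powr (4 * r + 5 / 2)" by simp
    qed
    finally show "entropy_number k (W_class 2 K 1) (torus_Lp \<infinity> 2) (torus_norm \<infinity> 2)
        \<le> ennreal (C * real k powr (- 2 * r) * ln (2 * real k) powr (4 * r + 5 / 2))" .
  qed
  ultimately show ?thesis using C(3) by blast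
qed

end
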